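(* Let $\Omega\subset\mathbb{R}^{d+1}$ be the closure of an open, connected, bounded $C^2$-domain. Let $r\in\mathbb{N}$ and $1\le p\le\infty$. Then there is a constant $C>0$ such that for every $n\in\mathbb{N}$ and every $f\in L^p(\Omega)$, $$\omega_\Omega^r(f,n^{-1})_p\le\frac{C}{n^r}\sum_{j=0}^n(j+1)^{r-1}E_j(f)_{L^p(\Omega)},$$ where $C$ is independent of $f$ and $n$.
   Context: Here $d\ge 1$, $\|\cdot\|$ is the Euclidean norm, $e_1,\dots,e_{d+1}$ is the standard basis of $\mathbb{R}^{d+1}$, points of $\mathbb{R}^{d+1}$ are written $(x,y)$ with $x\in\mathbb{R}^d$, $y\in\mathbb{R}$, and $\Gamma=\partial\Omega$. For $p<\infty$, $L^p(\Omega)$ is the Lebesgue space; $L^\infty(\Omega)$ means $C(\Omega)$ with the uniform norm. $\Pi_n^{d+1}$ is the space of real polynomials on $\mathbb{R}^{d+1}$ of total degree $\le n$ and $E_n(f)_{L^p(\Omega)}=\inf\{\|f-Q\|_{L^p(\Omega)}:Q\in\Pi_n^{d+1}\}$. $C^2$-domain: a bounded domain for which there are $\delta>0$, $M>0$ and a finite cover of the boundary by connected open sets $U_1,\dots,U_J$ such that (i) every $x$ in the domain with distance $<\delta$ to the boundary lies in some $U_j$ with $\mathrm{dist}(x,\partial U_j)>\delta$; (ii) for each $j$ there is a Cartesian coordinate system $(\xi_{j,1},\dots,\xi_{j,d+1})$ in $U_j$ in which the part of the domain in $U_j$ is given by $\xi_{j,d+1}\le f_j(\xi_{j,1},\dots,\xi_{j,d})$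 with $f_j\in C^2(\mathbb{R}^d)$ and $\max_{i,k}\|\partial_i\partial_kf_j\|_\infty\le M$. Differences: $\triangle_\xi^r f(\eta)=\sum_{j=0}^r(-1)^{r+j}\binom rj f(\eta+j\xi)$; $\triangle_\xi^r(f,\Omega,\eta)=\triangle_\xi^rf(\eta)$ if the segment $[\eta,\eta+r\xi]\subset\Omega$, and $=0$ otherwise. Ditzian–Totik part: for a unit vector $e$ and $\xi\in\Omega$, $\varphi_\Omega(e,\xi)=\max\{\sqrt{l_1l_2}: l_1,l_2\ge0,\ [\xi-l_1e,\xi+l_2e]\subset\Omega\}$; $\omega^r_{\Omega,\varphi}(f,t;e)_p=\sup_{|h|\le\min\{t,1\}}\|\triangle^r_{h\varphi_\Omega(e,\cdot)e}(f,\Omega,\cdot)\|_{L^p(\Omega)}$ and $\omega^r_{\Omega,\varphi}(f,t)_p=\max_{1\le j\le d+1}\omega^r_{\Omega,\varphi}(f,t;e_j)_p$. Domains of special type: $G$ is an upward $x_{d+1}$-domain with base size $b>0$ and parameter $L\ge1$ if $G=\zeta+\{(x,y):x\in(-b,b)^d,\ g(x)-Lb<y\le g(x)\}$ with $\zeta\in\mathbb{R}^{d+1}$, $g\in C^2(\mathbb{R}^d)$; it is always assumed that $L\ge 4\sqrt d\max_{x\in[-2b,2b]^d}\|\nabla g(x)\|+1$. Put $G^*=\zeta+\{(x,y):x\in(-2b,2b)^d,\ \min_{u\in[-2b,2b]^d}g(u)-4Lb<y\le g(x)\}$, $\partial'G=\zeta+\{(x,g(x)):x\in(-b,b)^d\}$,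 $\partial'G^*=\zeta+\{(x,g(x)):x\in(-2b,2b)^d\}$. Let $\sigma_j$ interchange the $j$-th and $(d+1)$-th coordinates and $\tau_j$ change the sign of the $j$-th coordinate. $G$ is an upward $x_j$-domain if $\sigma_j(G)$ is an upward $x_{d+1}$-domain, and a downward $x_j$-domain if $\tau_j(G)$ is an upward $x_j$-domain; $G^*,\partial'G,\partial'G^*$ are defined by transporting through these maps. A domain of special type is an upward or downward $x_j$-domain for some $1\le j\le d+1$. A domain of special type $G\subset\Omega$ is attached to $\Gamma$ if $\overline{G^*}\cap\Gamma=\overline{\partial'G^*}$ and there is an open rectangular box $Q$ (sides parallel to the axes) with $G^*=Q\cap\Omega$. Tangential part: fix a parameter $A_0>1$. If $G\subset\Omega$ is an upward $x_{d+1}$-domain with $\zeta=0$, that is, $G=\{(x,y):x\in(-b,b)^d,\ g(x)-Lb<y\le g(x)\}$ with $b>0$, $g\in C^2(\mathbb{R}^d)$ and $L\ge 4\sqrt d\max_{x\in[-2b,2b]^d}\|\nabla g(x)\|+1$, put $\xi_j(u)=e_j+\partial_jg(u)e_{d+1}$ ($1\le j\le d$), $G^t=\{\xi\in G:\mathrm{dist}(\xi,\partial'G)\ge A_0t^2\}$, $I_x(tb)=\{u\in(-b,b)^d:\|u-x\|\le tb\}$, and for $0<t\le1$ $$\widetilde\omega^r_G(f,t)_p=\sup_{0<s\le t,\ 1\le j\le d}\Bigl(\int_{G^t}\Bigl[\frac1{(bt)^d}\int_{I_x(tb)}|\triangle^r_{s\xi_j(u)}(f,\Omega,(x,y))|^p\,du\Bigr]dx\,dy\Bigr)^{1/p}$$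 (with $L^\infty$-norms replacing the $L^p$-norms when $p=\infty$); for $t>1$, $\widetilde\omega^r_G(f,t)_p=\widetilde\omega^r_G(f,1)_p$. For a general domain of special type, $\widetilde\omega^r_G(f,t)_p=\widetilde\omega^r_{T(G)}(f\circ T^{-1},t)_p$ (with $\Omega$ replaced by $T(\Omega)$), $T$ being a composition of a translation and the maps $\sigma_j,\tau_j$ taking $G$ to an upward $x_{d+1}$-domain with $\zeta=0$. Fix domains of special type $G_1,\dots,G_{m_0}\subset\Omega$ attached to $\Gamma$ that cover $\Gamma$ (such a finite cover exists). Then $\omega^r_\Omega(f,t)_p=\omega^r_{\Omega,\varphi}(f,t)_p+\sum_{j=1}^{m_0}\widetilde\omega^r_{G_j}(f,t)_p$. *)

theory Defs
  imports "HOL-Analysis.Analysis"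
begin

text \<open>The space of points (x, y) with x in R^d and y in R, where d = CARD('d); the norm of the
  product type is the Euclidean one. The d+1 coordinates are indexed by 'd option, and None is the
  last one, y.\<close>

type_synonym 'd pt = "(real ^ 'd) \<times> real"

definition coord :: "'d option \<Rightarrow> ('d::finite) pt \<Rightarrow> real" where
  "coord j \<xi> = (case j of None \<Rightarrow> snd \<xi> | Some i \<Rightarrow> fst \<xi> $ i)"

definition unit_vec :: "'d option \<Rightarrow> ('d::finite) pt" where
  "unit_vec j = (case j of None \<Rightarrow> (0, 1) | Some i \<Rightarrow> (axis i 1, 0))"

definition swap_last :: "'d option \<Rightarrow> ('d::finite) pt \<Rightarrow> 'd pt" where
  "swap_last j \<xi> =
     (case j of None \<Rightarrow> \<xi>
      | Some i \<Rightarrow> ((\<chi> k. if k = i then snd \<xi> else fst \<xi> $ k), fst \<xi> $ i))"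

definition flip_sign :: "'d option \<Rightarrow> ('d::finite) pt \<Rightarrow> 'd pt" where
  "flip_sign j \<xi> =
     (case j of None \<Rightarrow> (fst \<xi>, - snd \<xi>)
      | Some i \<Rightarrow> ((\<chi> k. if k = i then - fst \<xi> $ k else fst \<xi> $ k), snd \<xi>))"


section \<open>Twice continuously differentiable functions and domains\<close>

definition partial :: "'d \<Rightarrow> (real ^ 'd \<Rightarrow> real) \<Rightarrow> real ^ ('d::finite) \<Rightarrow> real" where
  "partial i g x = frechet_derivative g (at x) (axis i 1)"

definition grad :: "(real ^ 'd \<Rightarrow> real) \<Rightarrow> real ^ ('d::finite) \<Rightarrow> real ^ 'd" where
  "grad g x = (\<chi> i. partial i g x)"

definition C1_fun :: "(real ^ ('d::finite) \<Rightarrow> real) \<Rightarrow> bool" where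
  "C1_fun g \<longleftrightarrow> (\<forall>x. g differentiable (at x)) \<and> (\<forall>i. continuous_on UNIV (partial i g))"

definition C2_fun :: "(real ^ ('d::finite) \<Rightarrow> real) \<Rightarrow> bool" where
  "C2_fun g \<longleftrightarrow> C1_fun g \<and> (\<forall>i. C1_fun (partial i g))"

text \<open>Here D is the open domain itself, hence the strict inequality in the last clause; in U j the
  closure of D is then given by the non-strict inequality. The Cartesian coordinates of
  \<open>\<xi>\<close> are those of \<open>A (\<xi> - c)\<close>.\<close>

definition C2_domain :: "('d::finite) pt set \<Rightarrow> bool" where
  "C2_domain D \<longleftrightarrow>
     open D \<and> connected D \<and> bounded D \<and> D \<noteq> {} \<and>
     (\<exists>\<delta>>0. \<exists>M>0. \<exists>(J::nat) U.
        (\<forall>j<J. open (U j) \<and> connected (U j)) \<and>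
        frontier D \<subseteq> (\<Union>j<J. U j) \<and>
        (\<forall>\<xi>\<in>D. infdist \<xi> (frontier D) < \<delta> \<longrightarrow>
           (\<exists>j<J. \<xi> \<in> U j \<and> infdist \<xi> (frontier (U j)) > \<delta>)) \<and>
        (\<forall>j<J. \<exists>(A :: 'd pt \<Rightarrow> 'd pt) c f. orthogonal_transformation A \<and> C2_fun f \<and>
           (\<forall>i k x. \<bar>partial i (partial k f) x\<bar> \<le> M) \<and>
           D \<inter> U j = {\<xi> \<in> U j. snd (A (\<xi> - c)) < f (fst (A (\<xi> - c)))}))"


section \<open>Norms and best approximation\<close>

definition ennreal_powr :: "ennreal \<Rightarrow> real \<Rightarrow> ennreal" where
  "ennreal_powr a s = (if a = \<infinity> then \<infinity> else ennreal (enn2real a powr s))"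

text \<open>For \<open>p = \<infinity>\<close> the norm is the uniform norm and the space consists of continuous
  functions.\<close>

definition Lp_norm :: "ennreal \<Rightarrow> 'a::euclidean_space set \<Rightarrow> ('a \<Rightarrow> real) \<Rightarrow> ennreal" where
  "Lp_norm p S F =
     (if p = \<infinity> then (SUP \<xi>\<in>S. ennreal \<bar>F \<xi>\<bar>)
      else ennreal_powr (\<integral>\<^sup>+\<xi>\<in>S. ennreal (\<bar>F \<xi>\<bar> powr enn2real p) \<partial>lebesgue) (1 / enn2real p))"

definition Lp_space :: "ennreal \<Rightarrow> 'a::euclidean_space set \<Rightarrow> ('a \<Rightarrow> real) set" where
  "Lp_space p S =
     (if p = \<infinity> then {f. continuous_on S f}
      else {f. f \<in> borel_measurable (lebesgue_on S) \<and> Lp_norm p S f < \<infinity>})"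

definition poly_space :: "nat \<Rightarrow> (('d::finite) pt \<Rightarrow> real) set" where
  "poly_space n =
     {Q. \<exists>c. \<forall>\<xi>. Q \<xi> = (\<Sum>\<alpha> | sum \<alpha> UNIV \<le> n. c (\<alpha> :: 'd option \<Rightarrow> nat) * (\<Prod>j\<in>UNIV. coord j \<xi> ^ \<alpha> j))}"

definition best_approx :: "ennreal \<Rightarrow> ('d::finite) pt set \<Rightarrow> nat \<Rightarrow> ('d pt \<Rightarrow> real) \<Rightarrow> ennreal" where
  "best_approx p \<Omega> n f = (INF Q\<in>poly_space n. Lp_norm p \<Omega> (\<lambda>\<xi>. f \<xi> - Q \<xi>))"


section \<open>Differences and the Ditzian--Totik part\<close>

definition fin_diff :: "nat \<Rightarrow> 'a::real_vector \<Rightarrow> ('a \<Rightarrow> real) \<Rightarrow> 'a \<Rightarrow> real" where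
  "fin_diff r \<xi> f \<eta> = (\<Sum>j=0..r. (-1) ^ (r + j) * real (r choose j) * f (\<eta> + real j *\<^sub>R \<xi>))"

definition fin_diff_on :: "nat \<Rightarrow> 'a::real_vector \<Rightarrow> ('a \<Rightarrow> real) \<Rightarrow> 'a set \<Rightarrow> 'a \<Rightarrow> real" where
  "fin_diff_on r \<xi> f \<Omega> \<eta> =
     (if closed_segment \<eta> (\<eta> + real r *\<^sub>R \<xi>) \<subseteq> \<Omega> then fin_diff r \<xi> f \<eta> else 0)"

definition phi_dist :: "'a::real_vector set \<Rightarrow> 'a \<Rightarrow> 'a \<Rightarrow> real" where
  "phi_dist \<Omega> e \<xi> =
     Sup {sqrt (l1 * l2) | l1 l2. 0 \<le> l1 \<and> 0 \<le> l2 \<and>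
            closed_segment (\<xi> - l1 *\<^sub>R e) (\<xi> + l2 *\<^sub>R e) \<subseteq> \<Omega>}"

definition omega_dir ::
  "ennreal \<Rightarrow> 'a::euclidean_space set \<Rightarrow> nat \<Rightarrow> ('a \<Rightarrow> real) \<Rightarrow> real \<Rightarrow> 'a \<Rightarrow> ennreal" where
  "omega_dir p \<Omega> r f t e =
     (SUP h\<in>{h. \<bar>h\<bar> \<le> min t 1}.
        Lp_norm p \<Omega> (\<lambda>\<xi>. fin_diff_on r ((h * phi_dist \<Omega> e \<xi>) *\<^sub>R e) f \<Omega> \<xi>))"

definition omega_phi ::
  "ennreal \<Rightarrow> ('d::finite) pt set \<Rightarrow> nat \<Rightarrow> ('d pt \<Rightarrow> real) \<Rightarrow> real \<Rightarrow> ennreal" where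
  "omega_phi p \<Omega> r f t = Max (range (\<lambda>j. omega_dir p \<Omega> r f t (unit_vec j)))"


section \<open>Domains of special type\<close>

text \<open>The starred domain depends on g outside the cube over which the domain itself lies, so a domain
  of special type is represented by its data rather than by a point set: coordinate direction,
  upward or downward, \<open>\<zeta>\<close>, base size, parameter L and the function g.\<close>

record ('d::finite) special_domain =
  sd_dir :: "'d option"
  sd_down :: bool
  sd_zeta :: "'d pt"
  sd_base :: real
  sd_param :: real
  sd_fun :: "real ^ 'd \<Rightarrow> real"

abbreviation cube :: "real \<Rightarrow> (real ^ ('d::finite)) set" where
  "cube b \<equiv> box (vec (- b)) (vec b)"

abbreviation closed_cube :: "real \<Rightarrow> (real ^ ('d::finite)) set" where
  "closed_cube b \<equiv> cbox (vec (- b)) (vec b)"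

definition special_domain_valid :: "('d::finite) special_domain \<Rightarrow> bool" where
  "special_domain_valid G \<longleftrightarrow>
     sd_base G > 0 \<and> sd_param G \<ge> 1 \<and> C2_fun (sd_fun G) \<and>
     sd_param G \<ge>
       4 * sqrt (real CARD('d)) * (SUP x\<in>closed_cube (2 * sd_base G). norm (grad (sd_fun G) x)) + 1"

text \<open>The map \<open>T\<^sup>-\<^sup>1\<close>, which carries the upward model domain with \<open>\<zeta> = 0\<close> onto G: if
  \<open>\<tau>\<^sub>j(G)\<close> is an upward \<open>x\<^sub>j\<close>-domain then \<open>G = \<tau>\<^sub>j(\<sigma>\<^sub>j(\<zeta> + H))\<close> with H the model domain.\<close>

definition sd_place :: "('d::finite) special_domain \<Rightarrow> 'd pt \<Rightarrow> 'd pt" where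
  "sd_place G \<xi> =
     (if sd_down G then flip_sign (sd_dir G) else id) (swap_last (sd_dir G) (sd_zeta G + \<xi>))"

definition model_set :: "real \<Rightarrow> real \<Rightarrow> (real ^ 'd \<Rightarrow> real) \<Rightarrow> ('d::finite) pt set" where
  "model_set b L g = {(x, y). x \<in> cube b \<and> g x - L * b < y \<and> y \<le> g x}"

definition model_star :: "real \<Rightarrow> real \<Rightarrow> (real ^ 'd \<Rightarrow> real) \<Rightarrow> ('d::finite) pt set" where
  "model_star b L g =
     {(x, y). x \<in> cube (2 * b) \<and> (INF u\<in>closed_cube (2 * b). g u) - 4 * L * b < y \<and> y \<le> g x}"

definition model_bdry :: "real \<Rightarrow> (real ^ 'd \<Rightarrow> real) \<Rightarrow> ('d::finite) pt set" where
  "model_bdry b g = {(x, g x) | x. x \<in> cube b}"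

definition sd_set :: "('d::finite) special_domain \<Rightarrow> 'd pt set" where
  "sd_set G = sd_place G ` model_set (sd_base G) (sd_param G) (sd_fun G)"

definition sd_star :: "('d::finite) special_domain \<Rightarrow> 'd pt set" where
  "sd_star G = sd_place G ` model_star (sd_base G) (sd_param G) (sd_fun G)"

definition sd_bdry_star :: "('d::finite) special_domain \<Rightarrow> 'd pt set" where
  "sd_bdry_star G = sd_place G ` model_bdry (2 * sd_base G) (sd_fun G)"

definition attached :: "('d::finite) special_domain \<Rightarrow> 'd pt set \<Rightarrow> bool" where
  "attached G \<Omega> \<longleftrightarrow>
     sd_set G \<subseteq> \<Omega> \<and>
     closure (sd_star G) \<inter> frontier \<Omega> = closure (sd_bdry_star G) \<and>
     (\<exists>a c. sd_star G = box a c \<inter> \<Omega>)"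


section \<open>The tangential part and the full modulus\<close>

definition tangent_vec :: "(real ^ 'd \<Rightarrow> real) \<Rightarrow> 'd \<Rightarrow> real ^ 'd \<Rightarrow> ('d::finite) pt" where
  "tangent_vec g j u = unit_vec (Some j) + partial j g u *\<^sub>R unit_vec None"

definition model_inner ::
  "real \<Rightarrow> real \<Rightarrow> real \<Rightarrow> (real ^ 'd \<Rightarrow> real) \<Rightarrow> real \<Rightarrow> ('d::finite) pt set" where
  "model_inner A0 b L g t = {\<xi> \<in> model_set b L g. infdist \<xi> (model_bdry b g) \<ge> A0 * t\<^sup>2}"

definition tangent_nbhd :: "real \<Rightarrow> real \<Rightarrow> real ^ 'd \<Rightarrow> (real ^ ('d::finite)) set" where
  "tangent_nbhd b t x = {u \<in> cube b. norm (u - x) \<le> t * b}"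

definition model_modulus ::
  "real \<Rightarrow> ennreal \<Rightarrow> ('d::finite) pt set \<Rightarrow> real \<Rightarrow> real \<Rightarrow> (real ^ 'd \<Rightarrow> real) \<Rightarrow>
   nat \<Rightarrow> ('d pt \<Rightarrow> real) \<Rightarrow> real \<Rightarrow> ennreal" where
  "model_modulus A0 p \<Omega> b L g r f t =
     (SUP s\<in>{0<..t}. SUP j.
        if p = \<infinity>
        then (SUP \<xi>\<in>model_inner A0 b L g t. SUP u\<in>tangent_nbhd b t (fst \<xi>).
                ennreal \<bar>fin_diff_on r (s *\<^sub>R tangent_vec g j u) f \<Omega> \<xi>\<bar>)
        else ennreal_powr
               (\<integral>\<^sup>+\<xi>\<in>model_inner A0 b L g t.
                  ennreal (1 / (b * t) ^ CARD('d)) *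
                  (\<integral>\<^sup>+u\<in>tangent_nbhd b t (fst \<xi>).
                     ennreal (\<bar>fin_diff_on r (s *\<^sub>R tangent_vec g j u) f \<Omega> \<xi>\<bar> powr enn2real p)
                   \<partial>lebesgue)
                \<partial>lebesgue)
               (1 / enn2real p))"

definition omega_tan ::
  "real \<Rightarrow> ennreal \<Rightarrow> ('d::finite) pt set \<Rightarrow> 'd special_domain \<Rightarrow>
   nat \<Rightarrow> ('d pt \<Rightarrow> real) \<Rightarrow> real \<Rightarrow> ennreal" where
  "omega_tan A0 p \<Omega> G r f t =
     model_modulus A0 p (sd_place G -` \<Omega>) (sd_base G) (sd_param G) (sd_fun G)
       r (f \<circ> sd_place G) (min t 1)"

definition omega_full ::
  "real \<Rightarrow> ennreal \<Rightarrow> ('d::finite) pt set \<Rightarrow> nat \<Rightarrow> (nat \<Rightarrow> 'd special_domain) \<Rightarrow>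
   nat \<Rightarrow> ('d pt \<Rightarrow> real) \<Rightarrow> real \<Rightarrow> ennreal" where
  "omega_full A0 p \<Omega> m0 G r f t = omega_phi p \<Omega> r f t + (\<Sum>j<m0. omega_tan A0 p \<Omega> (G j) r f t)"

end

theory Submission
  imports Defs "HOL-Complex_Analysis.Complex_Analysis"
begin

text \<open>By a discrete Cauchy formula, a difference of order \<open>r\<close> and step \<open>s\<close> of a polynomial along a line is
  at most \<open>C (s / \<rho>)\<^sup>r\<close> times an average of its values at complex points of the line at distance
  \<open>\<rho>\<close>. With \<open>\<rho>\<close> of order \<open>1 / N\<close> for degree \<open>N\<close>, Bernstein inequalities for differences thus reduce to
  the stability of \<open>L\<^sup>p\<close> norms of polynomials under complex perturbations of the argument. On an interval,
  in the variable \<open>x = cos t\<close>, this stability (for perturbations of size \<open>sqrt (1 - x\<^sup>2) / N + 1 / N\<^sup>2\<close>)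
  comes from the subharmonicity of \<open>\<bar>q\<bar>\<^sup>p\<close> and a weighted Markov inequality; applied to chords it gives the
  Ditzian--Totik part.

  In the tangential part the complexified line in direction \<open>\<xi>\<^sub>j(u)\<close> is compared with a parabola through
  the same point which is tangent to \<open>\<xi>\<^sub>j(x)\<close> and stays below the graph of \<open>g\<close>. Since
  \<open>\<bar>u - x\<bar> \<le> b / n\<close>, the two differ in the last coordinate by \<open>O(1 / N\<^sup>2)\<close>, which the interval estimate
  absorbs, and a complex parameter of size \<open>1 / N\<close> on the parabola is moved back to real parameters by
  harmonic measure.

  Finally \<open>f\<close> is split into the error of a best approximant and a telescoping sum over dyadic degrees.\<close>

section \<open>Subharmonicity on the unit disc\<close>

text \<open>The obstacle in the interval estimate is the measure: with \<open>x = cos t\<close> it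
  becomes \<open>\<bar>sin t\<bar> dt\<close>, and a mean value inequality for
  \<open>q (cos t)\<close> alone does not see this weight. But \<open>2 * \<bar>sin t\<bar>\<close>
  is the modulus of \<open>1 - w\<^sup>2\<close> at \<open>w = exp (\<i> t)\<close>, so the weight
  can be absorbed as a factor \<open>(1 - w\<^sup>2) powr (1 / p)\<close> of a holomorphic function.
  Near the endpoints the weight is small; what is lost there is recovered on lines at height of
  order \<open>1 / N\<close>, where the sine has modulus at least \<open>1 / N\<close>. The
  Ditzian-Totik step fits this estimate because on a chord with ends \<open>a\<close> and
  \<open>b\<close> it is a multiple of \<open>sqrt ((x - a) * (b - x))\<close>, the affine image of
  \<open>sqrt (1 - x\<^sup>2)\<close>. For the error \<open>f - P\<close> no analytic structure is
  available, and its values at shifted points have to be bounded by a change of variables: on chords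
  the Jacobian is at least 1/2 as long as the whole segment stays in the chord. Differences are
  controlled by complex averages only while step times degree is below a fixed constant, which is
  why degrees stop at \<open>\<kappa> n\<close> and the factor \<open>1 / \<kappa>\<close> ends up
  in the constant.\<close>

definition circle_int :: "(real \<Rightarrow> ennreal) \<Rightarrow> ennreal" where
  "circle_int G = (\<integral>\<^sup>+t\<in>{0..2*pi}. G t \<partial>lborel)"

lemma circle_int_mono: "(\<And>t. G t \<le> H t) \<Longrightarrow> circle_int G \<le> circle_int H"
  unfolding circle_int_def by (intro nn_integral_mono mult_right_mono) auto

lemma circle_int_cmult:
  assumes [measurable]: "G \<in> borel_measurable borel"
  shows "circle_int (\<lambda>t. c * G t) = c * circle_int G"
  unfolding circle_int_def by (subst nn_integral_cmult[symmetric]) (auto simp: mult.assoc)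

lemma circle_int_add:
  assumes [measurable]: "G \<in> borel_measurable borel" "H \<in> borel_measurable borel"
  shows "circle_int (\<lambda>t. G t + H t) = circle_int G + circle_int H"
  unfolding circle_int_def by (subst nn_integral_add[symmetric]) (auto simp: distrib_right)

lemma circle_int_swap:
  assumes [measurable]: "(\<lambda>(s, t). G s t) \<in> borel_measurable (borel \<Otimes>\<^sub>M borel)"
  shows "circle_int (\<lambda>s. circle_int (G s)) = circle_int (\<lambda>t. circle_int (\<lambda>s. G s t))"
proof -
  have "circle_int (\<lambda>s. circle_int (G s))
      = (\<integral>\<^sup>+s. \<integral>\<^sup>+t. G s t * indicator {0..2*pi} t * indicator {0..2*pi} s \<partial>lborel \<partial>lborel)"
    unfolding circle_int_def by (intro nn_integral_cong) (subst nn_integral_multc, auto)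
  also have "\<dots> = (\<integral>\<^sup>+t. \<integral>\<^sup>+s. G s t * indicator {0..2*pi} t * indicator {0..2*pi} s \<partial>lborel \<partial>lborel)"
    by (rule lborel_pair.Fubini') simp
  also have "\<dots> = (\<integral>\<^sup>+t. \<integral>\<^sup>+s. G s t * indicator {0..2*pi} s * indicator {0..2*pi} t \<partial>lborel \<partial>lborel)"
    by (simp add: mult_ac)
  also have "\<dots> = circle_int (\<lambda>t. circle_int (\<lambda>s. G s t))"
    unfolding circle_int_def by (intro nn_integral_cong) (subst nn_integral_multc, auto)
  finally show ?thesis .
qed

lemma nn_integral_interval_shift:
  fixes G :: "real \<Rightarrow> ennreal"
  assumes [measurable]: "G \<in> borel_measurable borel"
  shows "(\<integral>\<^sup>+t\<in>{u..v}. G (t + a) \<partial>lborel) = (\<integral>\<^sup>+t\<in>{u + a..v + a}. G t \<partial>lborel)"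
  by (subst nn_integral_real_affine[of "\<lambda>t. G t * indicator {u + a..v + a} t" 1 a])
     (auto intro!: nn_integral_cong simp: add.commute indicator_def)

lemma nn_integral_interval_split:
  fixes G :: "real \<Rightarrow> ennreal"
  assumes [measurable]: "G \<in> borel_measurable borel" and "u \<le> v" "v \<le> w"
  shows "(\<integral>\<^sup>+t\<in>{u..w}. G t \<partial>lborel) = (\<integral>\<^sup>+t\<in>{u..v}. G t \<partial>lborel) + (\<integral>\<^sup>+t\<in>{v..w}. G t \<partial>lborel)"
proof -
  have "(\<integral>\<^sup>+t\<in>{u..w}. G t \<partial>lborel) = (\<integral>\<^sup>+t. G t * indicator {u..v} t + G t * indicator {v..w} t \<partial>lborel)"
    by (intro nn_integral_cong_AE, rule AE_I[of _ _ "{v}"])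
       (use assms in \<open>auto simp: indicator_def\<close>)
  then show ?thesis by (simp add: nn_integral_add)
qed

text \<open>After reduction of \<open>a\<close> modulo \<open>2 * pi\<close> to some
  \<open>b\<close> in \<open>{0..2*pi}\<close>, the part of the shifted interval beyond
  \<open>2 * pi\<close> is moved back to \<open>{0..b}\<close> by periodicity.\<close>

lemma circle_int_shift:
  fixes G :: "real \<Rightarrow> ennreal"
  assumes [measurable]: "G \<in> borel_measurable borel" and per: "\<And>t. G (t + 2 * pi) = G t"
  shows "circle_int (\<lambda>t. G (t + a)) = circle_int G"
proof -
  have main: "(\<integral>\<^sup>+t\<in>{a..2*pi + a}. G t \<partial>lborel) = circle_int G" if "0 \<le> a" "a \<le> 2 * pi" for a
  proof -
    have "(\<integral>\<^sup>+t\<in>{a..2*pi + a}. G t \<partial>lborel)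
        = (\<integral>\<^sup>+t\<in>{a..2*pi}. G t \<partial>lborel) + (\<integral>\<^sup>+t\<in>{2*pi..2*pi + a}. G t \<partial>lborel)"
      using that by (intro nn_integral_interval_split) auto
    also have "(\<integral>\<^sup>+t\<in>{2*pi..2*pi + a}. G t \<partial>lborel) = (\<integral>\<^sup>+t\<in>{0..a}. G t \<partial>lborel)"
    proof -
      have "(\<integral>\<^sup>+t\<in>{0..a}. G (t + 2*pi) \<partial>lborel) = (\<integral>\<^sup>+t\<in>{0 + 2*pi..a + 2*pi}. G t \<partial>lborel)"
        by (rule nn_integral_interval_shift) fact
      then show ?thesis by (simp only: per add_0 add.commute)
    qed
    also have "(\<integral>\<^sup>+t\<in>{a..2*pi}. G t \<partial>lborel) + (\<integral>\<^sup>+t\<in>{0..a}. G t \<partial>lborel) = circle_int G"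
      unfolding circle_int_def using that
      by (subst nn_integral_interval_split[of G 0 a "2*pi"]) (auto simp: add.commute)
    finally show ?thesis .
  qed
  have perk0: "G (t + 2 * pi * real k) = G t" for t k
  proof (induction k)
    case (Suc i) then show ?case using per[of "t + 2 * pi * real i"] by (simp add: algebra_simps)
  qed simp
  have perk: "G (t + 2 * pi * of_int k) = G t" for t and k :: int
  proof (cases "k \<ge> 0")
    case True
    then show ?thesis using perk0[of t "nat k"] by simp
  next
    case False
    then show ?thesis using perk0[of "t + 2 * pi * of_int k" "nat (- k)"] by simp
  qed
  define k where "k = \<lfloor>a / (2 * pi)\<rfloor>"
  define b where "b = a - 2 * pi * of_int k"
  have k1: "of_int k \<le> a / (2 * pi)" and k2: "a / (2 * pi) < of_int k + 1" by (auto simp: k_def)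
  have "of_int k * (2 * pi) \<le> a" using k1 by (simp add: pos_le_divide_eq)
  moreover have "a < (of_int k + 1) * (2 * pi)" using k2 by (simp add: pos_divide_less_eq)
  ultimately have b: "0 \<le> b" "b \<le> 2 * pi" by (auto simp: b_def algebra_simps)
  have "circle_int (\<lambda>t. G (t + a)) = circle_int (\<lambda>t. G (t + b))"
    using perk[of "_ + b" k] by (simp add: b_def algebra_simps)
  also have "\<dots> = (\<integral>\<^sup>+t\<in>{0 + b..2*pi + b}. G t \<partial>lborel)"
    unfolding circle_int_def by (rule nn_integral_interval_shift) fact
  also have "\<dots> = circle_int G"
    using main[OF b] by simp
  finally show ?thesis .
qed

lemma circle_int_continuous:
  fixes f :: "real \<Rightarrow> real"
  assumes "continuous_on {0..2*pi} f" "\<And>t. 0 \<le> f t"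
  shows "circle_int (\<lambda>t. ennreal (f t)) = ennreal (integral {0..2*pi} f)"
proof -
  have "(f has_integral integral {0..2*pi} f) {0..2*pi}"
    using assms by (intro integrable_integral integrable_continuous_interval)
  then show ?thesis
    unfolding circle_int_def
    using nn_integral_has_integral_lebesgue'[of "{0..2*pi}" f "integral {0..2*pi} f"] assms
    by (auto simp: nn_integral_completion)
qed

text \<open>The convex power lies above its tangent at \<open>m\<close>. Integrated against a
  probability density with mean \<open>m\<close>, the linear term cancels and Jensen's inequality
  results; Minkowski's inequality below rests on it too. The case \<open>a = 0\<close> is apart
  because the tangent argument runs on the open half-line.\<close>

lemma powr_tangent_le:
  fixes a m p :: real
  assumes "0 \<le> a" "0 < m" "1 \<le> p"
  shows "m powr p + p * m powr (p - 1) * (a - m) \<le> a powr p"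
proof (cases "a = 0")
  case True
  have "m powr (p - 1) * m = m powr p" using powr_mult_base[of m "p - 1"] assms by (simp add: mult.commute)
  then have "m powr p + p * m powr (p - 1) * (a - m) = (1 - p) * m powr p"
    using True by (simp add: algebra_simps)
  also have "\<dots> \<le> 0" using assms by (simp add: mult_nonpos_nonneg)
  finally show ?thesis using True by simp
next
  case False
  have "p * m powr (p - 1) * (a - m) \<le> a powr p - m powr p"
  proof (rule convex_on_imp_above_tangent[of "{0<..}" "\<lambda>x. x powr p" m a "p * m powr (p - 1)"])
    show "convex_on {0<..} (\<lambda>x. x powr p)" using assms by (intro powr_convex)
    show "connected {(0::real)<..}" by auto
    show "m \<in> interior {0<..}" using assms by (simp add: interior_open)
    show "a \<in> {0<..}" using False assms by simp
    show "((\<lambda>x. x powr p) has_real_derivative p * m powr (p - 1)) (at m within {0<..})"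
      using has_real_derivative_powr[of m p] assms by (simp add: has_field_derivative_at_within)
  qed
  then show ?thesis by simp
qed

text \<open>The Poisson kernel of the unit disc, with the factor \<open>1 / (2 * pi)\<close>
  included so that it has integral 1 over \<open>{0..2*pi}\<close>.\<close>

definition pois :: "complex \<Rightarrow> real \<Rightarrow> real" where
  "pois w t = (1 - (cmod w)\<^sup>2) / (2 * pi * (cmod (cis t - w))\<^sup>2)"

lemma pois_nonneg:
  assumes "cmod w < 1" shows "0 \<le> pois w t"
proof -
  have "(cmod w)\<^sup>2 \<le> 1" using assms by (intro power_le_one) auto
  then show ?thesis unfolding pois_def by (intro divide_nonneg_nonneg) simp_all
qed

lemma pois_denominator:
  assumes "cmod w < 1" shows "cis t - w \<noteq> 0"
proof
  assume "cis t - w = 0"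
  then have "cmod w = cmod (cis t)" by simp
  then show False using assms by simp
qed

lemma continuous_on_pois: "cmod w < 1 \<Longrightarrow> continuous_on A (pois w)"
  unfolding pois_def by (intro continuous_intros) (simp add: pois_denominator[simplified])

text \<open>Cauchy's integral formula is applied not to \<open>F\<close> but to its product
  \<open>f\<close> with \<open>(1 - |w|^2) / (1 - cnj w * u)\<close>. The extra factor is
  holomorphic in \<open>u\<close>, equals 1 at \<open>u = w\<close>, and on the circle turns the
  Cauchy kernel into the Poisson kernel.\<close>

lemma pois_has_integral:
  assumes F: "F holomorphic_on ball 0 1" "continuous_on (cball 0 1) F" and w: "cmod w < 1"
  shows "((\<lambda>t. of_real (pois w t) * F (cis t)) has_integral F w) {0..2*pi}"
proof -
  define f where "f = (\<lambda>u. F u * (1 - (cmod w)\<^sup>2) / (1 - cnj w * u))"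
  have nz: "1 - cnj w * u \<noteq> 0" if "cmod u \<le> 1" for u
  proof
    assume "1 - cnj w * u = 0"
    then have "cmod (cnj w * u) = 1" by simp
    moreover have "cmod (cnj w * u) \<le> cmod w * 1" unfolding norm_mult complex_mod_cnj
      using that by (intro mult_left_mono) auto
    ultimately show False using w by simp
  qed
  have fw: "f w = F w"
  proof -
    have "1 - cnj w * w = 1 - of_real ((cmod w)\<^sup>2)" by (simp only: complex_norm_square mult.commute)
    moreover have "1 - cnj w * w \<noteq> 0" using nz w by simp
    ultimately show ?thesis by (simp add: f_def)
  qed
  have "((\<lambda>u. f u / (u - w)) has_contour_integral (2 * of_real pi * \<i> * f w)) (circlepath 0 1)"
  proof (rule Cauchy_integral_circlepath)
    show "continuous_on (cball 0 1) f" "f holomorphic_on ball 0 1"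
      unfolding f_def using F nz by (auto intro!: continuous_intros holomorphic_intros)
  qed (use w in auto)
  then have "((\<lambda>t. f (cis t) / (cis t - w) * \<i> * cis t) has_integral (2 * of_real pi * \<i> * F w)) {0..2*pi}"
    unfolding circlepath_def fw by (subst (asm) has_contour_integral_part_circlepath_iff) auto
  then have "((\<lambda>t. 1 / (2 * of_real pi * \<i>) * (f (cis t) / (cis t - w) * \<i> * cis t)) has_integral
      1 / (2 * of_real pi * \<i>) * (2 * of_real pi * \<i> * F w)) {0..2*pi}"
    by (rule has_integral_mult_right)
  moreover have "1 / (2 * of_real pi * \<i>) * (f (cis t) / (cis t - w) * \<i> * cis t) = of_real (pois w t) * F (cis t)" for t
  proof -
    have c: "cis t \<noteq> 0" "cis t * cnj (cis t) = 1" by (auto simp: cis_cnj cis_mult)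
    have "of_real ((cmod (cis t - w))\<^sup>2) = (cis t - w) * cnj (cis t - w)"
      by (simp only: complex_norm_square)
    then have "cis t * of_real ((cmod (cis t - w))\<^sup>2) = (cis t - w) * (cis t * cnj (cis t) - cnj w * cis t)"
      by (simp only: complex_cnj_diff) (simp add: algebra_simps)
    \<comment> \<open>Since \<open>cis t\<close> has modulus 1,
      \<open>cis t * cnj (cis t - w) = 1 - cnj w * cis t\<close>; this merges the two denominators
      into \<open>|cis t - w|^2\<close>.\<close>
    then have e: "cis t * of_real ((cmod (cis t - w))\<^sup>2) = (cis t - w) * (1 - cnj w * cis t)"
      by (simp only: c(2))
    have n: "cis t - w \<noteq> 0" "1 - cnj w * cis t \<noteq> 0" using pois_denominator[OF w] nz[of "cis t"] by auto
    have aux2: "X * c / (2 * of_real pi * (c * Q)) = X / (2 * of_real pi * Q)"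
      if "c \<noteq> 0" for X Q c :: complex using that by simp
    have aux: "1 / (2 * of_real pi * \<i>) * (X / Y / Z * \<i> * c) = X * c / (2 * of_real pi * (Z * Y))"
      if "Y \<noteq> 0" "Z \<noteq> 0" for X Y Z c :: complex using that by (simp add: field_simps)
    have "1 / (2 * of_real pi * \<i>) * (f (cis t) / (cis t - w) * \<i> * cis t)
      = F (cis t) * (1 - (cmod w)\<^sup>2) * cis t / (2 * of_real pi * ((cis t - w) * (1 - cnj w * cis t)))"
      using aux[OF n(2,1)] by (simp add: f_def mult_ac)
    also have "\<dots> = F (cis t) * (1 - (cmod w)\<^sup>2) / (2 * of_real pi * of_real ((cmod (cis t - w))\<^sup>2))"
      unfolding e[symmetric] using aux2[OF c(1)] by simp
    also have "\<dots> = of_real (pois w t) * F (cis t)" by (simp add: pois_def)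
    finally show ?thesis .
  qed
  ultimately show ?thesis by simp
qed

lemma pois_integral_1:
  assumes "cmod w < 1" shows "(pois w has_integral 1) {0..2*pi}"
proof -
  have "((\<lambda>t. of_real (pois w t) * 1) has_integral (1::complex)) {0..2*pi}"
    using assms by (intro pois_has_integral[where F = "\<lambda>_. 1"]) auto
  from has_integral_linear[OF this bounded_linear_Re] show ?thesis by (simp add: o_def)
qed

lemma circle_int_pois:
  assumes "cmod w < 1" shows "circle_int (\<lambda>t. ennreal (pois w t)) = 1"
  using pois_integral_1[OF assms]
  by (subst circle_int_continuous) (auto intro!: continuous_on_pois pois_nonneg simp: assms integral_unique)

lemma cmod_cis_diff: "(cmod (cis t - of_real \<rho> * cis s))\<^sup>2 = 1 + \<rho>\<^sup>2 - 2 * \<rho> * cos (t - s)"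
proof -
  have aux: "(c - \<rho> * d)\<^sup>2 + (x - \<rho> * y)\<^sup>2 = (c\<^sup>2 + x\<^sup>2) + \<rho>\<^sup>2 * (d\<^sup>2 + y\<^sup>2) - 2 * \<rho> * (c * d + x * y)" for c \<rho> d x y :: real
    by (simp add: power2_eq_square algebra_simps)
  have "(cmod (cis t - of_real \<rho> * cis s))\<^sup>2
      = ((cos t)\<^sup>2 + (sin t)\<^sup>2) + \<rho>\<^sup>2 * ((cos s)\<^sup>2 + (sin s)\<^sup>2) - 2 * \<rho> * (cos t * cos s + sin t * sin s)"
    using aux[of "cos t" \<rho> "cos s" "sin t" "sin s"] unfolding cmod_power2 by simp
  then show ?thesis by (simp add: cos_diff)
qed

text \<open>For points of one circle about 0 the kernel depends only on the difference of the two
  angles. Exchanging their roles shows that it also has integral 1 as a function of the angle of the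
  inner point.\<close>

lemma pois_swap: "pois (of_real \<rho> * cis s) t = pois (of_real \<rho> * cis t) s"
  using cos_minus[of "t - s"] unfolding pois_def cmod_cis_diff by (simp add: norm_mult)

text \<open>Jensen's inequality for the Poisson density: the tangent is taken at the Poisson mean
  \<open>m\<close> of \<open>cmod (F (cis t))\<close>, which dominates \<open>cmod (F w)\<close>.
  For \<open>m = 0\<close> there is no tangent, but then \<open>F w = 0\<close>.\<close>

lemma pois_powr_le:
  fixes p :: real
  assumes F: "F holomorphic_on ball 0 1" "continuous_on (cball 0 1) F" and w: "cmod w < 1" and p: "1 \<le> p"
  shows "ennreal (cmod (F w) powr p) \<le> circle_int (\<lambda>t. ennreal (pois w t * cmod (F (cis t)) powr p))"
proof -
  have cF: "continuous_on {0..2*pi} (\<lambda>t. cmod (F (cis t)))"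
    by (intro continuous_on_norm continuous_on_compose2[OF F(2)] continuous_intros) auto
  have cp: "continuous_on {0..2*pi} (\<lambda>t. cmod (F (cis t)) powr p)"
    using p by (intro continuous_on_powr' cF continuous_intros) auto
  note ck = continuous_on_pois[OF w, of "{0..2*pi}"]
  have i1: "(\<lambda>t. pois w t * cmod (F (cis t))) integrable_on {0..2*pi}"
    and i2: "(\<lambda>t. pois w t * cmod (F (cis t)) powr p) integrable_on {0..2*pi}"
    and i3: "pois w integrable_on {0..2*pi}"
    by (intro integrable_continuous_interval continuous_intros ck cF cp)+
  define m where "m = integral {0..2*pi} (\<lambda>t. pois w t * cmod (F (cis t)))"
  have "cmod (F w) = cmod (integral {0..2*pi} (\<lambda>t. of_real (pois w t) * F (cis t)))"
    using pois_has_integral[OF F w] by (simp add: integral_unique)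
  also have "\<dots> \<le> m" unfolding m_def
    using pois_has_integral[OF F w] pois_nonneg[OF w]
    by (intro integral_norm_bound_integral i1) (auto simp: has_integral_integrable norm_mult)
  finally have m: "cmod (F w) \<le> m" .
  have "cmod (F w) powr p \<le> integral {0..2*pi} (\<lambda>t. pois w t * cmod (F (cis t)) powr p)"
  proof (cases "m = 0")
    case True
    then have "cmod (F w) powr p = 0" using m by simp
    then show ?thesis using pois_nonneg[OF w] by (simp add: integral_nonneg i2)
  next
    case False
    then have mp: "0 < m" using m norm_ge_zero[of "F w"] by linarith
    have "cmod (F w) powr p \<le> m powr p" using m p by (intro powr_mono2) auto
    also have "\<dots> = integral {0..2*pi} (\<lambda>t. pois w t * (m powr p - p * m powr (p - 1) * m) + p * m powr (p - 1) * (pois w t * cmod (F (cis t))))"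
      using pois_integral_1[OF w]
      by (subst integral_add) (auto intro!: integrable_on_mult_right integrable_on_mult_left i1 i3 simp: m_def[symmetric] integral_unique)
    also have "\<dots> = integral {0..2*pi} (\<lambda>t. pois w t * (m powr p + p * m powr (p - 1) * (cmod (F (cis t)) - m)))"
      by (intro arg_cong[where f = "integral {0..2*pi}"] ext) (simp add: algebra_simps)
    also have "\<dots> \<le> integral {0..2*pi} (\<lambda>t. pois w t * cmod (F (cis t)) powr p)"
      using powr_tangent_le[OF _ mp p] pois_nonneg[OF w]
      by (intro integral_le i2 integrable_continuous_interval continuous_intros ck cF mult_left_mono) auto
    finally show ?thesis .
  qed
  then show ?thesis
    by (subst circle_int_continuous)
       (auto intro!: continuous_intros ck cp pois_nonneg w mult_nonneg_nonneg ennreal_leI)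
qed

text \<open>Integrating the Poisson bound over the circle of radius \<open>\<rho>\<close> and
  exchanging the integrals leaves, by \<open>pois_swap\<close>, a kernel of total mass 1 in front of
  each boundary value.\<close>

lemma circle_mean_mono:
  fixes p \<rho> :: real
  assumes F: "F holomorphic_on ball 0 1" "continuous_on (cball 0 1) F" and p: "1 \<le> p" and \<rho>: "0 \<le> \<rho>" "\<rho> \<le> 1"
  shows "circle_int (\<lambda>s. ennreal (cmod (F (of_real \<rho> * cis s)) powr p)) \<le> circle_int (\<lambda>t. ennreal (cmod (F (cis t)) powr p))"
proof (cases "\<rho> = 1")
  case False
  then have w: "cmod (of_real \<rho> * cis s) < 1" for s using \<rho> by (simp add: norm_mult)
  have contF: "continuous_on UNIV (\<lambda>t. cmod (F (cis t)) powr p)"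
    using p by (intro continuous_on_powr' continuous_on_norm continuous_on_compose2[OF F(2)] continuous_intros) auto
  have m1[measurable]: "(\<lambda>t. cmod (F (cis t)) powr p) \<in> borel_measurable borel"
    using contF by (rule borel_measurable_continuous_onI)
  have "continuous_on UNIV (\<lambda>z. pois (of_real \<rho> * cis (fst z)) (snd z))"
    unfolding pois_def using pois_denominator[OF w] by (auto intro!: continuous_intros)
  then have m2: "(\<lambda>z. pois (of_real \<rho> * cis (fst z)) (snd z)) \<in> borel_measurable (borel \<Otimes>\<^sub>M borel)"
    by (subst borel_prod) (rule borel_measurable_continuous_onI)
  have "circle_int (\<lambda>s. ennreal (cmod (F (of_real \<rho> * cis s)) powr p))
    \<le> circle_int (\<lambda>s. circle_int (\<lambda>t. ennreal (pois (of_real \<rho> * cis s) t * cmod (F (cis t)) powr p)))"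
    by (intro circle_int_mono pois_powr_le F w p)
  also have "\<dots> = circle_int (\<lambda>t. circle_int (\<lambda>s. ennreal (pois (of_real \<rho> * cis s) t * cmod (F (cis t)) powr p)))"
    using m2 by (intro circle_int_swap) (simp add: split_beta')
  also have "\<dots> = circle_int (\<lambda>t. circle_int (\<lambda>s. ennreal (cmod (F (cis t)) powr p) * ennreal (pois (of_real \<rho> * cis t) s)))" (is "circle_int ?f = circle_int ?g")
    using pois_nonneg[OF w] 
    by (intro arg_cong[where f = circle_int] ext) (subst pois_swap, simp add: ennreal_mult mult.commute)
  also have "\<dots> = circle_int (\<lambda>t. ennreal (cmod (F (cis t)) powr p))"
    using w by (subst circle_int_cmult) (auto simp: circle_int_pois intro!: measurable_compose[OF borel_measurable_continuous_onI measurable_ennreal] continuous_on_pois)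
  finally show ?thesis .
qed auto

section \<open>Polynomials in the cosine off the real axis\<close>

text \<open>\<open>w\<^sup>N q((w + 1 / w) / 2)\<close>, written so that it makes sense at \<open>w = 0\<close>; for \<open>w = exp (\<i> t)\<close> the last
  argument is \<open>cos t\<close>.\<close>

definition circ_poly :: "nat \<Rightarrow> complex poly \<Rightarrow> complex \<Rightarrow> complex" where
  "circ_poly N q w = (\<Sum>k\<le>N. coeff q k * w ^ (N - k) * ((w\<^sup>2 + 1) / 2) ^ k)"

lemma poly_altdef_le:
  fixes q :: "'a::comm_semiring_1 poly"
  assumes "degree q \<le> N"
  shows "poly q x = (\<Sum>k\<le>N. coeff q k * x ^ k)"
  unfolding poly_altdef using assms
  by (intro sum.mono_neutral_left) (auto simp: coeff_eq_0)

lemma circ_poly_eq: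
  assumes "degree q \<le> N" "w \<noteq> 0"
  shows "circ_poly N q w = w ^ N * poly q ((w + 1 / w) / 2)"
  unfolding circ_poly_def poly_altdef_le[OF assms(1)] sum_distrib_left
proof (rule sum.cong)
  fix k assume "k \<in> {..N}"
  then have "w ^ N = w ^ (N - k) * w ^ k" by (simp flip: power_add)
  moreover have "w * ((w + 1 / w) / 2) = (w\<^sup>2 + 1) / 2"
    using assms(2) by (simp add: field_simps power2_eq_square)
  then have "((w\<^sup>2 + 1) / 2) ^ k = w ^ k * ((w + 1 / w) / 2) ^ k"
    by (metis power_mult_distrib)
  ultimately show "coeff q k * w ^ (N - k) * ((w\<^sup>2 + 1) / 2) ^ k = w ^ N * (coeff q k * ((w + 1 / w) / 2) ^ k)"
    by (simp only: mult_ac)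
qed simp

text \<open>Under \<open>w = exp (\<i> * z)\<close> the line \<open>Im z = \<eta>\<close> becomes
  the circle of radius \<open>exp (- \<eta>)\<close>. Statements about circles for the entire
  function \<open>circ_poly N q\<close> thus become statements about \<open>poly q (cos z)\<close>
  on horizontal lines, at the price of an exponential factor.\<close>

lemma circ_poly_exp:
  assumes "degree q \<le> N"
  shows "cmod (circ_poly N q (exp (\<i> * z))) = exp (- real N * Im z) * cmod (poly q (cos z))"
proof -
  have "(exp (\<i> * z) + 1 / exp (\<i> * z)) / 2 = cos z"
    unfolding cos_exp_eq exp_minus inverse_eq_divide ..
  moreover have "cmod (exp (\<i> * z) ^ N) = exp (- real N * Im z)"
    using exp_of_nat_mult[of N "- Im z"] by (simp add: norm_power norm_exp_eq_Re)
  ultimately show ?thesis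
    using circ_poly_eq[OF assms, of "exp (\<i> * z)"] by (simp add: norm_mult)
qed

lemma holomorphic_circ_poly: "circ_poly N q holomorphic_on A"
  unfolding circ_poly_def by (intro holomorphic_intros) auto

lemma holomorphic_circ_poly_scale: "(\<lambda>w. circ_poly N q (c * w)) holomorphic_on A"
  unfolding circ_poly_def by (intro holomorphic_intros) auto

lemma exp_i_complex: "exp (\<i> * (of_real t + \<i> * of_real \<eta>)) = of_real (exp (- \<eta>)) * cis t"
proof -
  have "\<i> * (of_real t + \<i> * of_real \<eta>) = of_real (- \<eta>) + \<i> * of_real t" by (simp add: algebra_simps)
  then show ?thesis by (simp only: exp_add exp_of_real cis_conv_exp)
qed

text \<open>For real \<open>z\<close> this exhibits \<open>2 * \<bar>sin t\<bar>\<close> as the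
  modulus of a holomorphic function of \<open>w = exp (\<i> * z)\<close>. The factor
  \<open>exp (- Im z)\<close> off the real axis is the source of the \<open>+ 1\<close> in the
  exponent of \<open>Iw_Im_le\<close>.\<close>

lemma cmod_one_minus_exp: "cmod (1 - (exp (\<i> * z))\<^sup>2) = 2 * exp (- Im z) * cmod (sin z)"
proof -
  have "1 - (exp (\<i> * z))\<^sup>2 = - 2 * \<i> * exp (\<i> * z) * sin z"
    by (simp add: sin_exp_eq exp_minus field_simps power2_eq_square)
  then show ?thesis by (simp add: norm_mult norm_exp_eq_Re)
qed

definition I0 :: "real \<Rightarrow> complex poly \<Rightarrow> complex \<Rightarrow> ennreal" where
  "I0 p q \<alpha> = circle_int (\<lambda>t. ennreal (cmod (poly q (cos (of_real t + \<alpha>))) powr p))"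

text \<open>The weight has a shift \<open>\<beta>\<close> of its own: subharmonicity controls the
  case \<open>\<beta> = \<alpha>\<close>, whereas the substitution \<open>x = cos t\<close> calls
  for \<open>\<beta> = 0\<close>.\<close>

definition Iw :: "real \<Rightarrow> complex poly \<Rightarrow> complex \<Rightarrow> complex \<Rightarrow> ennreal" where
  "Iw p q \<alpha> \<beta> = circle_int (\<lambda>t. ennreal (cmod (poly q (cos (of_real t + \<alpha>))) powr p * cmod (sin (of_real t + \<beta>))))"

lemma borel_measurable_poly[measurable]: "poly (q :: complex poly) \<in> borel_measurable borel"
  by (intro borel_measurable_continuous_onI continuous_intros)

lemma complex_cos_periodic: "cos (z + 2 * of_real pi) = cos (z::complex)"
  and complex_sin_periodic: "sin (z + 2 * of_real pi) = sin (z::complex)"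
  using cos_add[of z "2 * of_real pi"] sin_add[of z "2 * of_real pi"]
  by (simp_all flip: cos_of_real sin_of_real of_real_mult add: sin_double cos_double)

lemma Iw_shift: "Iw p q (\<alpha> + of_real a) (\<beta> + of_real a) = Iw p q \<alpha> \<beta>"
proof -
  let ?G = "\<lambda>t. ennreal (cmod (poly q (cos (of_real t + \<alpha>))) powr p * cmod (sin (of_real t + \<beta>)))"
  have "?G (t + 2 * pi) = ?G t" for t
    using complex_cos_periodic[of "of_real t + \<alpha>"] complex_sin_periodic[of "of_real t + \<beta>"] by (simp add: add_ac)
  then have "circle_int (\<lambda>t. ?G (t + a)) = circle_int ?G" by (intro circle_int_shift) measurable
  then show ?thesis by (simp add: Iw_def add_ac)
qed

lemma I0_shift: "I0 p q (\<alpha> + of_real a) = I0 p q \<alpha>"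
proof -
  let ?G = "\<lambda>t. ennreal (cmod (poly q (cos (of_real t + \<alpha>))) powr p)"
  have "?G (t + 2 * pi) = ?G t" for t
    using complex_cos_periodic[of "of_real t + \<alpha>"] by (simp add: add_ac)
  then have "circle_int (\<lambda>t. ?G (t + a)) = circle_int ?G" by (intro circle_int_shift) measurable
  then show ?thesis by (simp add: I0_def add_ac)
qed

lemma circle_int_reflect:
  fixes G :: "real \<Rightarrow> ennreal"
  assumes [measurable]: "G \<in> borel_measurable borel"
  shows "circle_int (\<lambda>t. G (2 * pi - t)) = circle_int G"
  unfolding circle_int_def
  by (subst (2) nn_integral_real_affine[where c = "-1" and t = "2 * pi"])
     (auto intro!: nn_integral_cong simp: indicator_def)

lemma Iw_reflect: "Iw p q (- \<alpha>) (- \<beta>) = Iw p q \<alpha> \<beta>"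
proof -
  let ?G = "\<lambda>t. ennreal (cmod (poly q (cos (of_real t + \<alpha>))) powr p * cmod (sin (of_real t + \<beta>)))"
  have "?G (2 * pi - t) = ennreal (cmod (poly q (cos (of_real t + - \<alpha>))) powr p * cmod (sin (of_real t + - \<beta>)))" for t
    using complex_cos_periodic[of "- (of_real t - \<alpha>)"] complex_sin_periodic[of "- (of_real t - \<beta>)"]
    unfolding cos_minus sin_minus by (simp add: algebra_simps)
  then show ?thesis unfolding Iw_def using circle_int_reflect[of ?G] by simp
qed

lemma I0_reflect: "I0 p q (- \<alpha>) = I0 p q \<alpha>"
proof -
  let ?G = "\<lambda>t. ennreal (cmod (poly q (cos (of_real t + \<alpha>))) powr p)"
  have "?G (2 * pi - t) = ennreal (cmod (poly q (cos (of_real t + - \<alpha>))) powr p)" for t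
    using complex_cos_periodic[of "- (of_real t - \<alpha>)"]
    unfolding cos_minus by (simp add: algebra_simps)
  then show ?thesis unfolding I0_def using circle_int_reflect[of ?G] by simp
qed

lemma I0_Im: "I0 p q \<alpha> = I0 p q (\<i> * of_real (Im \<alpha>))"
proof -
  have "\<alpha> = \<i> * of_real (Im \<alpha>) + of_real (Re \<alpha>)" by (simp add: complex_eq_iff)
  then show ?thesis by (metis I0_shift)
qed

lemma Iw_Im: "Iw p q \<alpha> \<alpha> = Iw p q (\<i> * of_real (Im \<alpha>)) (\<i> * of_real (Im \<alpha>))"
proof -
  have "\<alpha> = \<i> * of_real (Im \<alpha>) + of_real (Re \<alpha>)" by (simp add: complex_eq_iff)
  then show ?thesis by (metis Iw_shift)
qed

lemma exp_powr_real: "exp (x::real) powr p = exp (p * x)"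
  by (simp add: powr_def)

text \<open>The circular means of \<open>\<bar>F w\<bar> powr p\<close> with
  \<open>F w = circ_poly N q w * (1 - w\<^sup>2) powr (1 / p)\<close> increase with the radius and
  carry exactly the weight of \<open>Iw\<close>. Comparing the radii \<open>exp (- \<eta>)\<close>
  and 1 gives the bound for heights \<open>\<eta> \<ge> 0\<close>; negative heights follow by
  reflection.\<close>

lemma Iw_Im_le:
  assumes deg: "degree q \<le> N" and p: "1 \<le> p"
  shows "Iw p q \<alpha> \<alpha> \<le> ennreal (exp ((p * real N + 1) * \<bar>Im \<alpha>\<bar>)) * Iw p q 0 0"
proof -
  have main: "Iw p q (\<i> * of_real \<eta>) (\<i> * of_real \<eta>) \<le> ennreal (exp ((p * real N + 1) * \<eta>)) * Iw p q 0 0"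
    if \<eta>: "0 \<le> \<eta>" for \<eta>
  proof -
    define F where "F = (\<lambda>w. circ_poly N q w * (1 - w\<^sup>2) powr (of_real (1 / p)))"
    \<comment> \<open>\<open>1 - w\<^sup>2\<close> stays in the right half-plane, away from the
      branch cut: the principal power is holomorphic inside the disc and, its exponent being
      positive, continuous up to the two zeros on the circle.\<close>
    have re: "0 \<le> Re (1 - w\<^sup>2)" "cmod w < 1 \<Longrightarrow> 0 < Re (1 - w\<^sup>2)" if "cmod w \<le> 1" for w
    proof -
      have "Re (w\<^sup>2) \<le> (cmod w)\<^sup>2" by (metis complex_Re_le_cmod norm_power)
      moreover have "(cmod w)\<^sup>2 \<le> 1" using that by (intro power_le_one) auto
      moreover have "(cmod w)\<^sup>2 < 1" if "cmod w < 1" using that by (simp add: power_less_one_iff)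
      ultimately show "0 \<le> Re (1 - w\<^sup>2)" "cmod w < 1 \<Longrightarrow> 0 < Re (1 - w\<^sup>2)" by auto
    qed
    have hol: "F holomorphic_on ball 0 1"
      unfolding F_def using re(2)
      by (intro holomorphic_intros holomorphic_circ_poly) (force simp: complex_nonpos_Reals_iff)+
    have cont: "continuous_on (cball 0 1) F"
      unfolding F_def using re(1) p
      by (intro continuous_intros holomorphic_on_imp_continuous_on[OF holomorphic_circ_poly]) auto
    have Fp: "cmod (F w) powr p = cmod (circ_poly N q w) powr p * cmod (1 - w\<^sup>2)" for w
      using p by (simp add: F_def norm_mult powr_mult norm_powr_real_powr' powr_powr)
    have eq: "cmod (F (of_real (exp (- h)) * cis t)) powr p
        = 2 * exp (- (p * real N + 1) * h) * (cmod (poly q (cos (of_real t + \<i> * of_real h))) powr p * cmod (sin (of_real t + \<i> * of_real h)))" for t h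
    proof -
      have "cmod (F (of_real (exp (- h)) * cis t)) powr p
         = (exp (- real N * h) * cmod (poly q (cos (of_real t + \<i> * of_real h)))) powr p * (2 * exp (- h) * cmod (sin (of_real t + \<i> * of_real h)))"
        unfolding Fp exp_i_complex[symmetric] circ_poly_exp[OF deg] cmod_one_minus_exp by simp
      also have "\<dots> = exp (- p * real N * h) * exp (- h) * (2 * (cmod (poly q (cos (of_real t + \<i> * of_real h))) powr p * cmod (sin (of_real t + \<i> * of_real h))))"
        by (simp add: powr_mult exp_powr_real mult_ac)
      also have "exp (- p * real N * h) * exp (- h) = exp (- (p * real N + 1) * h)"
        by (simp add: algebra_simps flip: exp_add)
      finally show ?thesis by simp
    qed
    have e0: "circle_int (\<lambda>s. ennreal (cmod (F (of_real (exp (- h)) * cis s)) powr p))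
        = ennreal (2 * exp (- (p * real N + 1) * h)) * Iw p q (\<i> * of_real h) (\<i> * of_real h)" for h
      unfolding eq Iw_def by (subst circle_int_cmult[symmetric]) (auto simp: ennreal_mult)
    have "ennreal (2 * exp (- (p * real N + 1) * \<eta>)) * Iw p q (\<i> * of_real \<eta>) (\<i> * of_real \<eta>)
       \<le> ennreal (2 * exp (- (p * real N + 1) * 0)) * Iw p q (\<i> * of_real 0) (\<i> * of_real 0)"
      unfolding e0[symmetric] using circle_mean_mono[OF hol cont p, of "exp (- \<eta>)"] \<eta> by simp
    then have "ennreal (exp ((p * real N + 1) * \<eta>) / 2) * (ennreal (2 * exp (- (p * real N + 1) * \<eta>)) * Iw p q (\<i> * of_real \<eta>) (\<i> * of_real \<eta>))
       \<le> ennreal (exp ((p * real N + 1) * \<eta>) / 2) * (ennreal 2 * Iw p q 0 0)"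
      by (intro mult_left_mono) auto
    moreover have "exp ((p * real N + 1) * \<eta>) / 2 * (2 * exp (- (p * real N + 1) * \<eta>)) = 1"
      by (simp add: algebra_simps flip: exp_add) 
    moreover have "ennreal (exp ((p * real N + 1) * \<eta>) / 2) * (ennreal 2 * Iw p q 0 0) = ennreal (exp ((p * real N + 1) * \<eta>)) * Iw p q 0 0"
      by (subst mult.assoc[symmetric], subst ennreal_mult[symmetric]) auto
    ultimately show ?thesis
      by (simp add: mult.assoc[symmetric] flip: ennreal_mult)
  qed
  show ?thesis
  proof (cases "Im \<alpha> \<ge> 0")
    case True
    then show ?thesis using main[of "Im \<alpha>"] by (subst Iw_Im) simp
  next
    case False
    have "Iw p q \<alpha> \<alpha> = Iw p q (\<i> * of_real (- Im \<alpha>)) (\<i> * of_real (- Im \<alpha>))"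
      by (subst Iw_reflect[symmetric], subst Iw_Im) simp
    then show ?thesis using main[of "- Im \<alpha>"] False by simp
  qed
qed

text \<open>Scaling the argument of \<open>circ_poly\<close> by \<open>exp \<eta>\<close> places the
  line of height \<open>- \<eta>\<close> on the unit circle and all higher lines inside, so that one
  monotonicity covers positive and negative heights. Reflection turns \<open>- \<eta>\<close> into
  \<open>\<eta>\<close>, and the two exponential factors are merged into one.\<close>

lemma I0_mono:
  assumes deg: "degree q \<le> N" and p: "1 \<le> p" and \<eta>: "\<bar>Im \<alpha>\<bar> \<le> \<eta>"
  shows "I0 p q \<alpha> \<le> ennreal (exp (2 * p * real N * \<eta>)) * I0 p q (\<i> * of_real \<eta>)"
proof -
  define b where "b = Im \<alpha>"
  define F where "F = (\<lambda>w. circ_poly N q (of_real (exp \<eta>) * w))"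
  have hol: "F holomorphic_on A" for A unfolding F_def by (rule holomorphic_circ_poly_scale)
  have eq: "cmod (F (of_real (exp (- \<eta> - h)) * cis t)) powr p
        = exp (- (p * real N) * h) * cmod (poly q (cos (of_real t + \<i> * of_real h))) powr p" for t h
  proof -
    have e: "complex_of_real (exp \<eta>) * (of_real (exp (- \<eta> - h)) * cis t) = exp (\<i> * (of_real t + \<i> * of_real h))"
      unfolding exp_i_complex by (simp add: exp_diff exp_minus field_simps)
    have "cmod (F (of_real (exp (- \<eta> - h)) * cis t)) powr p
        = (exp (- real N * h) * cmod (poly q (cos (of_real t + \<i> * of_real h)))) powr p"
      unfolding F_def e circ_poly_exp[OF deg] by simp
    then show ?thesis by (simp add: powr_mult exp_powr_real mult_ac)
  qed
  have e0: "circle_int (\<lambda>s. ennreal (cmod (F (of_real (exp (- \<eta> - h)) * cis s)) powr p))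
        = ennreal (exp (- (p * real N) * h)) * I0 p q (\<i> * of_real h)" for h
    unfolding eq I0_def by (subst circle_int_cmult[symmetric]) (auto simp: ennreal_mult)
  have "ennreal (exp (- (p * real N) * b)) * I0 p q (\<i> * of_real b) \<le> ennreal (exp (- (p * real N) * - \<eta>)) * I0 p q (\<i> * of_real (- \<eta>))"
    unfolding e0[symmetric]
    using circle_mean_mono[OF hol holomorphic_on_imp_continuous_on[OF hol] p, of "exp (- \<eta> - b)"] \<eta> b_def by simp
  then have "ennreal (exp (p * real N * b)) * (ennreal (exp (- (p * real N) * b)) * I0 p q (\<i> * of_real b))
      \<le> ennreal (exp (p * real N * b)) * (ennreal (exp (- (p * real N) * - \<eta>)) * I0 p q (\<i> * of_real (- \<eta>)))"
    by (intro mult_left_mono) auto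
  moreover have "exp (p * real N * b) * exp (- (p * real N) * b) = 1" by (simp flip: exp_add)
  moreover have "I0 p q (\<i> * of_real (- \<eta>)) = I0 p q (\<i> * of_real \<eta>)"
    using I0_reflect[of p q "\<i> * of_real \<eta>"] by simp
  moreover have "I0 p q (\<i> * of_real b) = I0 p q \<alpha>" using I0_Im[of p q \<alpha>] by (simp add: b_def)
  ultimately have "I0 p q \<alpha> \<le> ennreal (exp (p * real N * b) * exp (p * real N * \<eta>)) * I0 p q (\<i> * of_real \<eta>)"
    by (simp add: mult.assoc[symmetric] flip: ennreal_mult)
  also have "exp (p * real N * b) * exp (p * real N * \<eta>) \<le> exp (2 * p * real N * \<eta>)"
  proof -
    have "p * real N * b \<le> p * real N * \<eta>" using p \<eta> b_def by (intro mult_left_mono) auto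
    then show ?thesis unfolding exp_add[symmetric] exp_le_cancel_iff by linarith
  qed
  then have "ennreal (exp (p * real N * b) * exp (p * real N * \<eta>)) * I0 p q (\<i> * of_real \<eta>)
      \<le> ennreal (exp (2 * p * real N * \<eta>)) * I0 p q (\<i> * of_real \<eta>)"
    by (intro mult_right_mono ennreal_leI) auto
  finally show ?thesis .
qed

section \<open>Sine and cosine off the real axis, and the comparison of weighted with unweighted
  means\<close>

lemma abs_le_abs_sinh: "\<bar>x\<bar> \<le> \<bar>sinh (x::real)\<bar>"
proof -
  have "x \<le> sinh x" if "0 \<le> x" for x :: real
  proof -
    have "((\<lambda>x. sinh x - x) has_real_derivative (cosh x - 1)) (at x)" for x :: real
      by (auto intro!: derivative_eq_intros)
    then have "sinh 0 - 0 \<le> sinh x - x"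
      using that by (intro deriv_nonneg_imp_mono[where g = "\<lambda>x. sinh x - x" and g' = "\<lambda>x. cosh x - 1"])
        (auto simp: cosh_real_ge_1)
    then show ?thesis by simp
  qed
  from this[of x] this[of "-x"] show ?thesis by (cases "0 \<le> x") auto
qed

lemma cmod_sin_squared: "(cmod (sin z))\<^sup>2 = (sin (Re z))\<^sup>2 + (sinh (Im z))\<^sup>2"
  unfolding norm_sin_squared cos_double_sin sinh_field_def exp_double exp_minus
  by (simp add: field_simps power2_eq_square)

lemma cmod_cos_squared: "(cmod (cos z))\<^sup>2 = (cos (Re z))\<^sup>2 + (sinh (Im z))\<^sup>2"
  unfolding norm_cos_squared sinh_field_def exp_minus by (simp add: power_divide)

lemma abs_Im_le_cmod_sin: "\<bar>Im z\<bar> \<le> cmod (sin z)"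
proof -
  have "\<bar>Im z\<bar>\<^sup>2 \<le> \<bar>sinh (Im z)\<bar>\<^sup>2" using abs_le_abs_sinh by (intro power_mono) auto
  also have "\<dots> \<le> (cmod (sin z))\<^sup>2" by (simp add: cmod_sin_squared)
  finally show ?thesis by (rule power2_le_imp_le) simp
qed

lemma cmod_cos_le: "cmod (cos z) \<le> exp \<bar>Im z\<bar>"
proof -
  have "cmod (cos z) \<le> (cmod (exp (\<i> * z)) + cmod (exp (- (\<i> * z)))) / 2"
    unfolding cos_exp_eq using norm_triangle_ineq[of "exp (\<i> * z)" "exp (- (\<i> * z))"] by (simp add: norm_divide)
  also have "\<dots> = (exp (- Im z) + exp (Im z)) / 2" by (simp add: norm_exp_eq_Re)
  also have "\<dots> \<le> (exp \<bar>Im z\<bar> + exp \<bar>Im z\<bar>) / 2"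
    by (intro divide_right_mono add_mono) auto
  finally show ?thesis by simp
qed

text \<open>At height \<open>2 / N\<close> the sine has modulus at least \<open>2 / N\<close>, so
  the weight can be inserted at the cost of \<open>N / 2\<close>; \<open>Iw_Im_le\<close> then
  returns to the real axis with a factor that does not grow with \<open>N\<close>.\<close>

lemma I0_le_Iw:
  assumes deg: "degree q \<le> N" and p: "1 \<le> p" and N: "1 \<le> N" and \<alpha>: "\<bar>Im \<alpha>\<bar> \<le> 2 / real N"
  shows "I0 p q \<alpha> \<le> ennreal (real N * exp (6 * p + 2)) * Iw p q 0 0"
proof -
  \<comment> \<open>Height \<open>2 / N\<close> rather than \<open>1 / N\<close>, so that the lemma
    still covers shifts by \<open>1 / N\<close> of a line that already lies at height
    \<open>1 / N\<close>.\<close>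
  define \<eta> where "\<eta> = 2 / real N"
  have \<eta>: "0 \<le> \<eta>" "\<eta> \<le> 2" "real N * \<eta> = 2" using N by (auto simp: \<eta>_def field_simps)
  have "ennreal (2 / real N) * I0 p q (\<i> * of_real \<eta>)
      = circle_int (\<lambda>t. ennreal (2 / real N) * ennreal (cmod (poly q (cos (of_real t + \<i> * of_real \<eta>))) powr p))"
    unfolding I0_def by (subst circle_int_cmult) auto
  also have "\<dots> \<le> Iw p q (\<i> * of_real \<eta>) (\<i> * of_real \<eta>)"
    unfolding Iw_def
  proof (rule circle_int_mono)
    fix t :: real
    have "\<eta> \<le> cmod (sin (of_real t + \<i> * of_real \<eta>))"
      using abs_Im_le_cmod_sin[of "of_real t + \<i> * of_real \<eta>"] \<eta> by simp
    then have "2 / real N * cmod (poly q (cos (of_real t + \<i> * of_real \<eta>))) powr p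
         \<le> cmod (sin (of_real t + \<i> * of_real \<eta>)) * cmod (poly q (cos (of_real t + \<i> * of_real \<eta>))) powr p"
      by (intro mult_right_mono) (auto simp: \<eta>_def)
    then show "ennreal (2 / real N) * ennreal (cmod (poly q (cos (of_real t + \<i> * of_real \<eta>))) powr p)
       \<le> ennreal (cmod (poly q (cos (of_real t + \<i> * of_real \<eta>))) powr p * cmod (sin (of_real t + \<i> * of_real \<eta>)))"
      by (simp add: mult.commute flip: ennreal_mult)
  qed
  also have "\<dots> \<le> ennreal (exp ((p * real N + 1) * \<eta>)) * Iw p q 0 0"
    using Iw_Im_le[OF deg p, of "\<i> * of_real \<eta>"] \<eta> by simp
  finally have 1: "ennreal (2 / real N) * I0 p q (\<i> * of_real \<eta>) \<le> ennreal (exp ((p * real N + 1) * \<eta>)) * Iw p q 0 0" .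
  have "I0 p q \<alpha> \<le> ennreal (exp (2 * p * real N * \<eta>)) * I0 p q (\<i> * of_real \<eta>)"
    using I0_mono[OF deg p] \<alpha> unfolding \<eta>_def by blast
  also have "\<dots> = ennreal (exp (2 * p * real N * \<eta>) * (real N / 2)) * (ennreal (2 / real N) * I0 p q (\<i> * of_real \<eta>))"
    using N by (simp add: mult.assoc[symmetric] flip: ennreal_mult)
  also have "\<dots> \<le> ennreal (exp (2 * p * real N * \<eta>) * (real N / 2)) * (ennreal (exp ((p * real N + 1) * \<eta>)) * Iw p q 0 0)"
    by (intro mult_left_mono 1) auto
  also have "\<dots> = ennreal (exp (2 * p * real N * \<eta>) * (real N / 2) * exp ((p * real N + 1) * \<eta>)) * Iw p q 0 0"
    by (subst mult.assoc[symmetric], subst ennreal_mult[symmetric]) auto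
  also have "exp (2 * p * real N * \<eta>) * (real N / 2) * exp ((p * real N + 1) * \<eta>) \<le> real N * exp (6 * p + 2)"
  proof -
    have "2 * p * real N * \<eta> + (p * real N + 1) * \<eta> = 3 * p * (real N * \<eta>) + \<eta>" by (simp add: algebra_simps)
    also have "\<dots> \<le> 6 * p + 2" unfolding \<eta>(3) using \<eta>(2) by simp
    finally have "exp (2 * p * real N * \<eta>) * exp ((p * real N + 1) * \<eta>) \<le> exp (6 * p + 2)" by (simp flip: exp_add)
    then have "(real N / 2) * (exp (2 * p * real N * \<eta>) * exp ((p * real N + 1) * \<eta>)) \<le> real N * exp (6 * p + 2)"
      by (intro mult_mono) auto
    then show ?thesis by (simp only: mult_ac)
  qed
  then have "ennreal (exp (2 * p * real N * \<eta>) * (real N / 2) * exp ((p * real N + 1) * \<eta>)) * Iw p q 0 0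
     \<le> ennreal (real N * exp (6 * p + 2)) * Iw p q 0 0"
    by (intro mult_right_mono ennreal_leI) auto
  finally show ?thesis .
qed

lemma cmod_sin_diff_le:
  assumes "\<bar>Im z\<bar> \<le> 1" "\<bar>Im w\<bar> \<le> 1"
  shows "cmod (sin z - sin w) \<le> exp 1 * cmod (z - w)"
proof -
  have S: "{z. \<bar>Im z\<bar> \<le> 1} = {z. Im z \<le> 1} \<inter> {z. Im z \<ge> -1}" by auto
  have "convex {z. \<bar>Im z\<bar> \<le> 1}"
    unfolding S by (intro convex_Int convex_halfspace_Im_le convex_halfspace_Im_ge)
  then show ?thesis
  proof (rule field_differentiable_bound[where f' = cos])
    show "(sin has_field_derivative cos z) (at z within {z. \<bar>Im z\<bar> \<le> 1})" for z :: complex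
      by (rule has_field_derivative_at_within[OF DERIV_sin])
    show "cmod (cos z) \<le> exp 1" if "z \<in> {z. \<bar>Im z\<bar> \<le> 1}" for z
      using cmod_cos_le[of z] that by (smt (verit) exp_le_cancel_iff mem_Collect_eq)
  qed (use assms in auto)
qed

text \<open>Replacing the weight at \<open>t\<close> by the weight at the shifted point costs
  \<open>exp 1 / N\<close> times the unweighted mean, and \<open>I0_le_Iw\<close> bounds that mean
  with a loss of exactly one factor \<open>N\<close>: the two cancel.\<close>

lemma Iw_le:
  assumes deg: "degree q \<le> N" and p: "1 \<le> p" and N: "1 \<le> N" and \<alpha>: "cmod \<alpha> \<le> 1 / real N"
  shows "Iw p q \<alpha> 0 \<le> ennreal (exp (p + 1) + exp (6 * p + 3)) * Iw p q 0 0"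
proof -
  have Im: "\<bar>Im \<alpha>\<bar> \<le> 1 / real N" "1 / real N \<le> 1" "1 / real N \<le> 2 / real N"
    using abs_Im_le_cmod[of \<alpha>] \<alpha> N by (auto intro: divide_right_mono)
  have "Iw p q \<alpha> 0 \<le> circle_int (\<lambda>t. ennreal (cmod (poly q (cos (of_real t + \<alpha>))) powr p * cmod (sin (of_real t + \<alpha>)))
       + ennreal (exp 1 / real N) * ennreal (cmod (poly q (cos (of_real t + \<alpha>))) powr p))"
    unfolding Iw_def
  proof (rule circle_int_mono)
    fix t :: real
    have "cmod (sin (of_real t)) \<le> cmod (sin (of_real t + \<alpha>)) + cmod (sin (of_real t) - sin (of_real t + \<alpha>))"
      by (rule norm_triangle_sub)
    also have "cmod (sin (of_real t) - sin (of_real t + \<alpha>)) \<le> exp 1 * cmod (of_real t - (of_real t + \<alpha>))"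
      using Im by (intro cmod_sin_diff_le) auto
    also have "\<dots> \<le> exp 1 * (1 / real N)" using \<alpha> by (intro mult_left_mono) auto
    finally have "cmod (poly q (cos (of_real t + \<alpha>))) powr p * cmod (sin (of_real t))
       \<le> cmod (poly q (cos (of_real t + \<alpha>))) powr p * (cmod (sin (of_real t + \<alpha>)) + exp 1 / real N)"
      by (intro mult_left_mono) auto
    then show "ennreal (cmod (poly q (cos (of_real t + \<alpha>))) powr p * cmod (sin (of_real t + 0)))
     \<le> ennreal (cmod (poly q (cos (of_real t + \<alpha>))) powr p * cmod (sin (of_real t + \<alpha>)))
       + ennreal (exp 1 / real N) * ennreal (cmod (poly q (cos (of_real t + \<alpha>))) powr p)"
      by (simp add: algebra_simps flip: ennreal_mult ennreal_plus)
  qed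
  also have "\<dots> = Iw p q \<alpha> \<alpha> + ennreal (exp 1 / real N) * I0 p q \<alpha>"
    unfolding Iw_def I0_def by (subst circle_int_add) (auto simp: circle_int_cmult)
  also have "\<dots> \<le> ennreal (exp (p + 1)) * Iw p q 0 0 + ennreal (exp 1 / real N) * (ennreal (real N * exp (6 * p + 2)) * Iw p q 0 0)"
  proof (intro add_mono mult_left_mono)
    show "I0 p q \<alpha> \<le> ennreal (real N * exp (6 * p + 2)) * Iw p q 0 0"
      using Im by (intro I0_le_Iw deg p N) auto
    have "(p * real N + 1) * \<bar>Im \<alpha>\<bar> \<le> (p * real N + 1) * (1 / real N)"
      using Im p by (intro mult_left_mono) auto
    also have "\<dots> \<le> p + 1" using N by (simp add: field_simps)
    finally have "ennreal (exp ((p * real N + 1) * \<bar>Im \<alpha>\<bar>)) * Iw p q 0 0 \<le> ennreal (exp (p + 1)) * Iw p q 0 0"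
      by (intro mult_right_mono ennreal_leI) auto
    with Iw_Im_le[OF deg p, of \<alpha>] show "Iw p q \<alpha> \<alpha> \<le> ennreal (exp (p + 1)) * Iw p q 0 0" by (rule order_trans)
  qed simp
  also have "\<dots> = ennreal (exp (p + 1) + exp (6 * p + 3)) * Iw p q 0 0"
  proof -
    have "exp 1 / real N * (real N * exp (6 * p + 2)) = exp (6 * p + 3)"
      using N by (simp flip: exp_add)
    then show ?thesis by (simp add: mult.assoc[symmetric] distrib_right ennreal_plus flip: ennreal_mult)
  qed
  finally show ?thesis .
qed

section \<open>Norms of extended valued functions\<close>

lemma ennreal_powr_ennreal [simp]: "0 \<le> x \<Longrightarrow> ennreal_powr (ennreal x) s = ennreal (x powr s)"
  by (simp add: ennreal_powr_def)

lemma ennreal_powr_top [simp]: "ennreal_powr top s = top"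
  by (simp add: ennreal_powr_def)

lemma ennreal_powr_0 [simp]: "ennreal_powr 0 s = 0"
  by (simp add: ennreal_powr_def)

lemma ennreal_powr_1 [simp]: "ennreal_powr a 1 = a"
  by (cases a) (auto simp: ennreal_powr_def)

lemma ennreal_powr_mono: "a \<le> b \<Longrightarrow> 0 \<le> s \<Longrightarrow> ennreal_powr a s \<le> ennreal_powr b s"
  by (cases a; cases b) (auto intro!: ennreal_leI powr_mono2 simp: top_unique)

lemma ennreal_powr_mult:
  assumes "0 < s" shows "ennreal_powr (a * b) s = ennreal_powr a s * ennreal_powr b s"
proof (cases a; cases b)
  fix x y assume "0 \<le> x" "a = ennreal x" "0 \<le> y" "b = ennreal y"
  then show ?thesis using assms by (simp add: powr_mult flip: ennreal_mult)
next
  fix x assume "0 \<le> x" "a = ennreal x" "b = top"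
  then show ?thesis using assms by (cases "x = 0") (auto simp: ennreal_mult_top)
next
  fix x assume "0 \<le> x" "b = ennreal x" "a = top"
  then show ?thesis using assms by (cases "x = 0") (auto simp: ennreal_top_mult)
qed simp

lemma ennreal_powr_powr:
  assumes "0 < s" "0 < s'" shows "ennreal_powr (ennreal_powr a s) s' = ennreal_powr a (s * s')"
  by (cases a) (use assms in \<open>auto simp: powr_powr\<close>)

lemma ennreal_powr_inverse:
  assumes "0 < s"
  shows "ennreal_powr (ennreal_powr a s) (1 / s) = a" "ennreal_powr (ennreal_powr a (1 / s)) s = a"
  using assms by (simp_all add: ennreal_powr_powr)

lemma measurable_ennreal_powr [measurable]:
  assumes [measurable]: "f \<in> borel_measurable M" shows "(\<lambda>x. ennreal_powr (f x) s) \<in> borel_measurable M"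
  unfolding ennreal_powr_def by measurable

text \<open>Written for extended valued integrands so that a function on \<open>\<Omega>\<close> can be replaced by a Borel
  majorant, which may have to be infinite on a null set.\<close>

definition lpn :: "real \<Rightarrow> 'a measure \<Rightarrow> ('a \<Rightarrow> ennreal) \<Rightarrow> ennreal" where
  "lpn p M F = ennreal_powr (\<integral>\<^sup>+x. ennreal_powr (F x) p \<partial>M) (1 / p)"

lemma lpn_mono: "1 \<le> p \<Longrightarrow> (\<And>x. x \<in> space M \<Longrightarrow> F x \<le> G x) \<Longrightarrow> lpn p M F \<le> lpn p M G"
  unfolding lpn_def by (intro ennreal_powr_mono nn_integral_mono) auto

lemma lpn_power: "1 \<le> p \<Longrightarrow> ennreal_powr (lpn p M F) p = (\<integral>\<^sup>+x. ennreal_powr (F x) p \<partial>M)"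
  unfolding lpn_def by (simp add: ennreal_powr_inverse)

lemma lpn_le_iff:
  assumes "1 \<le> p"
  shows "lpn p M F \<le> c \<longleftrightarrow> (\<integral>\<^sup>+x. ennreal_powr (F x) p \<partial>M) \<le> ennreal_powr c p"
proof
  assume "lpn p M F \<le> c"
  then have "ennreal_powr (lpn p M F) p \<le> ennreal_powr c p" using assms by (intro ennreal_powr_mono) auto
  then show "(\<integral>\<^sup>+x. ennreal_powr (F x) p \<partial>M) \<le> ennreal_powr c p" using assms by (simp add: lpn_power)
next
  assume "(\<integral>\<^sup>+x. ennreal_powr (F x) p \<partial>M) \<le> ennreal_powr c p"
  then have "lpn p M F \<le> ennreal_powr (ennreal_powr c p) (1 / p)"
    unfolding lpn_def using assms by (intro ennreal_powr_mono) auto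
  then show "lpn p M F \<le> c" using assms by (simp add: ennreal_powr_inverse)
qed

lemma lpn_cmult:
  assumes "1 \<le> p" and [measurable]: "F \<in> borel_measurable M"
  shows "lpn p M (\<lambda>x. c * F x) = c * lpn p M F"
  unfolding lpn_def using assms
  by (simp add: ennreal_powr_mult nn_integral_cmult ennreal_powr_inverse)

lemma powr_mean_le:
  fixes x y l p :: real
  assumes "0 \<le> x" "0 \<le> y" "0 \<le> l" "l \<le> 1" "1 \<le> p"
  shows "(l * x + (1 - l) * y) powr p \<le> l * x powr p + (1 - l) * y powr p"
proof (cases "l * x + (1 - l) * y = 0")
  case False
  define m where "m = l * x + (1 - l) * y"
  have m: "0 < m" using assms False unfolding m_def
    by (metis add_nonneg_nonneg diff_ge_0_iff_ge less_eq_real_def mult_nonneg_nonneg)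
  have "m powr p = l * (m powr p + p * m powr (p - 1) * (x - m)) + (1 - l) * (m powr p + p * m powr (p - 1) * (y - m))"
  proof -
    have "l * (x - m) + (1 - l) * (y - m) = 0" by (simp add: m_def algebra_simps)
    then have "p * m powr (p - 1) * (l * (x - m) + (1 - l) * (y - m)) = 0" by simp
    then show ?thesis by (simp add: algebra_simps)
  qed
  also have "\<dots> \<le> l * x powr p + (1 - l) * y powr p"
    using assms powr_tangent_le[OF _ m] by (intro add_mono mult_left_mono) auto
  finally show ?thesis by (simp add: m_def)
qed (use assms in auto)

text \<open>\<open>x + y\<close> is \<open>a + b\<close> times the convex combination of
  \<open>x / a\<close> and \<open>y / b\<close> with weights \<open>a / (a + b)\<close> and
  \<open>b / (a + b)\<close>. Integrated with \<open>a\<close> and \<open>b\<close> close to the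
  norms of two functions, this gives Minkowski's inequality.\<close>

lemma ennreal_powr_add_le:
  fixes a b p :: real and x y :: ennreal
  assumes "0 < a" "0 < b" "1 \<le> p"
  shows "ennreal_powr (x + y) p \<le> ennreal ((a + b) powr p) *
    (ennreal (a / (a + b) / a powr p) * ennreal_powr x p + ennreal (b / (a + b) / b powr p) * ennreal_powr y p)"
proof (cases x; cases y)
  fix u v assume uv: "0 \<le> u" "x = ennreal u" "0 \<le> v" "y = ennreal v"
  define l where "l = a / (a + b)"
  have l: "0 \<le> l" "l \<le> 1" "1 - l = b / (a + b)" using assms by (auto simp: l_def field_simps)
  have "(u + v) powr p = ((a + b) * (l * (u / a) + (1 - l) * (v / b))) powr p"
  proof -
    have "l * (u / a) = u / (a + b)" "(1 - l) * (v / b) = v / (a + b)"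
      unfolding l(3) using assms by (simp_all add: l_def)
    then have "(a + b) * (l * (u / a) + (1 - l) * (v / b)) = u + v"
      using assms by (simp flip: add_divide_distrib)
    then show ?thesis by simp
  qed
  also have "\<dots> = (a + b) powr p * (l * (u / a) + (1 - l) * (v / b)) powr p"
    using assms uv l by (simp add: powr_mult)
  also have "\<dots> \<le> (a + b) powr p * (l * (u / a) powr p + (1 - l) * (v / b) powr p)"
    using assms uv l by (intro mult_left_mono powr_mean_le) auto
  also have "\<dots> = (a + b) powr p * (a / (a + b) / a powr p * u powr p + b / (a + b) / b powr p * v powr p)"
    unfolding l(3) using assms uv by (simp add: l_def powr_divide)
  finally show ?thesis using uv assms
    by (simp flip: ennreal_plus ennreal_mult)
qed (use assms in \<open>auto simp: ennreal_mult_top\<close>)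

lemma lpn_add:
  assumes p: "1 \<le> p" and [measurable]: "F \<in> borel_measurable M" "G \<in> borel_measurable M"
  shows "lpn p M (\<lambda>x. F x + G x) \<le> lpn p M F + lpn p M G"
proof (cases "lpn p M F = top \<or> lpn p M G = top")
  case False
  show ?thesis
  proof (rule ennreal_le_epsilon)
    fix e :: real assume e: "0 < e"
    \<comment> \<open>The summand \<open>e / 2\<close> keeps \<open>a\<close> and \<open>b\<close>
      positive even when a norm vanishes.\<close>
    define a where "a = enn2real (lpn p M F) + e / 2"
    define b where "b = enn2real (lpn p M G) + e / 2"
    have ab: "0 < a" "0 < b" using e by (auto simp: a_def b_def add_nonneg_pos)
    have fa: "lpn p M F \<le> ennreal a" and gb: "lpn p M G \<le> ennreal b"
      using False e by (auto simp: a_def b_def ennreal_plus less_top)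
    have "(\<integral>\<^sup>+x. ennreal_powr (F x + G x) p \<partial>M)
      \<le> (\<integral>\<^sup>+x. ennreal ((a + b) powr p) *
          (ennreal (a / (a + b) / a powr p) * ennreal_powr (F x) p + ennreal (b / (a + b) / b powr p) * ennreal_powr (G x) p) \<partial>M)"
      using ennreal_powr_add_le[OF ab p] by (intro nn_integral_mono) auto
    also have "\<dots> = ennreal ((a + b) powr p) *
          (ennreal (a / (a + b) / a powr p) * (\<integral>\<^sup>+x. ennreal_powr (F x) p \<partial>M) + ennreal (b / (a + b) / b powr p) * (\<integral>\<^sup>+x. ennreal_powr (G x) p \<partial>M))"
      by (simp add: nn_integral_cmult nn_integral_add)
    also have "\<dots> \<le> ennreal ((a + b) powr p) *
          (ennreal (a / (a + b) / a powr p) * ennreal (a powr p) + ennreal (b / (a + b) / b powr p) * ennreal (b powr p))"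
      using fa gb ab by (intro mult_left_mono add_mono) (auto simp: lpn_le_iff[OF p])
    also have "\<dots> = ennreal ((a + b) powr p)"
    proof -
      have "a / (a + b) / a powr p * a powr p + b / (a + b) / b powr p * b powr p = a / (a + b) + b / (a + b)"
        using ab by simp
      also have "\<dots> = 1" using ab by (simp flip: add_divide_distrib)
      finally show ?thesis using ab by (simp flip: ennreal_plus ennreal_mult)
    qed
    also have "\<dots> = ennreal_powr (ennreal (a + b)) p" using ab by (subst ennreal_powr_ennreal) auto
    finally have "lpn p M (\<lambda>x. F x + G x) \<le> ennreal (a + b)" unfolding lpn_le_iff[OF p] .
    also have "ennreal (a + b) = lpn p M F + lpn p M G + ennreal e"
    proof -
      have "a + b = enn2real (lpn p M F) + enn2real (lpn p M G) + e" by (simp add: a_def b_def)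
      then show ?thesis using False e by (simp add: ennreal_plus less_top)
    qed
    finally show "lpn p M (\<lambda>x. F x + G x) \<le> lpn p M F + lpn p M G + ennreal e" .
  qed
qed auto

lemma lpn_0: "1 \<le> p \<Longrightarrow> lpn p M (\<lambda>x. 0) = 0"
  by (simp add: lpn_def)

lemma lpn_sum:
  assumes p: "1 \<le> p" and [measurable]: "\<And>i. i \<in> I \<Longrightarrow> F i \<in> borel_measurable M"
  shows "lpn p M (\<lambda>x. \<Sum>i\<in>I. F i x) \<le> (\<Sum>i\<in>I. lpn p M (F i))"
proof (cases "finite I")
  case True
  then show ?thesis using assms(2)
  proof (induction I rule: finite_induct)
    case (insert i I)
    have "lpn p M (\<lambda>x. \<Sum>i\<in>insert i I. F i x) = lpn p M (\<lambda>x. F i x + (\<Sum>i\<in>I. F i x))"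
      using insert by simp
    also have "\<dots> \<le> lpn p M (F i) + lpn p M (\<lambda>x. \<Sum>i\<in>I. F i x)"
      using insert by (intro lpn_add p) auto
    also have "\<dots> \<le> lpn p M (F i) + (\<Sum>i\<in>I. lpn p M (F i))"
      using insert by (intro add_left_mono) auto
    finally show ?case using insert by simp
  qed (simp add: lpn_0 p)
qed (simp add: lpn_0 p)

section \<open>Derivatives and complex perturbations of the argument\<close>

lemma powr_add_le:
  fixes a b p :: real
  assumes "0 \<le> a" "0 \<le> b" "1 \<le> p"
  shows "(a + b) powr p \<le> 2 powr p * (a powr p + b powr p)"
proof -
  have "(a + b) powr p \<le> (2 * max a b) powr p" using assms by (intro powr_mono2) auto
  also have "\<dots> = 2 powr p * max a b powr p" using assms by (simp add: powr_mult)
  also have "max a b powr p \<le> a powr p + b powr p" by (auto simp: max_def)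
  finally show ?thesis by simp
qed

lemma measurable_cis[measurable]: "cis \<in> borel_measurable borel"
  by (intro borel_measurable_continuous_onI continuous_intros)

text \<open>\<open>F\<close> is the difference quotient at 0 of
  \<open>u \<mapsto> f (z + \<rho> u)\<close>, with its removable singularity filled in. At the
  centre it is \<open>\<rho>\<close> times the derivative, on the unit circle it is bounded by two
  values of \<open>f\<close>; subharmonicity at the centre then gives a Cauchy estimate in the
  mean.\<close>

lemma deriv_powr_le:
  fixes p \<rho> :: real
  assumes f: "f holomorphic_on UNIV" and p: "1 \<le> p" and \<rho>: "0 < \<rho>"
  shows "ennreal ((\<rho> * cmod (deriv f z)) powr p) \<le>
     ennreal (2 powr p) * (ennreal (cmod (f z) powr p) + ennreal (1 / (2 * pi)) * circle_int (\<lambda>t. ennreal (cmod (f (z + of_real \<rho> * cis t)) powr p)))"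
proof -
  define g where "g = (\<lambda>u. f (z + of_real \<rho> * u))"
  define F where "F = (\<lambda>u. if u = 0 then deriv g 0 else (g u - g 0) / (u - 0))"
  have gh: "g holomorphic_on UNIV"
  proof -
    have "(\<lambda>u. z + of_real \<rho> * u) holomorphic_on UNIV" by (intro holomorphic_intros)
    from holomorphic_on_compose_gen[OF this f] show ?thesis by (simp add: g_def o_def)
  qed
  have Fh: "F holomorphic_on A" for A
  proof (rule holomorphic_on_subset)
    show "F holomorphic_on UNIV" unfolding F_def by (rule pole_lemma[OF gh]) simp
  qed simp
  have cf[measurable]: "f \<in> borel_measurable borel"
    by (intro borel_measurable_continuous_onI holomorphic_on_imp_continuous_on f)
  have F0: "cmod (F 0) = \<rho> * cmod (deriv f z)"
  proof -
    have "(f has_field_derivative deriv f z) (at z)"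
      using f by (simp add: holomorphic_derivI)
    then have "(g has_field_derivative deriv f z * of_real \<rho>) (at 0)"
      unfolding g_def
      by (intro DERIV_chain2[where g = "\<lambda>u. z + of_real \<rho> * u"]) (auto intro!: derivative_eq_intros)
    then have "deriv g 0 = deriv f z * of_real \<rho>" by (rule DERIV_imp_deriv)
    then show ?thesis using \<rho> by (simp add: F_def norm_mult)
  qed
  have Fc: "cmod (F (cis t)) powr p \<le> 2 powr p * (cmod (f z) powr p + cmod (f (z + of_real \<rho> * cis t)) powr p)" for t
  proof -
    have "cmod (F (cis t)) = cmod (g (cis t) - g 0)" by (simp add: F_def norm_divide)
    also have "\<dots> \<le> cmod (g (cis t)) + cmod (g 0)" by (rule norm_triangle_ineq4)
    finally have "cmod (F (cis t)) \<le> cmod (f z) + cmod (f (z + of_real \<rho> * cis t))" by (simp add: g_def)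
    then have "cmod (F (cis t)) powr p \<le> (cmod (f z) + cmod (f (z + of_real \<rho> * cis t))) powr p"
      using p by (intro powr_mono2) auto
    also note powr_add_le[OF norm_ge_zero norm_ge_zero p]
    finally show ?thesis .
  qed
  have "ennreal (cmod (F 0) powr p) \<le> circle_int (\<lambda>t. ennreal (pois 0 t * cmod (F (cis t)) powr p))"
    by (rule pois_powr_le[OF Fh holomorphic_on_imp_continuous_on[OF Fh] _ p]) simp
  also have "\<dots> \<le> circle_int (\<lambda>t. ennreal (2 powr p) * (ennreal (cmod (f z) powr p) * ennreal (pois 0 t)
       + ennreal (1 / (2 * pi)) * ennreal (cmod (f (z + of_real \<rho> * cis t)) powr p)))"
  proof (rule circle_int_mono)
    fix t
    have "pois 0 t * cmod (F (cis t)) powr p \<le> 2 powr p * (cmod (f z) powr p * pois 0 t + 1 / (2 * pi) * cmod (f (z + of_real \<rho> * cis t)) powr p)"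
      using mult_left_mono[OF Fc, of "1 / (2 * pi)" t] by (simp add: pois_def algebra_simps)
    then show "ennreal (pois 0 t * cmod (F (cis t)) powr p) \<le> ennreal (2 powr p) * (ennreal (cmod (f z) powr p) * ennreal (pois 0 t)
       + ennreal (1 / (2 * pi)) * ennreal (cmod (f (z + of_real \<rho> * cis t)) powr p))"
      using pois_nonneg[of 0 t] by (simp add: ennreal_leI flip: ennreal_mult ennreal_plus)
  qed
  also have "\<dots> = ennreal (2 powr p) * (ennreal (cmod (f z) powr p) * circle_int (\<lambda>t. ennreal (pois 0 t))
       + ennreal (1 / (2 * pi)) * circle_int (\<lambda>t. ennreal (cmod (f (z + of_real \<rho> * cis t)) powr p)))"
    by (subst circle_int_cmult, simp add: pois_def, subst circle_int_add)
       (simp_all add: pois_def circle_int_cmult)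
  finally show ?thesis by (simp add: F0 circle_int_pois)
qed

lemma deriv_poly_cos: "deriv (\<lambda>z. poly q (cos z)) z = - sin z * poly (pderiv q) (cos z)"
proof -
  have "((\<lambda>z. poly q (cos z)) has_field_derivative poly (pderiv q) (cos z) * - sin z) (at z)"
    by (rule DERIV_chain2[OF poly_DERIV DERIV_cos])
  then show ?thesis by (simp add: DERIV_imp_deriv mult.commute)
qed

lemma holomorphic_poly_cos: "(\<lambda>z::complex. poly q (cos z)) holomorphic_on A"
proof -
  have "poly q \<circ> cos holomorphic_on A"
    by (rule holomorphic_on_compose) (auto intro!: holomorphic_intros)
  then show ?thesis by (simp add: o_def)
qed

lemma circle_int_const: "circle_int (\<lambda>t. c) = ennreal (2 * pi) * c"
  unfolding circle_int_def by (simp add: nn_integral_cmult mult.commute)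

lemma circle_mean_bound:
  assumes "\<And>t. G t \<le> B"
  shows "ennreal (1 / (2 * pi)) * circle_int G \<le> B"
proof -
  have "ennreal (1 / (2 * pi)) * circle_int G \<le> ennreal (1 / (2 * pi)) * circle_int (\<lambda>t. B)"
    by (intro mult_left_mono circle_int_mono assms) auto
  also have "\<dots> = B" unfolding circle_int_const by (simp add: mult.assoc[symmetric] flip: ennreal_mult)
  finally show ?thesis .
qed

text \<open>The weight makes both the Bernstein estimate (weight \<open>\<bar>sin t\<bar>\<close>) and its companion off the
  real axis (weight 1) instances of one statement.\<close>

lemma deriv_weighted_le:
  fixes p \<rho> :: real and \<omega> :: "real \<Rightarrow> real"
  assumes p: "1 \<le> p" and \<rho>: "0 < \<rho>" and [measurable]: "\<omega> \<in> borel_measurable borel" and \<omega>: "\<And>t. 0 \<le> \<omega> t"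
    and B: "\<And>\<beta>. cmod \<beta> \<le> \<rho> \<Longrightarrow> circle_int (\<lambda>t. ennreal (cmod (poly q (cos (of_real t + (\<alpha> + \<beta>)))) powr p * \<omega> t)) \<le> B"
  shows "circle_int (\<lambda>t. ennreal ((\<rho> * cmod (sin (of_real t + \<alpha>) * poly (pderiv q) (cos (of_real t + \<alpha>)))) powr p * \<omega> t)) \<le> ennreal (2 * 2 powr p) * B"
proof -
  let ?T = "\<lambda>z. cmod (poly q (cos z)) powr p"
  have "circle_int (\<lambda>t. ennreal ((\<rho> * cmod (sin (of_real t + \<alpha>) * poly (pderiv q) (cos (of_real t + \<alpha>)))) powr p * \<omega> t))
    \<le> circle_int (\<lambda>t. ennreal (2 powr p) * (ennreal (?T (of_real t + \<alpha>) * \<omega> t)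
         + ennreal (1 / (2 * pi)) * circle_int (\<lambda>s. ennreal (?T (of_real t + \<alpha> + of_real \<rho> * cis s) * \<omega> t))))"
  proof (rule circle_int_mono)
    fix t
    have "ennreal ((\<rho> * cmod (sin (of_real t + \<alpha>) * poly (pderiv q) (cos (of_real t + \<alpha>)))) powr p)
       \<le> ennreal (2 powr p) * (ennreal (?T (of_real t + \<alpha>))
         + ennreal (1 / (2 * pi)) * circle_int (\<lambda>s. ennreal (?T (of_real t + \<alpha> + of_real \<rho> * cis s))))"
      using deriv_powr_le[OF holomorphic_poly_cos p \<rho>, of q "of_real t + \<alpha>"] by (simp add: deriv_poly_cos)
    from mult_right_mono[OF this, of "ennreal (\<omega> t)"]
    have "ennreal ((\<rho> * cmod (sin (of_real t + \<alpha>) * poly (pderiv q) (cos (of_real t + \<alpha>)))) powr p * \<omega> t)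
       \<le> ennreal (2 powr p) * (ennreal (?T (of_real t + \<alpha>)) * ennreal (\<omega> t)
         + ennreal (1 / (2 * pi)) * (ennreal (\<omega> t) * circle_int (\<lambda>s. ennreal (?T (of_real t + \<alpha> + of_real \<rho> * cis s)))))"
      using \<omega>[of t] by (simp add: ennreal_mult mult.assoc distrib_right) (simp add: mult_ac)
    also have "ennreal (\<omega> t) * circle_int (\<lambda>s. ennreal (?T (of_real t + \<alpha> + of_real \<rho> * cis s)))
       = circle_int (\<lambda>s. ennreal (?T (of_real t + \<alpha> + of_real \<rho> * cis s) * \<omega> t))"
      using \<omega>[of t] by (subst circle_int_cmult[symmetric]) (auto simp: ennreal_mult mult.commute)
    finally show "ennreal ((\<rho> * cmod (sin (of_real t + \<alpha>) * poly (pderiv q) (cos (of_real t + \<alpha>)))) powr p * \<omega> t)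
      \<le> ennreal (2 powr p) * (ennreal (?T (of_real t + \<alpha>) * \<omega> t)
         + ennreal (1 / (2 * pi)) * circle_int (\<lambda>s. ennreal (?T (of_real t + \<alpha> + of_real \<rho> * cis s) * \<omega> t)))"
      using \<omega>[of t] by (simp add: ennreal_mult)
  qed
  also have "\<dots> = ennreal (2 powr p) * (circle_int (\<lambda>t. ennreal (?T (of_real t + \<alpha>) * \<omega> t))
         + ennreal (1 / (2 * pi)) * circle_int (\<lambda>t. circle_int (\<lambda>s. ennreal (?T (of_real t + \<alpha> + of_real \<rho> * cis s) * \<omega> t))))"
  proof -
    have [measurable]: "(\<lambda>t. circle_int (\<lambda>s. ennreal (?T (of_real t + \<alpha> + of_real \<rho> * cis s) * \<omega> t))) \<in> borel_measurable borel"
      unfolding circle_int_def by measurable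
    show ?thesis by (subst circle_int_cmult, measurable, subst circle_int_add) (simp_all add: circle_int_cmult)
  qed
  also have "circle_int (\<lambda>t. circle_int (\<lambda>s. ennreal (?T (of_real t + \<alpha> + of_real \<rho> * cis s) * \<omega> t)))
     = circle_int (\<lambda>s. circle_int (\<lambda>t. ennreal (?T (of_real t + \<alpha> + of_real \<rho> * cis s) * \<omega> t)))"
    by (rule circle_int_swap) measurable
  also have "ennreal (2 powr p) * (circle_int (\<lambda>t. ennreal (?T (of_real t + \<alpha>) * \<omega> t)) + ennreal (1 / (2 * pi)) * \<dots>)
     \<le> ennreal (2 powr p) * (B + B)"
  proof (intro mult_left_mono add_mono circle_mean_bound)
    show "circle_int (\<lambda>t. ennreal (?T (of_real t + \<alpha>) * \<omega> t)) \<le> B"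
      using B[of 0] \<rho> by simp
    show "circle_int (\<lambda>t. ennreal (?T (of_real t + \<alpha> + of_real \<rho> * cis s) * \<omega> t)) \<le> B" for s
      using B[of "of_real \<rho> * cis s"] \<rho> by (simp add: norm_mult add.assoc)
  qed auto
  also have "\<dots> = ennreal (2 * 2 powr p) * B"
    by (simp add: ennreal_mult mult_ac distrib_left flip: mult_2)
  finally show ?thesis .
qed

text \<open>The derivative of \<open>poly q (cos z)\<close> contains the factor
  \<open>sin z\<close>, so the derivative of \<open>q\<close> is recovered by dividing by the sine.
  Where \<open>\<bar>sin t\<bar> > 1 / N\<close> this costs one factor \<open>N\<close> on top of
  the \<open>N\<close> of the Bernstein estimate. Where \<open>\<bar>sin t\<bar> \<le> 1 / N\<close>
  the weight itself is at most \<open>1 / N\<close>, and the unweighted mean of the derivative is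
  estimated on the line of height \<open>1 / N\<close>, on which the sine is large enough. The
  constant stands inside \<open>powr p\<close> so that the bound can be iterated.\<close>

lemma Iw_pderiv_le:
  fixes p :: real
  assumes p: "1 \<le> p"
  obtains C where "0 < C" "\<And>N q. 1 \<le> N \<Longrightarrow> degree q \<le> N \<Longrightarrow> Iw p (pderiv q) 0 0 \<le> ennreal ((C * (real N)\<^sup>2) powr p) * Iw p q 0 0"
proof -
  define a where "a = exp (p + 1) + exp (6 * p + 3)"
  define A where "A = exp (2 * p) * (2 * 2 powr p) * exp (6 * p + 2) + (2 * 2 powr p) * a"
  have A: "0 < A" by (auto simp: A_def a_def intro!: add_pos_pos mult_pos_pos)
  have main: "Iw p (pderiv q) 0 0 \<le> ennreal (A * (real N)\<^sup>2 powr p) * Iw p q 0 0"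
    if N: "1 \<le> N" and deg: "degree q \<le> N" for N q
  proof -
    define \<rho> where "\<rho> = 1 / real N"
    have \<rho>: "0 < \<rho>" "\<rho> \<le> 1" "real N * \<rho> = 1" using N by (auto simp: \<rho>_def)
    let ?z = "\<i> * complex_of_real \<rho>"
    let ?d = "\<lambda>z. cmod (poly (pderiv q) (cos z))"
    let ?s = "\<lambda>z. cmod (sin (z::complex))"
    have deg': "degree (pderiv q) \<le> N" using deg by (simp add: degree_pderiv)
    have NN: "real N powr p * real N powr p = (real N)\<^sup>2 powr p"
      by (simp add: power2_eq_square powr_mult)
    \<comment> \<open>Circles of radius \<open>\<rho>\<close> about points of the line of height
      \<open>\<rho>\<close> stay within height \<open>2 / N\<close>, the range of
      \<open>I0_le_Iw\<close>.\<close>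
    have 1: "circle_int (\<lambda>t. ennreal ((\<rho> * cmod (sin (of_real t + ?z) * poly (pderiv q) (cos (of_real t + ?z)))) powr p * 1))
       \<le> ennreal (2 * 2 powr p) * (ennreal (real N * exp (6 * p + 2)) * Iw p q 0 0)"
    proof (rule deriv_weighted_le[OF p \<rho>(1)])
      fix \<beta> assume "cmod \<beta> \<le> \<rho>"
      then have "\<bar>Im (?z + \<beta>)\<bar> \<le> 2 / real N"
        using abs_Im_le_cmod[of \<beta>] \<rho> by (simp add: \<rho>_def)
      then show "circle_int (\<lambda>t. ennreal (cmod (poly q (cos (of_real t + (?z + \<beta>)))) powr p * 1))
          \<le> ennreal (real N * exp (6 * p + 2)) * Iw p q 0 0"
        using I0_le_Iw[OF deg p N] by (simp add: I0_def)
    qed auto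
    have "I0 p (pderiv q) ?z \<le> circle_int (\<lambda>t. ennreal ((real N)\<^sup>2 powr p) *
        ennreal ((\<rho> * cmod (sin (of_real t + ?z) * poly (pderiv q) (cos (of_real t + ?z)))) powr p * 1))"
      unfolding I0_def
    proof (rule circle_int_mono)
      fix t
      have "\<rho> \<le> ?s (of_real t + ?z)" using abs_Im_le_cmod_sin[of "of_real t + ?z"] \<rho> by simp
      then have "\<rho> * (\<rho> * ?d (of_real t + ?z)) \<le> \<rho> * (?s (of_real t + ?z) * ?d (of_real t + ?z))"
        using \<rho> by (intro mult_left_mono mult_right_mono) auto
      then have "(real N)\<^sup>2 * (\<rho> * (\<rho> * ?d (of_real t + ?z))) \<le> (real N)\<^sup>2 * (\<rho> * cmod (sin (of_real t + ?z) * poly (pderiv q) (cos (of_real t + ?z))))"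
        unfolding norm_mult by (rule mult_left_mono) simp
      moreover have "(real N)\<^sup>2 * (\<rho> * (\<rho> * ?d (of_real t + ?z))) = ?d (of_real t + ?z)"
        using \<rho>(3) by (metis (no_types, opaque_lifting) mult.assoc mult.commute mult_1 power2_eq_square)
      ultimately have "?d (of_real t + ?z) powr p \<le> ((real N)\<^sup>2 * (\<rho> * cmod (sin (of_real t + ?z) * poly (pderiv q) (cos (of_real t + ?z))))) powr p"
        using p by (intro powr_mono2) auto
      also have "\<dots> = (real N)\<^sup>2 powr p * (\<rho> * cmod (sin (of_real t + ?z) * poly (pderiv q) (cos (of_real t + ?z)))) powr p"
        using \<rho> by (simp add: powr_mult)
      finally show "ennreal (?d (of_real t + ?z) powr p) \<le> ennreal ((real N)\<^sup>2 powr p) *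
        ennreal ((\<rho> * cmod (sin (of_real t + ?z) * poly (pderiv q) (cos (of_real t + ?z)))) powr p * 1)"
        by (simp add: ennreal_leI flip: ennreal_mult)
    qed
    also have "\<dots> \<le> ennreal ((real N)\<^sup>2 powr p) * (ennreal (2 * 2 powr p) * (ennreal (real N * exp (6 * p + 2)) * Iw p q 0 0))"
      by (subst circle_int_cmult) (use 1 in \<open>auto intro!: mult_left_mono\<close>)
    finally have 2: "I0 p (pderiv q) ?z \<le> \<dots>" .
    \<comment> \<open>Coming back from height \<open>\<rho>\<close> to the real axis costs only
      \<open>exp (2 * p)\<close>, because \<open>real N * \<rho> = 1\<close>.\<close>
    have "I0 p (pderiv q) 0 \<le> ennreal (exp (2 * p * real N * \<rho>)) * I0 p (pderiv q) ?z"
      using \<rho> by (intro I0_mono deg' p) auto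
    also have "exp (2 * p * real N * \<rho>) = exp (2 * p)" using \<rho>(3) by (simp add: mult.assoc)
    also have "ennreal (exp (2 * p)) * I0 p (pderiv q) ?z \<le> ennreal (exp (2 * p)) * (ennreal ((real N)\<^sup>2 powr p) * (ennreal (2 * 2 powr p) * (ennreal (real N * exp (6 * p + 2)) * Iw p q 0 0)))"
      by (intro mult_left_mono 2) auto
    finally have 3: "ennreal \<rho> * I0 p (pderiv q) 0 \<le> ennreal \<rho> * \<dots>" by (intro mult_left_mono) auto
    also have "\<dots> = ennreal (\<rho> * (exp (2 * p) * ((real N)\<^sup>2 powr p * ((2 * 2 powr p) * (real N * exp (6 * p + 2)))))) * Iw p q 0 0"
      using \<rho> by (simp add: ennreal_mult mult.assoc)
    also have "\<rho> * (exp (2 * p) * ((real N)\<^sup>2 powr p * ((2 * 2 powr p) * (real N * exp (6 * p + 2)))))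
       = (exp (2 * p) * (2 * 2 powr p) * exp (6 * p + 2)) * (real N)\<^sup>2 powr p"
      using N by (simp add: \<rho>_def)
    finally have 3: "ennreal \<rho> * I0 p (pderiv q) 0 \<le> ennreal ((exp (2 * p) * (2 * 2 powr p) * exp (6 * p + 2)) * (real N)\<^sup>2 powr p) * Iw p q 0 0" .
    have 4: "circle_int (\<lambda>t. ennreal ((\<rho> * cmod (sin (of_real t + 0) * poly (pderiv q) (cos (of_real t + 0)))) powr p * ?s (of_real t)))
       \<le> ennreal (2 * 2 powr p) * (ennreal a * Iw p q 0 0)"
    proof (rule deriv_weighted_le[OF p \<rho>(1)])
      fix \<beta> assume "cmod \<beta> \<le> \<rho>"
      then show "circle_int (\<lambda>t. ennreal (cmod (poly q (cos (of_real t + (0 + \<beta>)))) powr p * ?s (of_real t)))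
          \<le> ennreal a * Iw p q 0 0"
        using Iw_le[OF deg p N, of \<beta>] by (simp add: Iw_def \<rho>_def a_def)
    qed auto
    have "Iw p (pderiv q) 0 0 \<le> circle_int (\<lambda>t. ennreal \<rho> * ennreal (?d (of_real t + 0) powr p)
        + ennreal ((real N)\<^sup>2 powr p) * ennreal ((\<rho> * cmod (sin (of_real t + 0) * poly (pderiv q) (cos (of_real t + 0)))) powr p * ?s (of_real t)))"
      unfolding Iw_def
    proof (rule circle_int_mono)
      fix t :: real
      let ?t = "complex_of_real t + 0"
      have "?d ?t powr p * ?s ?t \<le> \<rho> * ?d ?t powr p + (real N)\<^sup>2 powr p * ((\<rho> * cmod (sin ?t * poly (pderiv q) (cos ?t))) powr p * ?s ?t)"
      proof (cases "?s ?t \<le> \<rho>")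
        case True
        then have "?d ?t powr p * ?s ?t \<le> ?d ?t powr p * \<rho>" by (intro mult_left_mono) auto
        then show ?thesis by (simp add: mult.commute add_increasing2)
      next
        case False
        then have "\<rho> * (\<rho> * ?d ?t) \<le> \<rho> * (?s ?t * ?d ?t)"
          using \<rho> by (intro mult_left_mono mult_right_mono) auto
        then have "(real N)\<^sup>2 * (\<rho> * (\<rho> * ?d ?t)) \<le> (real N)\<^sup>2 * (\<rho> * cmod (sin ?t * poly (pderiv q) (cos ?t)))"
          unfolding norm_mult by (rule mult_left_mono) simp
        moreover have "(real N)\<^sup>2 * (\<rho> * (\<rho> * ?d ?t)) = ?d ?t"
          using \<rho>(3) by (metis (no_types, opaque_lifting) mult.assoc mult.commute mult_1 power2_eq_square)
        ultimately have "?d ?t \<le> (real N)\<^sup>2 * (\<rho> * cmod (sin ?t * poly (pderiv q) (cos ?t)))"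
          by (simp only:)
        then have "?d ?t powr p \<le> ((real N)\<^sup>2 * (\<rho> * cmod (sin ?t * poly (pderiv q) (cos ?t)))) powr p"
          using p by (intro powr_mono2) simp_all
        also have "\<dots> = (real N)\<^sup>2 powr p * (\<rho> * cmod (sin ?t * poly (pderiv q) (cos ?t))) powr p"
          using \<rho> by (simp add: powr_mult)
        finally have "?d ?t powr p * ?s ?t \<le> (real N)\<^sup>2 powr p * (\<rho> * cmod (sin ?t * poly (pderiv q) (cos ?t))) powr p * ?s ?t"
          by (intro mult_right_mono) auto
        then show ?thesis using \<rho> by (simp add: mult.assoc add_increasing)
      qed
      then show "ennreal (?d ?t powr p * ?s ?t) \<le> ennreal \<rho> * ennreal (?d ?t powr p)
        + ennreal ((real N)\<^sup>2 powr p) * ennreal ((\<rho> * cmod (sin ?t * poly (pderiv q) (cos ?t))) powr p * ?s (of_real t))"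
        using \<rho> by (simp add: ennreal_leI flip: ennreal_mult ennreal_plus)
    qed
    also have "\<dots> = ennreal \<rho> * I0 p (pderiv q) 0 + ennreal ((real N)\<^sup>2 powr p) *
       circle_int (\<lambda>t. ennreal ((\<rho> * cmod (sin (of_real t + 0) * poly (pderiv q) (cos (of_real t + 0)))) powr p * ?s (of_real t)))"
      unfolding I0_def by (subst circle_int_add) (auto simp: circle_int_cmult)
    also have "\<dots> \<le> ennreal ((exp (2 * p) * (2 * 2 powr p) * exp (6 * p + 2)) * (real N)\<^sup>2 powr p) * Iw p q 0 0
        + ennreal ((real N)\<^sup>2 powr p) * (ennreal (2 * 2 powr p) * (ennreal a * Iw p q 0 0))"
      by (intro add_mono mult_left_mono 3 4) auto
    also have "\<dots> = ennreal (A * (real N)\<^sup>2 powr p) * Iw p q 0 0"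
    proof -
      have "ennreal ((real N)\<^sup>2 powr p) * (ennreal (2 * 2 powr p) * (ennreal a * Iw p q 0 0)) = ennreal ((real N)\<^sup>2 powr p * (2 * 2 powr p) * a) * Iw p q 0 0"
        by (simp add: ennreal_mult a_def mult.assoc)
      moreover have "A * (real N)\<^sup>2 powr p = (exp (2 * p) * (2 * 2 powr p) * exp (6 * p + 2)) * (real N)\<^sup>2 powr p + (real N)\<^sup>2 powr p * (2 * 2 powr p) * a"
        by (simp add: A_def algebra_simps)
      ultimately show ?thesis
        by (simp add: ennreal_plus a_def add_pos_pos less_imp_le flip: distrib_right)
    qed
    finally show ?thesis .
  qed
  show thesis
  proof (rule that)
    show "0 < A powr (1 / p)" using A by simp
    fix N :: nat and q :: "complex poly" assume Nq: "1 \<le> N" "degree q \<le> N"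
    have "(A powr (1 / p) * (real N)\<^sup>2) powr p = A * (real N)\<^sup>2 powr p"
      using A p by (simp add: powr_mult powr_powr)
    then show "Iw p (pderiv q) 0 0 \<le> ennreal ((A powr (1 / p) * (real N)\<^sup>2) powr p) * Iw p q 0 0"
      using main[OF Nq] by simp
  qed
qed

section \<open>Perturbed arguments as complex shifts of the angle with a quadratic error\<close>

lemma cmod_sin_le: "cmod w \<le> 1 \<Longrightarrow> cmod (sin w) \<le> 3 * cmod w"
proof -
  assume w: "cmod w \<le> 1"
  have "cmod (sin w - sin 0) \<le> exp 1 * cmod (w - 0)"
    using abs_Im_le_cmod[of w] w by (intro cmod_sin_diff_le) auto
  also have "\<dots> \<le> 3 * cmod (w - 0)" using exp_le by (intro mult_right_mono) auto
  finally show ?thesis by simp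
qed

lemma cmod_one_minus_cos_le:
  assumes "cmod w \<le> 1" shows "cmod (cos w - 1) \<le> 5 * (cmod w)\<^sup>2"
proof -
  have "cos w - 1 = - 2 * (sin (w / 2))\<^sup>2" using cos_double_sin[of "w / 2"] by simp
  then have "cmod (cos w - 1) = 2 * (cmod (sin (w / 2)))\<^sup>2" by (simp add: norm_mult norm_power)
  also have "\<dots> \<le> 2 * (3 * cmod (w / 2))\<^sup>2"
    using assms by (intro mult_left_mono power_mono cmod_sin_le) (auto simp: norm_divide)
  also have "\<dots> \<le> 5 * (cmod w)\<^sup>2" by (simp add: norm_divide power_mult_distrib power_divide)
  finally show ?thesis .
qed

lemma cmod_sin_minus_id_le:
  assumes "cmod w \<le> 1" shows "cmod (sin w - w) \<le> 5 * (cmod w)\<^sup>2"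
proof -
  have "cmod ((\<lambda>u. sin u - u) w - (\<lambda>u. sin u - u) 0) \<le> (5 * (cmod w)\<^sup>2) * cmod (w - 0)"
  proof (rule field_differentiable_bound[where f' = "\<lambda>u. cos u - 1"])
    show "convex (cball (0::complex) (cmod w))" by simp
    fix u assume u: "u \<in> cball (0::complex) (cmod w)"
    show "((\<lambda>u. sin u - u) has_field_derivative cos u - 1) (at u within cball 0 (cmod w))"
      by (rule has_field_derivative_at_within) (auto intro!: derivative_eq_intros)
    have "cmod (cos u - 1) \<le> 5 * (cmod u)\<^sup>2" using u assms by (intro cmod_one_minus_cos_le) auto
    also have "\<dots> \<le> 5 * (cmod w)\<^sup>2" using u by (intro mult_left_mono power_mono) auto
    finally show "cmod (cos u - 1) \<le> 5 * (cmod w)\<^sup>2" .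
  qed auto
  also have "\<dots> \<le> 5 * (cmod w)\<^sup>2 * 1" using assms by (intro mult_left_mono) auto
  finally show ?thesis by simp
qed

text \<open>\<open>cos t + z * sin t\<close> is the first-order expansion of
  \<open>cos (t - z)\<close>. A perturbation of \<open>x = cos t\<close> by
  \<open>z * sqrt (1 - x\<^sup>2)\<close> is therefore a complex shift of the angle up to an error
  of order \<open>1 / N^2\<close> when \<open>z\<close> is of order \<open>1 / N\<close>.\<close>

lemma cos_tangent_approx:
  fixes t :: real
  assumes "cmod z \<le> 1"
  shows "cmod (of_real (cos t) + z * of_real (sin t) - cos (of_real t - z)) \<le> 10 * (cmod z)\<^sup>2"
proof -
  have "of_real (cos t) + z * of_real (sin t) - cos (of_real t - z)
      = - (of_real (cos t) * (cos z - 1)) - of_real (sin t) * (sin z - z)"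
    by (simp add: cos_diff cos_of_real sin_of_real algebra_simps)
  also have "cmod \<dots> \<le> cmod (of_real (cos t) * (cos z - 1)) + cmod (of_real (sin t) * (sin z - z))"
    by (metis norm_minus_cancel norm_triangle_ineq4)
  also have "\<dots> \<le> 1 * (5 * (cmod z)\<^sup>2) + 1 * (5 * (cmod z)\<^sup>2)"
    unfolding norm_mult using assms
    by (intro add_mono mult_mono cmod_one_minus_cos_le cmod_sin_minus_id_le) auto
  finally show ?thesis by simp
qed

lemma higher_deriv_poly: "(deriv ^^ k) (poly q) = poly ((pderiv ^^ k) (q :: complex poly))"
proof (induction k)
  case (Suc k)
  have "deriv (poly ((pderiv ^^ k) q)) x = poly (pderiv ((pderiv ^^ k) q)) x" for x
    by (rule DERIV_imp_deriv poly_DERIV)+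
  then show ?case by (simp add: Suc fun_eq_iff)
qed simp

lemma higher_pderiv_eq_0: "degree q < k \<Longrightarrow> (pderiv ^^ k) (q :: complex poly) = 0"
  by (simp add: poly_eq_iff coeff_higher_pderiv coeff_eq_0)

lemma poly_taylor:
  fixes q :: "complex poly"
  assumes "degree q \<le> N"
  shows "poly q (x + \<epsilon>) = (\<Sum>k\<le>N. poly ((pderiv ^^ k) q) x / fact k * \<epsilon> ^ k)"
proof -
  have "(\<lambda>k. (deriv ^^ k) (poly q) x / fact k * (x + \<epsilon> - x) ^ k) sums poly q (x + \<epsilon>)"
    by (rule holomorphic_power_series[of _ _ "cmod \<epsilon> + 1"]) (auto intro!: holomorphic_intros simp: dist_norm)
  then have "(\<lambda>k. poly ((pderiv ^^ k) q) x / fact k * \<epsilon> ^ k) sums poly q (x + \<epsilon>)"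
    by (simp add: higher_deriv_poly)
  moreover have "(\<lambda>k. poly ((pderiv ^^ k) q) x / fact k * \<epsilon> ^ k) sums (\<Sum>k\<le>N. poly ((pderiv ^^ k) q) x / fact k * \<epsilon> ^ k)"
    using assms by (intro sums_finite) (auto simp: higher_pderiv_eq_0)
  ultimately show ?thesis by (rule sums_unique2)
qed

text \<open>With this measure the \<open>p\<close>-th root of \<open>Iw p q \<alpha> 0\<close> is a
  norm \<open>lpn\<close>, so that Taylor terms can be added by Minkowski's inequality.\<close>

definition sin_measure :: "real measure" where
  "sin_measure = density lborel (\<lambda>t. indicator {0..2*pi} t * ennreal \<bar>sin t\<bar>)"

lemma sets_sin_measure [measurable_cong, simp]: "sets sin_measure = sets borel"
  by (simp add: sin_measure_def)

lemma lpn_sin_measure: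
  assumes "1 \<le> p" and [measurable]: "F \<in> borel_measurable borel" and "\<And>t. 0 \<le> F t"
  shows "lpn p sin_measure (\<lambda>t. ennreal (F t)) = ennreal_powr (circle_int (\<lambda>t. ennreal (F t powr p * \<bar>sin t\<bar>))) (1 / p)"
proof -
  have "(\<integral>\<^sup>+t. ennreal_powr (ennreal (F t)) p \<partial>sin_measure) = circle_int (\<lambda>t. ennreal (F t powr p * \<bar>sin t\<bar>))"
    unfolding sin_measure_def circle_int_def using assms(3)
    by (subst nn_integral_density) (auto intro!: nn_integral_cong simp: ennreal_mult indicator_def mult.commute)
  then show ?thesis by (simp add: lpn_def)
qed

lemma cmod_sin_of_real: "cmod (sin (complex_of_real t)) = \<bar>sin t\<bar>"
  by (metis norm_of_real sin_of_real real_norm_def)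

lemma Iw_alt: "Iw p q \<alpha> 0 = circle_int (\<lambda>t. ennreal (cmod (poly q (cos (of_real t + \<alpha>))) powr p * \<bar>sin t\<bar>))"
  by (simp add: Iw_def cmod_sin_of_real)

lemma lpn_Iw:
  "1 \<le> p \<Longrightarrow> lpn p sin_measure (\<lambda>t. ennreal (cmod (poly q (cos (of_real t + \<alpha>))))) = ennreal_powr (Iw p q \<alpha> 0) (1 / p)"
  by (subst lpn_sin_measure) (auto simp: Iw_alt)

lemma exp_partial_sum_le:
  assumes "0 \<le> (x::real)" shows "(\<Sum>k\<le>n. x ^ k / fact k) \<le> exp x"
proof -
  have "(\<lambda>k. x ^ k / fact k) sums exp x"
    using exp_converges[of x] by (simp add: divide_inverse mult.commute)
  moreover from this have "(\<Sum>k\<le>n. x ^ k / fact k) \<le> (\<Sum>k. x ^ k / fact k)"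
    using assms by (intro sum_le_suminf) (auto simp: sums_iff)
  ultimately show ?thesis by (simp add: sums_iff)
qed

text \<open>The perturbed point is \<open>cos (t - z)\<close> plus a remainder of size at most
  \<open>11 / N^2\<close>. In the Taylor expansion at \<open>cos (t - z)\<close> every derivative
  costs \<open>C * N^2\<close> by the weighted Markov inequality, and every power of the remainder
  repays this up to \<open>11 * C\<close>. The factorials make the sum of the norms bounded by
  \<open>exp (11 * C)\<close>, whatever the degree.\<close>

lemma Iw_perturb_le:
  fixes p :: real
  assumes p: "1 \<le> p"
  obtains C where "0 < C" "\<And>N q z \<beta>. 1 \<le> N \<Longrightarrow> degree q \<le> N \<Longrightarrow> cmod z \<le> 1 / real N \<Longrightarrow> cmod \<beta> \<le> 1 / (real N)\<^sup>2 \<Longrightarrow>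
    circle_int (\<lambda>t. ennreal (cmod (poly q (of_real (cos t) + z * of_real (sin t) + \<beta>)) powr p * \<bar>sin t\<bar>)) \<le> ennreal C * Iw p q 0 0"
proof -
  obtain C where C: "0 < C" "\<And>N q. 1 \<le> N \<Longrightarrow> degree q \<le> N \<Longrightarrow> Iw p (pderiv q) 0 0 \<le> ennreal ((C * (real N)\<^sup>2) powr p) * Iw p q 0 0"
    by (rule Iw_pderiv_le[OF p]) blast
  define a where "a = exp (p + 1) + exp (6 * p + 3)"
  have a: "0 < a" by (simp add: a_def add_pos_pos)
  define K where "K = a powr (1 / p) * exp (11 * C)"
  have K: "0 < K" using a by (simp add: K_def)
  show thesis
  proof (rule that[of "K powr p"])
    fix N :: nat and q :: "complex poly" and z \<beta> :: complex
    assume N: "1 \<le> N" and deg: "degree q \<le> N" and z: "cmod z \<le> 1 / real N" and \<beta>: "cmod \<beta> \<le> 1 / (real N)\<^sup>2"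
    \<comment> \<open>10 from \<open>cos_tangent_approx\<close> and 1 from
      \<open>\<beta>\<close>.\<close>
    define c where "c = 11 / (real N)\<^sup>2"
    have c0: "0 \<le> c" by (simp add: c_def)
    define X where "X = ennreal_powr (Iw p q 0 0) (1 / p)"
    let ?q = "\<lambda>k. (pderiv ^^ k) q"
    have degk: "degree (?q k) \<le> N" for k using deg by (simp add: degree_higher_pderiv)
    have Mk: "ennreal_powr (Iw p (?q k) 0 0) (1 / p) \<le> ennreal ((C * (real N)\<^sup>2) ^ k) * X" for k
    proof (induction k)
      case (Suc k)
      have "ennreal_powr (Iw p (?q (Suc k)) 0 0) (1 / p) \<le> ennreal_powr (ennreal ((C * (real N)\<^sup>2) powr p) * Iw p (?q k) 0 0) (1 / p)"
        using C(2)[OF N degk[of k]] p by (intro ennreal_powr_mono) auto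
      also have "\<dots> = ennreal (C * (real N)\<^sup>2) * ennreal_powr (Iw p (?q k) 0 0) (1 / p)"
        using p C(1) by (simp add: ennreal_powr_mult powr_powr)
      also have "\<dots> \<le> ennreal (C * (real N)\<^sup>2) * (ennreal ((C * (real N)\<^sup>2) ^ k) * X)"
        by (intro mult_left_mono Suc) auto
      also have "\<dots> = ennreal ((C * (real N)\<^sup>2) ^ Suc k) * X"
        using C(1) by (simp add: ennreal_mult mult.assoc)
      finally show ?case .
    qed (simp add: X_def)
    define F where "F = (\<lambda>k t. ennreal (c ^ k / fact k) * ennreal (cmod (poly (?q k) (cos (of_real t + - z)))))"
    have Fk: "lpn p sin_measure (F k) \<le> ennreal (a powr (1 / p) * ((11 * C) ^ k / fact k)) * X" for k
    proof -
      have "lpn p sin_measure (F k) = ennreal (c ^ k / fact k) * ennreal_powr (Iw p (?q k) (- z) 0) (1 / p)"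
        unfolding F_def by (subst lpn_cmult[OF p], measurable, simp only: lpn_Iw[OF p])
      also have "\<dots> \<le> ennreal (c ^ k / fact k) * ennreal_powr (ennreal a * Iw p (?q k) 0 0) (1 / p)"
        unfolding a_def using p z by (intro mult_left_mono ennreal_powr_mono Iw_le[OF degk p N]) auto
      also have "\<dots> = ennreal (c ^ k / fact k) * (ennreal (a powr (1 / p)) * ennreal_powr (Iw p (?q k) 0 0) (1 / p))"
        using p a by (simp add: ennreal_powr_mult)
      also have "\<dots> \<le> ennreal (c ^ k / fact k) * (ennreal (a powr (1 / p)) * (ennreal ((C * (real N)\<^sup>2) ^ k) * X))"
        by (intro mult_left_mono Mk) auto
      also have "\<dots> = ennreal (c ^ k / fact k * (a powr (1 / p) * (C * (real N)\<^sup>2) ^ k)) * X"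
        using C(1) c0 by (simp add: mult.assoc[symmetric] flip: ennreal_mult)
      also have "c ^ k / fact k * (a powr (1 / p) * (C * (real N)\<^sup>2) ^ k) = a powr (1 / p) * ((c * (C * (real N)\<^sup>2)) ^ k / fact k)"
        by (simp add: power_mult_distrib)
      also have "c * (C * (real N)\<^sup>2) = 11 * C" using N by (simp add: c_def)
      finally show ?thesis .
    qed
    define G where "G = (\<lambda>t::real. cmod (poly q (of_real (cos t) + z * of_real (sin t) + \<beta>)))"
    have [measurable]: "G \<in> borel_measurable borel"
      unfolding G_def by measurable
    have "lpn p sin_measure (\<lambda>t. ennreal (G t)) \<le> lpn p sin_measure (\<lambda>t. \<Sum>k\<le>N. F k t)"
    proof (rule lpn_mono[OF p])
      fix t :: real
      define \<epsilon> where "\<epsilon> = of_real (cos t) + z * of_real (sin t) + \<beta> - cos (of_real t - z)"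
      have "cmod \<epsilon> \<le> cmod (of_real (cos t) + z * of_real (sin t) - cos (of_real t - z)) + cmod \<beta>"
        unfolding \<epsilon>_def by (metis (no_types, lifting) add.commute add_diff_eq norm_triangle_ineq)
      also have "\<dots> \<le> 10 * (cmod z)\<^sup>2 + 1 / (real N)\<^sup>2"
      proof (intro add_mono cos_tangent_approx \<beta>)
        show "cmod z \<le> 1" using z N by (rule_tac order_trans[OF z]) auto
      qed
      also have "\<dots> \<le> 10 * (1 / real N)\<^sup>2 + 1 / (real N)\<^sup>2"
        using z by (intro add_mono mult_left_mono power_mono) auto
      finally have \<epsilon>: "cmod \<epsilon> \<le> c" by (simp add: c_def power_divide)
      have "G t = cmod (poly q (cos (of_real t - z) + \<epsilon>))" by (simp add: G_def \<epsilon>_def add.assoc)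
      also have "\<dots> \<le> (\<Sum>k\<le>N. cmod (poly (?q k) (cos (of_real t - z)) / fact k * \<epsilon> ^ k))"
        unfolding poly_taylor[OF deg] by (rule norm_sum)
      also have "\<dots> \<le> (\<Sum>k\<le>N. c ^ k / fact k * cmod (poly (?q k) (cos (of_real t + - z))))"
      proof (rule sum_mono)
        fix k
        have "cmod (poly (?q k) (cos (of_real t - z)) / fact k * \<epsilon> ^ k) = cmod (poly (?q k) (cos (of_real t - z))) * (cmod \<epsilon> ^ k / fact k)"
          by (simp add: norm_mult norm_divide norm_power)
        also have "\<dots> \<le> cmod (poly (?q k) (cos (of_real t - z))) * (c ^ k / fact k)"
          using \<epsilon> by (intro mult_left_mono divide_right_mono power_mono) auto
        finally show "cmod (poly (?q k) (cos (of_real t - z)) / fact k * \<epsilon> ^ k) \<le> c ^ k / fact k * cmod (poly (?q k) (cos (of_real t + - z)))"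
          by (simp add: mult.commute)
      qed
      finally have "ennreal (G t) \<le> ennreal (\<Sum>k\<le>N. c ^ k / fact k * cmod (poly (?q k) (cos (of_real t + - z))))"
        by (rule ennreal_leI)
      also have "\<dots> = (\<Sum>k\<le>N. F k t)"
        unfolding F_def using c0 by (simp add: sum_ennreal flip: ennreal_mult)
      finally show "ennreal (G t) \<le> (\<Sum>k\<le>N. F k t)" .
    qed
    also have "\<dots> \<le> (\<Sum>k\<le>N. lpn p sin_measure (F k))"
      by (rule lpn_sum[OF p]) (simp add: F_def)
    also have "\<dots> \<le> (\<Sum>k\<le>N. ennreal (a powr (1 / p) * ((11 * C) ^ k / fact k)) * X)"
      by (intro sum_mono Fk)
    also have "\<dots> = ennreal (\<Sum>k\<le>N. a powr (1 / p) * ((11 * C) ^ k / fact k)) * X"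
      using C(1) by (simp add: sum_ennreal flip: sum_distrib_right)
    also have "\<dots> \<le> ennreal K * X"
    proof (intro mult_right_mono ennreal_leI)
      have "(\<Sum>k\<le>N. (11 * C) ^ k / fact k) \<le> exp (11 * C)" using C(1) by (intro exp_partial_sum_le) auto
      then show "(\<Sum>k\<le>N. a powr (1 / p) * ((11 * C) ^ k / fact k)) \<le> K"
        unfolding K_def sum_distrib_left[symmetric] by (intro mult_left_mono) auto
    qed auto
    finally have "lpn p sin_measure (\<lambda>t. ennreal (G t)) \<le> ennreal K * X" .
    moreover have "lpn p sin_measure (\<lambda>t. ennreal (G t)) = ennreal_powr (circle_int (\<lambda>t. ennreal (G t powr p * \<bar>sin t\<bar>))) (1 / p)"
      using p by (intro lpn_sin_measure) (auto simp: G_def)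
    ultimately have "ennreal_powr (ennreal_powr (circle_int (\<lambda>t. ennreal (G t powr p * \<bar>sin t\<bar>))) (1 / p)) p \<le> ennreal_powr (ennreal K * X) p"
      using p by (intro ennreal_powr_mono) auto
    then show "circle_int (\<lambda>t. ennreal (cmod (poly q (of_real (cos t) + z * of_real (sin t) + \<beta>)) powr p * \<bar>sin t\<bar>)) \<le> ennreal (K powr p) * Iw p q 0 0"
      using p K by (simp add: ennreal_powr_inverse ennreal_powr_mult X_def G_def)
  qed (use K in simp)
qed

section \<open>Return from the circle to the interval\<close>

lemma sin_nonpos_pi_2pi: "pi \<le> t \<Longrightarrow> t \<le> 2 * pi \<Longrightarrow> sin t \<le> 0"
  using sin_ge_zero[of "t - pi"] by (simp add: sin_diff)

lemma nn_integral_cos_substitution: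
  fixes H :: "real \<Rightarrow> ennreal"
  assumes [measurable]: "H \<in> borel_measurable borel"
  shows "(\<integral>\<^sup>+t\<in>{0..pi}. H (cos t) * ennreal (sin t) \<partial>lborel) = (\<integral>\<^sup>+x\<in>{-1..1}. H x \<partial>lborel)"
    and "(\<integral>\<^sup>+t\<in>{pi..2*pi}. H (cos t) * ennreal (- sin t) \<partial>lborel) = (\<integral>\<^sup>+x\<in>{-1..1}. H x \<partial>lborel)"
proof -
  have "(\<integral>\<^sup>+x. H (- x) * indicator {- cos 0..- cos pi} x \<partial>lborel) = (\<integral>\<^sup>+t. H (- (- cos t)) * ennreal (sin t) * indicator {0..pi} t \<partial>lborel)"
    by (rule nn_integral_substitution_aux[where g = "\<lambda>t. - cos t" and f = "\<lambda>x. H (- x)"])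
       (auto intro!: derivative_eq_intros continuous_intros sin_ge_zero)
  moreover have "(\<integral>\<^sup>+x. H (- x) * indicator {-1..1} x \<partial>lborel) = (\<integral>\<^sup>+x\<in>{-1..1}. H x \<partial>lborel)"
    by (subst (2) nn_integral_real_affine[where c = "-1" and t = 0]) (auto intro!: nn_integral_cong simp: indicator_def)
  ultimately show "(\<integral>\<^sup>+t\<in>{0..pi}. H (cos t) * ennreal (sin t) \<partial>lborel) = (\<integral>\<^sup>+x\<in>{-1..1}. H x \<partial>lborel)"
    by simp
  have "(\<integral>\<^sup>+x. H x * indicator {cos pi..cos (2 * pi)} x \<partial>lborel) = (\<integral>\<^sup>+t. H (cos t) * ennreal (- sin t) * indicator {pi..2 * pi} t \<partial>lborel)"
    by (rule nn_integral_substitution_aux[where g = cos and g' = "\<lambda>t. - sin t"])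
       (auto intro!: DERIV_cos continuous_intros sin_nonpos_pi_2pi)
  then show "(\<integral>\<^sup>+t\<in>{pi..2*pi}. H (cos t) * ennreal (- sin t) \<partial>lborel) = (\<integral>\<^sup>+x\<in>{-1..1}. H x \<partial>lborel)"
    by simp
qed

lemma circle_int_cos:
  fixes H :: "real \<Rightarrow> ennreal"
  assumes [measurable]: "H \<in> borel_measurable borel"
  shows "circle_int (\<lambda>t. H (cos t) * ennreal \<bar>sin t\<bar>) = 2 * (\<integral>\<^sup>+x\<in>{-1..1}. H x \<partial>lborel)"
proof -
  have "circle_int (\<lambda>t. H (cos t) * ennreal \<bar>sin t\<bar>)
      = (\<integral>\<^sup>+t\<in>{0..pi}. H (cos t) * ennreal \<bar>sin t\<bar> \<partial>lborel) + (\<integral>\<^sup>+t\<in>{pi..2*pi}. H (cos t) * ennreal \<bar>sin t\<bar> \<partial>lborel)"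
    unfolding circle_int_def by (rule nn_integral_interval_split) auto
  also have "(\<integral>\<^sup>+t\<in>{0..pi}. H (cos t) * ennreal \<bar>sin t\<bar> \<partial>lborel) = (\<integral>\<^sup>+t\<in>{0..pi}. H (cos t) * ennreal (sin t) \<partial>lborel)"
    by (intro nn_integral_cong) (auto simp: indicator_def sin_ge_zero)
  also have "(\<integral>\<^sup>+t\<in>{pi..2*pi}. H (cos t) * ennreal \<bar>sin t\<bar> \<partial>lborel) = (\<integral>\<^sup>+t\<in>{pi..2*pi}. H (cos t) * ennreal (- sin t) \<partial>lborel)"
    by (intro nn_integral_cong) (auto simp: indicator_def sin_nonpos_pi_2pi)
  finally show ?thesis unfolding nn_integral_cos_substitution[OF assms] by (simp only: mult_2)
qed

text \<open>The left side is an integral over the upper half circle only, where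
  \<open>sqrt (1 - (cos t)\<^sup>2)\<close> is \<open>sin t\<close>; the bound is an integral over
  the whole circle, which covers the interval twice. Hence the factor 2.\<close>

lemma interval_perturb_le:
  fixes p :: real
  assumes p: "1 \<le> p"
  obtains C where "0 < C" "\<And>N q z \<beta>. 1 \<le> N \<Longrightarrow> degree q \<le> N \<Longrightarrow> cmod z \<le> 1 / real N \<Longrightarrow> cmod \<beta> \<le> 1 / (real N)\<^sup>2 \<Longrightarrow>
    (\<integral>\<^sup>+x\<in>{-1..1}. ennreal (cmod (poly q (of_real x + z * of_real (sqrt (1 - x\<^sup>2)) + \<beta>)) powr p) \<partial>lborel)
    \<le> ennreal C * (\<integral>\<^sup>+x\<in>{-1..1}. ennreal (cmod (poly q (of_real x)) powr p) \<partial>lborel)"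
proof -
  obtain C where C: "0 < C" "\<And>N q z \<beta>. 1 \<le> N \<Longrightarrow> degree q \<le> N \<Longrightarrow> cmod z \<le> 1 / real N \<Longrightarrow> cmod \<beta> \<le> 1 / (real N)\<^sup>2 \<Longrightarrow>
    circle_int (\<lambda>t. ennreal (cmod (poly q (of_real (cos t) + z * of_real (sin t) + \<beta>)) powr p * \<bar>sin t\<bar>)) \<le> ennreal C * Iw p q 0 0"
    by (rule Iw_perturb_le[OF p]) blast
  show thesis
  proof (rule that[of "C * 2"])
    fix N :: nat and q :: "complex poly" and z \<beta> :: complex
    assume a: "1 \<le> N" "degree q \<le> N" "cmod z \<le> 1 / real N" "cmod \<beta> \<le> 1 / (real N)\<^sup>2"
    let ?H = "\<lambda>x. ennreal (cmod (poly q (of_real x + z * of_real (sqrt (1 - x\<^sup>2)) + \<beta>)) powr p)"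
    have "(\<integral>\<^sup>+x\<in>{-1..1}. ?H x \<partial>lborel) = (\<integral>\<^sup>+t\<in>{0..pi}. ?H (cos t) * ennreal (sin t) \<partial>lborel)"
      by (rule nn_integral_cos_substitution(1)[symmetric]) measurable
    also have "\<dots> \<le> circle_int (\<lambda>t. ennreal (cmod (poly q (of_real (cos t) + z * of_real (sin t) + \<beta>)) powr p * \<bar>sin t\<bar>))"
      unfolding circle_int_def
    proof (intro nn_integral_mono)
      fix t :: real
      show "?H (cos t) * ennreal (sin t) * indicator {0..pi} t
        \<le> ennreal (cmod (poly q (of_real (cos t) + z * of_real (sin t) + \<beta>)) powr p * \<bar>sin t\<bar>) * indicator {0..2 * pi} t"
      proof (cases "t \<in> {0..pi}")
        case True
        then have s: "0 \<le> sin t" by (auto intro: sin_ge_zero)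
        then have "sqrt (1 - (cos t)\<^sup>2) = sin t" by (simp flip: sin_squared_eq)
        then show ?thesis using True s by (simp add: ennreal_mult)
      qed auto
    qed
    also have "\<dots> \<le> ennreal C * Iw p q 0 0" by (rule C(2)[OF a])
    also have "Iw p q 0 0 = circle_int (\<lambda>t. ennreal (cmod (poly q (of_real (cos t))) powr p) * ennreal \<bar>sin t\<bar>)"
      by (simp add: Iw_alt ennreal_mult cos_of_real)
    also have "\<dots> = 2 * (\<integral>\<^sup>+x\<in>{-1..1}. ennreal (cmod (poly q (of_real x)) powr p) \<partial>lborel)"
      by (rule circle_int_cos) measurable
    finally show "(\<integral>\<^sup>+x\<in>{-1..1}. ?H x \<partial>lborel) \<le> ennreal (C * 2) * (\<integral>\<^sup>+x\<in>{-1..1}. ennreal (cmod (poly q (of_real x)) powr p) \<partial>lborel)"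
      using C(1) by (simp add: ennreal_mult mult.assoc)
  qed (use C(1) in simp)
qed

section \<open>Finite differences and harmonic measure\<close>

lemma fin_diff_Suc: "fin_diff (Suc r) \<xi> f \<eta> = fin_diff r \<xi> f (\<eta> + \<xi>) - fin_diff r \<xi> f \<eta>"
proof -
  let ?c = "\<lambda>j. (-1) ^ (r + j) * real (r choose j) :: real" and ?f = "\<lambda>j. f (\<eta> + real j *\<^sub>R \<xi>)"
  have 1: "fin_diff r \<xi> f (\<eta> + \<xi>) = (\<Sum>j\<le>r. ?c j * ?f (Suc j))"
    unfolding fin_diff_def by (simp add: atMost_atLeast0 scaleR_add_left add_ac)
  have 2: "fin_diff r \<xi> f \<eta> = (\<Sum>j\<le>Suc r. ?c j * ?f j)"
    unfolding fin_diff_def by (simp add: atMost_atLeast0)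
  have "fin_diff (Suc r) \<xi> f \<eta> = (\<Sum>j\<le>Suc r. (-1) ^ (Suc r + j) * real (Suc r choose j) * ?f j)"
    unfolding fin_diff_def by (simp add: atMost_atLeast0)
  also have "\<dots> = - (?c 0 * ?f 0) + (\<Sum>j\<le>r. ?c j * ?f (Suc j) - ?c (Suc j) * ?f (Suc j))"
    by (subst sum.atMost_Suc_shift) (auto intro!: sum.cong simp: algebra_simps)
  also have "\<dots> = - (?c 0 * ?f 0) + ((\<Sum>j\<le>r. ?c j * ?f (Suc j)) - (\<Sum>j\<le>r. ?c (Suc j) * ?f (Suc j)))"
    by (simp only: sum_subtractf)
  also have "\<dots> = (\<Sum>j\<le>r. ?c j * ?f (Suc j)) - (\<Sum>j\<le>Suc r. ?c j * ?f j)"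
    unfolding sum.atMost_Suc_shift by simp
  finally show ?thesis by (simp only: 1 2)
qed

lemma fin_diff_sum: "fin_diff r \<xi> (\<lambda>x. \<Sum>i\<in>I. g i x) \<eta> = (\<Sum>i\<in>I. fin_diff r \<xi> (g i) \<eta>)"
  unfolding fin_diff_def by (subst sum.swap) (simp add: sum_distrib_left)

lemma fin_diff_cmult: "fin_diff r \<xi> (\<lambda>x. c * g x) \<eta> = c * fin_diff r \<xi> g \<eta>"
  unfolding fin_diff_def by (simp add: sum_distrib_left mult_ac)

lemma fin_diff_power_eq_0: "k < r \<Longrightarrow> fin_diff r 1 (\<lambda>x::real. x ^ k) a = 0"
proof (induction r arbitrary: k a)
  case (Suc r)
  have "fin_diff (Suc r) 1 (\<lambda>x::real. x ^ k) a = fin_diff r 1 (\<lambda>x. (x + 1) ^ k - x ^ k) a"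
    unfolding fin_diff_Suc by (simp add: fin_diff_def sum_subtractf algebra_simps)
  also have "(\<lambda>x::real. (x + 1) ^ k - x ^ k) = (\<lambda>x. \<Sum>i<k. real (k choose i) * x ^ i)"
  proof
    fix x :: real
    have "(x + 1) ^ k = (\<Sum>i\<le>k. real (k choose i) * x ^ i)" by (simp add: binomial_ring)
    then show "(x + 1) ^ k - x ^ k = (\<Sum>i<k. real (k choose i) * x ^ i)"
      by (simp add: lessThan_Suc_atMost[symmetric])
  qed
  also have "fin_diff r 1 (\<lambda>x. \<Sum>i<k. real (k choose i) * x ^ i) a = 0"
    unfolding fin_diff_sum fin_diff_cmult using Suc by (intro sum.neutral) auto
  finally show ?case .
qed simp

text \<open>\<open>S\<close> is the \<open>r\<close>-th difference of \<open>x ^ k\<close> at 0 with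
  step 1, that is, the factor that the \<open>k\<close>-th Taylor coefficient receives in a
  difference. The orders below \<open>r\<close> disappear, and this is what produces the power
  \<open>r\<close> of the step.\<close>

lemma alternating_binomial_power_sum:
  fixes r k :: nat
  defines "S \<equiv> (\<Sum>j=0..r. (-1) ^ (r + j) * real (r choose j) * real j ^ k)"
  shows "k < r \<Longrightarrow> S = 0" and "\<bar>S\<bar> \<le> 2 ^ r * real r ^ k"
proof -
  show "k < r \<Longrightarrow> S = 0"
    using fin_diff_power_eq_0[of k r 0] by (simp add: fin_diff_def S_def)
  have "\<bar>S\<bar> \<le> (\<Sum>j=0..r. real (r choose j) * real r ^ k)"
    unfolding S_def
    by (rule order_trans[OF sum_abs]) (auto intro!: sum_mono mult_left_mono power_mono simp: abs_mult)
  also have "\<dots> = 2 ^ r * real r ^ k"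
  proof -
    have "(\<Sum>j=0..r. real (r choose j)) = 2 ^ r"
      using choose_row_sum[of r] by (metis atMost_atLeast0 of_nat_numeral of_nat_power of_nat_sum)
    then show ?thesis by (simp flip: sum_distrib_right)
  qed
  finally show "\<bar>S\<bar> \<le> 2 ^ r * real r ^ k" .
qed

section \<open>Cauchy estimates from averages over roots of unity\<close>

definition unity_root :: "nat \<Rightarrow> nat \<Rightarrow> complex" where
  "unity_root m l = cis (2 * pi * real l / real m)"

lemma norm_unity_root [simp]: "cmod (unity_root m l) = 1"
  by (simp add: unity_root_def)

lemma sum_unity_root:
  assumes "k < m" "i < m"
  shows "(\<Sum>l<m. unity_root m l ^ k * cnj (unity_root m l) ^ i) = (if k = i then of_nat m else 0)"
proof -
  define x where "x = cis (2 * pi * (real k - real i) / real m)"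
  have e: "unity_root m l ^ k * cnj (unity_root m l) ^ i = x ^ l" for l
    unfolding unity_root_def x_def cis_cnj Complex.DeMoivre cis_mult
    by (rule arg_cong[where f = cis]) (simp add: right_diff_distrib diff_divide_distrib mult_ac)
  show ?thesis
  proof (cases "k = i")
    case True
    then show ?thesis unfolding e by (simp add: x_def)
  next
    case False
    have "x ^ m = cis (2 * pi * of_int (int k - int i))"
      unfolding x_def Complex.DeMoivre using assms by (intro arg_cong[where f = cis]) simp
    also have "\<dots> = 1" by (rule cis_multiple_2pi) simp
    finally have xm: "x ^ m = 1" .
    have "x \<noteq> 1"
    proof
      assume "x = 1"
      then have "cos (2 * pi * (real k - real i) / real m) = 1" by (simp add: x_def complex_eq_iff)
      then obtain n :: int where n: "2 * pi * (real k - real i) / real m = of_int n * 2 * pi"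
        unfolding cos_one_2pi_int by blast
      then have "(2 * pi) * ((real k - real i) / real m) = (2 * pi) * of_int n" by simp
      then have "(real k - real i) / real m = of_int n"
        using pi_gt_zero by (simp only: mult_cancel_left) simp
      then have "real k - real i = of_int n * real m" using assms by (simp add: divide_eq_eq)
      then have "of_int (int k - int i) = (of_int (n * int m) :: real)" by simp
      then have "int k - int i = n * int m" by (simp only: of_int_eq_iff)
      moreover have "\<bar>int k - int i\<bar> < int m" using assms by auto
      ultimately have "\<bar>n\<bar> * int m < 1 * int m" by (simp add: abs_mult)
      then have "\<bar>n\<bar> < 1" by (rule mult_right_less_imp_less) simp
      then have "n = 0" by simp
      then show False using \<open>int k - int i = n * int m\<close> False by simp
    qed
    then show ?thesis using False by (simp add: e sum_gp_strict xm)
  qed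
qed

text \<open>Finite averages instead of Cauchy's integral formula, since they commute with all later
  integrations.\<close>

lemma coeff_average:
  fixes H :: "complex poly"
  assumes "degree H \<le> D" "i \<le> D"
  shows "coeff H i * of_real \<rho> ^ i * of_nat (Suc D)
    = (\<Sum>l<Suc D. poly H (of_real \<rho> * unity_root (Suc D) l) * cnj (unity_root (Suc D) l) ^ i)"
proof -
  let ?w = "unity_root (Suc D)"
  have "(\<Sum>l<Suc D. poly H (of_real \<rho> * ?w l) * cnj (?w l) ^ i)
      = (\<Sum>l<Suc D. \<Sum>k\<le>D. coeff H k * of_real \<rho> ^ k * (?w l ^ k * cnj (?w l) ^ i))"
    unfolding poly_altdef_le[OF assms(1)] by (simp add: sum_distrib_right power_mult_distrib mult.assoc del: sum.lessThan_Suc)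
  also have "\<dots> = (\<Sum>k\<le>D. coeff H k * of_real \<rho> ^ k * (\<Sum>l<Suc D. ?w l ^ k * cnj (?w l) ^ i))"
    by (subst sum.swap) (simp add: sum_distrib_left del: sum.lessThan_Suc)
  also have "\<dots> = (\<Sum>k\<le>D. if k = i then coeff H k * of_real \<rho> ^ k * of_nat (Suc D) else 0)"
    using assms(2) by (intro sum.cong) (auto simp: sum_unity_root simp del: sum.lessThan_Suc)
  also have "\<dots> = coeff H i * of_real \<rho> ^ i * of_nat (Suc D)" using assms(2) by simp
  finally show ?thesis by simp
qed

text \<open>The difference annihilates the powers below \<open>r\<close>, and the coefficients of
  the others satisfy a Cauchy estimate by the average \<open>A\<close> over the circle of radius
  \<open>\<rho>\<close>. The condition on \<open>h\<close> makes the ratio \<open>x\<close> of the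
  remaining series at most 1/2, so the series is dominated by twice its first term, which contains
  \<open>x ^ r\<close>.\<close>

lemma difference_le_average:
  fixes H :: "complex poly" and h \<rho> :: real
  assumes H: "degree H \<le> D" and r: "1 \<le> r" and \<rho>: "0 < \<rho>" and h: "2 * real r * \<bar>h\<bar> \<le> \<rho>"
  shows "cmod (\<Sum>j=0..r. of_real ((-1) ^ (r + j) * real (r choose j)) * poly H (of_real (real j * h)))
    \<le> 2 * (2 * real r) ^ r * (\<bar>h\<bar> / \<rho>) ^ r * ((\<Sum>l<Suc D. cmod (poly H (of_real \<rho> * unity_root (Suc D) l))) / real (Suc D))"
proof -
  define A where "A = (\<Sum>l<Suc D. cmod (poly H (of_real \<rho> * unity_root (Suc D) l))) / real (Suc D)"
  have A0: "0 \<le> A" by (auto simp: A_def intro!: divide_nonneg_nonneg sum_nonneg simp del: sum.lessThan_Suc)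
  \<comment> \<open>The discrete Cauchy estimate: \<open>D + 1\<close> points of the circle suffice
    because the degree is at most \<open>D\<close>.\<close>
  have cA: "cmod (coeff H k) * \<rho> ^ k \<le> A" if "k \<le> D" for k
  proof -
    have "cmod (coeff H k * of_real \<rho> ^ k * of_nat (Suc D))
        \<le> (\<Sum>l<Suc D. cmod (poly H (of_real \<rho> * unity_root (Suc D) l) * cnj (unity_root (Suc D) l) ^ k))"
      unfolding coeff_average[OF H that] by (rule norm_sum)
    also have "\<dots> = (\<Sum>l<Suc D. cmod (poly H (of_real \<rho> * unity_root (Suc D) l)))"
      by (intro sum.cong) (simp_all add: norm_mult norm_power)
    finally have "cmod (coeff H k * of_real \<rho> ^ k) * real (Suc D) \<le> (\<Sum>l<Suc D. cmod (poly H (of_real \<rho> * unity_root (Suc D) l)))"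
      by (simp only: norm_mult norm_of_nat)
    then have "cmod (coeff H k * of_real \<rho> ^ k) \<le> A"
      unfolding A_def by (subst pos_le_divide_eq) auto
    then show ?thesis using \<rho> by (simp add: norm_mult norm_power)
  qed
  define x where "x = real r * \<bar>h\<bar> / \<rho>"
  have x: "0 \<le> x" "x \<le> 1 / 2" using \<rho> h by (auto simp: x_def field_simps)
  define S where "S = (\<lambda>k. \<Sum>j=0..r. (-1) ^ (r + j) * real (r choose j) * real j ^ k)"
  have "(\<Sum>j=0..r. of_real ((-1) ^ (r + j) * real (r choose j)) * poly H (of_real (real j * h)))
     = (\<Sum>j=0..r. \<Sum>k\<le>D. coeff H k * of_real (h ^ k) * of_real ((-1) ^ (r + j) * real (r choose j) * real j ^ k))"
    unfolding poly_altdef_le[OF H] by (simp add: sum_distrib_left power_mult_distrib mult_ac)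
  also have "\<dots> = (\<Sum>k\<le>D. coeff H k * of_real (h ^ k) * of_real (S k))"
    by (subst sum.swap) (simp add: S_def sum_distrib_left)
  also have "cmod \<dots> \<le> (\<Sum>k\<le>D. if k < r then 0 else 2 ^ r * A * x ^ k)"
  proof (rule sum_norm_le)
    fix k assume k: "k \<in> {..D}"
    show "cmod (coeff H k * of_real (h ^ k) * of_real (S k)) \<le> (if k < r then 0 else 2 ^ r * A * x ^ k)"
    proof (cases "k < r")
      case True
      then show ?thesis using alternating_binomial_power_sum(1)[of k r] by (simp add: S_def)
    next
      case False
      have "cmod (coeff H k * of_real (h ^ k) * of_real (S k)) = cmod (coeff H k) * \<bar>h\<bar> ^ k * \<bar>S k\<bar>"
        by (simp add: norm_mult norm_power power_abs)
      also have "\<dots> \<le> cmod (coeff H k) * \<bar>h\<bar> ^ k * (2 ^ r * real r ^ k)"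
        unfolding S_def by (intro mult_left_mono alternating_binomial_power_sum(2)) auto
      also have "\<dots> = 2 ^ r * (cmod (coeff H k) * \<rho> ^ k) * x ^ k"
        using \<rho> by (simp add: x_def power_divide power_mult_distrib)
      also have "\<dots> \<le> 2 ^ r * A * x ^ k"
        using k x by (intro mult_right_mono mult_left_mono cA) auto
      finally show ?thesis using False by simp
    qed
  qed
  also have "\<dots> \<le> (\<Sum>k\<le>D. 2 ^ r * A * x ^ r * (if k < r then 0 else (1/2) ^ (k - r)))"
  proof (rule sum_mono)
    fix k
    show "(if k < r then 0 else 2 ^ r * A * x ^ k) \<le> 2 ^ r * A * x ^ r * (if k < r then 0 else (1/2) ^ (k - r))"
    proof (cases "k < r")
      case False
      then have "x ^ k = x ^ r * x ^ (k - r)" by (simp flip: power_add)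
      also have "\<dots> \<le> x ^ r * (1/2) ^ (k - r)" using x by (intro mult_left_mono power_mono) auto
      finally have "2 ^ r * A * x ^ k \<le> 2 ^ r * A * (x ^ r * (1/2) ^ (k - r))" using A0 by (intro mult_left_mono) auto
      then show ?thesis using False by (simp add: mult.assoc)
    qed simp
  qed
  also have "\<dots> = 2 ^ r * A * x ^ r * (\<Sum>k\<le>D. if k < r then 0 else (1/2) ^ (k - r))"
    by (simp add: sum_distrib_left)
  also have "\<dots> \<le> 2 ^ r * A * x ^ r * 2"
  proof (intro mult_left_mono)
    have "(\<Sum>k\<le>D. if k < r then 0 else (1/2::real) ^ (k - r)) = (\<Sum>k\<in>{r..D}. (1/2) ^ (k - r))"
      by (intro sum.mono_neutral_cong_right) auto
    also have "\<dots> = (\<Sum>i\<in>(\<lambda>k. k - r) ` {r..D}. (1/2) ^ i)"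
      by (subst sum.reindex) (auto simp: inj_on_def)
    also have "\<dots> \<le> (\<Sum>i. (1/2) ^ i)" by (intro sum_le_suminf) (auto simp: summable_geometric)
    also have "\<dots> = 2" by (simp add: suminf_geometric)
    finally show "(\<Sum>k\<le>D. if k < r then 0 else (1/2::real) ^ (k - r)) \<le> 2" .
  qed (use A0 x in auto)
  also have "\<dots> = 2 * (2 * real r) ^ r * (\<bar>h\<bar> / \<rho>) ^ r * A"
    by (simp add: x_def power_mult_distrib power_divide)
  finally show ?thesis by (simp only: A_def)
qed

text \<open>On the unit circle \<open>circ_poly N q\<close> has modulus at most \<open>B\<close>,
  hence also inside: a maximum principle, read off here from the Poisson inequality with exponent 1.
  The exponential is the factor \<open>w ^ N\<close> brought to the other side.\<close>

lemma bernstein_walsh: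
  assumes deg: "degree q \<le> N" and B: "\<And>x. -1 \<le> x \<Longrightarrow> x \<le> 1 \<Longrightarrow> cmod (poly q (of_real x)) \<le> B"
  shows "cmod (poly q (cos \<theta>)) \<le> exp (real N * \<bar>Im \<theta>\<bar>) * B"
proof -
  have main: "cmod (poly q (cos \<theta>)) \<le> exp (real N * Im \<theta>) * B" if "0 < Im \<theta>" for \<theta>
  proof -
    let ?w = "exp (\<i> * \<theta>)"
    have w: "cmod ?w < 1" using that by (simp add: norm_exp_eq_Re)
    have pm: "pois ?w \<in> borel_measurable borel"
      using w by (intro borel_measurable_continuous_onI continuous_on_pois)
    have bd: "cmod (circ_poly N q (cis t)) \<le> B" for t
      using circ_poly_exp[OF deg, of "of_real t"] B[of "cos t"] by (simp add: cos_of_real flip: cis_conv_exp)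
    have B0: "0 \<le> B" using order_trans[OF norm_ge_zero B[of 0]] by simp
    have "ennreal (cmod (circ_poly N q ?w) powr 1) \<le> circle_int (\<lambda>t. ennreal (pois ?w t * cmod (circ_poly N q (cis t)) powr 1))"
      by (rule pois_powr_le[OF holomorphic_circ_poly holomorphic_on_imp_continuous_on[OF holomorphic_circ_poly] w]) simp
    also have "\<dots> \<le> circle_int (\<lambda>t. ennreal B * ennreal (pois ?w t))"
    proof (rule circle_int_mono)
      fix t
      have "pois ?w t * cmod (circ_poly N q (cis t)) \<le> B * pois ?w t"
        using mult_left_mono[OF bd[of t] pois_nonneg[OF w, of t]] by (simp add: mult.commute)
      then show "ennreal (pois ?w t * cmod (circ_poly N q (cis t)) powr 1) \<le> ennreal B * ennreal (pois ?w t)"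
        using B0 pois_nonneg[OF w, of t] by (simp add: ennreal_leI flip: ennreal_mult)
    qed
    also have "\<dots> = ennreal B"
      using w pm by (subst circle_int_cmult) (simp_all add: circle_int_pois)
    finally have "cmod (circ_poly N q ?w) \<le> B" using B0 by simp
    then have "exp (- real N * Im \<theta>) * cmod (poly q (cos \<theta>)) \<le> B" by (simp add: circ_poly_exp[OF deg])
    then have "exp (real N * Im \<theta>) * (exp (- real N * Im \<theta>) * cmod (poly q (cos \<theta>))) \<le> exp (real N * Im \<theta>) * B"
      by (intro mult_left_mono) auto
    then show ?thesis by (simp add: mult.assoc[symmetric] flip: exp_add)
  qed
  consider "Im \<theta> = 0" | "0 < Im \<theta>" | "Im \<theta> < 0" by linarith
  then show ?thesis
  proof cases
    case 1
    then have "cos \<theta> = of_real (cos (Re \<theta>))" by (metis complex_is_Real_iff cos_of_real of_real_Re)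
    then show ?thesis using B[of "cos (Re \<theta>)"] 1 by simp
  next
    case 2 then show ?thesis using main by simp
  next
    case 3 then show ?thesis using main[of "- \<theta>"] by simp
  qed
qed

text \<open>\<open>\<mu>\<close> is the image under the cosine of the Poisson density at
  \<open>exp (\<i> * \<theta>)\<close>: harmonic measure of the complement of the interval, seen
  from \<open>cos \<theta>\<close>. It depends on \<open>\<theta>\<close> alone and serves all
  polynomials at once, which later permits an exchange with other integrals.\<close>

lemma poisson_measure_exists:
  fixes \<theta> :: complex and p :: real
  assumes p: "1 \<le> p"
  obtains \<mu> :: "real measure" where "sets \<mu> = sets borel" "emeasure \<mu> UNIV = 1" "AE v in \<mu>. v \<in> {-1..1}"
    "\<And>N q. degree q \<le> N \<Longrightarrow> ennreal (cmod (poly q (cos \<theta>)) powr p) \<le>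
       ennreal (exp (p * real N * \<bar>Im \<theta>\<bar>)) * (\<integral>\<^sup>+v. ennreal (cmod (poly q (of_real v)) powr p) \<partial>\<mu>)"
proof -
  note result = that
  \<comment> \<open>As the cosine is even, \<open>\<theta>\<close> may be replaced by
    \<open>- \<theta>\<close>; so only the upper half-plane, which is mapped into the disc, has to
    be treated.\<close>
  have main: thesis if pos: "0 < Im \<theta>'" and c: "cos \<theta>' = cos \<theta>" and im: "Im \<theta>' = \<bar>Im \<theta>\<bar>" for \<theta>'
  proof -
    let ?w = "exp (\<i> * \<theta>')"
    have w: "cmod ?w < 1" using pos by (simp add: norm_exp_eq_Re)
    have [measurable]: "pois ?w \<in> borel_measurable borel"
      using w by (intro borel_measurable_continuous_onI continuous_on_pois)
    define M where "M = density lborel (\<lambda>t. ennreal (pois ?w t) * indicator {0..2*pi} t)"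
    define \<mu> where "\<mu> = distr M borel cos"
    have [measurable]: "cos \<in> M \<rightarrow>\<^sub>M borel" by (simp add: M_def)
    have int: "(\<integral>\<^sup>+v. G v \<partial>\<mu>) = circle_int (\<lambda>t. ennreal (pois ?w t) * G (cos t))" if [measurable]: "G \<in> borel_measurable borel" for G
      unfolding \<mu>_def M_def circle_int_def
      by (subst nn_integral_distr, simp, simp, subst nn_integral_density) (auto intro!: nn_integral_cong simp: mult_ac)
    show thesis
    proof (rule result)
      show "sets \<mu> = sets borel" by (simp add: \<mu>_def)
      have "emeasure \<mu> UNIV = (\<integral>\<^sup>+v. 1 \<partial>\<mu>)" by (simp add: \<mu>_def)
      also have "\<dots> = 1" using circle_int_pois[OF w] by (subst int) auto
      finally show "emeasure \<mu> UNIV = 1" .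
      show "AE v in \<mu>. v \<in> {-1..1}" unfolding \<mu>_def by (subst AE_distr_iff) auto
      fix N and q :: "complex poly" assume deg: "degree q \<le> N"
      have "ennreal (cmod (circ_poly N q ?w) powr p) \<le> circle_int (\<lambda>t. ennreal (pois ?w t * cmod (circ_poly N q (cis t)) powr p))"
        by (rule pois_powr_le[OF holomorphic_circ_poly holomorphic_on_imp_continuous_on[OF holomorphic_circ_poly] w p])
      also have "\<dots> = circle_int (\<lambda>t. ennreal (pois ?w t) * ennreal (cmod (poly q (of_real (cos t))) powr p))"
        using circ_poly_exp[OF deg, of "of_real t" for t] pois_nonneg[OF w]
        by (simp add: cos_of_real ennreal_mult flip: cis_conv_exp)
      also have "\<dots> = (\<integral>\<^sup>+v. ennreal (cmod (poly q (of_real v)) powr p) \<partial>\<mu>)"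
        by (rule int[symmetric]) measurable
      finally have "ennreal (cmod (circ_poly N q ?w) powr p) \<le> \<dots>" .
      moreover have "cmod (circ_poly N q ?w) powr p = exp (- (p * real N * Im \<theta>')) * cmod (poly q (cos \<theta>)) powr p"
        by (simp add: circ_poly_exp[OF deg] powr_mult exp_powr_real c mult_ac)
      ultimately have "ennreal (exp (- (p * real N * Im \<theta>'))) * ennreal (cmod (poly q (cos \<theta>)) powr p) \<le> (\<integral>\<^sup>+v. ennreal (cmod (poly q (of_real v)) powr p) \<partial>\<mu>)"
        by (simp add: ennreal_mult)
      then have "ennreal (exp (p * real N * Im \<theta>')) * (ennreal (exp (- (p * real N * Im \<theta>'))) * ennreal (cmod (poly q (cos \<theta>)) powr p))
         \<le> ennreal (exp (p * real N * Im \<theta>')) * (\<integral>\<^sup>+v. ennreal (cmod (poly q (of_real v)) powr p) \<partial>\<mu>)"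
        by (intro mult_left_mono) auto
      moreover have "exp (p * real N * Im \<theta>') * exp (- (p * real N * Im \<theta>')) = 1" by (simp flip: exp_add)
      ultimately show "ennreal (cmod (poly q (cos \<theta>)) powr p) \<le>
       ennreal (exp (p * real N * \<bar>Im \<theta>\<bar>)) * (\<integral>\<^sup>+v. ennreal (cmod (poly q (of_real v)) powr p) \<partial>\<mu>)"
        by (simp add: im mult.assoc[symmetric] flip: ennreal_mult)
    qed
  qed
  consider "Im \<theta> = 0" | "0 < Im \<theta>" | "Im \<theta> < 0" by linarith
  then show thesis
  proof cases
    case 1
    then have c: "cos \<theta> = of_real (cos (Re \<theta>))" by (metis complex_is_Real_iff cos_of_real of_real_Re)
    \<comment> \<open>The unit mass at the real point \<open>cos \<theta>\<close>: there is nothing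
      to average.\<close>
    define \<mu> where "\<mu> = distr (count_space {cos (Re \<theta>)}) borel (\<lambda>x. x)"
    have int: "(\<integral>\<^sup>+v. G v \<partial>\<mu>) = G (cos (Re \<theta>))" if "G \<in> borel_measurable borel" for G
      unfolding \<mu>_def using that by (subst nn_integral_distr) (auto simp: nn_integral_count_space_finite)
    show thesis
    proof (rule that)
      show "sets \<mu> = sets borel" by (simp add: \<mu>_def)
      have "emeasure \<mu> UNIV = (\<integral>\<^sup>+v. 1 \<partial>\<mu>)" by (simp add: \<mu>_def)
      also have "\<dots> = 1" by (subst int) auto
      finally show "emeasure \<mu> UNIV = 1" .
      show "AE v in \<mu>. v \<in> {-1..1}" unfolding \<mu>_def by (subst AE_distr_iff) (auto simp: AE_count_space)
      show "ennreal (cmod (poly q (cos \<theta>)) powr p) \<le>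
         ennreal (exp (p * real N * \<bar>Im \<theta>\<bar>)) * (\<integral>\<^sup>+v. ennreal (cmod (poly q (of_real v)) powr p) \<partial>\<mu>)" for N q
        using 1 c by (subst int) auto
    qed
  next
    case 2 then show thesis using main by simp
  next
    case 3 then show thesis using main[of "- \<theta>"] by simp
  qed
qed

text \<open>The left side of the hypothesis is \<open>|sin \<theta>|^2 + |cos \<theta>|^2 = 1 + 2 *
  (sinh (Im \<theta>))^2\<close>. In terms of \<open>cos \<theta>\<close> it describes an ellipse
  with foci -1 and 1, so heights can be estimated without computing an inverse cosine.\<close>

lemma Im_arccos_le:
  assumes "cmod ((cos \<theta>)\<^sup>2 - 1) + (cmod (cos \<theta>))\<^sup>2 \<le> 1 + 2 * \<delta>\<^sup>2" "0 \<le> \<delta>"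
  shows "\<bar>Im \<theta>\<bar> \<le> \<delta>"
proof -
  have "(cos \<theta>)\<^sup>2 - 1 = - (sin \<theta>)\<^sup>2" by (simp add: cos_squared_eq)
  then have "cmod ((cos \<theta>)\<^sup>2 - 1) = (cmod (sin \<theta>))\<^sup>2" by (simp add: norm_power)
  then have "(sin (Re \<theta>))\<^sup>2 + (cos (Re \<theta>))\<^sup>2 + 2 * (sinh (Im \<theta>))\<^sup>2 \<le> 1 + 2 * \<delta>\<^sup>2"
    using assms(1) by (simp only: cmod_sin_squared cmod_cos_squared)
  then have "(sinh (Im \<theta>))\<^sup>2 \<le> \<delta>\<^sup>2" by simp
  then have "\<bar>sinh (Im \<theta>)\<bar> \<le> \<delta>" using assms(2) by (metis abs_le_square_iff abs_of_nonneg)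
  with abs_le_abs_sinh[of "Im \<theta>"] show ?thesis by linarith
qed

text \<open>The perturbed point lies in an ellipse of size \<open>14 / N\<close>, on which a
  polynomial of degree \<open>N\<close> grows by at most \<open>exp 14\<close>. The quantity of
  \<open>Im_arccos_le\<close> is known exactly at \<open>\<zeta>0 = cos (t - z)\<close> and changes
  by at most \<open>34 * cmod \<epsilon>\<close> on the way to \<open>\<zeta>\<close>.\<close>

lemma bernstein_walsh_perturb:
  assumes N: "1 \<le> N" and deg: "degree q \<le> N" and z: "cmod z \<le> 1 / real N" and \<beta>: "cmod \<beta> \<le> 1 / (real N)\<^sup>2"
    and x: "-1 \<le> x" "x \<le> 1" and B: "\<And>x. -1 \<le> x \<Longrightarrow> x \<le> 1 \<Longrightarrow> cmod (poly q (of_real x)) \<le> B"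
  shows "cmod (poly q (of_real x + z * of_real (sqrt (1 - x\<^sup>2)) + \<beta>)) \<le> exp 14 * B"
proof -
  define t where "t = arccos x"
  have t: "cos t = x" "sin t = sqrt (1 - x\<^sup>2)" using x by (auto simp: t_def sin_arccos)
  define \<zeta>0 where "\<zeta>0 = cos (of_real t - z)"
  define \<zeta> where "\<zeta> = of_real x + z * of_real (sqrt (1 - x\<^sup>2)) + \<beta>"
  define \<epsilon> where "\<epsilon> = \<zeta> - \<zeta>0"
  have z1: "cmod z \<le> 1" using z N by (rule_tac order_trans[OF z]) auto
  have "cmod \<epsilon> \<le> cmod (of_real (cos t) + z * of_real (sin t) - cos (of_real t - z)) + cmod \<beta>"
    unfolding \<epsilon>_def \<zeta>_def \<zeta>0_def t by (metis (no_types, lifting) add.commute add_diff_eq norm_triangle_ineq)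
  also have "\<dots> \<le> 10 * (cmod z)\<^sup>2 + 1 / (real N)\<^sup>2" by (intro add_mono cos_tangent_approx \<beta> z1)
  also have "\<dots> \<le> 10 * (1 / real N)\<^sup>2 + 1 / (real N)\<^sup>2" using z by (intro add_mono mult_left_mono power_mono) auto
  finally have e: "cmod \<epsilon> \<le> 11 / (real N)\<^sup>2" by (simp add: power_divide)
  have N2: "1 / (real N)\<^sup>2 \<le> 1" using N by (simp add: divide_le_eq_1)
  have e11: "cmod \<epsilon> \<le> 11" using e N2 by linarith
  have im: "\<bar>Im (of_real t - z)\<bar> \<le> cmod z" using abs_Im_le_cmod[of z] by simp
  have "exp \<bar>Im (of_real t - z)\<bar> \<le> exp 1" using im z1 by simp
  then have c3: "cmod \<zeta>0 \<le> 3" unfolding \<zeta>0_def using cmod_cos_le[of "of_real t - z"] exp_le by linarith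
  have "(sinh (Im (of_real t - z)))\<^sup>2 = (cmod (sin (\<i> * of_real (Im (of_real t - z)))))\<^sup>2"
    by (simp add: cmod_sin_squared)
  also have "\<dots> \<le> (3 * cmod (\<i> * of_real (Im (of_real t - z))))\<^sup>2"
    using im z1 by (intro power_mono cmod_sin_le) (auto simp: norm_mult)
  also have "\<dots> \<le> (3 * (1 / real N))\<^sup>2" using im z by (intro power_mono mult_left_mono) (auto simp: norm_mult)
  finally have sh: "(sinh (Im (of_real t - z)))\<^sup>2 \<le> 9 / (real N)\<^sup>2" by (simp add: power_divide power_mult_distrib)
  have "\<zeta>0\<^sup>2 - 1 = - (sin (of_real t - z))\<^sup>2" by (simp add: \<zeta>0_def cos_squared_eq)
  then have "cmod (\<zeta>0\<^sup>2 - 1) = (cmod (sin (of_real t - z)))\<^sup>2" by (simp add: norm_power)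
  then have z0: "cmod (\<zeta>0\<^sup>2 - 1) + (cmod \<zeta>0)\<^sup>2 = 1 + 2 * (sinh (Im (of_real t - z)))\<^sup>2"
    unfolding \<zeta>0_def by (simp only: cmod_sin_squared cmod_cos_squared) simp
  have z\<epsilon>: "\<zeta> = \<zeta>0 + \<epsilon>" by (simp add: \<epsilon>_def)
  \<comment> \<open>\<open>17 = 2 * 3 + 11\<close>, from the crude bounds 3 for
    \<open>cmod \<zeta>0\<close> and 11 for \<open>cmod \<epsilon>\<close>.\<close>
  have d: "2 * (cmod \<zeta>0 * cmod \<epsilon>) + (cmod \<epsilon>)\<^sup>2 \<le> 17 * cmod \<epsilon>"
  proof -
    have "cmod \<zeta>0 * cmod \<epsilon> \<le> 3 * cmod \<epsilon>" using c3 by (intro mult_right_mono) auto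
    moreover have "(cmod \<epsilon>)\<^sup>2 \<le> 11 * cmod \<epsilon>" unfolding power2_eq_square using e11 by (intro mult_right_mono) auto
    ultimately show ?thesis by linarith
  qed
  have "\<zeta>\<^sup>2 - 1 = (\<zeta>0\<^sup>2 - 1) + (2 * \<zeta>0 * \<epsilon> + \<epsilon>\<^sup>2)" by (simp add: z\<epsilon> power2_eq_square algebra_simps)
  then have "cmod (\<zeta>\<^sup>2 - 1) \<le> cmod (\<zeta>0\<^sup>2 - 1) + cmod (2 * \<zeta>0 * \<epsilon> + \<epsilon>\<^sup>2)" by (simp only: norm_triangle_ineq)
  also have "cmod (2 * \<zeta>0 * \<epsilon> + \<epsilon>\<^sup>2) \<le> cmod (2 * \<zeta>0 * \<epsilon>) + cmod (\<epsilon>\<^sup>2)" by (rule norm_triangle_ineq)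
  also have "\<dots> = 2 * (cmod \<zeta>0 * cmod \<epsilon>) + (cmod \<epsilon>)\<^sup>2" by (simp add: norm_mult norm_power)
  finally have a1: "cmod (\<zeta>\<^sup>2 - 1) \<le> cmod (\<zeta>0\<^sup>2 - 1) + 17 * cmod \<epsilon>" using d by linarith
  have "(cmod \<zeta>)\<^sup>2 \<le> (cmod \<zeta>0 + cmod \<epsilon>)\<^sup>2" unfolding z\<epsilon> by (intro power_mono norm_triangle_ineq) auto
  also have "\<dots> = (cmod \<zeta>0)\<^sup>2 + (2 * (cmod \<zeta>0 * cmod \<epsilon>) + (cmod \<epsilon>)\<^sup>2)" by (simp add: power2_eq_square algebra_simps)
  finally have a2: "(cmod \<zeta>)\<^sup>2 \<le> (cmod \<zeta>0)\<^sup>2 + 17 * cmod \<epsilon>" using d by linarith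
  have "cmod (\<zeta>\<^sup>2 - 1) + (cmod \<zeta>)\<^sup>2 \<le> 1 + 2 * (sinh (Im (of_real t - z)))\<^sup>2 + 34 * cmod \<epsilon>"
    using a1 a2 z0 by linarith
  also have "\<dots> \<le> 1 + 2 * (9 / (real N)\<^sup>2) + 34 * (11 / (real N)\<^sup>2)"
    using sh e by (intro add_mono mult_left_mono) auto
  \<comment> \<open>\<open>2 * 9 + 34 * 11 = 392 = 2 * 14^2\<close>, which is where 14 comes
    from.\<close>
  also have "\<dots> = 1 + 392 * (1 / (real N)\<^sup>2)" by simp
  also have "392 * (1 / (real N)\<^sup>2) = 2 * (14 / real N)\<^sup>2" by (simp add: power_divide)
  finally have "cmod (\<zeta>\<^sup>2 - 1) + (cmod \<zeta>)\<^sup>2 \<le> 1 + 2 * (14 / real N)\<^sup>2" .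
  moreover have \<zeta>c: "\<zeta> = cos (Arccos \<zeta>)" by simp
  ultimately have "\<bar>Im (Arccos \<zeta>)\<bar> \<le> 14 / real N" by (intro Im_arccos_le) auto
  then have "real N * \<bar>Im (Arccos \<zeta>)\<bar> \<le> 14" using N by (simp add: field_simps)
  moreover have "cmod (poly q \<zeta>) \<le> exp (real N * \<bar>Im (Arccos \<zeta>)\<bar>) * B"
    using bernstein_walsh[OF deg B, of "Arccos \<zeta>"] by simp
  moreover have "0 \<le> B" using order_trans[OF norm_ge_zero B[of 0]] by simp
  ultimately show ?thesis unfolding \<zeta>_def[symmetric]
    by (smt (verit, best) exp_le_cancel_iff mult_right_mono)
qed

section \<open>Arbitrary intervals, and Bernstein inequalities for differences on them\<close>

lemma degree_pcompose_linear:
  fixes q :: "'a::idom poly"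
  assumes "degree q \<le> N" shows "degree (pcompose q [:c, d:]) \<le> N"
proof -
  have "degree (pcompose q [:c, d:]) \<le> degree q * 1"
    unfolding degree_pcompose by (rule mult_left_mono) auto
  then show ?thesis using assms by simp
qed

text \<open>The Ditzian-Totik weight of the chord \<open>{a..b}\<close>, see
  \<open>phi_dist_line\<close>; on \<open>{-1..1}\<close> it is
  \<open>sqrt (1 - x\<^sup>2)\<close>.\<close>

definition phi_interval :: "real \<Rightarrow> real \<Rightarrow> real \<Rightarrow> real" where
  "phi_interval a b x = sqrt ((x - a) * (b - x))"

lemma phi_interval_affine:
  fixes a b x :: real
  assumes "a < b" defines "m \<equiv> (a + b) / 2" and "l \<equiv> (b - a) / 2"
  shows "phi_interval a b (m + l * x) = l * sqrt (1 - x\<^sup>2)"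
proof -
  have "(m + l * x - a) * (b - (m + l * x)) = l\<^sup>2 * (1 - x\<^sup>2)"
    by (simp add: m_def l_def power2_eq_square field_simps)
  then show ?thesis using assms(1) by (simp add: phi_interval_def real_sqrt_mult l_def)
qed

lemma nn_integral_interval_affine:
  fixes a b :: real and F :: "real \<Rightarrow> ennreal"
  assumes ab: "a < b" and [measurable]: "F \<in> borel_measurable borel"
  defines "m \<equiv> (a + b) / 2" and "l \<equiv> (b - a) / 2"
  shows "(\<integral>\<^sup>+y\<in>{a..b}. F y \<partial>lborel) = ennreal l * (\<integral>\<^sup>+x\<in>{-1..1}. F (m + l * x) \<partial>lborel)"
proof -
  have l: "0 < l" using ab by (simp add: l_def)
  have "indicator {a..b} (m + l * x) = (indicator {-1..1} x :: ennreal)" for x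
  proof -
    have "(a \<le> m + l * x) = (- 1 \<le> x)"
    proof -
      have "a = m + l * (-1)" by (simp add: m_def l_def field_simps)
      then have "(a \<le> m + l * x) = (l * (-1) \<le> l * x)" by linarith
      also have "\<dots> = (-1 \<le> x)" using l by (subst mult_le_cancel_left_pos) auto
      finally show ?thesis .
    qed
    moreover have "(m + l * x \<le> b) = (x \<le> 1)"
    proof -
      have "b = m + l * 1" by (simp add: m_def l_def field_simps)
      then have "(m + l * x \<le> b) = (l * x \<le> l * 1)" by linarith
      also have "\<dots> = (x \<le> 1)" using l by (subst mult_le_cancel_left_pos) auto
      finally show ?thesis .
    qed
    ultimately show ?thesis by (simp add: indicator_def)
  qed
  then show ?thesis
    using l by (subst nn_integral_real_affine[of _ l m]) auto
qed

lemma borel_measurable_phi_interval [measurable]: "phi_interval a b \<in> borel_measurable borel"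
  unfolding phi_interval_def by measurable

lemma interval_perturb_ab_le:
  fixes p :: real
  assumes p: "1 \<le> p"
  obtains C where "0 < C" "\<And>N q z \<beta> a b. 1 \<le> N \<Longrightarrow> degree q \<le> N \<Longrightarrow> a < b \<Longrightarrow> cmod z \<le> 1 / real N \<Longrightarrow> cmod \<beta> \<le> (b - a) / 2 / (real N)\<^sup>2 \<Longrightarrow>
    (\<integral>\<^sup>+x\<in>{a..b}. ennreal (cmod (poly q (of_real x + z * of_real (phi_interval a b x) + \<beta>)) powr p) \<partial>lborel)
    \<le> ennreal C * (\<integral>\<^sup>+x\<in>{a..b}. ennreal (cmod (poly q (of_real x)) powr p) \<partial>lborel)"
proof -
  obtain C where C: "0 < C" "\<And>N q z \<beta>. 1 \<le> N \<Longrightarrow> degree q \<le> N \<Longrightarrow> cmod z \<le> 1 / real N \<Longrightarrow> cmod \<beta> \<le> 1 / (real N)\<^sup>2 \<Longrightarrow>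
    (\<integral>\<^sup>+x\<in>{-1..1}. ennreal (cmod (poly q (of_real x + z * of_real (sqrt (1 - x\<^sup>2)) + \<beta>)) powr p) \<partial>lborel)
    \<le> ennreal C * (\<integral>\<^sup>+x\<in>{-1..1}. ennreal (cmod (poly q (of_real x)) powr p) \<partial>lborel)"
    by (rule interval_perturb_le[OF p]) blast
  show thesis
  proof (rule that[OF C(1)])
    fix N :: nat and q :: "complex poly" and z \<beta> :: complex and a b :: real
    assume N: "1 \<le> N" and deg: "degree q \<le> N" and ab: "a < b" and z: "cmod z \<le> 1 / real N" and \<beta>: "cmod \<beta> \<le> (b - a) / 2 / (real N)\<^sup>2"
    define m where "m = (a + b) / 2"
    define l where "l = (b - a) / 2"
    have l: "0 < l" using ab by (simp add: l_def)
    define q' where "q' = pcompose q [:of_real m, of_real l:]"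
    have deg': "degree q' \<le> N" unfolding q'_def by (rule degree_pcompose_linear[OF deg])
    have q': "poly q' x = poly q (of_real m + of_real l * x)" for x by (simp add: q'_def poly_pcompose mult.commute)
    have \<beta>': "cmod (\<beta> / of_real l) \<le> 1 / (real N)\<^sup>2" using \<beta> l
      by (simp add: norm_divide l_def[symmetric] divide_le_eq mult.commute)
    have "(\<integral>\<^sup>+x\<in>{a..b}. ennreal (cmod (poly q (of_real x + z * of_real (phi_interval a b x) + \<beta>)) powr p) \<partial>lborel)
      = ennreal l * (\<integral>\<^sup>+x\<in>{-1..1}. ennreal (cmod (poly q' (of_real x + z * of_real (sqrt (1 - x\<^sup>2)) + \<beta> / of_real l)) powr p) \<partial>lborel)"
    proof -
      have e: "of_real (m + l * x) + z * of_real (phi_interval a b (m + l * x)) + \<beta>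
          = of_real m + of_real l * (of_real x + z * of_real (sqrt (1 - x\<^sup>2)) + \<beta> / of_real l)" for x
        unfolding m_def l_def phi_interval_affine[OF ab] using l by (simp add: l_def[symmetric] algebra_simps)
      have "(\<integral>\<^sup>+x\<in>{a..b}. ennreal (cmod (poly q (of_real x + z * of_real (phi_interval a b x) + \<beta>)) powr p) \<partial>lborel)
        = ennreal l * (\<integral>\<^sup>+x\<in>{-1..1}. ennreal (cmod (poly q (of_real (m + l * x) + z * of_real (phi_interval a b (m + l * x)) + \<beta>)) powr p) \<partial>lborel)"
        unfolding m_def l_def by (rule nn_integral_interval_affine[OF ab]) measurable
      then show ?thesis by (simp only: q' e)
    qed
    also have "\<dots> \<le> ennreal l * (ennreal C * (\<integral>\<^sup>+x\<in>{-1..1}. ennreal (cmod (poly q' (of_real x)) powr p) \<partial>lborel))"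
      by (intro mult_left_mono C(2)[OF N deg' z \<beta>']) auto
    also have "\<dots> = ennreal C * (ennreal l * (\<integral>\<^sup>+x\<in>{-1..1}. ennreal (cmod (poly q (of_real (m + l * x))) powr p) \<partial>lborel))"
      by (simp add: q' mult_ac)
    also have "ennreal l * (\<integral>\<^sup>+x\<in>{-1..1}. ennreal (cmod (poly q (of_real (m + l * x))) powr p) \<partial>lborel)
       = (\<integral>\<^sup>+x\<in>{a..b}. ennreal (cmod (poly q (of_real x)) powr p) \<partial>lborel)"
      by (subst nn_integral_interval_affine[OF ab]) (simp_all add: m_def[symmetric] l_def[symmetric])
    finally show "(\<integral>\<^sup>+x\<in>{a..b}. ennreal (cmod (poly q (of_real x + z * of_real (phi_interval a b x) + \<beta>)) powr p) \<partial>lborel)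
    \<le> ennreal C * (\<integral>\<^sup>+x\<in>{a..b}. ennreal (cmod (poly q (of_real x)) powr p) \<partial>lborel)" .
  qed
qed

lemma bernstein_walsh_perturb_ab:
  assumes N: "1 \<le> N" and deg: "degree q \<le> N" and ab: "a < b" and z: "cmod z \<le> 1 / real N" and \<beta>: "cmod \<beta> \<le> (b - a) / 2 / (real N)\<^sup>2"
    and x: "a \<le> x" "x \<le> b" and B: "\<And>x. a \<le> x \<Longrightarrow> x \<le> b \<Longrightarrow> cmod (poly q (of_real x)) \<le> B"
  shows "cmod (poly q (of_real x + z * of_real (phi_interval a b x) + \<beta>)) \<le> exp 14 * B"
proof -
  define m where "m = (a + b) / 2"
  define l where "l = (b - a) / 2"
  have l: "0 < l" using ab by (simp add: l_def)
  define q' where "q' = pcompose q [:of_real m, of_real l:]"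
  have deg': "degree q' \<le> N" unfolding q'_def by (rule degree_pcompose_linear[OF deg])
  have q': "poly q' x = poly q (of_real m + of_real l * x)" for x by (simp add: q'_def poly_pcompose mult.commute)
  have \<beta>': "cmod (\<beta> / of_real l) \<le> 1 / (real N)\<^sup>2" using \<beta> l
    by (simp add: norm_divide l_def[symmetric] divide_le_eq mult.commute)
  define y where "y = (x - m) / l"
  have xy: "x = m + l * y" using l by (simp add: y_def)
  have ml: "m - l = a" "m + l = b" by (simp_all add: m_def l_def field_simps)
  have y: "-1 \<le> y" "y \<le> 1" using x l ml by (auto simp: y_def field_simps)
  have "cmod (poly q' (of_real y + z * of_real (sqrt (1 - y\<^sup>2)) + \<beta> / of_real l)) \<le> exp 14 * B"
  proof (rule bernstein_walsh_perturb[OF N deg' z \<beta>' y])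
    fix u :: real assume u: "-1 \<le> u" "u \<le> 1"
    have "l * (-1) \<le> l * u" "l * u \<le> l * 1" by (rule mult_left_mono, use u l in auto)+
    then have "a \<le> m + l * u" "m + l * u \<le> b" using ml by auto
    then show "cmod (poly q' (of_real u)) \<le> B" using B[of "m + l * u"] by (simp add: q')
  qed
  moreover have "of_real x + z * of_real (phi_interval a b x) + \<beta>
      = of_real m + of_real l * (of_real y + z * of_real (sqrt (1 - y\<^sup>2)) + \<beta> / of_real l)"
    unfolding xy m_def l_def phi_interval_affine[OF ab] using l by (simp add: l_def[symmetric] algebra_simps)
  ultimately show ?thesis by (simp add: q')
qed

definition cdiff :: "nat \<Rightarrow> real \<Rightarrow> complex poly \<Rightarrow> complex" where
  "cdiff r h H = (\<Sum>j=0..r. of_real ((-1) ^ (r + j) * real (r choose j)) * poly H (of_real (real j * h)))"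

text \<open>Composition with \<open>z \<mapsto> x + c * z\<close> moves a step that varies with
  \<open>x\<close> into the polynomial: in the complex parameter the step \<open>h\<close>, and
  hence the radius of the averages, is the same for all \<open>x\<close>.\<close>

lemma cdiff_fin_diff:
  assumes "\<And>y::real. poly q (of_real y) = of_real (f y)"
  shows "cmod (cdiff r h (pcompose q [:of_real x, of_real c:])) = \<bar>fin_diff r (h * c) f x\<bar>"
proof -
  have "cdiff r h (pcompose q [:of_real x, of_real c:]) = of_real (fin_diff r (h * c) f x)"
    unfolding cdiff_def fin_diff_def of_real_sum
  proof (rule sum.cong[OF refl])
    fix j
    have "poly (pcompose q [:of_real x, of_real c:]) (of_real (real j * h)) = poly q (of_real (x + real j *\<^sub>R (h * c)))"
      by (simp add: poly_pcompose mult_ac)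
    then show "of_real ((-1) ^ (r + j) * real (r choose j)) * poly (pcompose q [:of_real x, of_real c:]) (of_real (real j * h))
       = of_real ((-1) ^ (r + j) * real (r choose j) * f (x + real j *\<^sub>R (h * c)))"
      by (simp only: assms of_real_mult)
  qed
  then show ?thesis by simp
qed

text \<open>The difference at \<open>x\<close> is bounded by an average over the perturbations
  \<open>z = \<rho> * unity_root (Suc N) l\<close>. These \<open>N + 1\<close> values do not depend
  on \<open>x\<close>, so each term falls under \<open>interval_perturb_ab_le\<close>, and
  Minkowski's inequality adds them up.\<close>

lemma interval_difference_le:
  fixes p :: real and r :: nat
  assumes p: "1 \<le> p" and r: "1 \<le> r"
  obtains C where "0 < C" "\<And>N (q :: complex poly) f h a b. 1 \<le> N \<Longrightarrow> degree q \<le> N \<Longrightarrow> (\<And>y. poly q (of_real y) = of_real (f y)) \<Longrightarrow> a < b \<Longrightarrow> 2 * real r * \<bar>h\<bar> \<le> 1 / real N \<Longrightarrow>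
    (\<integral>\<^sup>+x\<in>{a..b}. ennreal (\<bar>fin_diff r (h * phi_interval a b x) f x\<bar> powr p) \<partial>lborel)
    \<le> ennreal ((C * (\<bar>h\<bar> * real N) ^ r) powr p) * (\<integral>\<^sup>+x\<in>{a..b}. ennreal (\<bar>f x\<bar> powr p) \<partial>lborel)"
proof -
  obtain C where C: "0 < C" "\<And>N q z \<beta> a b. 1 \<le> N \<Longrightarrow> degree q \<le> N \<Longrightarrow> a < b \<Longrightarrow> cmod z \<le> 1 / real N \<Longrightarrow> cmod \<beta> \<le> (b - a) / 2 / (real N)\<^sup>2 \<Longrightarrow>
    (\<integral>\<^sup>+x\<in>{a..b}. ennreal (cmod (poly q (of_real x + z * of_real (phi_interval a b x) + \<beta>)) powr p) \<partial>lborel)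
    \<le> ennreal C * (\<integral>\<^sup>+x\<in>{a..b}. ennreal (cmod (poly q (of_real x)) powr p) \<partial>lborel)"
    by (rule interval_perturb_ab_le[OF p]) blast
  define K where "K = 2 * (2 * real r) ^ r * C powr (1 / p)"
  have K: "0 < K" using C(1) r by (simp add: K_def)
  show thesis
  proof (rule that[OF K])
    fix N :: nat and q :: "complex poly" and f :: "real \<Rightarrow> real" and h a b :: real
    assume N: "1 \<le> N" and deg: "degree q \<le> N" and f: "\<And>y. poly q (of_real y) = of_real (f y)" and ab: "a < b" and h: "2 * real r * \<bar>h\<bar> \<le> 1 / real N"
    have fa: "\<bar>f y\<bar> = cmod (poly q (of_real y))" for y by (simp add: f)
    have "f = (\<lambda>y. Re (poly q (of_real y)))" by (simp add: f)
    then have [measurable]: "f \<in> borel_measurable borel"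
      by (simp only:) (intro borel_measurable_continuous_onI continuous_intros)
    define \<rho> where "\<rho> = 1 / real N"
    have \<rho>: "0 < \<rho>" using N by (simp add: \<rho>_def)
    let ?w = "unity_root (Suc N)"
    define M where "M = density lborel (indicator {a..b} :: real \<Rightarrow> ennreal)"
    have [measurable_cong, simp]: "sets M = sets borel" by (simp add: M_def)
    have lM: "lpn p M (\<lambda>x. ennreal (F x)) = ennreal_powr (\<integral>\<^sup>+x\<in>{a..b}. ennreal (F x powr p) \<partial>lborel) (1 / p)"
      if [measurable]: "F \<in> borel_measurable borel" and "\<And>x. 0 \<le> F x" for F
      unfolding lpn_def M_def using that(2) by (subst nn_integral_density) (auto simp: mult.commute)
    define k where "k = 2 * (2 * real r) ^ r * (\<bar>h\<bar> / \<rho>) ^ r"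
    have k0: "0 \<le> k" using \<rho> by (simp add: k_def)
    define X where "X = lpn p M (\<lambda>x. ennreal \<bar>f x\<bar>)"
    define F where "F = (\<lambda>l x. ennreal (k / real (Suc N)) * ennreal (cmod (poly q (of_real x + (of_real \<rho> * ?w l) * of_real (phi_interval a b x)))))"
    have FX: "lpn p M (F l) \<le> ennreal (k / real (Suc N)) * (ennreal (C powr (1 / p)) * X)" for l
    proof -
      have "lpn p M (F l) = ennreal (k / real (Suc N)) * lpn p M (\<lambda>x. ennreal (cmod (poly q (of_real x + (of_real \<rho> * ?w l) * of_real (phi_interval a b x)))))"
        unfolding F_def by (subst lpn_cmult[OF p]) auto
      also have "\<dots> \<le> ennreal (k / real (Suc N)) * ennreal_powr (ennreal C * (\<integral>\<^sup>+x\<in>{a..b}. ennreal (\<bar>f x\<bar> powr p) \<partial>lborel)) (1 / p)"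
        using C(2)[OF N deg ab, of "of_real \<rho> * ?w l" 0] p ab \<rho>
        by (subst lM) (auto intro!: mult_left_mono ennreal_powr_mono simp: norm_mult norm_divide \<rho>_def fa)
      also have "ennreal_powr (ennreal C * (\<integral>\<^sup>+x\<in>{a..b}. ennreal (\<bar>f x\<bar> powr p) \<partial>lborel)) (1 / p) = ennreal (C powr (1 / p)) * X"
        unfolding X_def using p C(1) by (subst lM) (auto simp: ennreal_powr_mult)
      finally show ?thesis .
    qed
    have "lpn p M (\<lambda>x. ennreal \<bar>fin_diff r (h * phi_interval a b x) f x\<bar>) \<le> lpn p M (\<lambda>x. \<Sum>l<Suc N. F l x)"
    proof (rule lpn_mono[OF p])
      fix x :: real
      let ?H = "pcompose q [:of_real x, of_real (phi_interval a b x):]"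
      have dH: "degree ?H \<le> N" by (rule degree_pcompose_linear[OF deg])
      have "\<bar>fin_diff r (h * phi_interval a b x) f x\<bar> \<le> k * ((\<Sum>l<Suc N. cmod (poly ?H (of_real \<rho> * ?w l))) / real (Suc N))"
        unfolding cdiff_fin_diff[of q f r h x "phi_interval a b x", OF f, symmetric] k_def cdiff_def
        using difference_le_average[OF dH r \<rho>] h by (simp add: \<rho>_def del: sum.lessThan_Suc)
      also have "\<dots> = (\<Sum>l<Suc N. k / real (Suc N) * cmod (poly q (of_real x + (of_real \<rho> * ?w l) * of_real (phi_interval a b x))))"
        by (simp add: poly_pcompose sum_divide_distrib sum_distrib_left mult_ac del: sum.lessThan_Suc)
      finally show "ennreal \<bar>fin_diff r (h * phi_interval a b x) f x\<bar> \<le> (\<Sum>l<Suc N. F l x)"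
        unfolding F_def using k0 by (simp add: sum_ennreal ennreal_leI del: sum.lessThan_Suc flip: ennreal_mult)
    qed
    also have "\<dots> \<le> (\<Sum>l<Suc N. lpn p M (F l))" by (rule lpn_sum[OF p]) (simp add: F_def)
    also have "\<dots> \<le> (\<Sum>l<Suc N. ennreal (k / real (Suc N)) * (ennreal (C powr (1 / p)) * X))"
      by (intro sum_mono FX)
    also have "\<dots> = ennreal (real (Suc N) * (k / real (Suc N) * C powr (1 / p))) * X"
      using k0 by (simp add: mult.assoc[symmetric] ennreal_of_nat_eq_real_of_nat del: sum.lessThan_Suc of_nat_Suc flip: ennreal_mult)
    also have "real (Suc N) * (k / real (Suc N) * C powr (1 / p)) = K * (\<bar>h\<bar> * real N) ^ r"
      by (simp add: K_def k_def \<rho>_def del: of_nat_Suc)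
    finally have "lpn p M (\<lambda>x. ennreal \<bar>fin_diff r (h * phi_interval a b x) f x\<bar>) \<le> ennreal (K * (\<bar>h\<bar> * real N) ^ r) * X" .
    moreover have [measurable]: "(\<lambda>x. fin_diff r (h * phi_interval a b x) f x) \<in> borel_measurable borel"
      unfolding fin_diff_def by measurable
    ultimately have "ennreal_powr (\<integral>\<^sup>+x\<in>{a..b}. ennreal (\<bar>fin_diff r (h * phi_interval a b x) f x\<bar> powr p) \<partial>lborel) (1 / p)
       \<le> ennreal (K * (\<bar>h\<bar> * real N) ^ r) * ennreal_powr (\<integral>\<^sup>+x\<in>{a..b}. ennreal (\<bar>f x\<bar> powr p) \<partial>lborel) (1 / p)"
      unfolding X_def by (simp add: lM)
    from ennreal_powr_mono[OF this, of p]
    show "(\<integral>\<^sup>+x\<in>{a..b}. ennreal (\<bar>fin_diff r (h * phi_interval a b x) f x\<bar> powr p) \<partial>lborel)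
      \<le> ennreal ((K * (\<bar>h\<bar> * real N) ^ r) powr p) * (\<integral>\<^sup>+x\<in>{a..b}. ennreal (\<bar>f x\<bar> powr p) \<partial>lborel)"
      using p K by (simp add: ennreal_powr_mult ennreal_powr_inverse)
  qed
qed

lemma interval_difference_sup_le:
  fixes q :: "complex poly" and f :: "real \<Rightarrow> real"
  assumes r: "1 \<le> r" and N: "1 \<le> N" and deg: "degree q \<le> N" and f: "\<And>y. poly q (of_real y) = of_real (f y)"
    and ab: "a < b" and h: "2 * real r * \<bar>h\<bar> \<le> 1 / real N" and x: "a \<le> x" "x \<le> b"
    and B: "\<And>x. a \<le> x \<Longrightarrow> x \<le> b \<Longrightarrow> \<bar>f x\<bar> \<le> B"
  shows "\<bar>fin_diff r (h * phi_interval a b x) f x\<bar> \<le> 2 * (2 * real r) ^ r * exp 14 * (\<bar>h\<bar> * real N) ^ r * B"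
proof -
  define \<rho> where "\<rho> = 1 / real N"
  have \<rho>: "0 < \<rho>" using N by (simp add: \<rho>_def)
  let ?w = "unity_root (Suc N)"
  let ?H = "pcompose q [:of_real x, of_real (phi_interval a b x):]"
  have dH: "degree ?H \<le> N" by (rule degree_pcompose_linear[OF deg])
  have "\<bar>fin_diff r (h * phi_interval a b x) f x\<bar> \<le> 2 * (2 * real r) ^ r * (\<bar>h\<bar> / \<rho>) ^ r * ((\<Sum>l<Suc N. cmod (poly ?H (of_real \<rho> * ?w l))) / real (Suc N))"
    unfolding cdiff_fin_diff[of q f r h x "phi_interval a b x", OF f, symmetric] cdiff_def
    using difference_le_average[OF dH r \<rho>] h by (simp add: \<rho>_def del: sum.lessThan_Suc)
  also have "\<dots> \<le> 2 * (2 * real r) ^ r * (\<bar>h\<bar> / \<rho>) ^ r * ((\<Sum>l<Suc N. exp 14 * B) / real (Suc N))"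
  proof (intro mult_left_mono divide_right_mono sum_mono)
    fix l
    have "cmod (poly q (of_real x + (of_real \<rho> * ?w l) * of_real (phi_interval a b x) + 0)) \<le> exp 14 * B"
      using \<rho> ab B by (intro bernstein_walsh_perturb_ab[OF N deg ab _ _ x]) (auto simp: norm_mult norm_divide \<rho>_def f)
    then show "cmod (poly ?H (of_real \<rho> * ?w l)) \<le> exp 14 * B" by (simp add: poly_pcompose)
  qed (use \<rho> in auto)
  also have "\<dots> = 2 * (2 * real r) ^ r * (\<bar>h\<bar> / \<rho>) ^ r * (exp 14 * B)"
    by (simp del: sum.lessThan_Suc of_nat_Suc)
  also have "\<bar>h\<bar> / \<rho> = \<bar>h\<bar> * real N" by (simp add: \<rho>_def)
  finally show ?thesis by (simp add: mult_ac)
qed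

section \<open>Chords\<close>

text \<open>With \<open>u = t / 2\<close> both claims are multiples of
  \<open>S * cos u \<le> sin u\<close>, that is, of \<open>S \<le> tan u\<close>. Together with the
  converse that follows: for \<open>0 < t \<le> pi\<close> and \<open>x = cos t\<close>, the
  condition \<open>x + S * sqrt (1 - x\<^sup>2) \<le> 1\<close> amounts to
  \<open>t \<ge> 2 * arctan S\<close>.\<close>

lemma sin_half_angle_ge:
  fixes S t :: real
  assumes S: "0 \<le> S" and t: "2 * arctan S \<le> t" "t \<le> pi"
  shows "S * (1 + cos t) \<le> sin t" and "S * sin t \<le> 1 - cos t"
proof -
  define u where "u = t / 2"
  have tu: "t = 2 * u" by (simp add: u_def)
  have u: "arctan S \<le> u" "u \<le> pi / 2" "0 \<le> u" using t S zero_le_arctan_iff[of S] unfolding u_def by linarith+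
  have main: "S * cos u \<le> sin u"
  proof (cases "u = pi / 2")
    case False
    then have "u < pi / 2" using u by simp
    then have c: "0 < cos u" using u by (intro cos_gt_zero_pi) auto
    have "tan (arctan S) \<le> tan u"
      using u \<open>u < pi / 2\<close> arctan_lbound[of S] arctan_ubound[of S] by (subst tan_mono_le_eq) auto
    then have "S \<le> tan u" by (simp add: tan_arctan)
    then show ?thesis using c by (simp add: tan_def pos_le_divide_eq)
  next
    case True
    then show ?thesis by (simp only: sin_pi_half cos_pi_half)
  qed
  have c: "0 \<le> cos u" "0 \<le> sin u" using u by (auto intro!: cos_ge_zero sin_ge_zero)
  have "S * (1 + cos t) = 2 * cos u * (S * cos u)" unfolding tu cos_double_cos by (simp add: power2_eq_square)
  also have "\<dots> \<le> 2 * cos u * sin u" using main c by (intro mult_left_mono) auto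
  finally show "S * (1 + cos t) \<le> sin t" unfolding tu sin_double by (simp add: mult_ac)
  have "S * sin t = 2 * sin u * (S * cos u)" unfolding tu sin_double by simp
  also have "\<dots> \<le> 2 * sin u * sin u" using main c by (intro mult_left_mono) auto
  finally show "S * sin t \<le> 1 - cos t" unfolding tu cos_double_sin by (simp add: power2_eq_square)
qed

lemma arctan_le_of_half_angle:
  fixes S t :: real
  assumes t: "0 < t" "t \<le> pi" and le: "S * sin t \<le> 1 - cos t"
  shows "2 * arctan S \<le> t"
proof -
  define u where "u = t / 2"
  have tu: "t = 2 * u" by (simp add: u_def)
  have u: "0 < u" "u \<le> pi / 2" using t by (auto simp: u_def)
  have s: "0 < sin u" using u by (intro sin_gt_zero) auto
  have "2 * sin u * (S * cos u) \<le> 2 * sin u * sin u"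
    using le unfolding tu sin_double cos_double_sin by (simp add: power2_eq_square mult_ac)
  then have main: "S * cos u \<le> sin u" using s by (subst (asm) mult_le_cancel_left_pos) auto
  show ?thesis
  proof (cases "u = pi / 2")
    case True
    then show ?thesis using arctan_ubound[of S] unfolding tu by simp
  next
    case False
    then have u2: "u < pi / 2" using u by simp
    then have c: "0 < cos u" using u by (intro cos_gt_zero_pi) auto
    have "S \<le> tan u" using main c by (simp add: tan_def field_simps)
    then have "arctan S \<le> arctan (tan u)" by (simp add: arctan_le_iff)
    also have "\<dots> = u" using u u2 by (intro arctan_tan) auto
    finally show ?thesis by (simp add: tu)
  qed
qed

text \<open>In the angle the step map is \<open>t \<mapsto> cos t + s * sin t\<close>. If the full
  step \<open>S\<close> stays in the interval, then
  \<open>2 * s * cos t \<le> S * (1 + cos t) \<le> sin t\<close>, so the Jacobian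
  \<open>sin t - s * cos t\<close> is at least half of \<open>sin t\<close>. This is the origin of
  the factor 2.\<close>

lemma unit_interval_step_le:
  fixes H :: "real \<Rightarrow> ennreal" and s S :: real
  assumes [measurable]: "H \<in> borel_measurable borel" and s: "0 \<le> s" "s \<le> S"
  shows "(\<integral>\<^sup>+x\<in>{-1..1} \<inter> {x. x + S * sqrt (1 - x\<^sup>2) \<le> 1}. H (x + s * sqrt (1 - x\<^sup>2)) \<partial>lborel) \<le> 2 * (\<integral>\<^sup>+x\<in>{-1..1}. H x \<partial>lborel)"
proof -
  define t0 where "t0 = 2 * arctan S"
  have t0: "0 \<le> t0" "t0 < pi" using s arctan_ubound[of S] by (auto simp: t0_def)
  \<comment> \<open>The sign makes \<open>g\<close> increasing on \<open>{t0..pi}\<close>, as the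
    substitution rule requires.\<close>
  define g where "g = (\<lambda>t. - (cos t + s * sin t))"
  have half: "s * cos t \<le> sin t / 2" "0 \<le> sin t" "cos t + s * sin t \<le> 1" if "t \<in> {t0..pi}" for t
  proof -
    have t: "2 * arctan S \<le> t" "t \<le> pi" using that by (auto simp: t0_def)
    note S = sin_half_angle_ge[OF order_trans[OF s] t]
    show s0: "0 \<le> sin t" using that t0 by (intro sin_ge_zero) auto
    have "s * (2 * cos t) \<le> s * (1 + cos t)" using s cos_le_one[of t] by (intro mult_left_mono) auto
    also have "\<dots> \<le> S * (1 + cos t)" using s cos_ge_minus_one[of t] by (intro mult_right_mono) linarith+
    also have "\<dots> \<le> sin t" by (rule S(1))
    finally show "s * cos t \<le> sin t / 2" by simp
    have "s * sin t \<le> S * sin t" using s s0 by (intro mult_right_mono)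
    then show "cos t + s * sin t \<le> 1" using S(2) by linarith
  qed
  have "(\<integral>\<^sup>+x\<in>{-1..1} \<inter> {x. x + S * sqrt (1 - x\<^sup>2) \<le> 1}. H (x + s * sqrt (1 - x\<^sup>2)) \<partial>lborel)
      = (\<integral>\<^sup>+x\<in>{-1..1}. H (x + s * sqrt (1 - x\<^sup>2)) * indicator {x. x + S * sqrt (1 - x\<^sup>2) \<le> 1} x \<partial>lborel)"
    by (intro nn_integral_cong) (auto simp: indicator_def)
  also have "\<dots> = (\<integral>\<^sup>+t\<in>{0..pi}. H (cos t + s * sqrt (1 - (cos t)\<^sup>2)) * indicator {x. x + S * sqrt (1 - x\<^sup>2) \<le> 1} (cos t) * ennreal (sin t) \<partial>lborel)"
    by (rule nn_integral_cos_substitution(1)[symmetric]) measurable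
  also have "\<dots> \<le> (\<integral>\<^sup>+t. 2 * (H (- g t) * ennreal (sin t - s * cos t) * indicator {t0..pi} t) \<partial>lborel)"
  proof (rule nn_integral_mono)
    fix t :: real
    show "H (cos t + s * sqrt (1 - (cos t)\<^sup>2)) * indicator {x. x + S * sqrt (1 - x\<^sup>2) \<le> 1} (cos t) * ennreal (sin t) * indicator {0..pi} t
       \<le> 2 * (H (- g t) * ennreal (sin t - s * cos t) * indicator {t0..pi} t)"
    \<comment> \<open>At \<open>t = 0\<close> the half-angle criterion is silent, but there the
      factor \<open>sin t\<close> vanishes.\<close>
    proof (cases "t \<in> {0<..pi} \<and> cos t + S * sqrt (1 - (cos t)\<^sup>2) \<le> 1")
      case True
      then have "0 \<le> sin t" by (intro sin_ge_zero) auto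
      then have sq: "sqrt (1 - (cos t)\<^sup>2) = sin t" by (simp flip: sin_squared_eq)
      then have t: "t \<in> {t0..pi}" using True arctan_le_of_half_angle[of t S] by (auto simp: t0_def)
      have "sin t \<le> 2 * (sin t - s * cos t)" using half(1)[OF t] by simp
      then have "ennreal (sin t) \<le> ennreal (2 * (sin t - s * cos t))" by (rule ennreal_leI)
      also have "\<dots> = 2 * ennreal (sin t - s * cos t)" using half[OF t] by (subst ennreal_mult) auto
      finally have "H (- g t) * ennreal (sin t) \<le> H (- g t) * (2 * ennreal (sin t - s * cos t))"
        by (intro mult_left_mono) auto
      moreover have "- g t = cos t + s * sin t" by (simp add: g_def)
      ultimately show ?thesis using True t by (simp add: sq mult_ac)
    next
      case False
      then have "t = 0 \<or> t \<notin> {0..pi} \<or> \<not> cos t + S * sqrt (1 - (cos t)\<^sup>2) \<le> 1" by auto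
      then show ?thesis by (auto simp: indicator_def)
    qed
  qed
  also have "\<dots> = 2 * (\<integral>\<^sup>+t. H (- g t) * ennreal (sin t - s * cos t) * indicator {t0..pi} t \<partial>lborel)"
    unfolding g_def by (rule nn_integral_cmult) measurable
  also have "(\<integral>\<^sup>+t. H (- g t) * ennreal (sin t - s * cos t) * indicator {t0..pi} t \<partial>lborel)
       = (\<integral>\<^sup>+x. H (- x) * indicator {g t0..g pi} x \<partial>lborel)"
  proof (rule nn_integral_substitution_aux[symmetric, where f = "\<lambda>x. H (- x)"])
    show "(g has_real_derivative sin t - s * cos t) (at t)" for t
      unfolding g_def by (auto intro!: derivative_eq_intros)
    show "continuous_on {t0..pi} (\<lambda>t. sin t - s * cos t)" by (intro continuous_intros)
    show "0 \<le> sin t - s * cos t" if "t \<in> {t0..pi}" for t using half[OF that] by linarith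
  qed (use t0 in auto)
  also have "\<dots> \<le> (\<integral>\<^sup>+x\<in>{-1..1}. H (- x) \<partial>lborel)"
    using half(3)[of t0] t0 by (intro nn_integral_mono mult_left_mono) (auto simp: g_def indicator_def)
  also have "\<dots> = (\<integral>\<^sup>+x\<in>{-1..1}. H x \<partial>lborel)"
    by (subst (2) nn_integral_real_affine[where c = "-1" and t = 0]) (auto intro!: nn_integral_cong simp: indicator_def)
  finally show ?thesis by (simp add: mult_left_mono)
qed

text \<open>An affine map reduces to the unit interval with \<open>s = j * h\<close> and
  \<open>S = r * h\<close>; a negative \<open>h\<close> becomes positive when the interval is
  reflected.\<close>

lemma interval_step_le:
  fixes H :: "real \<Rightarrow> ennreal" and a b h :: real and j r :: nat
  assumes [measurable]: "H \<in> borel_measurable borel" and ab: "a < b" and j: "j \<le> r"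
  shows "(\<integral>\<^sup>+x\<in>{a..b} \<inter> {x. x + real r * (h * phi_interval a b x) \<in> {a..b}}. H (x + real j * (h * phi_interval a b x)) \<partial>lborel)
    \<le> 2 * (\<integral>\<^sup>+x\<in>{a..b}. H x \<partial>lborel)"
proof -
  have pos: "(\<integral>\<^sup>+x\<in>{a..b} \<inter> {x. x + real r * (h * phi_interval a b x) \<in> {a..b}}. H (x + real j * (h * phi_interval a b x)) \<partial>lborel)
    \<le> 2 * (\<integral>\<^sup>+x\<in>{a..b}. H x \<partial>lborel)"
    if [measurable]: "H \<in> borel_measurable borel" and ab: "a < b" and h: "0 \<le> h" for H a b and h :: real
  proof -
    define m where "m = (a + b) / 2"
    define l where "l = (b - a) / 2"
    have l: "0 < l" using ab by (simp add: l_def)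
    have b: "b = m + l * 1" by (simp add: m_def l_def field_simps)
    have "(\<integral>\<^sup>+x\<in>{a..b} \<inter> {x. x + real r * (h * phi_interval a b x) \<in> {a..b}}. H (x + real j * (h * phi_interval a b x)) \<partial>lborel)
      \<le> (\<integral>\<^sup>+x\<in>{a..b}. H (x + real j * (h * phi_interval a b x)) * indicator {x. x + real r * (h * phi_interval a b x) \<le> b} x \<partial>lborel)"
      by (intro nn_integral_mono) (auto simp: indicator_def)
    also have "\<dots> = ennreal l * (\<integral>\<^sup>+x\<in>{-1..1}. H (m + l * x + real j * (h * phi_interval a b (m + l * x)))
        * indicator {x. x + real r * (h * phi_interval a b x) \<le> b} (m + l * x) \<partial>lborel)"
      unfolding m_def l_def by (rule nn_integral_interval_affine[OF ab]) measurable
    also have "\<dots> = ennreal l * (\<integral>\<^sup>+x\<in>{-1..1} \<inter> {x. x + (real r * h) * sqrt (1 - x\<^sup>2) \<le> 1}. H (m + l * (x + (real j * h) * sqrt (1 - x\<^sup>2))) \<partial>lborel)"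
    proof (intro arg_cong[where f = "\<lambda>c. ennreal l * c"] nn_integral_cong)
      fix x :: real
      have ph: "phi_interval a b (m + l * x) = l * sqrt (1 - x\<^sup>2)"
        unfolding m_def l_def by (rule phi_interval_affine[OF ab])
      have e1: "m + l * x + real j * (h * phi_interval a b (m + l * x)) = m + l * (x + (real j * h) * sqrt (1 - x\<^sup>2))"
        unfolding ph by (simp add: algebra_simps)
      have e2: "m + l * x + real r * (h * phi_interval a b (m + l * x)) = m + l * (x + (real r * h) * sqrt (1 - x\<^sup>2))"
        unfolding ph by (simp add: algebra_simps)
      have "m + l * x + real r * (h * phi_interval a b (m + l * x)) \<le> b \<longleftrightarrow> x + (real r * h) * sqrt (1 - x\<^sup>2) \<le> 1"
        using arg_cong2[OF e2 b, of "(\<le>)"] l by (simp only: add_le_cancel_left mult_le_cancel_left_pos)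
      then show "H (m + l * x + real j * (h * phi_interval a b (m + l * x))) * indicator {x. x + real r * (h * phi_interval a b x) \<le> b} (m + l * x) * indicator {-1..1} x
        = H (m + l * (x + (real j * h) * sqrt (1 - x\<^sup>2))) * indicator ({-1..1} \<inter> {x. x + (real r * h) * sqrt (1 - x\<^sup>2) \<le> 1}) x"
        unfolding e1 by (cases "x \<in> {-1..1}") (simp_all add: indicator_def)
    qed
    also have "\<dots> \<le> ennreal l * (2 * (\<integral>\<^sup>+x\<in>{-1..1}. H (m + l * x) \<partial>lborel))"
      using h j by (intro mult_left_mono unit_interval_step_le) (auto intro!: mult_right_mono)
    also have "\<dots> = 2 * (ennreal l * (\<integral>\<^sup>+x\<in>{-1..1}. H (m + l * x) \<partial>lborel))" by (simp add: mult_ac)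
    also have "ennreal l * (\<integral>\<^sup>+x\<in>{-1..1}. H (m + l * x) \<partial>lborel) = (\<integral>\<^sup>+x\<in>{a..b}. H x \<partial>lborel)"
      unfolding m_def l_def by (rule nn_integral_interval_affine[OF ab, symmetric]) measurable
    finally show ?thesis .
  qed
  show ?thesis
  proof (cases "0 \<le> h")
    case True then show ?thesis using pos[OF assms(1) ab] by simp
  next
    case False
    have ph: "phi_interval a b (- x) = phi_interval (- b) (- a) x" for x
      by (simp add: phi_interval_def mult.commute)
        (metis add.commute minus_mult_minus mult.commute minus_add_distrib uminus_add_conv_diff add.inverse_inverse)
    have "(\<integral>\<^sup>+x\<in>{a..b} \<inter> {x. x + real r * (h * phi_interval a b x) \<in> {a..b}}. H (x + real j * (h * phi_interval a b x)) \<partial>lborel)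
       = (\<integral>\<^sup>+x\<in>{-b..-a} \<inter> {x. x + real r * ((- h) * phi_interval (- b) (- a) x) \<in> {-b..-a}}. H (- (x + real j * ((- h) * phi_interval (- b) (- a) x))) \<partial>lborel)"
      by (subst nn_integral_real_affine[where c = "-1" and t = 0], measurable)
         (auto intro!: nn_integral_cong simp: indicator_def ph algebra_simps)
    also have "\<dots> \<le> 2 * (\<integral>\<^sup>+x\<in>{-b..-a}. H (- x) \<partial>lborel)"
      using False ab by (intro pos) auto
    also have "(\<integral>\<^sup>+x\<in>{-b..-a}. H (- x) \<partial>lborel) = (\<integral>\<^sup>+x\<in>{a..b}. H x \<partial>lborel)"
      by (subst (2) nn_integral_real_affine[where c = "-1" and t = 0])
         (auto intro!: nn_integral_cong simp: indicator_def)
    finally show ?thesis .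
  qed
qed

text \<open>Only the components with nonempty interior are countably many and can be summed. All
  others are single points, and these may fill a set of positive measure, as in a fat Cantor set;
  therefore \<open>H1\<close> has to vanish on them.\<close>

lemma nn_integral_components_le:
  fixes K :: "real set" and H1 H2 :: "real \<Rightarrow> ennreal"
  assumes K: "compact K" and [measurable]: "H1 \<in> borel_measurable borel" "H2 \<in> borel_measurable borel"
    and le: "\<And>a b. a < b \<Longrightarrow> {a..b} \<in> components K \<Longrightarrow> (\<integral>\<^sup>+x\<in>{a..b}. H1 x \<partial>lborel) \<le> C * (\<integral>\<^sup>+x\<in>{a..b}. H2 x \<partial>lborel)"
    and degenerate: "\<And>x. {x} \<in> components K \<Longrightarrow> H1 x = 0"
  shows "(\<integral>\<^sup>+x\<in>K. H1 x \<partial>lborel) \<le> C * (\<integral>\<^sup>+x\<in>K. H2 x \<partial>lborel)"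
proof -
  define I where "I = {J \<in> components K. interior J \<noteq> {}}"
  have comp: "\<exists>a b. a \<le> b \<and> J = {a..b}" if "J \<in> components K" for J
  proof -
    have "connected J \<and> compact J" using that K by (auto intro: in_components_connected compact_components)
    then obtain a b where "J = {a..b}" by (auto simp: connected_compact_interval_1)
    moreover have "J \<noteq> {}" using that by (rule in_components_nonempty)
    ultimately show ?thesis by auto
  qed
  have disj: "disjoint_family_on (\<lambda>J. J) I"
    unfolding disjoint_family_on_def I_def using components_nonoverlap by blast
  have cnt: "countable I"
  proof (rule countable_disjoint_nonempty_interior_subsets)
    show "pairwise disjnt I"
      using disj unfolding disjoint_family_on_def pairwise_def disjnt_def by blast
  qed (auto simp: I_def)
  have sets: "J \<in> sets borel" if "J \<in> I" for J using that comp[of J] by (auto simp: I_def)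
  have sum: "(\<integral>\<^sup>+x\<in>\<Union>I. H x \<partial>lborel) = (\<integral>\<^sup>+J. (\<integral>\<^sup>+x\<in>J. H x \<partial>lborel) \<partial>count_space I)"
    if [measurable]: "H \<in> borel_measurable borel" for H :: "real \<Rightarrow> ennreal"
  proof -
    have "emeasure (density lborel H) (\<Union>((\<lambda>J. J) ` I)) = (\<integral>\<^sup>+J. emeasure (density lborel H) J \<partial>count_space I)"
      using sets cnt disj by (intro emeasure_UN_countable) auto
    moreover have "emeasure (density lborel H) J = (\<integral>\<^sup>+x\<in>J. H x \<partial>lborel)" if "J \<in> sets borel" for J
      using that by (subst emeasure_density) auto
    moreover have "\<Union>I \<in> sets borel" using sets cnt by (intro sets.countable_Union) auto
    ultimately show ?thesis using sets by (simp cong: nn_integral_cong_simp)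
  qed
  have "(\<integral>\<^sup>+x\<in>K. H1 x \<partial>lborel) \<le> (\<integral>\<^sup>+x\<in>\<Union>I. H1 x \<partial>lborel)"
  proof (rule nn_integral_mono)
    fix x
    show "H1 x * indicator K x \<le> H1 x * indicator (\<Union>I) x"
    proof (cases "x \<in> K \<and> x \<notin> \<Union>I")
      case True
      then have "x \<in> \<Union>(components K)" by simp
      then obtain J where J: "J \<in> components K" "x \<in> J" by blast
      then obtain a b where ab: "a \<le> b" "J = {a..b}" using comp by blast
      have "interior J = {}" using J True by (auto simp: I_def)
      then have "a = b" using ab interior_atLeastAtMost_real[of a b] by auto
      then have "{x} \<in> components K" using J ab by simp
      then show ?thesis by (simp add: degenerate)
    qed (auto simp: indicator_def)
  qed
  also have "\<dots> = (\<integral>\<^sup>+J. (\<integral>\<^sup>+x\<in>J. H1 x \<partial>lborel) \<partial>count_space I)" by (rule sum) simp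
  also have "\<dots> \<le> (\<integral>\<^sup>+J. C * (\<integral>\<^sup>+x\<in>J. H2 x \<partial>lborel) \<partial>count_space I)"
  proof (rule nn_integral_mono)
    fix J assume "J \<in> space (count_space I)"
    then have J: "J \<in> components K" "interior J \<noteq> {}" by (auto simp: I_def)
    then obtain a b where ab: "a \<le> b" "J = {a..b}" using comp by blast
    have "a < b" using J ab by (cases "a = b") auto
    then show "(\<integral>\<^sup>+x\<in>J. H1 x \<partial>lborel) \<le> C * (\<integral>\<^sup>+x\<in>J. H2 x \<partial>lborel)" using J ab le by auto
  qed
  also have "\<dots> = C * (\<integral>\<^sup>+x\<in>\<Union>I. H2 x \<partial>lborel)"
    by (subst nn_integral_cmult) (simp_all add: sum)
  also have "\<dots> \<le> C * (\<integral>\<^sup>+x\<in>K. H2 x \<partial>lborel)"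
  proof (rule mult_left_mono, rule nn_integral_mono)
    fix x
    have "\<Union>I \<subseteq> K" using in_components_subset by (fastforce simp: I_def)
    then show "H2 x * indicator (\<Union>I) x \<le> H2 x * indicator K x" by (auto simp: indicator_def)
  qed auto
  finally show ?thesis .
qed

section \<open>Slices of a compact set by a line\<close>

lemma line_segment_image:
  fixes a e :: "'a::real_vector"
  shows "(\<lambda>y. a + y *\<^sub>R e) ` closed_segment u v = closed_segment (a + u *\<^sub>R e) (a + v *\<^sub>R e)"
proof -
  have "(1 - t) *\<^sub>R (a + u *\<^sub>R e) + t *\<^sub>R (a + v *\<^sub>R e) = a + ((1 - t) * u + t * v) *\<^sub>R e" for t
    by (simp add: algebra_simps)
  then show ?thesis unfolding closed_segment_def by (force simp: image_iff)
qed

text \<open>A segment in \<open>\<Omega>\<close> through the point is connected and cannot leave the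
  component of the slice that contains the point. The maximum is thus reached by the segment between
  the two ends of that component.\<close>

lemma phi_dist_line:
  fixes a e :: "'a::real_vector" and \<Omega> :: "'a set"
  defines "K \<equiv> {y::real. a + y *\<^sub>R e \<in> \<Omega>}"
  assumes c: "{\<alpha>..\<beta>} \<in> components K" and y: "y \<in> {\<alpha>..\<beta>}"
  shows "phi_dist \<Omega> e (a + y *\<^sub>R e) = phi_interval \<alpha> \<beta> y"
proof -
  have sub: "{\<alpha>..\<beta>} \<subseteq> K" using c by (rule in_components_subset)
  have seg: "closed_segment (a + y *\<^sub>R e - l1 *\<^sub>R e) (a + y *\<^sub>R e + l2 *\<^sub>R e) \<subseteq> \<Omega> \<longleftrightarrow> closed_segment (y - l1) (y + l2) \<subseteq> K" for l1 l2
  proof -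
    have "closed_segment (a + y *\<^sub>R e - l1 *\<^sub>R e) (a + y *\<^sub>R e + l2 *\<^sub>R e) = (\<lambda>y. a + y *\<^sub>R e) ` closed_segment (y - l1) (y + l2)"
      unfolding line_segment_image by (simp add: algebra_simps)
    then show ?thesis by (auto simp: K_def)
  qed
  have bd: "l1 \<le> y - \<alpha>" "l2 \<le> \<beta> - y" if "0 \<le> l1" "0 \<le> l2" "closed_segment (y - l1) (y + l2) \<subseteq> K" for l1 l2
  proof -
    have "y \<in> closed_segment (y - l1) (y + l2)" using that by (simp add: closed_segment_eq_real_ivl)
    then have "closed_segment (y - l1) (y + l2) \<subseteq> {\<alpha>..\<beta>}" using that y
      by (intro components_maximal[OF c]) auto
    then have "{y - l1, y + l2} \<subseteq> {\<alpha>..\<beta>}" by (meson ends_in_segment subset_eq insert_subset empty_subsetI)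
    then show "l1 \<le> y - \<alpha>" "l2 \<le> \<beta> - y" by auto
  qed
  show ?thesis unfolding phi_dist_def
  proof (rule cSup_eq_maximum)
    have "closed_segment (y - (y - \<alpha>)) (y + (\<beta> - y)) \<subseteq> K" using sub y by (simp add: closed_segment_eq_real_ivl)
    then have "closed_segment (a + y *\<^sub>R e - (y - \<alpha>) *\<^sub>R e) (a + y *\<^sub>R e + (\<beta> - y) *\<^sub>R e) \<subseteq> \<Omega>"
      using seg[of "y - \<alpha>" "\<beta> - y"] by simp
    moreover have "0 \<le> y - \<alpha>" "0 \<le> \<beta> - y" using y by auto
    ultimately show "phi_interval \<alpha> \<beta> y \<in> {sqrt (l1 * l2) |l1 l2. 0 \<le> l1 \<and> 0 \<le> l2 \<and> closed_segment (a + y *\<^sub>R e - l1 *\<^sub>R e) (a + y *\<^sub>R e + l2 *\<^sub>R e) \<subseteq> \<Omega>}"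
      unfolding phi_interval_def by blast
  next
    fix x assume "x \<in> {sqrt (l1 * l2) |l1 l2. 0 \<le> l1 \<and> 0 \<le> l2 \<and> closed_segment (a + y *\<^sub>R e - l1 *\<^sub>R e) (a + y *\<^sub>R e + l2 *\<^sub>R e) \<subseteq> \<Omega>}"
    then obtain l1 l2 where x: "x = sqrt (l1 * l2)" and l: "0 \<le> l1" "0 \<le> l2" "closed_segment (y - l1) (y + l2) \<subseteq> K"
      using seg by blast
    show "x \<le> phi_interval \<alpha> \<beta> y" unfolding x phi_interval_def
      using bd[OF l] l by (intro real_sqrt_le_mono mult_mono) auto
  qed
qed

lemma fin_diff_0:
  assumes "1 \<le> r" shows "fin_diff r 0 f \<eta> = 0"
proof -
  have "fin_diff r 0 f \<eta> = (\<Sum>j=0..r. (-1) ^ (r + j) * real (r choose j) * real j ^ 0) * f \<eta>"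
    unfolding fin_diff_def by (simp add: sum_distrib_right)
  then show ?thesis using alternating_binomial_power_sum(1)[of 0 r] assms by simp
qed

lemma fin_diff_line: "fin_diff r (c *\<^sub>R e) f (a + y *\<^sub>R e) = fin_diff r c (\<lambda>y. f (a + y *\<^sub>R e)) y"
  unfolding fin_diff_def by (simp add: scaleR_left_distrib add.assoc)

lemma compact_line_slice:
  fixes a e :: "'a::euclidean_space"
  assumes "compact \<Omega>" "norm e = 1"
  shows "compact {y::real. a + y *\<^sub>R e \<in> \<Omega>}"
proof -
  have "{y::real. a + y *\<^sub>R e \<in> \<Omega>} = (\<lambda>y. a + y *\<^sub>R e) -` \<Omega>" by auto
  moreover have "closed \<dots>"
    using assms by (intro continuous_closed_vimage compact_imp_closed) (auto intro!: continuous_intros)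
  moreover have "bounded {y::real. a + y *\<^sub>R e \<in> \<Omega>}"
  proof -
    obtain B where B: "\<And>x. x \<in> \<Omega> \<Longrightarrow> norm x \<le> B" using assms(1) compact_imp_bounded bounded_iff by metis
    have "norm y \<le> B + norm a" if "a + y *\<^sub>R e \<in> \<Omega>" for y :: real
    proof -
      have "norm (y *\<^sub>R e) \<le> norm (a + y *\<^sub>R e) + norm a" by (metis add_diff_cancel_left' norm_triangle_ineq4)
      then show ?thesis using B[OF that] assms(2) by simp
    qed
    then show ?thesis by (auto simp: bounded_iff)
  qed
  ultimately show ?thesis by (simp add: compact_eq_bounded_closed)
qed

lemma line_segment_subset_iff:
  fixes a e :: "'a::real_vector"
  shows "closed_segment (a + u *\<^sub>R e) (a + v *\<^sub>R e) \<subseteq> \<Omega> \<longleftrightarrow> closed_segment u v \<subseteq> {y::real. a + y *\<^sub>R e \<in> \<Omega>}"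
  unfolding line_segment_image[symmetric] by auto

text \<open>The interval inequality is applied to every component of the slice. On a one-point
  component the step is 0, and a difference of positive order with step 0 vanishes.\<close>

lemma line_difference_le:
  fixes p :: real and r :: nat
  assumes p: "1 \<le> p" and r: "1 \<le> r"
  obtains C where "0 < C" "\<And>(\<Omega> :: 'a::euclidean_space set) a e N (q :: complex poly) f h.
    compact \<Omega> \<Longrightarrow> norm e = 1 \<Longrightarrow> (\<lambda>y. phi_dist \<Omega> e (a + y *\<^sub>R e) * indicator \<Omega> (a + y *\<^sub>R e)) \<in> borel_measurable borel \<Longrightarrow>
    1 \<le> N \<Longrightarrow> degree q \<le> N \<Longrightarrow> (\<And>y. poly q (of_real y) = of_real (f (a + y *\<^sub>R e))) \<Longrightarrow> 2 * real r * \<bar>h\<bar> \<le> 1 / real N \<Longrightarrow>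
    (\<integral>\<^sup>+y. ennreal (\<bar>fin_diff r ((h * phi_dist \<Omega> e (a + y *\<^sub>R e)) *\<^sub>R e) f (a + y *\<^sub>R e)\<bar> powr p) * indicator \<Omega> (a + y *\<^sub>R e) \<partial>lborel)
    \<le> ennreal ((C * (\<bar>h\<bar> * real N) ^ r) powr p) * (\<integral>\<^sup>+y. ennreal (\<bar>f (a + y *\<^sub>R e)\<bar> powr p) * indicator \<Omega> (a + y *\<^sub>R e) \<partial>lborel)"
proof -
  obtain C where C: "0 < C" "\<And>N (q :: complex poly) f h a b. 1 \<le> N \<Longrightarrow> degree q \<le> N \<Longrightarrow> (\<And>y. poly q (of_real y) = of_real (f y)) \<Longrightarrow> a < b \<Longrightarrow> 2 * real r * \<bar>h\<bar> \<le> 1 / real N \<Longrightarrow>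
    (\<integral>\<^sup>+x\<in>{a..b}. ennreal (\<bar>fin_diff r (h * phi_interval a b x) f x\<bar> powr p) \<partial>lborel)
    \<le> ennreal ((C * (\<bar>h\<bar> * real N) ^ r) powr p) * (\<integral>\<^sup>+x\<in>{a..b}. ennreal (\<bar>f x\<bar> powr p) \<partial>lborel)"
    by (rule interval_difference_le[OF p r]) blast
  show thesis
  proof (rule that[OF C(1)])
    fix \<Omega> :: "'a set" and a e N and q :: "complex poly" and f h
    assume \<Omega>: "compact \<Omega>" and e: "norm e = 1" and phi[measurable]: "(\<lambda>y. phi_dist \<Omega> e (a + y *\<^sub>R e) * indicator \<Omega> (a + y *\<^sub>R e)) \<in> borel_measurable borel"
      and N: "1 \<le> N" and deg: "degree q \<le> N" and f: "\<And>y. poly q (of_real y) = of_real (f (a + y *\<^sub>R e))" and h: "2 * real r * \<bar>h\<bar> \<le> 1 / real N"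
    define K where "K = {y::real. a + y *\<^sub>R e \<in> \<Omega>}"
    have K: "compact K" unfolding K_def by (rule compact_line_slice[OF \<Omega> e])
    define F where "F = (\<lambda>y::real. f (a + y *\<^sub>R e))"
    have "F = (\<lambda>y. Re (poly q (of_real y)))" by (simp add: f F_def)
    then have Fm[measurable]: "F \<in> borel_measurable borel"
      by (simp only:) (intro borel_measurable_continuous_onI continuous_intros)
    \<comment> \<open>Outside \<open>\<Omega>\<close> the set under \<open>Sup\<close> in
      \<open>phi_dist\<close> is empty and the value unspecified; the indicator removes these
      points.\<close>
    define \<phi> where "\<phi> = (\<lambda>y. phi_dist \<Omega> e (a + y *\<^sub>R e) * indicator \<Omega> (a + y *\<^sub>R e))"
    have [measurable]: "\<phi> \<in> borel_measurable borel" using phi by (simp add: \<phi>_def)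
    have \<phi>: "\<phi> y = phi_interval \<alpha> \<beta> y" if "{\<alpha>..\<beta>} \<in> components K" "y \<in> {\<alpha>..\<beta>}" for y \<alpha> \<beta>
    proof -
      have "a + y *\<^sub>R e \<in> \<Omega>" using in_components_subset[OF that(1)] that(2) by (auto simp: K_def)
      then show ?thesis using phi_dist_line[OF that(1)[unfolded K_def] that(2)] by (simp add: \<phi>_def)
    qed
    have "(\<integral>\<^sup>+y. ennreal (\<bar>fin_diff r ((h * phi_dist \<Omega> e (a + y *\<^sub>R e)) *\<^sub>R e) f (a + y *\<^sub>R e)\<bar> powr p) * indicator \<Omega> (a + y *\<^sub>R e) \<partial>lborel)
      = (\<integral>\<^sup>+y\<in>K. ennreal (\<bar>fin_diff r (h * \<phi> y) F y\<bar> powr p) \<partial>lborel)"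
      unfolding fin_diff_line by (intro nn_integral_cong) (auto simp: indicator_def K_def \<phi>_def F_def)
    also have "\<dots> \<le> ennreal ((C * (\<bar>h\<bar> * real N) ^ r) powr p) * (\<integral>\<^sup>+y\<in>K. ennreal (\<bar>F y\<bar> powr p) \<partial>lborel)"
    proof (rule nn_integral_components_le[OF K])
      have "(\<lambda>y. fin_diff r (h * \<phi> y) F y) \<in> borel_measurable borel" unfolding fin_diff_def by measurable
      then show "(\<lambda>y. ennreal (\<bar>fin_diff r (h * \<phi> y) F y\<bar> powr p)) \<in> borel_measurable borel" by measurable
    next
      fix \<alpha> \<beta> :: real assume ab: "\<alpha> < \<beta>" "{\<alpha>..\<beta>} \<in> components K"
      have "(\<integral>\<^sup>+x\<in>{\<alpha>..\<beta>}. ennreal (\<bar>fin_diff r (h * \<phi> x) F x\<bar> powr p) \<partial>lborel) = (\<integral>\<^sup>+x\<in>{\<alpha>..\<beta>}. ennreal (\<bar>fin_diff r (h * phi_interval \<alpha> \<beta> x) F x\<bar> powr p) \<partial>lborel)"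
        using \<phi>[OF ab(2)] by (intro nn_integral_cong) (auto simp: indicator_def)
      also have "\<dots> \<le> ennreal ((C * (\<bar>h\<bar> * real N) ^ r) powr p) * (\<integral>\<^sup>+x\<in>{\<alpha>..\<beta>}. ennreal (\<bar>F x\<bar> powr p) \<partial>lborel)"
        by (rule C(2)[OF N deg _ ab(1) h]) (simp add: f F_def)
      finally show "(\<integral>\<^sup>+x\<in>{\<alpha>..\<beta>}. ennreal (\<bar>fin_diff r (h * \<phi> x) F x\<bar> powr p) \<partial>lborel) \<le> \<dots>" .
    next
      fix x assume x: "{x} \<in> components K"
      then have "\<phi> x = 0" using \<phi>[of x x x] by (simp add: phi_interval_def)
      then show "ennreal (\<bar>fin_diff r (h * \<phi> x) F x\<bar> powr p) = 0" using fin_diff_0[OF r] by simp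
    qed measurable
    also have "(\<integral>\<^sup>+y\<in>K. ennreal (\<bar>F y\<bar> powr p) \<partial>lborel) = (\<integral>\<^sup>+y. ennreal (\<bar>f (a + y *\<^sub>R e)\<bar> powr p) * indicator \<Omega> (a + y *\<^sub>R e) \<partial>lborel)"
      by (intro nn_integral_cong) (auto simp: indicator_def K_def F_def)
    finally show "(\<integral>\<^sup>+y. ennreal (\<bar>fin_diff r ((h * phi_dist \<Omega> e (a + y *\<^sub>R e)) *\<^sub>R e) f (a + y *\<^sub>R e)\<bar> powr p) * indicator \<Omega> (a + y *\<^sub>R e) \<partial>lborel)
      \<le> ennreal ((C * (\<bar>h\<bar> * real N) ^ r) powr p) * (\<integral>\<^sup>+y. ennreal (\<bar>f (a + y *\<^sub>R e)\<bar> powr p) * indicator \<Omega> (a + y *\<^sub>R e) \<partial>lborel)" .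
  qed
qed

lemma component_of_point:
  fixes K :: "real set"
  assumes "compact K" "y \<in> K"
  obtains \<alpha> \<beta> where "{\<alpha>..\<beta>} \<in> components K" "y \<in> {\<alpha>..\<beta>}" "\<alpha> \<le> \<beta>"
proof -
  have "y \<in> \<Union>(components K)" using assms(2) by simp
  then obtain J where J: "J \<in> components K" "y \<in> J" by blast
  then have "connected J \<and> compact J" using assms by (auto intro: in_components_connected compact_components)
  then obtain a b where "J = {a..b}" by (auto simp: connected_compact_interval_1)
  with J show thesis by (intro that[of a b]) auto
qed

lemma line_difference_sup_le:
  fixes \<Omega> :: "'a::euclidean_space set" and q :: "complex poly"
  assumes r: "1 \<le> r" and \<Omega>: "compact \<Omega>" and e: "norm e = 1"
    and N: "1 \<le> N" and deg: "degree q \<le> N" and f: "\<And>y. poly q (of_real y) = of_real (f (\<xi> + y *\<^sub>R e))" and h: "2 * real r * \<bar>h\<bar> \<le> 1 / real N"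
    and \<xi>: "\<xi> \<in> \<Omega>" and B: "\<And>\<eta>. \<eta> \<in> \<Omega> \<Longrightarrow> \<bar>f \<eta>\<bar> \<le> B"
  shows "\<bar>fin_diff r ((h * phi_dist \<Omega> e \<xi>) *\<^sub>R e) f \<xi>\<bar> \<le> 2 * (2 * real r) ^ r * exp 14 * (\<bar>h\<bar> * real N) ^ r * B"
proof -
  define K where "K = {y::real. \<xi> + y *\<^sub>R e \<in> \<Omega>}"
  have K: "compact K" unfolding K_def by (rule compact_line_slice[OF \<Omega> e])
  have "0 \<in> K" using \<xi> by (simp add: K_def)
  then obtain \<alpha> \<beta> where ab: "{\<alpha>..\<beta>} \<in> components K" "0 \<in> {\<alpha>..\<beta>}" "\<alpha> \<le> \<beta>" by (rule component_of_point[OF K])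
  have ph: "phi_dist \<Omega> e (\<xi> + 0 *\<^sub>R e) = phi_interval \<alpha> \<beta> 0"
    using ab by (intro phi_dist_line) (auto simp: K_def)
  have B0: "0 \<le> B" using B[OF \<xi>] by linarith
  show ?thesis
  proof (cases "\<alpha> < \<beta>")
    case True
    have "\<bar>fin_diff r (h * phi_interval \<alpha> \<beta> 0) (\<lambda>y. f (\<xi> + y *\<^sub>R e)) 0\<bar> \<le> 2 * (2 * real r) ^ r * exp 14 * (\<bar>h\<bar> * real N) ^ r * B"
    proof (rule interval_difference_sup_le[OF r N deg f True h])
      fix x assume "\<alpha> \<le> x" "x \<le> \<beta>"
      then have "x \<in> K" using in_components_subset[OF ab(1)] by auto
      then show "\<bar>f (\<xi> + x *\<^sub>R e)\<bar> \<le> B" using B by (simp add: K_def)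
    qed (use ab in auto)
    then show ?thesis using ph fin_diff_line[of r "h * phi_interval \<alpha> \<beta> 0" e f \<xi> 0] by simp
  next
    case False
    then have "\<alpha> = 0" "\<beta> = 0" using ab by auto
    then have "phi_dist \<Omega> e \<xi> = 0" using ph by (simp add: phi_interval_def)
    then show ?thesis using fin_diff_0[OF r, of f \<xi>] B0 by simp
  qed
qed

text \<open>\<open>V\<close> is a Borel set of points whose whole difference segment lies in
  \<open>\<Omega>\<close>. Such a segment stays in the component of its starting point, so the
  change of variables on one interval applies to each component. Points of zero weight are kept out
  of \<open>V\<close> so that one-point components contribute nothing.\<close>

lemma line_step_le:
  fixes \<Omega> :: "'a::euclidean_space set" and H :: "'a \<Rightarrow> ennreal"
  assumes \<Omega>: "compact \<Omega>" and e: "norm e = 1" and j: "j \<le> r" and H[measurable]: "H \<in> borel_measurable borel"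
    and V[measurable]: "V \<in> sets borel" and VD: "\<And>\<xi>. \<xi> \<in> V \<Longrightarrow> \<xi> \<in> \<Omega> \<and> phi_dist \<Omega> e \<xi> \<noteq> 0 \<and> closed_segment \<xi> (\<xi> + real r *\<^sub>R ((h * phi_dist \<Omega> e \<xi>) *\<^sub>R e)) \<subseteq> \<Omega>"
    and phi: "(\<lambda>\<xi>. phi_dist \<Omega> e \<xi> * indicator \<Omega> \<xi>) \<in> borel_measurable borel"
  shows "(\<integral>\<^sup>+y. H (a + y *\<^sub>R e + real j *\<^sub>R ((h * (phi_dist \<Omega> e (a + y *\<^sub>R e) * indicator \<Omega> (a + y *\<^sub>R e))) *\<^sub>R e)) * indicator V (a + y *\<^sub>R e) \<partial>lborel)
    \<le> 2 * (\<integral>\<^sup>+y. H (a + y *\<^sub>R e) * indicator \<Omega> (a + y *\<^sub>R e) \<partial>lborel)"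
proof -
  define K where "K = {y::real. a + y *\<^sub>R e \<in> \<Omega>}"
  have K: "compact K" unfolding K_def by (rule compact_line_slice[OF \<Omega> e])
  define \<phi> where "\<phi> = (\<lambda>y. phi_dist \<Omega> e (a + y *\<^sub>R e) * indicator \<Omega> (a + y *\<^sub>R e))"
  have [measurable]: "(\<lambda>y::real. a + y *\<^sub>R e) \<in> borel_measurable borel"
    by (intro borel_measurable_continuous_onI continuous_intros)
  have [measurable]: "\<phi> \<in> borel_measurable borel"
    unfolding \<phi>_def by (rule measurable_compose[OF _ phi]) measurable
  have \<phi>: "\<phi> y = phi_interval \<alpha> \<beta> y" if "{\<alpha>..\<beta>} \<in> components K" "y \<in> {\<alpha>..\<beta>}" for y \<alpha> \<beta>
  proof -
    have "a + y *\<^sub>R e \<in> \<Omega>" using in_components_subset[OF that(1)] that(2) by (auto simp: K_def)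
    then show ?thesis using phi_dist_line[OF that(1)[unfolded K_def] that(2)] by (simp add: \<phi>_def)
  qed
  let ?H = "\<lambda>y::real. H (a + y *\<^sub>R e)"
  let ?H1 = "\<lambda>y. ?H (y + real j * (h * \<phi> y)) * indicator V (a + y *\<^sub>R e)"
  have "(\<integral>\<^sup>+y. H (a + y *\<^sub>R e + real j *\<^sub>R ((h * (phi_dist \<Omega> e (a + y *\<^sub>R e) * indicator \<Omega> (a + y *\<^sub>R e))) *\<^sub>R e)) * indicator V (a + y *\<^sub>R e) \<partial>lborel)
     = (\<integral>\<^sup>+y\<in>K. ?H1 y \<partial>lborel)"
    using VD by (intro nn_integral_cong) (auto simp: indicator_def K_def \<phi>_def scaleR_left_distrib add.assoc)
  also have "\<dots> \<le> 2 * (\<integral>\<^sup>+y\<in>K. ?H y \<partial>lborel)"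
  proof (rule nn_integral_components_le[OF K])
    show "?H1 \<in> borel_measurable borel" "?H \<in> borel_measurable borel" by measurable
  next
    fix \<alpha> \<beta> :: real assume ab: "\<alpha> < \<beta>" "{\<alpha>..\<beta>} \<in> components K"
    have "(\<integral>\<^sup>+y\<in>{\<alpha>..\<beta>}. ?H1 y \<partial>lborel)
       \<le> (\<integral>\<^sup>+x\<in>{\<alpha>..\<beta>} \<inter> {x. x + real r * (h * phi_interval \<alpha> \<beta> x) \<in> {\<alpha>..\<beta>}}. ?H (x + real j * (h * phi_interval \<alpha> \<beta> x)) \<partial>lborel)"
    proof (rule nn_integral_mono)
      fix y :: real
      show "?H1 y * indicator {\<alpha>..\<beta>} y
       \<le> ?H (y + real j * (h * phi_interval \<alpha> \<beta> y)) * indicator ({\<alpha>..\<beta>} \<inter> {x. x + real r * (h * phi_interval \<alpha> \<beta> x) \<in> {\<alpha>..\<beta>}}) y"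
      proof (cases "y \<in> {\<alpha>..\<beta>} \<and> a + y *\<^sub>R e \<in> V")
        case True
        then have y: "y \<in> {\<alpha>..\<beta>}" "a + y *\<^sub>R e \<in> V" by auto
        have py: "\<phi> y = phi_interval \<alpha> \<beta> y" by (rule \<phi>[OF ab(2) y(1)])
        moreover have "\<phi> y = phi_dist \<Omega> e (a + y *\<^sub>R e)" using VD[OF y(2)] by (simp add: \<phi>_def)
        ultimately have "closed_segment (a + y *\<^sub>R e) (a + (y + real r * (h * phi_interval \<alpha> \<beta> y)) *\<^sub>R e) \<subseteq> \<Omega>"
          using VD[OF y(2)] by (simp add: scaleR_left_distrib add.assoc)
        then have "closed_segment y (y + real r * (h * phi_interval \<alpha> \<beta> y)) \<subseteq> K"
          unfolding K_def line_segment_subset_iff .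
        then have "closed_segment y (y + real r * (h * phi_interval \<alpha> \<beta> y)) \<subseteq> {\<alpha>..\<beta>}"
          using y(1) by (intro components_maximal[OF ab(2)]) auto
        then have "y + real r * (h * phi_interval \<alpha> \<beta> y) \<in> {\<alpha>..\<beta>}" by (meson ends_in_segment(2) subsetD)
        then show ?thesis using y py by simp
      qed (auto simp: indicator_def)
    qed
    also have "\<dots> \<le> 2 * (\<integral>\<^sup>+x\<in>{\<alpha>..\<beta>}. ?H x \<partial>lborel)"
      by (rule interval_step_le[OF _ ab(1) j]) measurable
    finally show "(\<integral>\<^sup>+y\<in>{\<alpha>..\<beta>}. ?H1 y \<partial>lborel) \<le> 2 * (\<integral>\<^sup>+x\<in>{\<alpha>..\<beta>}. ?H x \<partial>lborel)" .
  next
    fix x assume x: "{x} \<in> components K"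
    then have "\<phi> x = 0" using \<phi>[of x x x] by (simp add: phi_interval_def)
    moreover have "a + x *\<^sub>R e \<in> \<Omega>" using in_components_subset[OF x] by (simp add: K_def)
    ultimately have "a + x *\<^sub>R e \<notin> V" using VD by (auto simp: \<phi>_def)
    then show "?H1 x = 0" by simp
  qed
  also have "(\<integral>\<^sup>+y\<in>K. ?H y \<partial>lborel) = (\<integral>\<^sup>+y. H (a + y *\<^sub>R e) * indicator \<Omega> (a + y *\<^sub>R e) \<partial>lborel)"
    by (intro nn_integral_cong) (auto simp: indicator_def K_def)
  finally show ?thesis .
qed

section \<open>Coordinates and lines\<close>

definition of_coord :: "('d option \<Rightarrow> real) \<Rightarrow> ('d::finite) pt" where
  "of_coord c = ((\<chi> i. c (Some i)), c None)"

lemma coord_of_coord [simp]: "coord k (of_coord c) = c k"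
  by (cases k) (auto simp: coord_def of_coord_def)

lemma coord_eqI: "(\<And>k. coord k \<xi> = coord k \<eta>) \<Longrightarrow> \<xi> = \<eta>"
proof (rule prod_eqI)
  assume c: "\<And>k. coord k \<xi> = coord k \<eta>"
  show "fst \<xi> = fst \<eta>" using c[of "Some i" for i] by (simp add: coord_def vec_eq_iff)
  show "snd \<xi> = snd \<eta>" using c[of None] by (simp add: coord_def)
qed

lemma coord_inner: "coord k \<xi> = \<xi> \<bullet> unit_vec k"
  by (cases k; cases \<xi>) (auto simp: coord_def unit_vec_def inner_axis)

lemma coord_unit_vec: "coord k (unit_vec j) = (if k = j then 1 else 0)"
  by (cases k; cases j) (auto simp: coord_def unit_vec_def axis_def)

lemma coord_simps [simp]:
  "coord k (\<xi> + \<eta>) = coord k \<xi> + coord k \<eta>" "coord k (\<xi> - \<eta>) = coord k \<xi> - coord k \<eta>"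
  "coord k (c *\<^sub>R \<xi>) = c * coord k \<xi>" "coord k 0 = 0" "coord k (- \<xi>) = - coord k \<xi>"
  by (simp_all add: coord_inner inner_add_left inner_diff_left)

lemma Basis_pt: "(Basis :: ('d::finite) pt set) = range unit_vec"
proof -
  have "(Basis :: ('d::finite) pt set) = (\<lambda>i. (axis i 1, 0)) ` UNIV \<union> {(0, 1)}"
    unfolding Basis_prod_def Basis_vec_def by (auto simp: image_iff)
  also have "\<dots> = range unit_vec"
    by (auto simp: unit_vec_def image_iff UNIV_option_conv split: option.splits)
  finally show ?thesis .
qed

lemma inj_unit_vec: "inj unit_vec"
proof (rule injI)
  fix j k :: "'a option" assume "(unit_vec j :: 'a pt) = unit_vec k"
  then have "coord k (unit_vec j :: 'a pt) = 1" by (simp add: coord_unit_vec)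
  then show "j = k" by (simp add: coord_unit_vec split: if_splits)
qed

lemma norm_unit_vec [simp]: "norm (unit_vec j) = 1"
  using Basis_pt by (intro norm_Basis) auto

lemma box_coord: "\<xi> \<in> box l u \<longleftrightarrow> (\<forall>k. coord k l < coord k \<xi> \<and> coord k \<xi> < coord k u)"
  by (simp add: mem_box Basis_pt coord_inner)

lemma prod_Basis_coord: "(\<Prod>b\<in>Basis. \<xi> \<bullet> b) = (\<Prod>k\<in>UNIV. coord k \<xi>)"
  unfolding Basis_pt by (subst prod.reindex[OF inj_unit_vec]) (simp add: coord_inner)

lemma continuous_on_coord [continuous_intros]:
  "continuous_on A f \<Longrightarrow> continuous_on A (\<lambda>x. coord k (f x))"
  unfolding coord_inner by (intro continuous_intros)

lemma continuous_on_of_coord: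
  assumes "\<And>k. continuous_on A (\<lambda>x. c x k)" shows "continuous_on A (\<lambda>x. of_coord (c x))"
  unfolding of_coord_def using assms by (intro continuous_intros)

text \<open>Translations followed by signed permutations of the coordinates: a family that contains
  both \<open>swap_last\<close> and \<open>sd_place\<close>, so that preservation of volume is
  proved once.\<close>

definition coord_isometry :: "('d option \<Rightarrow> real) \<Rightarrow> ('d option \<Rightarrow> 'd option) \<Rightarrow> ('d::finite) pt \<Rightarrow> 'd pt \<Rightarrow> 'd pt" where
  "coord_isometry s \<pi> \<zeta> \<xi> = of_coord (\<lambda>k. s k * (coord (\<pi> k) \<zeta> + coord (\<pi> k) \<xi>))"

lemma continuous_coord_isometry: "continuous_on A (coord_isometry s \<pi> \<zeta>)"
  unfolding coord_isometry_def by (intro continuous_on_of_coord continuous_intros)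

lemma borel_measurable_coord_isometry [measurable]: "coord_isometry s \<pi> \<zeta> \<in> borel_measurable borel"
  by (intro borel_measurable_continuous_onI continuous_coord_isometry)

text \<open>The preimage of a box is a box with permuted side lengths; where the sign is -1, the two
  ends of a side trade places.\<close>

lemma distr_coord_isometry:
  assumes \<pi>: "bij \<pi>" and s: "\<And>k. s k = 1 \<or> s k = -1"
  shows "distr lborel borel (coord_isometry s \<pi> \<zeta>) = lborel"
proof (rule lborel_eqI[symmetric])
  fix l u :: "'a pt"
  assume lu: "\<And>b. b \<in> Basis \<Longrightarrow> l \<bullet> b \<le> u \<bullet> b"
  have lu': "coord k l \<le> coord k u" for k using lu[of "unit_vec k"] by (simp add: Basis_pt coord_inner)
  define \<rho> where "\<rho> = inv \<pi>"
  have \<rho>: "\<rho> (\<pi> k) = k" "\<pi> (\<rho> k) = k" for k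
    using \<pi> by (auto simp: \<rho>_def bij_is_inj bij_is_surj surj_f_inv_f)
  have b\<rho>: "bij \<rho>" unfolding \<rho>_def using \<pi> by (rule bij_imp_bij_inv)
  define l' where "l' = of_coord (\<lambda>k. (if s (\<rho> k) = 1 then coord (\<rho> k) l else - coord (\<rho> k) u) - coord k \<zeta>)"
  define u' where "u' = of_coord (\<lambda>k. (if s (\<rho> k) = 1 then coord (\<rho> k) u else - coord (\<rho> k) l) - coord k \<zeta>)"
  have pre: "coord_isometry s \<pi> \<zeta> -` box l u = box l' u'"
  proof -
    have iff: "(coord k l < coord k (coord_isometry s \<pi> \<zeta> \<xi>) \<and> coord k (coord_isometry s \<pi> \<zeta> \<xi>) < coord k u)
       \<longleftrightarrow> (coord (\<pi> k) l' < coord (\<pi> k) \<xi> \<and> coord (\<pi> k) \<xi> < coord (\<pi> k) u')" for k \<xi>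
      using s[of k] by (auto simp: coord_isometry_def l'_def u'_def \<rho>)
    have "coord_isometry s \<pi> \<zeta> \<xi> \<in> box l u \<longleftrightarrow> \<xi> \<in> box l' u'" for \<xi>
      unfolding box_coord iff using \<rho>(2) by metis
    then show ?thesis unfolding vimage_def by blast
  qed
  have le: "l' \<bullet> b \<le> u' \<bullet> b" if "b \<in> Basis" for b
  proof -
    obtain k where b: "b = unit_vec k" using \<open>b \<in> Basis\<close> by (auto simp: Basis_pt)
    show ?thesis using lu'[of "\<rho> k"] by (simp add: b l'_def u'_def flip: coord_inner)
  qed
  have "emeasure (distr lborel borel (coord_isometry s \<pi> \<zeta>)) (box l u) = emeasure lborel (box l' u')"
    by (subst emeasure_distr) (auto simp: pre)
  also have "\<dots> = ennreal (\<Prod>b\<in>Basis. (u' - l') \<bullet> b)" by (rule emeasure_lborel_box[OF le])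
  also have "(\<Prod>b\<in>Basis. (u' - l') \<bullet> b) = (\<Prod>k\<in>UNIV. coord (\<rho> k) (u - l))"
    unfolding prod_Basis_coord by (intro prod.cong) (auto simp: l'_def u'_def)
  also have "\<dots> = (\<Prod>k\<in>UNIV. coord k (u - l))"
    by (rule prod.reindex_bij_betw[OF b\<rho>])
  finally show "emeasure (distr lborel borel (coord_isometry s \<pi> \<zeta>)) (box l u) = (\<Prod>b\<in>Basis. (u - l) \<bullet> b)"
    by (simp only: prod_Basis_coord)
qed simp

lemma nn_integral_coord_isometry:
  assumes "bij \<pi>" "\<And>k. s k = 1 \<or> s k = -1" and [measurable]: "H \<in> borel_measurable borel"
  shows "(\<integral>\<^sup>+\<xi>. H (coord_isometry s \<pi> \<zeta> \<xi>) \<partial>lborel) = (\<integral>\<^sup>+\<xi>. H \<xi> \<partial>lborel)"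
proof -
  have "(\<integral>\<^sup>+\<xi>. H \<xi> \<partial>distr lborel borel (coord_isometry s \<pi> \<zeta>)) = (\<integral>\<^sup>+\<xi>. H (coord_isometry s \<pi> \<zeta> \<xi>) \<partial>lborel)"
    by (rule nn_integral_distr) simp_all
  then show ?thesis by (simp only: distr_coord_isometry[OF assms(1,2)])
qed

lemma coord_swap_last: "coord k (swap_last j \<xi>) = coord (Transposition.transpose None j k) \<xi>"
  by (cases j; cases k) (auto simp: coord_def swap_last_def transpose_def)

lemma swap_last_isometry: "swap_last j = coord_isometry (\<lambda>_. 1) (Transposition.transpose None j) 0"
  by (intro ext coord_eqI) (simp add: coord_isometry_def coord_swap_last)

lemma coord_flip_sign: "coord k (flip_sign j \<xi>) = (if k = j then - coord k \<xi> else coord k \<xi>)"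
  by (cases j; cases k) (auto simp: coord_def flip_sign_def)

definition sd_sign :: "('d::finite) special_domain \<Rightarrow> 'd option \<Rightarrow> real" where
  "sd_sign G k = (if sd_down G \<and> k = sd_dir G then -1 else 1)"

definition sd_perm :: "('d::finite) special_domain \<Rightarrow> 'd option \<Rightarrow> 'd option" where
  "sd_perm G = Transposition.transpose None (sd_dir G)"

lemma sd_place_isometry: "sd_place G = coord_isometry (sd_sign G) (sd_perm G) (sd_zeta G)"
  by (intro ext coord_eqI)
     (simp add: coord_isometry_def sd_place_def coord_swap_last coord_flip_sign sd_sign_def sd_perm_def)

lemma bij_sd_perm [simp]: "bij (sd_perm G)" by (simp add: sd_perm_def)

lemma sd_sign_cases: "sd_sign G k = 1 \<or> sd_sign G k = -1" by (simp add: sd_sign_def)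

lemma nn_integral_sd_place:
  "H \<in> borel_measurable borel \<Longrightarrow> (\<integral>\<^sup>+\<xi>. H (sd_place G \<xi>) \<partial>lborel) = (\<integral>\<^sup>+\<xi>. H \<xi> \<partial>lborel)"
  unfolding sd_place_isometry by (rule nn_integral_coord_isometry) (auto simp: sd_sign_cases)

lemma nn_integral_lines:
  fixes H :: "('d::finite) pt \<Rightarrow> ennreal"
  assumes [measurable]: "H \<in> borel_measurable borel"
  shows "(\<integral>\<^sup>+\<xi>. H \<xi> \<partial>lborel) = (\<integral>\<^sup>+x. \<integral>\<^sup>+y. H (swap_last j (x, 0) + y *\<^sub>R unit_vec j) \<partial>lborel \<partial>lborel)"
proof -
  have [measurable]: "swap_last j \<in> borel_measurable borel" unfolding swap_last_isometry by measurable
  have [measurable]: "(\<lambda>x. H (swap_last j x)) \<in> borel_measurable (lborel \<Otimes>\<^sub>M lborel)"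
    unfolding lborel_prod by measurable
  have e: "swap_last j (x, y) = swap_last j (x, 0) + y *\<^sub>R unit_vec j" for x y
    by (cases j) (auto simp: swap_last_def unit_vec_def vec_eq_iff axis_def)
  have "(\<integral>\<^sup>+\<xi>. H \<xi> \<partial>lborel) = (\<integral>\<^sup>+\<xi>. H (swap_last j \<xi>) \<partial>lborel)"
    unfolding swap_last_isometry by (rule nn_integral_coord_isometry[symmetric]) auto
  also have "\<dots> = (\<integral>\<^sup>+\<xi>. H (swap_last j \<xi>) \<partial>(lborel \<Otimes>\<^sub>M lborel))" by (simp add: lborel_prod)
  also have "\<dots> = (\<integral>\<^sup>+x. \<integral>\<^sup>+y. H (swap_last j (x, y)) \<partial>lborel \<partial>lborel)"
    by (subst lborel.nn_integral_fst[symmetric]) auto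
  finally show ?thesis by (subst (asm) e)
qed

lemma nn_integral_lines_le:
  fixes H1 H2 :: "('d::finite) pt \<Rightarrow> ennreal"
  assumes [measurable]: "H1 \<in> borel_measurable borel" "H2 \<in> borel_measurable borel"
    and le: "\<And>a. (\<integral>\<^sup>+y. H1 (a + y *\<^sub>R unit_vec j) \<partial>lborel) \<le> c * (\<integral>\<^sup>+y. H2 (a + y *\<^sub>R unit_vec j) \<partial>lborel)"
  shows "(\<integral>\<^sup>+\<xi>. H1 \<xi> \<partial>lborel) \<le> c * (\<integral>\<^sup>+\<xi>. H2 \<xi> \<partial>lborel)"
proof -
  have m: "(\<lambda>x. \<integral>\<^sup>+y. H2 (swap_last j (x, 0) + y *\<^sub>R unit_vec j) \<partial>lborel) \<in> borel_measurable lborel"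
  proof -
    have "continuous_on UNIV (\<lambda>z::(real^'d) \<times> real. swap_last j (fst z, 0) + snd z *\<^sub>R unit_vec j)"
      unfolding swap_last_isometry
      by (intro continuous_intros continuous_on_compose2[OF continuous_coord_isometry[of UNIV]]) auto
    then have [measurable]: "(\<lambda>z::(real^'d) \<times> real. swap_last j (fst z, 0) + snd z *\<^sub>R unit_vec j) \<in> borel_measurable borel"
      by (rule borel_measurable_continuous_onI)
    have "(\<lambda>z. H2 (swap_last j (fst z, 0) + snd z *\<^sub>R unit_vec j)) \<in> borel_measurable (lborel \<Otimes>\<^sub>M lborel)"
      unfolding lborel_prod by measurable
    from lborel.borel_measurable_nn_integral_fst[OF this] show ?thesis by simp
  qed
  have "(\<integral>\<^sup>+\<xi>. H1 \<xi> \<partial>lborel) \<le> (\<integral>\<^sup>+x. c * (\<integral>\<^sup>+y. H2 (swap_last j (x, 0) + y *\<^sub>R unit_vec j) \<partial>lborel) \<partial>lborel)"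
    unfolding nn_integral_lines[OF assms(1), of j] by (intro nn_integral_mono le)
  also have "\<dots> = c * (\<integral>\<^sup>+\<xi>. H2 \<xi> \<partial>lborel)"
    unfolding nn_integral_lines[OF assms(2), of j] by (rule nn_integral_cmult[OF m])
  finally show ?thesis .
qed

section \<open>Measurability of the Ditzian-Totik weight and of the segment condition\<close>

lemma phi_dist_set_bdd:
  fixes \<Omega> :: "'a::euclidean_space set"
  assumes \<Omega>: "compact \<Omega>" and e: "norm e = 1"
  obtains B where "\<And>\<xi> l1 l2. 0 \<le> l1 \<Longrightarrow> 0 \<le> l2 \<Longrightarrow> closed_segment (\<xi> - l1 *\<^sub>R e) (\<xi> + l2 *\<^sub>R e) \<subseteq> \<Omega> \<Longrightarrow> l1 \<le> B \<and> l2 \<le> B"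
proof -
  obtain B where B: "\<And>x. x \<in> \<Omega> \<Longrightarrow> norm x \<le> B" using \<Omega> compact_imp_bounded bounded_iff by metis
  show thesis
  proof (rule that[of "2 * B"])
    fix \<xi> l1 l2 assume l: "0 \<le> l1" "0 \<le> l2" "closed_segment (\<xi> - l1 *\<^sub>R e) (\<xi> + l2 *\<^sub>R e) \<subseteq> \<Omega>"
    have "\<xi> - l1 *\<^sub>R e \<in> \<Omega>" "\<xi> + l2 *\<^sub>R e \<in> \<Omega>" using l(3) by auto
    then have "norm ((\<xi> + l2 *\<^sub>R e) - (\<xi> - l1 *\<^sub>R e)) \<le> B + B"
      using B[of "\<xi> - l1 *\<^sub>R e"] B[of "\<xi> + l2 *\<^sub>R e"] norm_triangle_ineq4[of "\<xi> + l2 *\<^sub>R e" "\<xi> - l1 *\<^sub>R e"] by linarith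
    moreover have "(\<xi> + l2 *\<^sub>R e) - (\<xi> - l1 *\<^sub>R e) = (l1 + l2) *\<^sub>R e" by (simp add: algebra_simps)
    ultimately have "l1 + l2 \<le> 2 * B" using l e by simp
    then show "l1 \<le> 2 * B \<and> l2 \<le> 2 * B" using l by auto
  qed
qed

lemma phi_dist_greater_iff:
  fixes \<Omega> :: "'a::euclidean_space set"
  assumes \<Omega>: "compact \<Omega>" and e: "norm e = 1" and \<xi>: "\<xi> \<in> \<Omega>"
  shows "c < phi_dist \<Omega> e \<xi> \<longleftrightarrow> (\<exists>l1 l2. 0 \<le> l1 \<and> 0 \<le> l2 \<and> closed_segment (\<xi> - l1 *\<^sub>R e) (\<xi> + l2 *\<^sub>R e) \<subseteq> \<Omega> \<and> c < sqrt (l1 * l2))"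
proof -
  let ?S = "{sqrt (l1 * l2) | l1 l2. 0 \<le> l1 \<and> 0 \<le> l2 \<and> closed_segment (\<xi> - l1 *\<^sub>R e) (\<xi> + l2 *\<^sub>R e) \<subseteq> \<Omega>}"
  obtain B where B: "\<And>\<xi> l1 l2. 0 \<le> l1 \<Longrightarrow> 0 \<le> l2 \<Longrightarrow> closed_segment (\<xi> - l1 *\<^sub>R e) (\<xi> + l2 *\<^sub>R e) \<subseteq> \<Omega> \<Longrightarrow> l1 \<le> B \<and> l2 \<le> B"
    by (rule phi_dist_set_bdd[OF \<Omega> e]) blast
  have "bdd_above ?S"
  proof (rule bdd_aboveI[of _ "sqrt (B * B)"])
    fix x assume "x \<in> ?S"
    then obtain l1 l2 where x: "x = sqrt (l1 * l2)" "0 \<le> l1" "0 \<le> l2" "closed_segment (\<xi> - l1 *\<^sub>R e) (\<xi> + l2 *\<^sub>R e) \<subseteq> \<Omega>" by blast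
    then have "l1 \<le> B" "l2 \<le> B" using B by auto
    then show "x \<le> sqrt (B * B)" unfolding x(1) using x by (intro real_sqrt_le_mono mult_mono) auto
  qed
  moreover have "?S \<noteq> {}" using \<xi> by (auto intro!: exI[of _ "0::real"])
  ultimately have "c < Sup ?S \<longleftrightarrow> (\<exists>x\<in>?S. c < x)" by (intro less_cSup_iff)
  then show ?thesis unfolding phi_dist_def by blast
qed

text \<open>For \<open>c \<ge> 0\<close> the weight exceeds \<open>c\<close> at \<open>\<xi>\<close>
  if some admissible pair \<open>l1\<close>, \<open>l2\<close> has
  \<open>sqrt (l1 * l2) > c\<close>. With the strict inequality replaced by
  \<open>\<ge> c + 1 / (n + 1)\<close> the admissible triples form compact sets \<open>S n\<close>,
  whose projections are compact, and the superlevel set is the union of these projections.\<close>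

lemma borel_measurable_phi_dist:
  fixes \<Omega> :: "'a::euclidean_space set"
  assumes \<Omega>: "compact \<Omega>" and e: "norm e = 1"
  shows "(\<lambda>\<xi>. phi_dist \<Omega> e \<xi> * indicator \<Omega> \<xi>) \<in> borel_measurable borel"
proof (rule borel_measurable_iff_greater[THEN iffD2], rule allI)
  fix c :: real
  obtain B where B: "\<And>\<xi> l1 l2. 0 \<le> l1 \<Longrightarrow> 0 \<le> l2 \<Longrightarrow> closed_segment (\<xi> - l1 *\<^sub>R e) (\<xi> + l2 *\<^sub>R e) \<subseteq> \<Omega> \<Longrightarrow> l1 \<le> B \<and> l2 \<le> B"
    by (rule phi_dist_set_bdd[OF \<Omega> e]) blast
  have nonneg: "0 \<le> phi_dist \<Omega> e \<xi>" if "\<xi> \<in> \<Omega>" for \<xi>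
  proof (rule ccontr)
    assume "\<not> 0 \<le> phi_dist \<Omega> e \<xi>"
    then have "phi_dist \<Omega> e \<xi> < 0" by simp
    have "\<not> phi_dist \<Omega> e \<xi> < sqrt (0 * 0)"
      using phi_dist_greater_iff[OF \<Omega> e that, of "phi_dist \<Omega> e \<xi>"] that by (auto dest!: spec[of _ "0::real"])
    then show False using \<open>phi_dist \<Omega> e \<xi> < 0\<close> by simp
  qed
  show "{w \<in> space borel. c < phi_dist \<Omega> e w * indicator \<Omega> w} \<in> sets borel"
  proof (cases "c < 0")
    case True
    then have "{w \<in> space borel. c < phi_dist \<Omega> e w * indicator \<Omega> w} = UNIV"
      using nonneg by (force simp: indicator_def)
    then show ?thesis by simp
  next
    case False
    define S where "S = (\<lambda>n::nat. {z :: 'a \<times> real \<times> real. fst z \<in> \<Omega> \<and> 0 \<le> fst (snd z) \<and> 0 \<le> snd (snd z) \<and> c + 1 / real (Suc n) \<le> sqrt (fst (snd z) * snd (snd z)) \<and>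
       closed_segment (fst z - fst (snd z) *\<^sub>R e) (fst z + snd (snd z) *\<^sub>R e) \<subseteq> \<Omega>})"
    have "compact (S n)" for n
    proof -
      have "S n = (\<Omega> \<times> {0..B} \<times> {0..B}) \<inter> {z. c + 1 / real (Suc n) \<le> sqrt (fst (snd z) * snd (snd z))} \<inter>
         (\<Inter>u\<in>{0..1}. (\<lambda>z. (1 - u) *\<^sub>R (fst z - fst (snd z) *\<^sub>R e) + u *\<^sub>R (fst z + snd (snd z) *\<^sub>R e)) -` \<Omega>)"
        unfolding S_def using B by (auto simp: closed_segment_def subset_eq; blast)
      moreover have "compact \<dots>"
        using \<Omega> by (intro compact_Int_closed compact_Times compact_Icc closed_Collect_le closed_INT ballI continuous_closed_vimage compact_imp_closed)
           (auto intro!: continuous_intros)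
      ultimately show ?thesis by simp
    qed
    then have "compact (fst ` S n)" for n by (intro compact_continuous_image continuous_intros)
    then have "(\<Union>n. fst ` S n) \<in> sets borel" by (intro sets.countable_UN) (auto intro: borel_compact)
    moreover have "{w \<in> space borel. c < phi_dist \<Omega> e w * indicator \<Omega> w} = (\<Union>n. fst ` S n)"
    proof (intro set_eqI iffI)
      fix w assume "w \<in> {w \<in> space borel. c < phi_dist \<Omega> e w * indicator \<Omega> w}"
      then have w: "w \<in> \<Omega>" "c < phi_dist \<Omega> e w" using False by (cases "w \<in> \<Omega>"; simp)+
      then obtain l1 l2 where l: "0 \<le> l1" "0 \<le> l2" "closed_segment (w - l1 *\<^sub>R e) (w + l2 *\<^sub>R e) \<subseteq> \<Omega>" "c < sqrt (l1 * l2)"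
        using phi_dist_greater_iff[OF \<Omega> e w(1)] by blast
      then obtain n where "inverse (real (Suc n)) < sqrt (l1 * l2) - c" using reals_Archimedean[of "sqrt (l1 * l2) - c"] by auto
      then have "(w, l1, l2) \<in> S n" using l w by (auto simp: S_def inverse_eq_divide)
      then show "w \<in> (\<Union>n. fst ` S n)" by force
    next
      fix w assume "w \<in> (\<Union>n. fst ` S n)"
      then obtain n l1 l2 where "(w, l1, l2) \<in> S n" by force
      then have l: "w \<in> \<Omega>" "0 \<le> l1" "0 \<le> l2" "closed_segment (w - l1 *\<^sub>R e) (w + l2 *\<^sub>R e) \<subseteq> \<Omega>" "c + 1 / real (Suc n) \<le> sqrt (l1 * l2)"
        by (auto simp: S_def)
      have "0 < 1 / real (Suc n)" by simp
      then have "c < sqrt (l1 * l2)" using l(5) by linarith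
      then have "c < phi_dist \<Omega> e w" using phi_dist_greater_iff[OF \<Omega> e l(1)] l by blast
      then show "w \<in> {w \<in> space borel. c < phi_dist \<Omega> e w * indicator \<Omega> w}" using l(1) by simp
    qed
    ultimately show ?thesis by simp
  qed
qed

text \<open>Supplies measurability of the condition in \<open>fin_diff_on\<close> that the
  difference segment lies in \<open>\<Omega>\<close>.\<close>

lemma closed_segment_in_closed:
  fixes \<Omega> :: "'a::euclidean_space set"
  assumes "closed \<Omega>"
  shows "closed {z :: 'a \<times> 'a. closed_segment (fst z) (fst z + snd z) \<subseteq> \<Omega>}"
proof -
  have seg: "closed_segment a b \<subseteq> \<Omega> \<longleftrightarrow> (\<forall>u\<in>{0..1}. (1 - u) *\<^sub>R a + u *\<^sub>R b \<in> \<Omega>)" for a b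
    unfolding closed_segment_def by fastforce
  have "{z :: 'a \<times> 'a. closed_segment (fst z) (fst z + snd z) \<subseteq> \<Omega>} = (\<Inter>u\<in>{0..1::real}. (\<lambda>z. (1 - u) *\<^sub>R fst z + u *\<^sub>R (fst z + snd z)) -` \<Omega>)"
    using seg by auto
  moreover have "closed \<dots>"
    by (intro closed_INT ballI continuous_closed_vimage assms) (auto intro!: continuous_intros)
  ultimately show ?thesis by simp
qed

section \<open>Polynomials of several variables\<close>

text \<open>\<open>Pc\<close> is only ever evaluated along polynomial curves, hence only its restrictions to them are
  required to be polynomials.\<close>

definition complex_extension :: "nat \<Rightarrow> (('d::finite) pt \<Rightarrow> real) \<Rightarrow> (('d option \<Rightarrow> complex) \<Rightarrow> complex) \<Rightarrow> bool" where
  "complex_extension N P Pc \<longleftrightarrow> continuous_on UNIV Pc \<and> (\<forall>\<xi>. Pc (\<lambda>k. of_real (coord k \<xi>)) = of_real (P \<xi>)) \<and>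
     (\<forall>m A. (\<forall>k. degree (A k) \<le> m) \<longrightarrow> (\<exists>Q. degree Q \<le> m * N \<and> (\<forall>z. poly Q z = Pc (\<lambda>k. poly (A k) z))))"

lemma complex_extension_real: "complex_extension N P Pc \<Longrightarrow> Pc (\<lambda>k. of_real (coord k \<xi>)) = of_real (P \<xi>)"
  unfolding complex_extension_def by blast

lemma complex_extension_curve:
  assumes "complex_extension N P Pc" "\<And>k. degree (A k) \<le> m"
  obtains Q where "degree Q \<le> m * N" "\<And>z. poly Q z = Pc (\<lambda>k. poly (A k) z)"
  using assms unfolding complex_extension_def by blast

lemma continuous_complex_extension:
  assumes "complex_extension N P Pc" "\<And>k. continuous_on A (\<lambda>x. Z x k)"
  shows "continuous_on A (\<lambda>x. Pc (Z x))"
proof -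
  have Z: "continuous_on A Z" using assms(2) by (rule continuous_on_coordinatewise_then_product)
  have Pc: "continuous_on UNIV Pc" using assms(1) unfolding complex_extension_def by blast
  show ?thesis by (rule continuous_on_compose2[OF Pc Z]) simp
qed

lemma poly_space_complex_extension:
  fixes P :: "('d::finite) pt \<Rightarrow> real"
  assumes "P \<in> poly_space N"
  obtains Pc where "complex_extension N P Pc"
proof -
  let ?I = "{\<alpha> :: 'd option \<Rightarrow> nat. sum \<alpha> UNIV \<le> N}"
  obtain c where c: "\<And>\<xi>. P \<xi> = (\<Sum>\<alpha>\<in>?I. c \<alpha> * (\<Prod>j\<in>UNIV. coord j \<xi> ^ \<alpha> j))"
    using assms unfolding poly_space_def by blast
  define Pc where "Pc = (\<lambda>Z :: 'd option \<Rightarrow> complex. \<Sum>\<alpha>\<in>?I. of_real (c \<alpha>) * (\<Prod>j\<in>UNIV. Z j ^ \<alpha> j))"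
  have "complex_extension N P Pc"
    unfolding complex_extension_def
  proof (intro conjI allI impI)
    show "continuous_on UNIV Pc"
      unfolding Pc_def by (intro continuous_intros continuous_on_product_coordinates)
    show "Pc (\<lambda>k. of_real (coord k \<xi>)) = of_real (P \<xi>)" for \<xi> by (simp add: Pc_def c)
    fix m and A :: "'d option \<Rightarrow> complex poly" assume A: "\<forall>k. degree (A k) \<le> m"
    define Q where "Q = (\<Sum>\<alpha>\<in>?I. smult (of_real (c \<alpha>)) (\<Prod>j\<in>UNIV. A j ^ \<alpha> j))"
    have d: "degree (smult (of_real (c \<alpha>)) (\<Prod>j\<in>UNIV. A j ^ \<alpha> j)) \<le> m * N" if "\<alpha> \<in> ?I" for \<alpha>
    proof -
      have "degree (smult (of_real (c \<alpha>)) (\<Prod>j\<in>UNIV. A j ^ \<alpha> j)) \<le> degree (\<Prod>j\<in>UNIV. A j ^ \<alpha> j)"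
        by (rule degree_smult_le)
      also have "\<dots> \<le> (\<Sum>j\<in>UNIV. degree (A j ^ \<alpha> j))" using degree_prod_sum_le[of UNIV "\<lambda>j. A j ^ \<alpha> j"] by (simp add: o_def)
      also have "\<dots> \<le> (\<Sum>j\<in>UNIV. m * \<alpha> j)"
        using A by (intro sum_mono order_trans[OF degree_power_le] mult_right_mono) auto
      also have "\<dots> \<le> m * N" using that by (simp flip: sum_distrib_left)
      finally show ?thesis .
    qed
    have "degree Q \<le> m * N"
    proof (cases "finite ?I")
      case True
      then show ?thesis unfolding Q_def using d by (intro degree_sum_le) auto
    qed (simp add: Q_def)
    moreover have "poly Q z = Pc (\<lambda>k. poly (A k) z)" for z
      by (simp add: Q_def Pc_def poly_sum poly_prod)
    ultimately show "\<exists>Q. degree Q \<le> m * N \<and> (\<forall>z. poly Q z = Pc (\<lambda>k. poly (A k) z))" by blast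
  qed
  then show thesis by (rule that)
qed

lemma poly_space_line:
  fixes P :: "('d::finite) pt \<Rightarrow> real"
  assumes "P \<in> poly_space N"
  obtains q :: "complex poly" where "degree q \<le> N" "\<And>y. poly q (of_real y) = of_real (P (a + y *\<^sub>R e))"
proof -
  obtain Pc where Pc: "complex_extension N P Pc" by (rule poly_space_complex_extension[OF assms])
  define A where "A = (\<lambda>k. [:complex_of_real (coord k a), of_real (coord k e):])"
  have "degree (A k) \<le> 1" for k by (simp add: A_def)
  then obtain Q where Q: "degree Q \<le> 1 * N" "\<And>z. poly Q z = Pc (\<lambda>k. poly (A k) z)"
    using complex_extension_curve[OF Pc, of A 1] by metis
  have "poly Q (of_real y) = of_real (P (a + y *\<^sub>R e))" for y
    using complex_extension_real[OF Pc, of "a + y *\<^sub>R e"] by (simp add: Q(2) A_def)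
  with Q(1) show thesis by (intro that[of Q]) auto
qed

lemma continuous_on_poly_space: "P \<in> poly_space N \<Longrightarrow> continuous_on A P"
proof -
  assume "P \<in> poly_space N"
  then obtain c where "\<forall>\<xi>. P \<xi> = (\<Sum>\<alpha> | sum \<alpha> UNIV \<le> N. c \<alpha> * (\<Prod>j\<in>UNIV. coord j \<xi> ^ \<alpha> j))"
    unfolding poly_space_def by blast
  then have "P = (\<lambda>\<xi>. \<Sum>\<alpha> | sum \<alpha> UNIV \<le> N. c \<alpha> * (\<Prod>j\<in>UNIV. coord j \<xi> ^ \<alpha> j))" by blast
  then show ?thesis by (simp only:) (intro continuous_intros)
qed

lemma borel_measurable_poly_space: "P \<in> poly_space N \<Longrightarrow> P \<in> borel_measurable borel"
  by (intro borel_measurable_continuous_onI continuous_on_poly_space)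

lemma finite_multidegrees: "finite {\<alpha> :: ('d::finite) \<Rightarrow> nat. sum \<alpha> UNIV \<le> N}"
proof (rule finite_subset)
  show "{\<alpha> :: 'd \<Rightarrow> nat. sum \<alpha> UNIV \<le> N} \<subseteq> PiE UNIV (\<lambda>_. {..N})"
  proof
    fix \<alpha> :: "'d \<Rightarrow> nat" assume a: "\<alpha> \<in> {\<alpha>. sum \<alpha> UNIV \<le> N}"
    have "\<alpha> x \<le> N" for x
    proof -
      have "\<alpha> x \<le> sum \<alpha> UNIV" by (rule member_le_sum) auto
      then show ?thesis using a by simp
    qed
    then show "\<alpha> \<in> PiE UNIV (\<lambda>_. {..N})" by (simp add: PiE_iff)
  qed
qed (intro finite_PiE, auto)

lemma poly_space_mono:
  assumes "P \<in> poly_space N" "N \<le> M" shows "P \<in> poly_space M"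
proof -
  obtain c where c: "\<And>\<xi>. P \<xi> = (\<Sum>\<alpha> | sum \<alpha> UNIV \<le> N. c \<alpha> * (\<Prod>j\<in>UNIV. coord j \<xi> ^ \<alpha> j))"
    using assms(1) unfolding poly_space_def by blast
  have "P \<xi> = (\<Sum>\<alpha> | sum \<alpha> UNIV \<le> M. (if sum \<alpha> UNIV \<le> N then c \<alpha> else 0) * (\<Prod>j\<in>UNIV. coord j \<xi> ^ \<alpha> j))" for \<xi>
    unfolding c using assms(2) by (intro sum.mono_neutral_cong_left finite_multidegrees) auto
  then show ?thesis unfolding poly_space_def
    by (intro CollectI exI[of _ "\<lambda>\<alpha>. if sum \<alpha> UNIV \<le> N then c \<alpha> else 0"] allI)
qed

lemma poly_space_diff:
  assumes "P \<in> poly_space N" "Q \<in> poly_space N" shows "(\<lambda>\<xi>. P \<xi> - Q \<xi>) \<in> poly_space N"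
proof -
  obtain c where c: "\<And>\<xi>. P \<xi> = (\<Sum>\<alpha> | sum \<alpha> UNIV \<le> N. c \<alpha> * (\<Prod>j\<in>UNIV. coord j \<xi> ^ \<alpha> j))"
    using assms(1) unfolding poly_space_def by blast
  obtain d where d: "\<And>\<xi>. Q \<xi> = (\<Sum>\<alpha> | sum \<alpha> UNIV \<le> N. d \<alpha> * (\<Prod>j\<in>UNIV. coord j \<xi> ^ \<alpha> j))"
    using assms(2) unfolding poly_space_def by blast
  have "P \<xi> - Q \<xi> = (\<Sum>\<alpha> | sum \<alpha> UNIV \<le> N. (c \<alpha> - d \<alpha>) * (\<Prod>j\<in>UNIV. coord j \<xi> ^ \<alpha> j))" for \<xi>
    by (simp add: c d left_diff_distrib sum_subtractf)
  then show ?thesis unfolding poly_space_def by (intro CollectI exI[of _ "\<lambda>\<alpha>. c \<alpha> - d \<alpha>"] allI)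
qed

lemma poly_space_0_const:
  assumes "P \<in> poly_space 0" obtains c where "P = (\<lambda>_. c)"
proof -
  obtain c where c: "\<And>\<xi>. P \<xi> = (\<Sum>\<alpha> | sum \<alpha> UNIV \<le> 0. c \<alpha> * (\<Prod>j\<in>UNIV. coord j \<xi> ^ \<alpha> j))"
    using assms unfolding poly_space_def by blast
  have "P = (\<lambda>_. \<Sum>\<alpha> | sum \<alpha> UNIV \<le> 0. c \<alpha>)" by (rule ext) (simp add: c)
  then show thesis by (rule that)
qed

lemma zero_poly_space: "(\<lambda>_. 0) \<in> poly_space N"
  unfolding poly_space_def by (auto intro!: exI[of _ "\<lambda>_. 0"])

lemma fin_diff_const: "1 \<le> r \<Longrightarrow> fin_diff r \<xi> (\<lambda>_. c) \<eta> = 0"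
  using fin_diff_0[of r "\<lambda>_. c" \<eta>] by (simp add: fin_diff_def)

lemma best_approx_antimono: "i \<le> j \<Longrightarrow> best_approx p \<Omega> j f \<le> best_approx p \<Omega> i f"
  unfolding best_approx_def by (intro INF_superset_mono) (auto intro: poly_space_mono)

text \<open>In the applications \<open>\<Psi>\<close> is a difference norm of \<open>f\<close> with step at most \<open>1 / n\<close> and \<open>\<Psi>' P\<close> the
  corresponding norm of a polynomial without the condition that the segment lies in \<open>\<Omega>\<close>; the
  Bernstein inequality for \<open>\<Psi>'\<close> is available only for degrees at most \<open>\<kappa> n\<close>.\<close>

lemma dyadic_inverse_estimate:
  fixes \<kappa> c1 c2 :: real and r :: nat
  assumes \<kappa>: "0 < \<kappa>" "\<kappa> \<le> 1" and c: "0 < c1" "0 < c2" and r: "1 \<le> r"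
  obtains C where "0 < C" "\<And>p (\<Omega> :: ('d::finite) pt set) f n \<Psi> \<Psi>'. 1 \<le> n \<Longrightarrow> Lp_norm p \<Omega> f < \<infinity> \<Longrightarrow>
     (\<And>k P Q. P \<in> poly_space k \<Longrightarrow> Q \<in> poly_space k \<Longrightarrow> Lp_norm p \<Omega> (\<lambda>\<xi>. P \<xi> - Q \<xi>) \<le> Lp_norm p \<Omega> (\<lambda>\<xi>. f \<xi> - P \<xi>) + Lp_norm p \<Omega> (\<lambda>\<xi>. f \<xi> - Q \<xi>)) \<Longrightarrow>
     (\<And>k P. P \<in> poly_space k \<Longrightarrow> \<Psi> \<le> \<Psi>' P + ennreal c1 * Lp_norm p \<Omega> (\<lambda>\<xi>. f \<xi> - P \<xi>)) \<Longrightarrow>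
     (\<And>k P Q. P \<in> poly_space k \<Longrightarrow> Q \<in> poly_space k \<Longrightarrow> \<Psi>' P \<le> \<Psi>' Q + \<Psi>' (\<lambda>\<xi>. P \<xi> - Q \<xi>)) \<Longrightarrow>
     (\<And>N P. 1 \<le> N \<Longrightarrow> real N \<le> \<kappa> * real n \<Longrightarrow> P \<in> poly_space N \<Longrightarrow> \<Psi>' P \<le> ennreal (c2 * (real N / real n) ^ r) * Lp_norm p \<Omega> P) \<Longrightarrow>
     (\<And>P. P \<in> poly_space 0 \<Longrightarrow> \<Psi>' P = 0) \<Longrightarrow>
     \<Psi> \<le> ennreal (C / real n ^ r) * (\<Sum>j=0..n. ennreal (real (j + 1) ^ (r - 1)) * best_approx p \<Omega> j f)"
proof -
  \<comment> \<open>The three terms pay for the error of the last approximant, for the passage from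
    degree 0 to degree 1, and for the telescoping sum over the dyadic degrees.\<close>
  define C where "C = c1 * (4 / \<kappa>) ^ r + 2 * c2 + 2 * 4 ^ r * c2"
  have C: "0 < C" using \<kappa> c by (auto simp: C_def intro!: add_pos_pos)
  show thesis
  proof (rule that[OF C])
    fix p and \<Omega> :: "'d pt set" and f n \<Psi> and \<Psi>' :: "('d pt \<Rightarrow> real) \<Rightarrow> ennreal"
    let ?nrm = "Lp_norm p \<Omega>"
    assume n: "1 \<le> n" and fin: "?nrm f < \<infinity>"
      and tri: "\<And>k P Q. P \<in> poly_space k \<Longrightarrow> Q \<in> poly_space k \<Longrightarrow> ?nrm (\<lambda>\<xi>. P \<xi> - Q \<xi>) \<le> ?nrm (\<lambda>\<xi>. f \<xi> - P \<xi>) + ?nrm (\<lambda>\<xi>. f \<xi> - Q \<xi>)"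
      and split: "\<And>k P. P \<in> poly_space k \<Longrightarrow> \<Psi> \<le> \<Psi>' P + ennreal c1 * ?nrm (\<lambda>\<xi>. f \<xi> - P \<xi>)"
      and sub: "\<And>k P Q. P \<in> poly_space k \<Longrightarrow> Q \<in> poly_space k \<Longrightarrow> \<Psi>' P \<le> \<Psi>' Q + \<Psi>' (\<lambda>\<xi>. P \<xi> - Q \<xi>)"
      and bern: "\<And>N P. 1 \<le> N \<Longrightarrow> real N \<le> \<kappa> * real n \<Longrightarrow> P \<in> poly_space N \<Longrightarrow> \<Psi>' P \<le> ennreal (c2 * (real N / real n) ^ r) * ?nrm P"
      and const: "\<And>P. P \<in> poly_space 0 \<Longrightarrow> \<Psi>' P = 0"
    define E where "E = (\<lambda>j. best_approx p \<Omega> j f)"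
    have Efin: "E j < \<infinity>" for j
    proof -
      have "E j \<le> ?nrm (\<lambda>\<xi>. f \<xi> - 0)" unfolding E_def best_approx_def by (rule INF_lower[OF zero_poly_space])
      then show ?thesis using fin by (simp add: order_le_less_trans)
    qed
    have Emono: "i \<le> j \<Longrightarrow> E j \<le> E i" for i j unfolding E_def by (rule best_approx_antimono)
    \<comment> \<open>In place of a minimiser, an approximant \<open>P j\<close> with error at most
      \<open>E j + \<epsilon>\<close> is used; \<open>\<epsilon>\<close> is removed at the
      end.\<close>
    have real_bound: "\<Psi> \<le> ennreal (C / real n ^ r * (\<Sum>j=0..n. real (j + 1) ^ (r - 1) * (enn2real (E j) + \<epsilon>)))" if \<epsilon>: "0 < \<epsilon>" for \<epsilon>
    proof -
      define e where "e = (\<lambda>j. enn2real (E j) + \<epsilon>)"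
      have e0: "0 < e j" for j using \<epsilon> enn2real_nonneg[of "E j"] unfolding e_def by linarith
      have emono: "i \<le> j \<Longrightarrow> e j \<le> e i" for i j
        using Emono[of i j] Efin[of i] by (auto simp: e_def intro!: enn2real_mono)
      define S where "S = (\<lambda>M. \<Sum>j=0..M. real (j + 1) ^ (r - 1) * e j)"
      have Smono: "M \<le> M' \<Longrightarrow> S M \<le> S M'" for M M'
        unfolding S_def using less_imp_le[OF e0] by (intro sum_mono2) auto
      have S0: "e 0 \<le> S n" using Smono[of 0 n] by (simp add: S_def)
      have Spos: "0 \<le> S M" for M unfolding S_def using e0 by (intro sum_nonneg mult_nonneg_nonneg) (auto intro: less_imp_le)
      have "\<exists>P. P \<in> poly_space j \<and> ?nrm (\<lambda>\<xi>. f \<xi> - P \<xi>) \<le> ennreal (e j)" for j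
      proof -
        have "E j < ennreal (e j)"
        proof -
          have "E j = ennreal (enn2real (E j))" using Efin[of j] by simp
          also have "\<dots> < ennreal (e j)" using \<epsilon> e0[of j] by (intro ennreal_lessI) (simp_all add: e_def)
          finally show ?thesis .
        qed
        then obtain P where "P \<in> poly_space j" "?nrm (\<lambda>\<xi>. f \<xi> - P \<xi>) < ennreal (e j)"
          unfolding E_def best_approx_def by (auto simp: INF_less_iff)
        then show ?thesis by (auto intro: less_imp_le)
      qed
      then obtain P where P: "\<And>j. P j \<in> poly_space j" "\<And>j. ?nrm (\<lambda>\<xi>. f \<xi> - P j \<xi>) \<le> ennreal (e j)" by metis
      have diff: "?nrm (\<lambda>\<xi>. P j \<xi> - P i \<xi>) \<le> ennreal (2 * e i)" if "i \<le> j" for i j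
      proof -
        have "?nrm (\<lambda>\<xi>. P j \<xi> - P i \<xi>) \<le> ?nrm (\<lambda>\<xi>. f \<xi> - P j \<xi>) + ?nrm (\<lambda>\<xi>. f \<xi> - P i \<xi>)"
          using tri[of "P j" j "P i"] P(1) poly_space_mono[OF P(1) that] by auto
        also have "\<dots> \<le> ennreal (e j) + ennreal (e i)" by (intro add_mono P)
        also have "\<dots> \<le> ennreal (e i) + ennreal (e i)" using emono[OF that] by (intro add_mono ennreal_leI) auto
        also have "\<dots> = ennreal (2 * e i)" using e0[of i] by (simp flip: ennreal_plus)
        finally show ?thesis .
      qed
      have step: "\<Psi>' (P j) \<le> \<Psi>' (P i) + ennreal (c2 * (real j / real n) ^ r * (2 * e i))" if "i \<le> j" "1 \<le> j" "real j \<le> \<kappa> * real n" for i j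
      proof -
        have Pi: "P i \<in> poly_space j" using poly_space_mono[OF P(1) that(1)] .
        have "\<Psi>' (P j) \<le> \<Psi>' (P i) + \<Psi>' (\<lambda>\<xi>. P j \<xi> - P i \<xi>)" by (rule sub[OF P(1) Pi])
        also have "\<Psi>' (\<lambda>\<xi>. P j \<xi> - P i \<xi>) \<le> ennreal (c2 * (real j / real n) ^ r) * ?nrm (\<lambda>\<xi>. P j \<xi> - P i \<xi>)"
          by (rule bern[OF that(2,3) poly_space_diff[OF P(1) Pi]])
        also have "\<dots> \<le> ennreal (c2 * (real j / real n) ^ r) * ennreal (2 * e i)"
          by (intro mult_left_mono diff that) auto
        also have "\<dots> = ennreal (c2 * (real j / real n) ^ r * (2 * e i))"
          using c e0[of i] by (simp flip: ennreal_mult)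
        finally show ?thesis by (simp add: add_left_mono)
      qed
      have main: "\<Psi> \<le> ennreal (C / real n ^ r * S n)"
      proof (cases "\<kappa> * real n < 1")
        case True
        have "\<Psi> \<le> \<Psi>' (P 0) + ennreal c1 * ?nrm (\<lambda>\<xi>. f \<xi> - P 0 \<xi>)" by (rule split[OF P(1)])
        also have "\<dots> \<le> 0 + ennreal c1 * ennreal (e 0)"
          using const[OF P(1)] by (intro add_mono mult_left_mono P) auto
        also have "\<dots> = ennreal (c1 * e 0)" using c e0[of 0] by (simp flip: ennreal_mult)
        also have "\<dots> \<le> ennreal (C / real n ^ r * S n)"
        proof (rule ennreal_leI)
          have "1 \<le> (4 / \<kappa>) / real n" using True \<kappa> n by (simp add: field_simps)
          then have "1 \<le> ((4 / \<kappa>) / real n) ^ r" by (rule one_le_power)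
          then have "c1 * e 0 \<le> c1 * e 0 * ((4 / \<kappa>) / real n) ^ r" using mult_left_mono[of 1 "((4 / \<kappa>) / real n) ^ r" "c1 * e 0"] c e0[of 0] by simp
          also have "\<dots> = (c1 * (4 / \<kappa>) ^ r) / real n ^ r * e 0" by (simp add: power_divide power_mult_distrib)
          also have "\<dots> \<le> C / real n ^ r * e 0"
            using c e0[of 0] by (intro mult_right_mono divide_right_mono) (auto simp: C_def)
          also have "\<dots> \<le> C / real n ^ r * S n" using S0 C by (intro mult_left_mono) auto
          finally show "c1 * e 0 \<le> C / real n ^ r * S n" .
        qed
        finally show ?thesis .
      next
        case False
        \<comment> \<open>\<open>2 ^ m\<close> is the last dyadic degree to which the Bernstein
          inequality applies.\<close>
        have ex: "\<exists>m. 2 ^ m \<le> \<kappa> * real n \<and> \<kappa> * real n < 2 ^ Suc m"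
        proof -
          define L where "L = (LEAST k. \<kappa> * real n < 2 ^ k)"
          obtain k where k: "\<kappa> * real n < 2 ^ k" using real_arch_pow[of 2 "\<kappa> * real n"] by auto
          have L: "\<kappa> * real n < 2 ^ L" unfolding L_def using LeastI[of "\<lambda>k. \<kappa> * real n < 2 ^ k" k] k by blast
          then have "L \<noteq> 0" using False by (intro notI) simp
          then obtain m where m: "L = Suc m" using not0_implies_Suc by blast
          have "\<not> \<kappa> * real n < 2 ^ m" using not_less_Least[of m "\<lambda>k. \<kappa> * real n < 2 ^ k"] m by (simp add: L_def)
          then show ?thesis using L m by (intro exI[of _ m]) auto
        qed
        then obtain m where m: "2 ^ m \<le> \<kappa> * real n" "\<kappa> * real n < 2 ^ Suc m" by blast
        \<comment> \<open>Dyadic condensation: each \<open>j\<close> with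
          \<open>2 ^ M < j \<le> 2 ^ Suc M\<close> has weight at least
          \<open>2 ^ (M * (r - 1))\<close> and \<open>e j \<ge> e (2 ^ Suc M)\<close>, and there are
          \<open>2 ^ M\<close> such \<open>j\<close>.\<close>
        have block: "(\<Sum>k\<le>M. 2 ^ (k * r) * e (2 ^ k)) \<le> 2 ^ r * S (2 ^ M)" for M
        proof (induction M)
          case 0
          have "1 * 1 \<le> (2::real) ^ r * 2 ^ (r - 1)" by (rule mult_mono) auto
          then have "1 * e 1 \<le> (2 ^ r * 2 ^ (r - 1)) * e 1" using e0[of 1] by (intro mult_right_mono) auto
          then have "e 1 \<le> 2 ^ r * (2 ^ (r - 1) * e 1)" by simp
          also have "\<dots> \<le> 2 ^ r * S 1" using e0[of 0] by (intro mult_left_mono) (auto simp: S_def)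
          finally show ?case by simp
        next
          case (Suc M)
          have "S (2 ^ Suc M) = S (2 ^ M) + (\<Sum>j=Suc (2 ^ M)..2 ^ M + 2 ^ M. real (j + 1) ^ (r - 1) * e j)"
            unfolding S_def power_Suc mult_2 using sum.ub_add_nat[of 0 "2 ^ M" "\<lambda>j. real (j + 1) ^ (r - 1) * e j" "2 ^ M"] by simp
          moreover have "(\<Sum>j=Suc (2 ^ M)..2 ^ M + 2 ^ M. 2 ^ (M * (r - 1)) * e (2 ^ Suc M)) \<le> (\<Sum>j=Suc (2 ^ M)..2 ^ M + 2 ^ M. real (j + 1) ^ (r - 1) * e j)"
          proof (rule sum_mono)
            fix j assume j: "j \<in> {Suc (2 ^ M)..2 ^ M + (2 ^ M :: nat)}"
            have "real (2 ^ M) \<le> real (j + 1)" using j by (intro of_nat_mono) simp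
            then have "(2 ^ M) ^ (r - 1) \<le> real (j + 1) ^ (r - 1)" by (intro power_mono) auto
            moreover have "e (2 ^ Suc M) \<le> e j" using j by (intro emono) auto
            ultimately show "2 ^ (M * (r - 1)) * e (2 ^ Suc M) \<le> real (j + 1) ^ (r - 1) * e j"
              using e0[of "2 ^ Suc M"] by (intro mult_mono) (auto simp: power_mult)
          qed
          moreover have "(\<Sum>j=Suc (2 ^ M)..2 ^ M + 2 ^ M. 2 ^ (M * (r - 1)) * e (2 ^ Suc M)) = 2 ^ (M * r) * e (2 ^ Suc M)"
          proof -
            have "(2::real) ^ M * 2 ^ (M * (r - 1)) = 2 ^ (M * r)"
              using r by (simp flip: power_add) (metis mult_Suc_right Suc_diff_1 Suc_le_lessD One_nat_def)
            then show ?thesis by (simp add: mult.assoc[symmetric])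
          qed
          ultimately have "2 ^ (M * r) * e (2 ^ Suc M) \<le> S (2 ^ Suc M) - S (2 ^ M)" by linarith
          then have "2 ^ r * (2 ^ (M * r) * e (2 ^ Suc M)) \<le> 2 ^ r * (S (2 ^ Suc M) - S (2 ^ M))" by (intro mult_left_mono) auto
          then have "2 ^ (Suc M * r) * e (2 ^ Suc M) \<le> 2 ^ r * S (2 ^ Suc M) - 2 ^ r * S (2 ^ M)"
            by (simp add: power_add algebra_simps)
          then show ?case using Suc by simp
        qed
        have nle: "2 ^ k \<le> n" if "k \<le> m" for k
        proof -
          have "real (2 ^ k) \<le> 2 ^ m" using that by (simp add: power_increasing)
          also have "\<dots> \<le> \<kappa> * real n" by (rule m)
          also have "\<dots> \<le> 1 * real n" using \<kappa> by (intro mult_right_mono) auto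
          finally show ?thesis by simp
        qed
        \<comment> \<open>The telescoping starts from the constant \<open>P 0\<close>, for which
          \<open>\<Psi>'\<close> vanishes; each doubling of the degree adds one Bernstein bound for
          the difference of consecutive approximants.\<close>
        have tel: "\<Psi>' (P (2 ^ M)) \<le> ennreal (2 * c2 / real n ^ r * (e 0 + 2 ^ r * (\<Sum>k<M. 2 ^ (k * r) * e (2 ^ k))))" if "M \<le> m" for M
          using that
        proof (induction M)
          case 0
          have "1 \<le> \<kappa> * real n" using False by simp
          then have "\<Psi>' (P 1) \<le> \<Psi>' (P 0) + ennreal (c2 * (real 1 / real n) ^ r * (2 * e 0))" by (intro step) auto
          then show ?case using const[OF P(1)] by (simp add: power_divide mult.assoc mult.left_commute)
        next
          case (Suc M)
          have "2 ^ Suc M \<le> (2::real) ^ m" using Suc.prems by (intro power_increasing) auto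
          then have le: "real (2 ^ Suc M) \<le> \<kappa> * real n" using m by simp
          have "\<Psi>' (P (2 ^ Suc M)) \<le> \<Psi>' (P (2 ^ M)) + ennreal (c2 * (real (2 ^ Suc M) / real n) ^ r * (2 * e (2 ^ M)))"
            using le by (intro step) (auto simp: power_increasing)
          also have "\<dots> \<le> ennreal (2 * c2 / real n ^ r * (e 0 + 2 ^ r * (\<Sum>k<M. 2 ^ (k * r) * e (2 ^ k)))) + ennreal (c2 * (real (2 ^ Suc M) / real n) ^ r * (2 * e (2 ^ M)))"
            using Suc by (intro add_right_mono) auto
          also have "\<dots> = ennreal (2 * c2 / real n ^ r * (e 0 + 2 ^ r * (\<Sum>k<M. 2 ^ (k * r) * e (2 ^ k))) + c2 * (real (2 ^ Suc M) / real n) ^ r * (2 * e (2 ^ M)))"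
            using c less_imp_le[OF e0] by (intro ennreal_plus[symmetric] mult_nonneg_nonneg divide_nonneg_nonneg add_nonneg_nonneg sum_nonneg) auto
          also have "c2 * (real (2 ^ Suc M) / real n) ^ r * (2 * e (2 ^ M)) = 2 * c2 / real n ^ r * (2 ^ r * (2 ^ (M * r) * e (2 ^ M)))"
            by (simp add: power_divide power_mult_distrib power_mult)
          finally show ?case by (simp add: algebra_simps)
        qed
        have bm: "2 ^ (m * r) * e (2 ^ m) \<le> 2 ^ r * S n"
        proof -
          have "2 ^ (m * r) * e (2 ^ m) \<le> (\<Sum>k\<le>m. 2 ^ (k * r) * e (2 ^ k))"
            using less_imp_le[OF e0] by (intro member_le_sum) auto
          also have "\<dots> \<le> 2 ^ r * S (2 ^ m)" by (rule block)
          also have "\<dots> \<le> 2 ^ r * S n" using nle[of m] by (intro mult_left_mono Smono) auto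
          finally show ?thesis .
        qed
        have sm: "(\<Sum>k<m. 2 ^ (k * r) * e (2 ^ k)) \<le> 2 ^ r * S n"
        proof -
          have "(\<Sum>k<m. 2 ^ (k * r) * e (2 ^ k)) \<le> (\<Sum>k\<le>m. 2 ^ (k * r) * e (2 ^ k))"
            using less_imp_le[OF e0] by (intro sum_mono2) auto
          also have "\<dots> \<le> 2 ^ r * S (2 ^ m)" by (rule block)
          also have "\<dots> \<le> 2 ^ r * S n" using nle[of m] by (intro mult_left_mono Smono) auto
          finally show ?thesis .
        qed
        \<comment> \<open>Since \<open>\<kappa> n < 2 ^ Suc m\<close>, the factor
          \<open>(2 ^ m * (2 / \<kappa> / n)) ^ r\<close> is at least 1; inserting it turns the last
          error into the last dyadic term.\<close>
        have em: "e (2 ^ m) \<le> (4 / \<kappa>) ^ r / real n ^ r * S n"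
        proof -
          have "1 \<le> 2 ^ m * (2 / \<kappa> / real n)" using m(2) \<kappa> n by (simp add: field_simps)
          then have "1 \<le> (2 ^ m * (2 / \<kappa> / real n)) ^ r" by (rule one_le_power)
          then have "e (2 ^ m) * 1 \<le> e (2 ^ m) * (2 ^ m * (2 / \<kappa> / real n)) ^ r" using e0[of "2 ^ m"] by (intro mult_left_mono) auto
          also have "\<dots> = (2 / \<kappa>) ^ r / real n ^ r * (2 ^ (m * r) * e (2 ^ m))"
            by (simp add: power_mult_distrib power_divide power_mult)
          also have "\<dots> \<le> (2 / \<kappa>) ^ r / real n ^ r * (2 ^ r * S n)" using bm \<kappa> by (intro mult_left_mono) auto
          also have "\<dots> = (4 / \<kappa>) ^ r / real n ^ r * S n"
          proof -
            have "(4 / \<kappa>) ^ r = (2 / \<kappa>) ^ r * 2 ^ r" by (simp flip: power_mult_distrib)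
            then show ?thesis by simp
          qed
          finally show ?thesis by simp
        qed
        have "\<Psi> \<le> \<Psi>' (P (2 ^ m)) + ennreal c1 * ?nrm (\<lambda>\<xi>. f \<xi> - P (2 ^ m) \<xi>)" by (rule split[OF P(1)])
        also have "\<dots> \<le> ennreal (2 * c2 / real n ^ r * (e 0 + 2 ^ r * (\<Sum>k<m. 2 ^ (k * r) * e (2 ^ k)))) + ennreal c1 * ennreal (e (2 ^ m))"
          by (intro add_mono tel mult_left_mono P) auto
        also have "\<dots> = ennreal (2 * c2 / real n ^ r * (e 0 + 2 ^ r * (\<Sum>k<m. 2 ^ (k * r) * e (2 ^ k))) + c1 * e (2 ^ m))"
          using c less_imp_le[OF e0] by (subst ennreal_plus) (auto simp: ennreal_mult intro!: mult_nonneg_nonneg divide_nonneg_nonneg add_nonneg_nonneg sum_nonneg)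
        also have "\<dots> \<le> ennreal (C / real n ^ r * S n)"
        proof (rule ennreal_leI)
          have "2 * c2 / real n ^ r * (e 0 + 2 ^ r * (\<Sum>k<m. 2 ^ (k * r) * e (2 ^ k))) \<le> 2 * c2 / real n ^ r * (S n + 2 ^ r * (2 ^ r * S n))"
            using c S0 sm by (intro mult_left_mono add_mono) auto
          moreover have "c1 * e (2 ^ m) \<le> c1 * ((4 / \<kappa>) ^ r / real n ^ r * S n)" using em c by (intro mult_left_mono) auto
          moreover have "2 * c2 / real n ^ r * (S n + 2 ^ r * (2 ^ r * S n)) + c1 * ((4 / \<kappa>) ^ r / real n ^ r * S n) = C / real n ^ r * S n"
          proof -
            have "(2::real) ^ r * 2 ^ r = 4 ^ r" by (simp flip: power_mult_distrib)
            then have "2 ^ r * (2 ^ r * S n) = 4 ^ r * S n" by (simp flip: mult.assoc)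
            then show ?thesis by (simp add: C_def add_divide_distrib algebra_simps)
          qed
          ultimately show "2 * c2 / real n ^ r * (e 0 + 2 ^ r * (\<Sum>k<m. 2 ^ (k * r) * e (2 ^ k))) + c1 * e (2 ^ m) \<le> C / real n ^ r * S n"
            by linarith
        qed
        finally show ?thesis .
      qed
      then show ?thesis by (simp add: S_def e_def)
    qed
    \<comment> \<open>The total weight with which \<open>\<epsilon>\<close> enters
      \<open>real_bound\<close>; the choice \<open>\<epsilon> / (W + 1)\<close> keeps its
      contribution below \<open>\<epsilon>\<close>.\<close>
    define W where "W = C / real n ^ r * (\<Sum>j=0..n. real (j + 1) ^ (r - 1))"
    have W: "0 \<le> W" unfolding W_def using C by (intro mult_nonneg_nonneg divide_nonneg_nonneg sum_nonneg) auto
    define S0 where "S0 = (\<Sum>j=0..n. real (j + 1) ^ (r - 1) * enn2real (E j))"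
    have S0: "0 \<le> S0" by (auto simp: S0_def intro!: sum_nonneg)
    have "\<Psi> \<le> ennreal (C / real n ^ r * S0)"
    proof (rule ennreal_le_epsilon)
      fix \<epsilon> :: real assume \<epsilon>: "0 < \<epsilon>"
      define \<delta> where "\<delta> = \<epsilon> / (W + 1)"
      have \<delta>: "0 < \<delta>" "W * \<delta> \<le> \<epsilon>" using \<epsilon> W by (auto simp: \<delta>_def field_simps)
      have "\<Psi> \<le> ennreal (C / real n ^ r * (\<Sum>j=0..n. real (j + 1) ^ (r - 1) * (enn2real (E j) + \<delta>)))"
        by (rule real_bound[OF \<delta>(1)])
      also have "C / real n ^ r * (\<Sum>j=0..n. real (j + 1) ^ (r - 1) * (enn2real (E j) + \<delta>)) = C / real n ^ r * S0 + W * \<delta>"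
        by (simp only: S0_def W_def distrib_left sum.distrib sum_distrib_right mult.assoc)
      also have "ennreal (C / real n ^ r * S0 + W * \<delta>) \<le> ennreal (C / real n ^ r * S0 + \<epsilon>)"
        using \<delta> by (intro ennreal_leI) auto
      also have "\<dots> = ennreal (C / real n ^ r * S0) + ennreal \<epsilon>"
        using C S0 \<epsilon> by (intro ennreal_plus mult_nonneg_nonneg divide_nonneg_nonneg) auto
      finally show "\<Psi> \<le> ennreal (C / real n ^ r * S0) + ennreal \<epsilon>" .
    qed
    also have "\<dots> = ennreal (C / real n ^ r) * ennreal S0" using C S0 by (intro ennreal_mult) auto
    also have "ennreal S0 = (\<Sum>j=0..n. ennreal (real (j + 1) ^ (r - 1)) * E j)"
      unfolding S0_def using Efin by (subst sum_ennreal[symmetric]) (auto simp: ennreal_mult intro!: sum.cong)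
    finally show "\<Psi> \<le> ennreal (C / real n ^ r) * (\<Sum>j=0..n. ennreal (real (j + 1) ^ (r - 1)) * best_approx p \<Omega> j f)"
      by (simp add: E_def)
  qed
qed

section \<open>The Ditzian--Totik part\<close>

lemma Lp_norm_lpn:
  assumes "p \<noteq> \<infinity>"
  shows "Lp_norm p S F = lpn (enn2real p) lebesgue (\<lambda>\<xi>. ennreal \<bar>F \<xi>\<bar> * indicator S \<xi>)"
proof -
  have "ennreal (\<bar>F \<xi>\<bar> powr enn2real p) * indicator S \<xi> = ennreal_powr (ennreal \<bar>F \<xi>\<bar> * indicator S \<xi>) (enn2real p)" for \<xi>
    by (auto simp: indicator_def)
  then show ?thesis using assms by (simp add: Lp_norm_def lpn_def)
qed

lemma lpn_lebesgue: "lpn p lebesgue F = lpn p lborel F"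
  by (simp add: lpn_def nn_integral_completion)

lemma one_le_enn2real: "1 \<le> p \<Longrightarrow> p \<noteq> \<infinity> \<Longrightarrow> 1 \<le> enn2real p"
  by (cases p) auto

lemma Lp_norm_uniform: "Lp_norm \<infinity> S F = (SUP \<xi>\<in>S. ennreal \<bar>F \<xi>\<bar>)"
  by (simp add: Lp_norm_def)

lemma Lp_space_diff_measurable:
  assumes "f \<in> Lp_space p S" "p \<noteq> \<infinity>" "S \<in> sets lebesgue" "P \<in> borel_measurable borel"
  shows "(\<lambda>\<xi>. ennreal \<bar>f \<xi> - P \<xi>\<bar> * indicator S \<xi>) \<in> borel_measurable lebesgue"
proof -
  have f[measurable]: "f \<in> borel_measurable (lebesgue_on S)" using assms(1,2) by (simp add: Lp_space_def)
  have [measurable]: "P \<in> borel_measurable (lebesgue_on S)"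
    using assms(4) by (intro measurable_restrict_space1 measurable_completion) simp
  have "(\<lambda>\<xi>. ennreal \<bar>f \<xi> - P \<xi>\<bar>) \<in> borel_measurable (lebesgue_on S)" by measurable
  then show ?thesis using assms(3) by (subst (asm) borel_measurable_restrict_space_iff_ennreal) auto
qed

lemma Lp_space_finite:
  assumes "f \<in> Lp_space p S" "compact S" shows "Lp_norm p S f < \<infinity>"
proof (cases "p = \<infinity>")
  case True
  then have "compact (f ` S)" using assms by (intro compact_continuous_image) (auto simp: Lp_space_def)
  then obtain B where B: "\<And>x. x \<in> S \<Longrightarrow> \<bar>f x\<bar> \<le> B"
    using compact_imp_bounded[of "f ` S"] by (auto simp: bounded_iff)
  have "Lp_norm p S f \<le> ennreal B"
    unfolding True Lp_norm_uniform using B by (intro SUP_least ennreal_leI)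
  then show ?thesis using ennreal_less_top[of B] by (simp add: order_le_less_trans)
qed (use assms in \<open>simp add: Lp_space_def\<close>)

lemma ennreal_abs_le_add: "\<bar>a\<bar> \<le> \<bar>b\<bar> + \<bar>c\<bar> \<Longrightarrow> ennreal \<bar>a\<bar> \<le> ennreal \<bar>b\<bar> + ennreal \<bar>c\<bar>"
  by (simp add: ennreal_leI flip: ennreal_plus)

lemma Lp_norm_triangle:
  assumes p: "1 \<le> p" and f: "f \<in> Lp_space p S" and S: "S \<in> sets lebesgue"
    and P: "P \<in> borel_measurable borel" "Q \<in> borel_measurable borel"
  shows "Lp_norm p S (\<lambda>\<xi>. P \<xi> - Q \<xi>) \<le> Lp_norm p S (\<lambda>\<xi>. f \<xi> - P \<xi>) + Lp_norm p S (\<lambda>\<xi>. f \<xi> - Q \<xi>)"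
proof (cases "p = \<infinity>")
  case True
  show ?thesis unfolding True Lp_norm_uniform
  proof (rule SUP_least)
    fix \<xi> assume \<xi>: "\<xi> \<in> S"
    have "ennreal \<bar>P \<xi> - Q \<xi>\<bar> \<le> ennreal \<bar>f \<xi> - P \<xi>\<bar> + ennreal \<bar>f \<xi> - Q \<xi>\<bar>"
      by (rule ennreal_abs_le_add) linarith
    also have "\<dots> \<le> (SUP \<xi>\<in>S. ennreal \<bar>f \<xi> - P \<xi>\<bar>) + (SUP \<xi>\<in>S. ennreal \<bar>f \<xi> - Q \<xi>\<bar>)"
      using \<xi> by (intro add_mono SUP_upper)
    finally show "ennreal \<bar>P \<xi> - Q \<xi>\<bar> \<le> \<dots>" .
  qed
next
  case False
  let ?p = "enn2real p"
  have p': "1 \<le> ?p" using p False by (rule one_le_enn2real)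
  note m[measurable] = Lp_space_diff_measurable[OF f False S P(1)] Lp_space_diff_measurable[OF f False S P(2)]
  have "lpn ?p lebesgue (\<lambda>\<xi>. ennreal \<bar>P \<xi> - Q \<xi>\<bar> * indicator S \<xi>)
     \<le> lpn ?p lebesgue (\<lambda>\<xi>. ennreal \<bar>f \<xi> - P \<xi>\<bar> * indicator S \<xi> + ennreal \<bar>f \<xi> - Q \<xi>\<bar> * indicator S \<xi>)"
  proof (rule lpn_mono[OF p'])
    fix \<xi>
    have "ennreal \<bar>P \<xi> - Q \<xi>\<bar> \<le> ennreal \<bar>f \<xi> - P \<xi>\<bar> + ennreal \<bar>f \<xi> - Q \<xi>\<bar>"
      by (rule ennreal_abs_le_add) linarith
    then show "ennreal \<bar>P \<xi> - Q \<xi>\<bar> * indicator S \<xi> \<le> ennreal \<bar>f \<xi> - P \<xi>\<bar> * indicator S \<xi> + ennreal \<bar>f \<xi> - Q \<xi>\<bar> * indicator S \<xi>"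
      by (auto simp: indicator_def)
  qed
  also have "\<dots> \<le> lpn ?p lebesgue (\<lambda>\<xi>. ennreal \<bar>f \<xi> - P \<xi>\<bar> * indicator S \<xi>) + lpn ?p lebesgue (\<lambda>\<xi>. ennreal \<bar>f \<xi> - Q \<xi>\<bar> * indicator S \<xi>)"
    by (rule lpn_add[OF p' m])
  finally show ?thesis by (simp add: Lp_norm_lpn[OF False])
qed

text \<open>The majorant dominates everywhere, not just almost everywhere: it will be composed with maps that
  are not known to preserve null sets.\<close>

lemma borel_majorant:
  fixes F :: "'a::euclidean_space \<Rightarrow> ennreal"
  assumes p: "1 \<le> p" and F: "F \<in> borel_measurable lebesgue"
  obtains h where "h \<in> borel_measurable borel" "\<And>\<xi>. F \<xi> \<le> h \<xi>" "lpn p lborel h = lpn p lborel F"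
proof -
  obtain g where g: "g \<in> borel_measurable lborel" and ae: "AE \<xi> in lborel. F \<xi> = g \<xi>"
    using completion_ex_borel_measurable[OF F] by blast
  obtain N where N: "{\<xi>. \<not> F \<xi> = g \<xi>} \<subseteq> N" "N \<in> null_sets lborel"
    using ae by (auto simp: eventually_ae_filter)
  define h where "h = (\<lambda>\<xi>. g \<xi> + top * indicator N \<xi>)"
  have [measurable]: "g \<in> borel_measurable borel" "N \<in> sets borel" using g N by auto
  have h: "h \<in> borel_measurable borel" unfolding h_def by measurable
  have "F \<xi> \<le> h \<xi>" for \<xi>
  proof (cases "\<xi> \<in> N")
    case False
    then have "F \<xi> = g \<xi>" using N(1) by blast
    then show ?thesis by (simp add: h_def)
  qed (simp add: h_def)
  moreover have "lpn p lborel h = lpn p lborel F"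
  proof -
    have "AE \<xi> in lborel. \<xi> \<notin> N" using N(2) by (rule AE_not_in)
    then have "AE \<xi> in lborel. ennreal_powr (h \<xi>) p = ennreal_powr (F \<xi>) p"
    proof (rule eventually_mono)
      fix \<xi> assume "\<xi> \<notin> N"
      moreover from this have "F \<xi> = g \<xi>" using N(1) by blast
      ultimately show "ennreal_powr (h \<xi>) p = ennreal_powr (F \<xi>) p" by (simp add: h_def)
    qed
    then show ?thesis unfolding lpn_def by (simp add: nn_integral_cong_AE)
  qed
  ultimately show thesis using h by (intro that)
qed

lemma fin_diff_triangle:
  "\<bar>fin_diff r \<xi> f \<eta>\<bar> \<le> \<bar>fin_diff r \<xi> P \<eta>\<bar> + (\<Sum>k=0..r. real (r choose k) * \<bar>f (\<eta> + real k *\<^sub>R \<xi>) - P (\<eta> + real k *\<^sub>R \<xi>)\<bar>)"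
proof -
  have "fin_diff r \<xi> f \<eta> = fin_diff r \<xi> P \<eta> + (\<Sum>k=0..r. (-1) ^ (r + k) * real (r choose k) * (f (\<eta> + real k *\<^sub>R \<xi>) - P (\<eta> + real k *\<^sub>R \<xi>)))"
    unfolding fin_diff_def by (simp add: sum.distrib[symmetric] algebra_simps)
  also have "\<bar>\<dots>\<bar> \<le> \<bar>fin_diff r \<xi> P \<eta>\<bar> + (\<Sum>k=0..r. \<bar>(-1) ^ (r + k) * real (r choose k) * (f (\<eta> + real k *\<^sub>R \<xi>) - P (\<eta> + real k *\<^sub>R \<xi>))\<bar>)"
    by (intro order_trans[OF abs_triangle_ineq] add_left_mono sum_abs)
  finally show ?thesis by (simp add: abs_mult)
qed

lemma fin_diff_diff: "fin_diff r \<xi> (\<lambda>x. P x - Q x) \<eta> = fin_diff r \<xi> P \<eta> - fin_diff r \<xi> Q \<eta>"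
  unfolding fin_diff_def by (simp add: sum_subtractf right_diff_distrib)

lemma segment_point:
  fixes \<eta> \<xi> :: "'a::real_vector"
  assumes "closed_segment \<eta> (\<eta> + real r *\<^sub>R \<xi>) \<subseteq> S" "k \<le> r" "1 \<le> r"
  shows "\<eta> + real k *\<^sub>R \<xi> \<in> S"
proof -
  have "\<eta> + real k *\<^sub>R \<xi> = (1 - real k / real r) *\<^sub>R \<eta> + (real k / real r) *\<^sub>R (\<eta> + real r *\<^sub>R \<xi>)"
    using assms(3) by (simp add: algebra_simps)
  moreover have "0 \<le> real k / real r" "real k / real r \<le> 1" using assms by auto
  ultimately have "\<eta> + real k *\<^sub>R \<xi> \<in> closed_segment \<eta> (\<eta> + real r *\<^sub>R \<xi>)" unfolding closed_segment_def by blast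
  then show ?thesis using assms(1) by blast
qed

lemma sum_binomial_ennreal: "(\<Sum>k=0..r. ennreal (real (r choose k)) * c) = ennreal (2 ^ r) * c"
proof -
  have "(\<Sum>j=0..r. real (r choose j)) = 2 ^ r"
    using choose_row_sum[of r] by (metis atMost_atLeast0 of_nat_numeral of_nat_power of_nat_sum)
  then show ?thesis by (simp add: sum_ennreal flip: sum_distrib_right)
qed

lemma uniform_norm_attained:
  assumes "compact S" "S \<noteq> {}" "continuous_on S F"
  obtains B where "\<And>x. x \<in> S \<Longrightarrow> \<bar>F x\<bar> \<le> B" "ennreal B = (SUP x\<in>S. ennreal \<bar>F x\<bar>)"
proof -
  have "continuous_on S (\<lambda>x. \<bar>F x\<bar>)" using assms(3) by (intro continuous_intros)
  then obtain x where x: "x \<in> S" "\<And>y. y \<in> S \<Longrightarrow> \<bar>F y\<bar> \<le> \<bar>F x\<bar>"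
    using continuous_attains_sup[OF assms(1,2)] by blast
  have "ennreal \<bar>F x\<bar> = (SUP x\<in>S. ennreal \<bar>F x\<bar>)"
    using x by (intro antisym SUP_upper SUP_least ennreal_leI)
  with x(2) show thesis by (rule that)
qed

text \<open>Every admissible \<open>h\<close> is treated separately, with a constant that does not
  depend on it. Polynomials are handled by the Bernstein inequality on chords. For
  \<open>f - P\<close> the values at the nodes of the difference are bounded through the change of
  variables of \<open>line_step_le\<close> if \<open>p\<close> is finite, and directly by the
  supremum if \<open>p = \<infinity>\<close>.\<close>

lemma omega_dir_le:
  fixes p :: ennreal and r :: nat and \<Omega> :: "('d::finite) pt set"
  assumes p: "1 \<le> p" and r: "1 \<le> r" and \<Omega>: "compact \<Omega>" and \<Omega>0: "\<Omega> \<noteq> {}"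
  obtains C where "0 < C" "\<And>n f j. 1 \<le> n \<Longrightarrow> f \<in> Lp_space p \<Omega> \<Longrightarrow>
    omega_dir p \<Omega> r f (1 / real n) (unit_vec j) \<le> ennreal (C / real n ^ r) * (\<Sum>j=0..n. ennreal (real (j + 1) ^ (r - 1)) * best_approx p \<Omega> j f)"
proof -
  \<comment> \<open>With \<open>\<bar>h\<bar> \<le> 1 / n\<close> and
    \<open>N \<le> \<kappa> n\<close> this gives the step condition
    \<open>2 * r * \<bar>h\<bar> \<le> 1 / N\<close> of the Bernstein inequality.\<close>
  define \<kappa> where "\<kappa> = 1 / (2 * real r)"
  have \<kappa>: "0 < \<kappa>" "\<kappa> \<le> 1" using r by (auto simp: \<kappa>_def)
  have step_ok: "2 * real r * \<bar>h\<bar> \<le> 1 / real N" if "\<bar>h\<bar> \<le> 1 / real n" "1 \<le> N" "1 \<le> n" "real N \<le> \<kappa> * real n" for h N n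
  proof -
    have "2 * real r * \<bar>h\<bar> * real N \<le> 2 * real r * (1 / real n) * (\<kappa> * real n)"
      using that by (intro mult_mono mult_left_mono) auto
    also have "\<dots> = 1" using r that by (simp add: \<kappa>_def)
    finally show ?thesis using that by (simp add: field_simps)
  qed
  have hN: "(\<bar>h\<bar> * real N) ^ r \<le> (real N / real n) ^ r" if "\<bar>h\<bar> \<le> 1 / real n" "1 \<le> n" for h N n
  proof (intro power_mono)
    have "\<bar>h\<bar> * real N \<le> 1 / real n * real N" using that by (intro mult_right_mono) auto
    then show "\<bar>h\<bar> * real N \<le> real N / real n" by simp
  qed simp
  have \<Omega>b: "\<Omega> \<in> sets borel" "\<Omega> \<in> sets lebesgue" "closed \<Omega>" using \<Omega> by (auto intro: borel_compact compact_imp_closed lmeasurable_compact fmeasurableD)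
  have fin: "Lp_norm p \<Omega> f < \<infinity>" if "f \<in> Lp_space p \<Omega>" for f using that \<Omega> by (rule Lp_space_finite)
  have tri: "Lp_norm p \<Omega> (\<lambda>\<xi>. P \<xi> - Q \<xi>) \<le> Lp_norm p \<Omega> (\<lambda>\<xi>. f \<xi> - P \<xi>) + Lp_norm p \<Omega> (\<lambda>\<xi>. f \<xi> - Q \<xi>)"
    if "f \<in> Lp_space p \<Omega>" "P \<in> poly_space k" "Q \<in> poly_space k" for f P Q k
    using that \<Omega>b by (intro Lp_norm_triangle[OF p]) (auto intro: borel_measurable_poly_space)
  show thesis
  proof (cases "p = \<infinity>")
    case True
    define c2 where "c2 = 2 * (2 * real r) ^ r * exp 14"
    have c2: "0 < c2" using r by (simp add: c2_def)
    obtain C where C: "0 < C" "\<And>p (\<Omega> :: 'd pt set) f n \<Psi> \<Psi>'. 1 \<le> n \<Longrightarrow> Lp_norm p \<Omega> f < \<infinity> \<Longrightarrow>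
     (\<And>k P Q. P \<in> poly_space k \<Longrightarrow> Q \<in> poly_space k \<Longrightarrow> Lp_norm p \<Omega> (\<lambda>\<xi>. P \<xi> - Q \<xi>) \<le> Lp_norm p \<Omega> (\<lambda>\<xi>. f \<xi> - P \<xi>) + Lp_norm p \<Omega> (\<lambda>\<xi>. f \<xi> - Q \<xi>)) \<Longrightarrow>
     (\<And>k P. P \<in> poly_space k \<Longrightarrow> \<Psi> \<le> \<Psi>' P + ennreal (2 ^ r) * Lp_norm p \<Omega> (\<lambda>\<xi>. f \<xi> - P \<xi>)) \<Longrightarrow>
     (\<And>k P Q. P \<in> poly_space k \<Longrightarrow> Q \<in> poly_space k \<Longrightarrow> \<Psi>' P \<le> \<Psi>' Q + \<Psi>' (\<lambda>\<xi>. P \<xi> - Q \<xi>)) \<Longrightarrow>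
     (\<And>N P. 1 \<le> N \<Longrightarrow> real N \<le> \<kappa> * real n \<Longrightarrow> P \<in> poly_space N \<Longrightarrow> \<Psi>' P \<le> ennreal (c2 * (real N / real n) ^ r) * Lp_norm p \<Omega> P) \<Longrightarrow>
     (\<And>P. P \<in> poly_space 0 \<Longrightarrow> \<Psi>' P = 0) \<Longrightarrow>
     \<Psi> \<le> ennreal (C / real n ^ r) * (\<Sum>j=0..n. ennreal (real (j + 1) ^ (r - 1)) * best_approx p \<Omega> j f)"
      by (rule dyadic_inverse_estimate[OF \<kappa> _ c2 r, of "2 ^ r"]) (simp, blast)
    show thesis
    proof (rule that[OF C(1)])
      fix n :: nat and f :: "'d pt \<Rightarrow> real" and j :: "'d option" assume n: "1 \<le> n" and f: "f \<in> Lp_space p \<Omega>"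
      define e where "e = (unit_vec j :: 'd pt)"
      have e: "norm e = 1" by (simp add: e_def)
      show "omega_dir p \<Omega> r f (1 / real n) (unit_vec j) \<le> ennreal (C / real n ^ r) * (\<Sum>j=0..n. ennreal (real (j + 1) ^ (r - 1)) * best_approx p \<Omega> j f)"
        unfolding omega_dir_def e_def[symmetric]
      proof (rule SUP_least)
        fix h assume "h \<in> {h. \<bar>h\<bar> \<le> min (1 / real n) 1}"
        then have h: "\<bar>h\<bar> \<le> 1 / real n" by simp
        define \<Psi>' where "\<Psi>' = (\<lambda>P. SUP \<xi>\<in>\<Omega>. ennreal \<bar>fin_diff r ((h * phi_dist \<Omega> e \<xi>) *\<^sub>R e) P \<xi>\<bar>)"
        show "Lp_norm p \<Omega> (\<lambda>\<xi>. fin_diff_on r ((h * phi_dist \<Omega> e \<xi>) *\<^sub>R e) f \<Omega> \<xi>)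
          \<le> ennreal (C / real n ^ r) * (\<Sum>j=0..n. ennreal (real (j + 1) ^ (r - 1)) * best_approx p \<Omega> j f)"
        proof (rule C(2)[OF n fin[OF f] tri[OF f], where \<Psi>' = \<Psi>'])
          fix k P assume P: "P \<in> (poly_space k :: ('d pt \<Rightarrow> real) set)"
          show "Lp_norm p \<Omega> (\<lambda>\<xi>. fin_diff_on r ((h * phi_dist \<Omega> e \<xi>) *\<^sub>R e) f \<Omega> \<xi>) \<le> \<Psi>' P + ennreal (2 ^ r) * Lp_norm p \<Omega> (\<lambda>\<xi>. f \<xi> - P \<xi>)"
            unfolding True Lp_norm_uniform
          proof (rule SUP_least)
            fix \<xi> assume \<xi>: "\<xi> \<in> \<Omega>"
            let ?v = "(h * phi_dist \<Omega> e \<xi>) *\<^sub>R e"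
            show "ennreal \<bar>fin_diff_on r ?v f \<Omega> \<xi>\<bar> \<le> \<Psi>' P + ennreal (2 ^ r) * (SUP \<xi>\<in>\<Omega>. ennreal \<bar>f \<xi> - P \<xi>\<bar>)"
            proof (cases "closed_segment \<xi> (\<xi> + real r *\<^sub>R ?v) \<subseteq> \<Omega>")
              case seg: True
              have "ennreal \<bar>fin_diff r ?v f \<xi>\<bar> \<le> ennreal (\<bar>fin_diff r ?v P \<xi>\<bar> + (\<Sum>k=0..r. real (r choose k) * \<bar>f (\<xi> + real k *\<^sub>R ?v) - P (\<xi> + real k *\<^sub>R ?v)\<bar>))"
                by (intro ennreal_leI fin_diff_triangle)
              also have "\<dots> = ennreal \<bar>fin_diff r ?v P \<xi>\<bar> + (\<Sum>k=0..r. ennreal (real (r choose k)) * ennreal \<bar>f (\<xi> + real k *\<^sub>R ?v) - P (\<xi> + real k *\<^sub>R ?v)\<bar>)"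
                by (subst ennreal_plus) (auto intro!: sum_nonneg simp: sum_ennreal simp flip: ennreal_mult)
              also have "\<dots> \<le> \<Psi>' P + (\<Sum>k=0..r. ennreal (real (r choose k)) * (SUP \<xi>\<in>\<Omega>. ennreal \<bar>f \<xi> - P \<xi>\<bar>))"
                unfolding \<Psi>'_def using \<xi> segment_point[OF seg _ r]
                by (intro add_mono sum_mono mult_left_mono) (auto intro: SUP_upper)
              finally show ?thesis using seg by (simp add: fin_diff_on_def sum_binomial_ennreal)
            qed (simp add: fin_diff_on_def)
          qed
        next
          fix k P Q
          show "\<Psi>' P \<le> \<Psi>' Q + \<Psi>' (\<lambda>\<xi>. P \<xi> - Q \<xi>)" unfolding \<Psi>'_def
          proof (rule SUP_least)
            fix \<xi> assume \<xi>: "\<xi> \<in> \<Omega>"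
            let ?D = "\<lambda>P. ennreal \<bar>fin_diff r ((h * phi_dist \<Omega> e \<xi>) *\<^sub>R e) P \<xi>\<bar>"
            have "?D P \<le> ?D Q + ?D (\<lambda>\<xi>. P \<xi> - Q \<xi>)"
              unfolding fin_diff_diff by (rule ennreal_abs_le_add) linarith
            also have "\<dots> \<le> (SUP \<xi>\<in>\<Omega>. ennreal \<bar>fin_diff r ((h * phi_dist \<Omega> e \<xi>) *\<^sub>R e) Q \<xi>\<bar>) + (SUP \<xi>\<in>\<Omega>. ennreal \<bar>fin_diff r ((h * phi_dist \<Omega> e \<xi>) *\<^sub>R e) (\<lambda>\<xi>. P \<xi> - Q \<xi>) \<xi>\<bar>)"
              using \<xi> by (intro add_mono SUP_upper)
            finally show "?D P \<le> \<dots>" .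
          qed
        next
          fix N and P :: "'d pt \<Rightarrow> real" assume N: "1 \<le> N" "real N \<le> \<kappa> * real n" and P: "P \<in> poly_space N"
          obtain B where B: "\<And>\<eta>. \<eta> \<in> \<Omega> \<Longrightarrow> \<bar>P \<eta>\<bar> \<le> B" and BS: "ennreal B = (SUP \<xi>\<in>\<Omega>. ennreal \<bar>P \<xi>\<bar>)"
            using uniform_norm_attained[OF \<Omega> \<Omega>0 continuous_on_poly_space[OF P]] by blast
          have "\<Psi>' P \<le> ennreal (c2 * (real N / real n) ^ r * B)" unfolding \<Psi>'_def
          proof (intro SUP_least ennreal_leI)
            fix \<xi> assume \<xi>: "\<xi> \<in> \<Omega>"
            obtain q :: "complex poly" where q: "degree q \<le> N" "\<And>y. poly q (of_real y) = of_real (P (\<xi> + y *\<^sub>R e))"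
              by (rule poly_space_line[OF P]) blast
            have "\<bar>fin_diff r ((h * phi_dist \<Omega> e \<xi>) *\<^sub>R e) P \<xi>\<bar> \<le> 2 * (2 * real r) ^ r * exp 14 * (\<bar>h\<bar> * real N) ^ r * B"
              by (rule line_difference_sup_le[OF r \<Omega> e N(1) q step_ok[OF h N(1) n N(2)] \<xi> B])
            also have "\<dots> \<le> c2 * (real N / real n) ^ r * B"
              unfolding c2_def using hN[OF h n, of N] B[OF \<xi>] by (intro mult_right_mono mult_left_mono) auto
            finally show "\<bar>fin_diff r ((h * phi_dist \<Omega> e \<xi>) *\<^sub>R e) P \<xi>\<bar> \<le> c2 * (real N / real n) ^ r * B" .
          qed
          also have "\<dots> = ennreal (c2 * (real N / real n) ^ r) * ennreal B"
            using c2 by (intro ennreal_mult') auto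
          also have "\<dots> \<le> ennreal (c2 * (real N / real n) ^ r) * Lp_norm p \<Omega> P"
            unfolding True Lp_norm_uniform BS by simp
          finally show "\<Psi>' P \<le> ennreal (c2 * (real N / real n) ^ r) * Lp_norm p \<Omega> P" .
        next
          fix P :: "'d pt \<Rightarrow> real" assume "P \<in> poly_space 0"
          then obtain c where "P = (\<lambda>_. c)" by (rule poly_space_0_const)
          then show "\<Psi>' P = 0" using r \<Omega>0 by (simp add: \<Psi>'_def fin_diff_const)
        qed
      qed
    qed
  next
    case False
    define pr where "pr = enn2real p"
    have pr: "1 \<le> pr" unfolding pr_def using p False by (rule one_le_enn2real)
    obtain c2 where c2: "0 < c2" "\<And>(\<Omega> :: 'd pt set) a e N (q :: complex poly) f h.
      compact \<Omega> \<Longrightarrow> norm e = 1 \<Longrightarrow> (\<lambda>y. phi_dist \<Omega> e (a + y *\<^sub>R e) * indicator \<Omega> (a + y *\<^sub>R e)) \<in> borel_measurable borel \<Longrightarrow>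
      1 \<le> N \<Longrightarrow> degree q \<le> N \<Longrightarrow> (\<And>y. poly q (of_real y) = of_real (f (a + y *\<^sub>R e))) \<Longrightarrow> 2 * real r * \<bar>h\<bar> \<le> 1 / real N \<Longrightarrow>
      (\<integral>\<^sup>+y. ennreal (\<bar>fin_diff r ((h * phi_dist \<Omega> e (a + y *\<^sub>R e)) *\<^sub>R e) f (a + y *\<^sub>R e)\<bar> powr pr) * indicator \<Omega> (a + y *\<^sub>R e) \<partial>lborel)
      \<le> ennreal ((c2 * (\<bar>h\<bar> * real N) ^ r) powr pr) * (\<integral>\<^sup>+y. ennreal (\<bar>f (a + y *\<^sub>R e)\<bar> powr pr) * indicator \<Omega> (a + y *\<^sub>R e) \<partial>lborel)"
      by (rule line_difference_le[OF pr r, where 'a = "'d pt"]) blast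
    obtain C where C: "0 < C" "\<And>p (\<Omega> :: 'd pt set) f n \<Psi> \<Psi>'. 1 \<le> n \<Longrightarrow> Lp_norm p \<Omega> f < \<infinity> \<Longrightarrow>
     (\<And>k P Q. P \<in> poly_space k \<Longrightarrow> Q \<in> poly_space k \<Longrightarrow> Lp_norm p \<Omega> (\<lambda>\<xi>. P \<xi> - Q \<xi>) \<le> Lp_norm p \<Omega> (\<lambda>\<xi>. f \<xi> - P \<xi>) + Lp_norm p \<Omega> (\<lambda>\<xi>. f \<xi> - Q \<xi>)) \<Longrightarrow>
     (\<And>k P. P \<in> poly_space k \<Longrightarrow> \<Psi> \<le> \<Psi>' P + ennreal (2 * 2 ^ r) * Lp_norm p \<Omega> (\<lambda>\<xi>. f \<xi> - P \<xi>)) \<Longrightarrow>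
     (\<And>k P Q. P \<in> poly_space k \<Longrightarrow> Q \<in> poly_space k \<Longrightarrow> \<Psi>' P \<le> \<Psi>' Q + \<Psi>' (\<lambda>\<xi>. P \<xi> - Q \<xi>)) \<Longrightarrow>
     (\<And>N P. 1 \<le> N \<Longrightarrow> real N \<le> \<kappa> * real n \<Longrightarrow> P \<in> poly_space N \<Longrightarrow> \<Psi>' P \<le> ennreal (c2 * (real N / real n) ^ r) * Lp_norm p \<Omega> P) \<Longrightarrow>
     (\<And>P. P \<in> poly_space 0 \<Longrightarrow> \<Psi>' P = 0) \<Longrightarrow>
     \<Psi> \<le> ennreal (C / real n ^ r) * (\<Sum>j=0..n. ennreal (real (j + 1) ^ (r - 1)) * best_approx p \<Omega> j f)"
      by (rule dyadic_inverse_estimate[OF \<kappa> _ c2(1) r, of "2 * 2 ^ r"]) (simp, blast)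
    show thesis
    proof (rule that[OF C(1)])
      fix n :: nat and f :: "'d pt \<Rightarrow> real" and j :: "'d option" assume n: "1 \<le> n" and f: "f \<in> Lp_space p \<Omega>"
      define e where "e = (unit_vec j :: 'd pt)"
      have e: "norm e = 1" by (simp add: e_def)
      define \<phi> where "\<phi> = (\<lambda>\<xi>. phi_dist \<Omega> e \<xi> * indicator \<Omega> \<xi>)"
      have \<phi>m[measurable]: "\<phi> \<in> borel_measurable borel" unfolding \<phi>_def by (rule borel_measurable_phi_dist[OF \<Omega> e])
      note [measurable] = \<Omega>b(1)
      show "omega_dir p \<Omega> r f (1 / real n) (unit_vec j) \<le> ennreal (C / real n ^ r) * (\<Sum>j=0..n. ennreal (real (j + 1) ^ (r - 1)) * best_approx p \<Omega> j f)"
        unfolding omega_dir_def e_def[symmetric]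
      proof (rule SUP_least)
        fix h assume "h \<in> {h. \<bar>h\<bar> \<le> min (1 / real n) 1}"
        then have h: "\<bar>h\<bar> \<le> 1 / real n" by simp
        define v where "v = (\<lambda>\<xi>. (h * \<phi> \<xi>) *\<^sub>R e)"
        have vm[measurable]: "v \<in> borel_measurable borel" unfolding v_def by measurable
        \<comment> \<open>\<open>fin_diff\<close> instead of \<open>fin_diff_on\<close>: a
          polynomial is defined everywhere, and the chord estimate bounds its difference at every
          point of \<open>\<Omega>\<close>.\<close>
        define D where "D = (\<lambda>P \<xi>. ennreal \<bar>fin_diff r (v \<xi>) P \<xi>\<bar> * indicator \<Omega> \<xi>)"
        define \<Psi>' where "\<Psi>' = (\<lambda>P. lpn pr lborel (D P))"
        have Dm[measurable]: "D P \<in> borel_measurable borel" if [measurable]: "P \<in> borel_measurable borel" for P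
          unfolding D_def fin_diff_def by measurable
        have v: "v \<xi> = (h * phi_dist \<Omega> e \<xi>) *\<^sub>R e" if "\<xi> \<in> \<Omega>" for \<xi> using that by (simp add: v_def \<phi>_def)
        \<comment> \<open>Where \<open>\<phi>\<close> vanishes, the difference is 0 anyway; these
          points are excluded because one-point chords can fill a set of positive measure, on which
          no change of variables is available.\<close>
        define V where "V = {\<xi>. \<xi> \<in> \<Omega> \<and> \<phi> \<xi> \<noteq> 0 \<and> (\<xi>, real r *\<^sub>R v \<xi>) \<in> {z. closed_segment (fst z) (fst z + snd z) \<subseteq> \<Omega>}}"
        have "{z :: 'd pt \<times> 'd pt. closed_segment (fst z) (fst z + snd z) \<subseteq> \<Omega>} \<in> sets borel"
          using closed_segment_in_closed[OF \<Omega>b(3)] by (rule borel_closed)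
        then have Vm[measurable]: "V \<in> sets borel" unfolding V_def by measurable
        have VD: "\<xi> \<in> \<Omega> \<and> phi_dist \<Omega> e \<xi> \<noteq> 0 \<and> closed_segment \<xi> (\<xi> + real r *\<^sub>R ((h * phi_dist \<Omega> e \<xi>) *\<^sub>R e)) \<subseteq> \<Omega>" if "\<xi> \<in> V" for \<xi>
          using that v[of \<xi>] by (auto simp: V_def \<phi>_def)
        show "Lp_norm p \<Omega> (\<lambda>\<xi>. fin_diff_on r ((h * phi_dist \<Omega> e \<xi>) *\<^sub>R e) f \<Omega> \<xi>)
          \<le> ennreal (C / real n ^ r) * (\<Sum>j=0..n. ennreal (real (j + 1) ^ (r - 1)) * best_approx p \<Omega> j f)"
        proof (rule C(2)[OF n fin[OF f] tri[OF f], where \<Psi>' = \<Psi>'])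
          fix k P assume P: "P \<in> (poly_space k :: ('d pt \<Rightarrow> real) set)"
          have Pm[measurable]: "P \<in> borel_measurable borel" by (rule borel_measurable_poly_space[OF P])
          obtain g where g[measurable]: "g \<in> borel_measurable borel" and gF: "\<And>\<xi>. ennreal \<bar>f \<xi> - P \<xi>\<bar> * indicator \<Omega> \<xi> \<le> g \<xi>"
            and gn: "lpn pr lborel g = lpn pr lborel (\<lambda>\<xi>. ennreal \<bar>f \<xi> - P \<xi>\<bar> * indicator \<Omega> \<xi>)"
            using borel_majorant[OF pr Lp_space_diff_measurable[OF f False \<Omega>b(2) Pm]] by blast
          define T where "T = (\<lambda>k \<xi>. ennreal (real (r choose k)) * (g (\<xi> + real k *\<^sub>R v \<xi>) * indicator V \<xi>))"
          have Tm[measurable]: "T k \<in> borel_measurable borel" for k unfolding T_def by measurable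
          have Tk: "lpn pr lborel (T k) \<le> ennreal (real (r choose k)) * (2 * lpn pr lborel g)" if k: "k \<le> r" for k
          proof -
            have "lpn pr lborel (\<lambda>\<xi>. g (\<xi> + real k *\<^sub>R v \<xi>) * indicator V \<xi>) \<le> ennreal (2 powr (1 / pr)) * lpn pr lborel g"
            proof -
              have "(\<integral>\<^sup>+\<xi>. ennreal_powr (g (\<xi> + real k *\<^sub>R v \<xi>)) pr * indicator V \<xi> \<partial>lborel) \<le> 2 * (\<integral>\<^sup>+\<xi>. ennreal_powr (g \<xi>) pr * indicator \<Omega> \<xi> \<partial>lborel)"
              proof (rule nn_integral_lines_le[where j = j])
                fix a :: "'d pt"
                show "(\<integral>\<^sup>+y. ennreal_powr (g (a + y *\<^sub>R unit_vec j + real k *\<^sub>R v (a + y *\<^sub>R unit_vec j))) pr * indicator V (a + y *\<^sub>R unit_vec j) \<partial>lborel)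
                  \<le> 2 * (\<integral>\<^sup>+y. ennreal_powr (g (a + y *\<^sub>R unit_vec j)) pr * indicator \<Omega> (a + y *\<^sub>R unit_vec j) \<partial>lborel)"
                  unfolding e_def[symmetric] v_def \<phi>_def
                  by (rule line_step_le[OF \<Omega> e k _ Vm VD borel_measurable_phi_dist[OF \<Omega> e], where H = "\<lambda>x. ennreal_powr (g x) pr"]) measurable
              qed measurable
              also have "\<dots> \<le> 2 * (\<integral>\<^sup>+\<xi>. ennreal_powr (g \<xi>) pr \<partial>lborel)"
                by (intro mult_left_mono nn_integral_mono) (auto simp: indicator_def)
              finally have "(\<integral>\<^sup>+\<xi>. ennreal_powr (g (\<xi> + real k *\<^sub>R v \<xi>) * indicator V \<xi>) pr \<partial>lborel) \<le> 2 * (\<integral>\<^sup>+\<xi>. ennreal_powr (g \<xi>) pr \<partial>lborel)"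
                by (rule order_trans[rotated]) (intro nn_integral_mono, auto simp: indicator_def)
              then show ?thesis using pr
                by (subst lpn_le_iff) (auto simp: ennreal_powr_mult powr_powr lpn_power)
            qed
            also have "\<dots> \<le> 2 * lpn pr lborel g"
            proof (intro mult_right_mono)
              have "2 powr (1 / pr) \<le> 2 powr 1" using pr by (intro powr_mono) auto
              then show "ennreal (2 powr (1 / pr)) \<le> 2" using ennreal_leI[of "2 powr (1 / pr)" 2] by simp
            qed simp
            finally have "lpn pr lborel (\<lambda>\<xi>. g (\<xi> + real k *\<^sub>R v \<xi>) * indicator V \<xi>) \<le> 2 * lpn pr lborel g" .
            moreover have "lpn pr lborel (T k) = ennreal (real (r choose k)) * lpn pr lborel (\<lambda>\<xi>. g (\<xi> + real k *\<^sub>R v \<xi>) * indicator V \<xi>)"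
              unfolding T_def by (rule lpn_cmult[OF pr]) measurable
            ultimately show ?thesis by (simp add: mult_left_mono)
          qed
          have "Lp_norm p \<Omega> (\<lambda>\<xi>. fin_diff_on r ((h * phi_dist \<Omega> e \<xi>) *\<^sub>R e) f \<Omega> \<xi>)
             = lpn pr lborel (\<lambda>\<xi>. ennreal \<bar>fin_diff_on r ((h * phi_dist \<Omega> e \<xi>) *\<^sub>R e) f \<Omega> \<xi>\<bar> * indicator \<Omega> \<xi>)"
            by (simp add: Lp_norm_lpn[OF False] lpn_lebesgue pr_def)
          also have "\<dots> \<le> lpn pr lborel (\<lambda>\<xi>. D P \<xi> + (\<Sum>k=0..r. T k \<xi>))"
          proof (rule lpn_mono[OF pr])
            fix \<xi>
            show "ennreal \<bar>fin_diff_on r ((h * phi_dist \<Omega> e \<xi>) *\<^sub>R e) f \<Omega> \<xi>\<bar> * indicator \<Omega> \<xi> \<le> D P \<xi> + (\<Sum>k=0..r. T k \<xi>)"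
            proof (cases "\<xi> \<in> \<Omega> \<and> closed_segment \<xi> (\<xi> + real r *\<^sub>R v \<xi>) \<subseteq> \<Omega> \<and> \<phi> \<xi> \<noteq> 0")
              case seg: True
              then have \<xi>V: "\<xi> \<in> V" by (simp add: V_def)
              have "ennreal \<bar>fin_diff r (v \<xi>) f \<xi>\<bar> \<le> ennreal (\<bar>fin_diff r (v \<xi>) P \<xi>\<bar> + (\<Sum>k=0..r. real (r choose k) * \<bar>f (\<xi> + real k *\<^sub>R v \<xi>) - P (\<xi> + real k *\<^sub>R v \<xi>)\<bar>))"
                by (intro ennreal_leI fin_diff_triangle)
              also have "\<dots> = ennreal \<bar>fin_diff r (v \<xi>) P \<xi>\<bar> + (\<Sum>k=0..r. ennreal (real (r choose k)) * ennreal \<bar>f (\<xi> + real k *\<^sub>R v \<xi>) - P (\<xi> + real k *\<^sub>R v \<xi>)\<bar>)"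
                by (subst ennreal_plus) (auto intro!: sum_nonneg simp: sum_ennreal simp flip: ennreal_mult)
              also have "\<dots> \<le> D P \<xi> + (\<Sum>k=0..r. T k \<xi>)"
              proof (intro add_mono sum_mono)
                show "ennreal \<bar>fin_diff r (v \<xi>) P \<xi>\<bar> \<le> D P \<xi>" using seg by (simp add: D_def)
                fix k assume "k \<in> {0..r}"
                then have "\<xi> + real k *\<^sub>R v \<xi> \<in> \<Omega>" using seg r by (intro segment_point) auto
                then show "ennreal (real (r choose k)) * ennreal \<bar>f (\<xi> + real k *\<^sub>R v \<xi>) - P (\<xi> + real k *\<^sub>R v \<xi>)\<bar> \<le> T k \<xi>"
                  using gF[of "\<xi> + real k *\<^sub>R v \<xi>"] \<xi>V by (simp add: T_def mult_left_mono)
              qed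
              finally show ?thesis using seg v[of \<xi>] by (simp add: fin_diff_on_def)
            next
              case nseg: False
              show ?thesis
              proof (cases "\<xi> \<in> \<Omega> \<and> closed_segment \<xi> (\<xi> + real r *\<^sub>R v \<xi>) \<subseteq> \<Omega>")
                case True
                then have "\<phi> \<xi> = 0" using nseg by blast
                then have "phi_dist \<Omega> e \<xi> = 0" using True by (simp add: \<phi>_def)
                then show ?thesis using fin_diff_0[OF r, of f \<xi>] by (simp add: fin_diff_on_def)
              next
                case False
                then show ?thesis using v[of \<xi>] by (cases "\<xi> \<in> \<Omega>") (auto simp: fin_diff_on_def)
              qed
            qed
          qed
          also have "\<dots> \<le> lpn pr lborel (D P) + lpn pr lborel (\<lambda>\<xi>. \<Sum>k=0..r. T k \<xi>)"
            by (rule lpn_add[OF pr]) measurable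
          also have "\<dots> \<le> lpn pr lborel (D P) + (\<Sum>k=0..r. lpn pr lborel (T k))"
            by (intro add_left_mono lpn_sum[OF pr]) measurable
          also have "\<dots> \<le> lpn pr lborel (D P) + (\<Sum>k=0..r. ennreal (real (r choose k)) * (2 * lpn pr lborel g))"
            using Tk by (intro add_left_mono sum_mono) auto
          also have "\<dots> = \<Psi>' P + ennreal (2 * 2 ^ r) * Lp_norm p \<Omega> (\<lambda>\<xi>. f \<xi> - P \<xi>)"
            by (simp only: sum_binomial_ennreal \<Psi>'_def gn Lp_norm_lpn[OF False] lpn_lebesgue pr_def[symmetric])
               (simp add: ennreal_mult mult_ac)
          finally show "Lp_norm p \<Omega> (\<lambda>\<xi>. fin_diff_on r ((h * phi_dist \<Omega> e \<xi>) *\<^sub>R e) f \<Omega> \<xi>) \<le> \<Psi>' P + ennreal (2 * 2 ^ r) * Lp_norm p \<Omega> (\<lambda>\<xi>. f \<xi> - P \<xi>)" .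
        next
          fix k and P Q :: "'d pt \<Rightarrow> real" assume PQ: "P \<in> poly_space k" "Q \<in> poly_space k"
          note [measurable] = PQ[THEN borel_measurable_poly_space]
          have "lpn pr lborel (D P) \<le> lpn pr lborel (\<lambda>\<xi>. D Q \<xi> + D (\<lambda>\<xi>. P \<xi> - Q \<xi>) \<xi>)"
          proof (rule lpn_mono[OF pr])
            fix \<xi>
            let ?D = "\<lambda>P. ennreal \<bar>fin_diff r (v \<xi>) P \<xi>\<bar>"
            have "?D P \<le> ?D Q + ?D (\<lambda>\<xi>. P \<xi> - Q \<xi>)"
              unfolding fin_diff_diff by (rule ennreal_abs_le_add) linarith
            then show "D P \<xi> \<le> D Q \<xi> + D (\<lambda>\<xi>. P \<xi> - Q \<xi>) \<xi>" by (auto simp: D_def indicator_def)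
          qed
          also have "\<dots> \<le> lpn pr lborel (D Q) + lpn pr lborel (D (\<lambda>\<xi>. P \<xi> - Q \<xi>))"
            by (rule lpn_add[OF pr]) measurable
          finally show "\<Psi>' P \<le> \<Psi>' Q + \<Psi>' (\<lambda>\<xi>. P \<xi> - Q \<xi>)" by (simp add: \<Psi>'_def)
        next
          fix N and P :: "'d pt \<Rightarrow> real" assume N: "1 \<le> N" "real N \<le> \<kappa> * real n" and P: "P \<in> poly_space N"
          have Pm[measurable]: "P \<in> borel_measurable borel" by (rule borel_measurable_poly_space[OF P])
          let ?c = "c2 * (\<bar>h\<bar> * real N) ^ r"
          have dm[measurable]: "(\<lambda>\<xi>. fin_diff r (v \<xi>) P \<xi>) \<in> borel_measurable borel" unfolding fin_diff_def by measurable
          have "(\<integral>\<^sup>+\<xi>. ennreal_powr (D P \<xi>) pr \<partial>lborel) = (\<integral>\<^sup>+\<xi>. ennreal (\<bar>fin_diff r (v \<xi>) P \<xi>\<bar> powr pr) * indicator \<Omega> \<xi> \<partial>lborel)"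
            by (intro nn_integral_cong) (auto simp: D_def indicator_def)
          also have "\<dots> \<le> ennreal (?c powr pr) * (\<integral>\<^sup>+\<xi>. ennreal (\<bar>P \<xi>\<bar> powr pr) * indicator \<Omega> \<xi> \<partial>lborel)"
          proof (rule nn_integral_lines_le[where j = j])
            fix a :: "'d pt"
            obtain q :: "complex poly" where q: "degree q \<le> N" "\<And>y. poly q (of_real y) = of_real (P (a + y *\<^sub>R e))"
              by (rule poly_space_line[OF P]) blast
            have [measurable]: "(\<lambda>y::real. a + y *\<^sub>R e) \<in> borel_measurable borel"
              by (intro borel_measurable_continuous_onI continuous_intros)
            have "(\<lambda>y. phi_dist \<Omega> e (a + y *\<^sub>R e) * indicator \<Omega> (a + y *\<^sub>R e)) \<in> borel_measurable borel"
              by (rule measurable_compose[OF _ borel_measurable_phi_dist[OF \<Omega> e]]) measurable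
            note c2(2)[OF \<Omega> e this N(1) q step_ok[OF h N(1) n N(2)]]
            moreover have "(\<integral>\<^sup>+y. ennreal (\<bar>fin_diff r (v (a + y *\<^sub>R e)) P (a + y *\<^sub>R e)\<bar> powr pr) * indicator \<Omega> (a + y *\<^sub>R e) \<partial>lborel)
               = (\<integral>\<^sup>+y. ennreal (\<bar>fin_diff r ((h * phi_dist \<Omega> e (a + y *\<^sub>R e)) *\<^sub>R e) P (a + y *\<^sub>R e)\<bar> powr pr) * indicator \<Omega> (a + y *\<^sub>R e) \<partial>lborel)"
              using v by (intro nn_integral_cong) (auto simp: indicator_def)
            ultimately show "(\<integral>\<^sup>+y. ennreal (\<bar>fin_diff r (v (a + y *\<^sub>R unit_vec j)) P (a + y *\<^sub>R unit_vec j)\<bar> powr pr) * indicator \<Omega> (a + y *\<^sub>R unit_vec j) \<partial>lborel)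
                \<le> ennreal (?c powr pr) * (\<integral>\<^sup>+y. ennreal (\<bar>P (a + y *\<^sub>R unit_vec j)\<bar> powr pr) * indicator \<Omega> (a + y *\<^sub>R unit_vec j) \<partial>lborel)"
              by (simp add: e_def[symmetric])
          qed measurable
          also have "(\<integral>\<^sup>+\<xi>. ennreal (\<bar>P \<xi>\<bar> powr pr) * indicator \<Omega> \<xi> \<partial>lborel) = (\<integral>\<^sup>+\<xi>. ennreal_powr (ennreal \<bar>P \<xi>\<bar> * indicator \<Omega> \<xi>) pr \<partial>lborel)"
            by (intro nn_integral_cong) (auto simp: indicator_def)
          finally have "\<Psi>' P \<le> ennreal ?c * Lp_norm p \<Omega> P"
            unfolding \<Psi>'_def using pr c2(1)
            by (subst lpn_le_iff) (auto simp: ennreal_powr_mult lpn_power Lp_norm_lpn[OF False] lpn_lebesgue pr_def[symmetric])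
          also have "\<dots> \<le> ennreal (c2 * (real N / real n) ^ r) * Lp_norm p \<Omega> P"
            using hN[OF h n, of N] c2(1) by (intro mult_right_mono ennreal_leI mult_left_mono) auto
          finally show "\<Psi>' P \<le> ennreal (c2 * (real N / real n) ^ r) * Lp_norm p \<Omega> P" .
        next
          fix P :: "'d pt \<Rightarrow> real" assume "P \<in> poly_space 0"
          then obtain c where "P = (\<lambda>_. c)" by (rule poly_space_0_const)
          then have "D P = (\<lambda>\<xi>. 0)" using r by (simp add: D_def fin_diff_const)
          then show "\<Psi>' P = 0" by (simp add: \<Psi>'_def lpn_0[OF pr])
        qed
      qed
    qed
  qed
qed

section \<open>The tangential part\<close>

lemma complex_extension_place:
  assumes Pc: "complex_extension N P Pc"
  shows "complex_extension N (P \<circ> sd_place G) (\<lambda>Z. Pc (\<lambda>k. of_real (sd_sign G k) * (of_real (coord (sd_perm G k) (sd_zeta G)) + Z (sd_perm G k))))"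
  unfolding complex_extension_def
proof (intro conjI allI impI)
  show "continuous_on UNIV (\<lambda>Z. Pc (\<lambda>k. of_real (sd_sign G k) * (of_real (coord (sd_perm G k) (sd_zeta G)) + Z (sd_perm G k))))"
    by (intro continuous_complex_extension[OF Pc] continuous_intros continuous_on_product_coordinates)
  fix \<xi>
  have "of_real (sd_sign G k) * (of_real (coord (sd_perm G k) (sd_zeta G)) + of_real (coord (sd_perm G k) \<xi>)) = complex_of_real (coord k (sd_place G \<xi>))" for k
    by (simp add: sd_place_isometry coord_isometry_def)
  then show "Pc (\<lambda>k. of_real (sd_sign G k) * (of_real (coord (sd_perm G k) (sd_zeta G)) + of_real (coord (sd_perm G k) \<xi>))) = of_real ((P \<circ> sd_place G) \<xi>)"
    using complex_extension_real[OF Pc, of "sd_place G \<xi>"] by simp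
next
  fix m and A :: "'a option \<Rightarrow> complex poly" assume A: "\<forall>k. degree (A k) \<le> m"
  define A' where "A' = (\<lambda>k. smult (of_real (sd_sign G k)) ([:of_real (coord (sd_perm G k) (sd_zeta G)):] + A (sd_perm G k)))"
  have "degree (A' k) \<le> m" for k
    unfolding A'_def using A by (intro order_trans[OF degree_smult_le] degree_add_le) auto
  then obtain Q where "degree Q \<le> m * N" "\<And>z. poly Q z = Pc (\<lambda>k. poly (A' k) z)"
    using complex_extension_curve[OF Pc, of A' m] by metis
  then show "\<exists>Q. degree Q \<le> m * N \<and> (\<forall>z. poly Q z = Pc (\<lambda>k. of_real (sd_sign G k) * (of_real (coord (sd_perm G k) (sd_zeta G)) + poly (A (sd_perm G k)) z)))"
    by (intro exI[of _ Q]) (simp add: A'_def)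
qed

section \<open>Calculus of the graph function\<close>

lemma mem_cube: "x \<in> cube b \<longleftrightarrow> (\<forall>i. - b < x $ i \<and> x $ i < b)"
  by (simp add: mem_box_cart)

lemma mem_closed_cube: "x \<in> closed_cube b \<longleftrightarrow> (\<forall>i. - b \<le> x $ i \<and> x $ i \<le> b)"
  by (simp add: mem_box_cart)

lemma C1_fun_has_derivative:
  "C1_fun g \<Longrightarrow> (g has_derivative frechet_derivative g (at x)) (at x)"
  unfolding C1_fun_def by (simp add: frechet_derivative_works[symmetric])

lemma C1_fun_continuous: "C1_fun g \<Longrightarrow> continuous_on A g"
  unfolding C1_fun_def by (meson continuous_at_imp_continuous_on differentiable_imp_continuous_within)

lemma frechet_derivative_partial:
  assumes "C1_fun g"
  shows "frechet_derivative g (at x) v = (\<Sum>i\<in>UNIV. v $ i * partial i g x)"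
proof -
  have lin: "linear (frechet_derivative g (at x))"
    using C1_fun_has_derivative[OF assms, of x] has_derivative_linear by blast
  have "frechet_derivative g (at x) v = frechet_derivative g (at x) (\<Sum>i\<in>UNIV. v $ i *\<^sub>R axis i 1)"
    by (simp add: basis_expansion scalar_mult_eq_scaleR[symmetric])
  also have "\<dots> = (\<Sum>i\<in>UNIV. v $ i * partial i g x)"
    by (simp add: linear_sum[OF lin] linear_scale[OF lin] partial_def)
  finally show ?thesis .
qed

lemma partials_bounded:
  assumes "C1_fun (g :: real ^ ('d::finite) \<Rightarrow> real)"
  obtains B where "0 < B" "\<And>i x. x \<in> closed_cube R \<Longrightarrow> \<bar>partial i g x\<bar> \<le> B"
proof -
  have "\<exists>B. \<forall>x\<in>closed_cube R. \<bar>partial i g x\<bar> \<le> B" for i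
  proof -
    have "compact (partial i g ` closed_cube R)"
      using assms unfolding C1_fun_def by (intro compact_continuous_image compact_cbox) (auto intro: continuous_on_subset)
    then show ?thesis using compact_imp_bounded[of "partial i g ` closed_cube R"] by (auto simp: bounded_iff)
  qed
  then obtain B where B: "\<And>i x. x \<in> closed_cube R \<Longrightarrow> \<bar>partial i g x\<bar> \<le> B i" by metis
  show thesis
  proof (rule that[of "(\<Sum>i\<in>UNIV. \<bar>B i\<bar>) + 1"])
    show "0 < (\<Sum>i\<in>UNIV. \<bar>B i\<bar>) + 1" by (intro add_nonneg_pos sum_nonneg) auto
    fix i and x :: "real ^ 'd" assume "x \<in> closed_cube R"
    then have "\<bar>partial i g x\<bar> \<le> \<bar>B i\<bar>" using B[of x i] by simp
    also have "\<dots> \<le> (\<Sum>i\<in>UNIV. \<bar>B i\<bar>)" by (rule member_le_sum) auto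
    finally show "\<bar>partial i g x\<bar> \<le> (\<Sum>i\<in>UNIV. \<bar>B i\<bar>) + 1" by simp
  qed
qed

lemma C1_fun_lipschitz:
  assumes g: "C1_fun (g :: real ^ ('d::finite) \<Rightarrow> real)"
  obtains M where "0 < M" "\<And>x y. x \<in> closed_cube R \<Longrightarrow> y \<in> closed_cube R \<Longrightarrow> \<bar>g x - g y\<bar> \<le> M * norm (x - y)"
proof -
  obtain B where B: "0 < B" "\<And>i x. x \<in> closed_cube R \<Longrightarrow> \<bar>partial i g x\<bar> \<le> B" by (rule partials_bounded[OF g]) blast
  define M where "M = real CARD('d) * B"
  have M: "0 < M" using B by (simp add: M_def)
  show thesis
  proof (rule that[OF M])
    fix x y :: "real ^ 'd" assume xy: "x \<in> closed_cube R" "y \<in> closed_cube R"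
    have "norm (g x - g y) \<le> M * norm (x - y)"
    proof (rule differentiable_bound[where f' = "\<lambda>x. frechet_derivative g (at x)"])
      show "convex (closed_cube R :: (real ^ 'd) set)" by (rule convex_box)
      fix z :: "real ^ 'd" assume z: "z \<in> closed_cube R"
      show "(g has_derivative frechet_derivative g (at z)) (at z within closed_cube R)"
        by (rule has_derivative_at_withinI[OF C1_fun_has_derivative[OF g]])
      show "onorm (frechet_derivative g (at z)) \<le> M"
      proof (rule onorm_bound)
        fix v
        have "norm (frechet_derivative g (at z) v) \<le> (\<Sum>i\<in>UNIV. norm (v $ i * partial i g z))"
          unfolding frechet_derivative_partial[OF g] by (rule norm_sum)
        also have "\<dots> \<le> (\<Sum>i\<in>(UNIV :: 'd set). norm v * B)"
          using B(2)[OF z] component_le_norm_cart[of v] by (intro sum_mono) (auto simp: abs_mult intro!: mult_mono)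
        finally show "norm (frechet_derivative g (at z) v) \<le> M * norm v" by (simp add: M_def mult_ac)
      qed (use M in auto)
    qed (use xy in auto)
    then show "\<bar>g x - g y\<bar> \<le> M * norm (x - y)" by simp
  qed
qed

lemma partial_has_derivative:
  assumes "C1_fun g"
  shows "((\<lambda>v. g (x + v *\<^sub>R axis j 1)) has_real_derivative partial j g (x + v *\<^sub>R axis j 1)) (at v)"
proof -
  have "((\<lambda>v. x + v *\<^sub>R axis j 1) has_derivative (\<lambda>h. h *\<^sub>R axis j 1)) (at v)"
    by (auto intro!: derivative_eq_intros)
  from has_derivative_compose[OF this C1_fun_has_derivative[OF assms]]
  have "((\<lambda>v. g (x + v *\<^sub>R axis j 1)) has_derivative (\<lambda>h. frechet_derivative g (at (x + v *\<^sub>R axis j 1)) (h *\<^sub>R axis j 1))) (at v)" .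
  moreover have "frechet_derivative g (at (x + v *\<^sub>R axis j 1)) (h *\<^sub>R axis j 1) = partial j g (x + v *\<^sub>R axis j 1) * h" for h
  proof -
    have "linear (frechet_derivative g (at (x + v *\<^sub>R axis j 1)))"
      using C1_fun_has_derivative[OF assms] has_derivative_linear by blast
    then show ?thesis by (simp add: linear_scale partial_def)
  qed
  ultimately show ?thesis by (simp add: has_field_derivative_def)
qed

text \<open>One \<open>M\<close> for both bounds, since it will serve as the coefficient of the
  quadratic term of the parabola and as the Lipschitz constant that compares
  \<open>\<xi>\<^sub>j(u)\<close> with \<open>\<xi>\<^sub>j(x)\<close>.\<close>

lemma C2_fun_taylor:
  assumes g: "C2_fun (g :: real ^ ('d::finite) \<Rightarrow> real)"
  obtains M where "0 < M"
    "\<And>x y j. x \<in> closed_cube R \<Longrightarrow> y \<in> closed_cube R \<Longrightarrow> \<bar>partial j g x - partial j g y\<bar> \<le> M * norm (x - y)"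
    "\<And>x v j. x \<in> closed_cube R \<Longrightarrow> x + v *\<^sub>R axis j 1 \<in> closed_cube R \<Longrightarrow> \<bar>g (x + v *\<^sub>R axis j 1) - g x - v * partial j g x\<bar> \<le> M * v\<^sup>2"
proof -
  have g1: "C1_fun g" and gj: "\<And>j. C1_fun (partial j g)" using g by (auto simp: C2_fun_def)
  have "\<exists>M>0. \<forall>x\<in>closed_cube R. \<forall>y\<in>closed_cube R. \<bar>partial j g x - partial j g y\<bar> \<le> M * norm (x - y)" for j
    using C1_fun_lipschitz[OF gj[of j], of R] by metis
  then obtain Mj where Mj: "\<And>j. 0 < Mj j" "\<And>j x y. x \<in> closed_cube R \<Longrightarrow> y \<in> closed_cube R \<Longrightarrow> \<bar>partial j g x - partial j g y\<bar> \<le> Mj j * norm (x - y)"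
    by metis
  define M where "M = (\<Sum>j\<in>UNIV. Mj j)"
  have le: "Mj j \<le> M" for j unfolding M_def using less_imp_le[OF Mj(1)] by (intro member_le_sum) auto
  have M: "0 < M" using Mj(1) le by (metis less_le_trans)
  have lip: "\<bar>partial j g x - partial j g y\<bar> \<le> M * norm (x - y)" if "x \<in> closed_cube R" "y \<in> closed_cube R" for x y j
    using Mj(2)[OF that, of j] mult_right_mono[OF le[of j], of "norm (x - y)"] by simp
  show thesis
  proof (rule that[OF M lip])
    fix x :: "real ^ 'd" and v j assume x: "x \<in> closed_cube R" "x + v *\<^sub>R axis j 1 \<in> closed_cube R"
    define F where "F = (\<lambda>u. g (x + u *\<^sub>R axis j 1) - u * partial j g x)"
    have "norm (F v - F 0) \<le> (M * \<bar>v\<bar>) * norm (v - 0)"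
    proof (rule field_differentiable_bound[where f' = "\<lambda>u. partial j g (x + u *\<^sub>R axis j 1) - partial j g x" and S = "closed_segment 0 v"])
      fix u :: real assume u: "u \<in> closed_segment 0 v"
      show "(F has_field_derivative partial j g (x + u *\<^sub>R axis j 1) - partial j g x) (at u within closed_segment 0 v)"
        unfolding F_def
        by (rule has_field_derivative_at_within)
           (intro DERIV_diff partial_has_derivative[OF g1], auto intro!: derivative_eq_intros)
      have "x + u *\<^sub>R axis j 1 \<in> closed_segment (x + 0 *\<^sub>R axis j 1) (x + v *\<^sub>R axis j 1)"
        unfolding line_segment_image[symmetric] using u by blast
      also have "\<dots> \<subseteq> closed_cube R" using x by (intro closed_segment_subset convex_box) auto
      finally have "\<bar>partial j g (x + u *\<^sub>R axis j 1) - partial j g x\<bar> \<le> M * norm (x + u *\<^sub>R axis j 1 - x)"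
        using x by (intro lip)
      also have "\<dots> = M * \<bar>u\<bar>" by simp
      also have "\<dots> \<le> M * \<bar>v\<bar>"
        using u M by (intro mult_left_mono) (auto simp: closed_segment_eq_real_ivl split: if_splits)
      finally show "norm (partial j g (x + u *\<^sub>R axis j 1) - partial j g x) \<le> M * \<bar>v\<bar>" by simp
    qed auto
    then show "\<bar>g (x + v *\<^sub>R axis j 1) - g x - v * partial j g x\<bar> \<le> M * v\<^sup>2"
      by (simp add: F_def algebra_simps power2_eq_square abs_mult_self_eq)
  qed
qed

lemma C2_fun_continuous:
  assumes "C2_fun g" shows "continuous_on A g" "continuous_on A (partial j g)"
  using assms unfolding C2_fun_def by (auto intro: C1_fun_continuous)

lemma fst_tangent_vec [simp]: "fst (tangent_vec g j u) = axis j 1"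
  by (simp add: tangent_vec_def unit_vec_def)

lemma coord_tangent_vec: "coord k (tangent_vec g j u) = (case k of None \<Rightarrow> partial j g u | Some i \<Rightarrow> if i = j then 1 else 0)"
  by (cases k) (auto simp: tangent_vec_def coord_unit_vec)

text \<open>The parabola \<open>v \<mapsto> paraboloid_point M g j x v w\<close> touches the direction \<open>\<xi>\<^sub>j(x)\<close> at \<open>v = 0\<close> and bends
  downwards fast enough to stay below the graph of \<open>g\<close>.\<close>

definition paraboloid_point :: "real \<Rightarrow> (real ^ ('d::finite) \<Rightarrow> real) \<Rightarrow> 'd \<Rightarrow> real ^ 'd \<Rightarrow> real \<Rightarrow> real \<Rightarrow> 'd pt" where
  "paraboloid_point M g j x v w = (x + v *\<^sub>R axis j 1, g x + v * partial j g x - M * v\<^sup>2 - w)"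

definition paraboloid_coord :: "real \<Rightarrow> (real ^ ('d::finite) \<Rightarrow> real) \<Rightarrow> 'd \<Rightarrow> real ^ 'd \<Rightarrow> complex \<Rightarrow> complex \<Rightarrow> 'd option \<Rightarrow> complex" where
  "paraboloid_coord M g j x v w k = (case k of
      None \<Rightarrow> of_real (g x) + v * of_real (partial j g x) - of_real M * v\<^sup>2 - w
    | Some i \<Rightarrow> of_real (x $ i) + (if i = j then v else 0))"

lemma paraboloid_coord_of_real:
  "paraboloid_coord M g j x (of_real v) (of_real w) k = of_real (coord k (paraboloid_point M g j x v w))"
  by (cases k) (auto simp: paraboloid_coord_def paraboloid_point_def coord_def axis_def)

text \<open>The complexified line through \<open>(x, y)\<close> in direction
  \<open>\<xi>\<^sub>j(u)\<close> is the parabola over \<open>x\<close> at the complex parameter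
  \<open>z\<close>, with a depth that differs from the real depth \<open>g x - y\<close> by a term
  linear in \<open>z\<close> times the variation of the slope, minus \<open>M * z\<^sup>2\<close>.
  Both are of order \<open>1 / N^2\<close> when \<open>z\<close> and \<open>u - x\<close> are of
  order \<open>1 / N\<close>.\<close>

lemma tangent_curve_paraboloid:
  "of_real (coord k (x, y)) + z * of_real (coord k (tangent_vec g j u))
    = paraboloid_coord M g j x z (of_real (g x - y) + (z * of_real (partial j g x - partial j g u) - of_real M * z\<^sup>2)) k"
  unfolding coord_tangent_vec by (cases k) (auto simp: paraboloid_coord_def coord_def algebra_simps)

text \<open>Degree \<open>2 * N\<close>, as the parabola is quadratic in \<open>v\<close>. The scale
  \<open>c\<close> will map \<open>{-1..1}\<close> onto the parameters for which the parabola stays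
  in the starred domain.\<close>

lemma paraboloid_curve_v:
  assumes "complex_extension N P Pc"
  obtains Q where "degree Q \<le> 2 * N" "\<And>v. poly Q v = Pc (paraboloid_coord M g j x (of_real c * v) w)"
proof -
  define A where "A = (\<lambda>k. case k of None \<Rightarrow> [:of_real (g x) - w, of_real (c * partial j g x), - of_real (M * c\<^sup>2):]
    | Some i \<Rightarrow> [:of_real (x $ i), if i = j then of_real c else (0::complex):])"
  have "degree (A k) \<le> 2" for k by (cases k) (auto simp: A_def intro: order_trans[OF degree_pCons_le])
  then obtain Q where Q: "degree Q \<le> 2 * N" "\<And>v. poly Q v = Pc (\<lambda>k. poly (A k) v)"
    using complex_extension_curve[OF assms, of A 2] by metis
  have "poly (A k) v = paraboloid_coord M g j x (of_real c * v) w k" for k v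
    by (cases k) (auto simp: A_def paraboloid_coord_def algebra_simps power2_eq_square)
  with Q show thesis by (intro that[of Q]) auto
qed

lemma paraboloid_curve_w:
  assumes "complex_extension N P Pc"
  obtains Q where "degree Q \<le> N" "\<And>w. poly Q w = Pc (paraboloid_coord M g j x v w)"
proof -
  define A where "A = (\<lambda>k. case k of None \<Rightarrow> [:of_real (g x) + v * of_real (partial j g x) - of_real M * v\<^sup>2, - 1:]
    | Some i \<Rightarrow> [:of_real (x $ i) + (if i = j then v else (0::complex)):])"
  have "degree (A k) \<le> 1" for k by (cases k) (auto simp: A_def)
  then obtain Q where Q: "degree Q \<le> 1 * N" "\<And>v. poly Q v = Pc (\<lambda>k. poly (A k) v)"
    using complex_extension_curve[OF assms, of A 1] by metis
  have "poly (A k) w = paraboloid_coord M g j x v w k" for k w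
    by (cases k) (auto simp: A_def paraboloid_coord_def algebra_simps)
  with Q show thesis by (intro that[of Q]) auto
qed

lemma tangent_curve_poly:
  assumes "complex_extension N P Pc"
  obtains H where "degree H \<le> N" "\<And>z. poly H z = Pc (\<lambda>k. of_real (coord k \<xi>) + z * of_real (coord k \<eta>))"
    "\<And>s. poly H (of_real s) = of_real (P (\<xi> + s *\<^sub>R \<eta>))"
proof -
  define A where "A = (\<lambda>k. [:complex_of_real (coord k \<xi>), of_real (coord k \<eta>):])"
  have "degree (A k) \<le> 1" for k by (simp add: A_def)
  then obtain Q where Q: "degree Q \<le> 1 * N" "\<And>z. poly Q z = Pc (\<lambda>k. poly (A k) z)"
    using complex_extension_curve[OF assms, of A 1] by metis
  have "poly Q (of_real s) = of_real (P (\<xi> + s *\<^sub>R \<eta>))" for s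
    using complex_extension_real[OF assms, of "\<xi> + s *\<^sub>R \<eta>"] by (simp add: Q(2) A_def)
  with Q show thesis by (intro that[of Q]) (auto simp: A_def)
qed

text \<open>The Taylor bound with the same \<open>M\<close> keeps the parabola below the graph, and
  a depth \<open>w \<ge> 0\<close> only lowers it. For \<open>\<bar>v\<bar> \<le> c\<close> it falls
  by at most \<open>b\<close>, which fits between the depth \<open>L * b\<close> of
  \<open>model_set\<close> and the depth \<open>4 * L * b\<close> of
  \<open>model_star\<close>.\<close>

lemma paraboloid_in_star:
  assumes g: "C2_fun (g :: real ^ ('d::finite) \<Rightarrow> real)" and b: "0 < b" and L: "1 \<le> L"
  obtains M c where "0 < M" "0 < c"
    "\<And>x y j. x \<in> cube b \<Longrightarrow> y \<in> cube b \<Longrightarrow> \<bar>partial j g x - partial j g y\<bar> \<le> M * norm (x - y)"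
    "\<And>x v w j. x \<in> cube b \<Longrightarrow> \<bar>v\<bar> \<le> c \<Longrightarrow> 0 \<le> w \<Longrightarrow> w \<le> L * b \<Longrightarrow> paraboloid_point M g j x v w \<in> model_star b L g"
proof -
  obtain M where M: "0 < M"
    "\<And>x y j. x \<in> closed_cube (2 * b) \<Longrightarrow> y \<in> closed_cube (2 * b) \<Longrightarrow> \<bar>partial j g x - partial j g y\<bar> \<le> M * norm (x - y)"
    "\<And>x v j. x \<in> closed_cube (2 * b) \<Longrightarrow> x + v *\<^sub>R axis j 1 \<in> closed_cube (2 * b) \<Longrightarrow> \<bar>g (x + v *\<^sub>R axis j 1) - g x - v * partial j g x\<bar> \<le> M * v\<^sup>2"
    by (rule C2_fun_taylor[OF g, of "2 * b"]) blast
  have g1: "C1_fun g" using g by (simp add: C2_fun_def)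
  obtain B where B: "0 < B" "\<And>i x. x \<in> closed_cube (2 * b) \<Longrightarrow> \<bar>partial i g x\<bar> \<le> B"
    by (rule partials_bounded[OF g1, of "2 * b"]) blast
  \<comment> \<open>\<open>c \<le> b\<close> keeps the base point in the doubled cube;
    \<open>c * (B + M * b) \<le> b\<close> bounds the fall of the parabola.\<close>
  define c where "c = min b (b / (B + M * b))"
  have den: "0 < B + M * b" using B M b by (simp add: add_pos_pos)
  have c: "0 < c" "c \<le> b" using b den by (auto simp: c_def)
  have "c \<le> b / (B + M * b)" by (simp add: c_def)
  then have cB: "c * (B + M * b) \<le> b" using den by (simp add: pos_le_divide_eq)
  have sub: "x \<in> closed_cube (2 * b)" if "x \<in> cube b" for x :: "real ^ 'd"
    unfolding mem_closed_cube
  proof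
    fix i
    have "- b < x $ i" "x $ i < b" using that by (auto simp: mem_cube)
    then show "- (2 * b) \<le> x $ i \<and> x $ i \<le> 2 * b" using b by linarith
  qed
  show thesis
  proof (rule that[OF M(1) c(1)])
    fix x y :: "real ^ 'd" and j assume "x \<in> cube b" "y \<in> cube b"
    then show "\<bar>partial j g x - partial j g y\<bar> \<le> M * norm (x - y)" by (intro M(2) sub)
  next
    fix x :: "real ^ 'd" and v w j assume x: "x \<in> cube b" and v: "\<bar>v\<bar> \<le> c" and w: "0 \<le> w" "w \<le> L * b"
    have xv: "- (2 * b) < (x + v *\<^sub>R axis j 1) $ i \<and> (x + v *\<^sub>R axis j 1) $ i < 2 * b" for i
    proof -
      have "- b < x $ i" "x $ i < b" using x by (auto simp: mem_cube)
      moreover have "\<bar>(v *\<^sub>R axis j 1 :: real ^ 'd) $ i\<bar> \<le> b" using v c b by (auto simp: axis_def)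
      ultimately show ?thesis unfolding vector_add_component by linarith
    qed
    have xc: "x + v *\<^sub>R axis j 1 \<in> closed_cube (2 * b)" unfolding mem_closed_cube using xv by (auto intro: less_imp_le)
    have "\<bar>g (x + v *\<^sub>R axis j 1) - g x - v * partial j g x\<bar> \<le> M * v\<^sup>2" by (rule M(3)[OF sub[OF x] xc])
    then have up: "g x + v * partial j g x - M * v\<^sup>2 - w \<le> g (x + v *\<^sub>R axis j 1)" using w by linarith
    have bd: "bdd_below (g ` closed_cube (2 * b))"
      by (intro bounded_imp_bdd_below compact_imp_bounded compact_continuous_image C2_fun_continuous[OF g] compact_cbox)
    have inf: "(INF u\<in>closed_cube (2 * b). g u) \<le> g x" by (rule cINF_lower[OF bd sub[OF x]])
    have "\<bar>v * partial j g x\<bar> \<le> c * B" unfolding abs_mult using v B(2)[OF sub[OF x], of j] c by (intro mult_mono) auto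
    moreover have "M * v\<^sup>2 \<le> M * (c * b)"
    proof -
      have "v\<^sup>2 = \<bar>v\<bar> * \<bar>v\<bar>" by (simp add: power2_eq_square)
      also have "\<dots> \<le> c * b" using v c by (intro mult_mono) auto
      finally show ?thesis using M by (intro mult_left_mono) auto
    qed
    moreover have "c * B + M * (c * b) \<le> b" using cB by (simp add: algebra_simps)
    moreover have "b \<le> L * b" using L b by simp
    moreover have "0 < L * b" using L b by simp
    ultimately have "(INF u\<in>closed_cube (2 * b). g u) - 4 * L * b < g x + v * partial j g x - M * v\<^sup>2 - w"
      using inf w by linarith
    then show "paraboloid_point M g j x v w \<in> model_star b L g"
      using up xv unfolding paraboloid_point_def model_star_def by (simp add: mem_cube del: vector_add_component)
  qed
qed

section \<open>The averaging measure of the tangential modulus\<close>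

lemma borel_measurable_fst_snd [measurable]:
  "(fst :: 'a::second_countable_topology \<times> 'b::second_countable_topology \<Rightarrow> 'a) \<in> borel_measurable borel"
  "(snd :: 'a \<times> 'b \<Rightarrow> 'b) \<in> borel_measurable borel"
  by (intro borel_measurable_continuous_onI continuous_intros)+

lemma sets_model_set:
  assumes "C2_fun g" shows "model_set b L g \<in> sets borel"
proof -
  have [measurable]: "g \<in> borel_measurable borel"
    by (intro borel_measurable_continuous_onI C2_fun_continuous[OF assms])
  have "model_set b L g = {\<xi> \<in> space borel. fst \<xi> \<in> cube b \<and> g (fst \<xi>) - L * b < snd \<xi> \<and> snd \<xi> \<le> g (fst \<xi>)}"
    by (auto simp: model_set_def)
  also have "\<dots> \<in> sets borel" by measurable
  finally show ?thesis .
qed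

lemma continuous_on_tangent_vec:
  assumes "C2_fun g" "continuous_on A f" shows "continuous_on A (\<lambda>z. tangent_vec g j (f z))"
  unfolding tangent_vec_def
  by (intro continuous_intros continuous_on_compose2[OF C2_fun_continuous(2)[OF assms(1), of UNIV]] assms(2)) auto

definition tan_weight :: "real \<Rightarrow> real \<Rightarrow> (real ^ ('d::finite) \<Rightarrow> real) \<Rightarrow> real \<Rightarrow> 'd pt \<times> (real ^ 'd) \<Rightarrow> ennreal" where
  "tan_weight b L g t z = indicator (model_set b L g) (fst z) * (ennreal (1 / (b * t) ^ CARD('d)) * indicator (tangent_nbhd b t (fst (fst z))) (snd z))"

text \<open>One measure on the pairs \<open>(\<xi>, u)\<close>, so that an iterated integral as in
  the tangential modulus becomes a single norm \<open>lpn\<close> and Minkowski's inequality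
  applies.\<close>

definition tan_measure :: "real \<Rightarrow> real \<Rightarrow> (real ^ ('d::finite) \<Rightarrow> real) \<Rightarrow> real \<Rightarrow> ('d pt \<times> (real ^ 'd)) measure" where
  "tan_measure b L g t = density (lborel \<Otimes>\<^sub>M lborel) (tan_weight b L g t)"

lemma borel_measurable_nbhd [measurable]:
  "(\<lambda>z. indicator (tangent_nbhd b t (fst (fst z))) (snd z) :: ennreal) \<in> borel_measurable (borel :: ((('d::finite) pt) \<times> (real ^ 'd)) measure)"
proof -
  have "(\<lambda>z :: 'd pt \<times> (real ^ 'd). indicator (tangent_nbhd b t (fst (fst z))) (snd z) :: ennreal)
      = indicator {z \<in> space borel. snd z \<in> cube b \<and> norm (snd z - fst (fst z)) \<le> t * b}"
    by (auto simp: tangent_nbhd_def indicator_def)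
  then show ?thesis by (simp only:) measurable
qed

lemma borel_measurable_tan_weight:
  assumes "C2_fun g" shows "tan_weight b L g t \<in> borel_measurable borel"
proof -
  note [measurable] = sets_model_set[OF assms]
  show ?thesis unfolding tan_weight_def by measurable
qed

lemma sets_tan_measure [simp, measurable_cong]: "sets (tan_measure b L g t) = sets borel"
  by (simp add: tan_measure_def lborel_prod)

lemma nn_integral_tan_measure:
  assumes g: "C2_fun g" and [measurable]: "F \<in> borel_measurable borel"
  shows "(\<integral>\<^sup>+z. F z \<partial>tan_measure b L g t)
    = (\<integral>\<^sup>+\<xi>\<in>model_set b L g. ennreal (1 / (b * t) ^ CARD('d)) * (\<integral>\<^sup>+u\<in>tangent_nbhd b t (fst \<xi>). F (\<xi>, u) \<partial>lborel) \<partial>(lborel :: ('d::finite) pt measure))"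
proof -
  note [measurable] = borel_measurable_tan_weight[OF g]
  have [measurable]: "(\<lambda>u. F (\<xi>, u) * indicator (tangent_nbhd b t (fst \<xi>)) u) \<in> borel_measurable borel" for \<xi>
  proof -
    have "(\<lambda>z. F z * indicator (tangent_nbhd b t (fst (fst z))) (snd z)) \<in> borel_measurable borel" by measurable
    moreover have "(\<lambda>u. (\<xi>, u)) \<in> borel_measurable borel" by (intro borel_measurable_continuous_onI continuous_intros)
    ultimately have "(\<lambda>z. F z * indicator (tangent_nbhd b t (fst (fst z))) (snd z)) \<circ> (\<lambda>u. (\<xi>, u)) \<in> borel_measurable borel"
      by (rule measurable_comp[rotated])
    then show ?thesis by (simp add: o_def)
  qed
  have "(\<integral>\<^sup>+z. F z \<partial>tan_measure b L g t) = (\<integral>\<^sup>+z. tan_weight b L g t z * F z \<partial>(lborel \<Otimes>\<^sub>M lborel))"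
    unfolding tan_measure_def by (subst nn_integral_density) (auto simp: lborel_prod)
  also have "\<dots> = (\<integral>\<^sup>+\<xi>. \<integral>\<^sup>+u. tan_weight b L g t (\<xi>, u) * F (\<xi>, u) \<partial>lborel \<partial>lborel)"
    by (subst lborel.nn_integral_fst[symmetric]) (auto simp: lborel_prod)
  also have "\<dots> = (\<integral>\<^sup>+\<xi>. \<integral>\<^sup>+u. indicator (model_set b L g) \<xi> * ennreal (1 / (b * t) ^ CARD('d)) * (F (\<xi>, u) * indicator (tangent_nbhd b t (fst \<xi>)) u) \<partial>lborel \<partial>lborel)"
    by (intro nn_integral_cong) (simp add: tan_weight_def mult_ac)
  also have "\<dots> = (\<integral>\<^sup>+\<xi>. indicator (model_set b L g) \<xi> * ennreal (1 / (b * t) ^ CARD('d)) * (\<integral>\<^sup>+u. F (\<xi>, u) * indicator (tangent_nbhd b t (fst \<xi>)) u \<partial>lborel) \<partial>lborel)"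
    by (intro nn_integral_cong nn_integral_cmult) measurable
  finally show ?thesis by (simp add: mult_ac)
qed

lemma emeasure_ball_le:
  fixes x :: "real ^ ('d::finite)"
  assumes "A \<subseteq> {u. norm (u - x) \<le> R}" "0 \<le> R"
  shows "emeasure lborel A \<le> ennreal ((2 * R) ^ CARD('d))"
proof -
  have "A \<subseteq> cbox (x - vec R) (x + vec R)"
  proof
    fix u assume "u \<in> A"
    then have n: "norm (u - x) \<le> R" using assms by blast
    have "\<bar>u $ i - x $ i\<bar> \<le> R" for i using component_le_norm_cart[of "u - x" i] n by simp
    then show "u \<in> cbox (x - vec R) (x + vec R)" by (auto simp: mem_box_cart abs_le_iff algebra_simps)
  qed
  then have "emeasure lborel A \<le> emeasure lborel (cbox (x - vec R) (x + vec R))" by (intro emeasure_mono) auto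
  also have "\<dots> = ennreal (\<Prod>b\<in>Basis. (x + vec R - (x - vec R)) \<bullet> b)"
    using assms(2) by (intro emeasure_lborel_cbox) (auto simp: Basis_vec_def inner_axis)
  also have "(\<Prod>b\<in>Basis. (x + vec R - (x - vec R)) \<bullet> b) = (\<Prod>b\<in>(Basis :: (real ^ 'd) set). 2 * R)"
    by (intro prod.cong) (auto simp: Basis_vec_def inner_axis)
  finally show ?thesis by simp
qed

text \<open>The ball lies in a cube of side \<open>2 * t * b\<close>; the normalised integral over
  \<open>u\<close> therefore has total mass at most \<open>2 ^ CARD('d)\<close>, uniformly in
  \<open>t\<close>.\<close>

lemma nbhd_weight_le:
  fixes x :: "real ^ ('d::finite)"
  assumes "0 < b" "0 < t" "A \<subseteq> {u. norm (u - x) \<le> t * b}"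
  shows "ennreal (1 / (b * t) ^ CARD('d)) * emeasure lborel A \<le> ennreal (2 ^ CARD('d))"
proof -
  have "ennreal (1 / (b * t) ^ CARD('d)) * emeasure lborel A \<le> ennreal (1 / (b * t) ^ CARD('d)) * ennreal ((2 * (t * b)) ^ CARD('d))"
    using assms by (intro mult_left_mono emeasure_ball_le) auto
  also have "\<dots> = ennreal (1 / (b * t) ^ CARD('d) * (2 * (t * b)) ^ CARD('d))"
    using assms by (intro ennreal_mult[symmetric]) auto
  also have "1 / (b * t) ^ CARD('d) * (2 * (t * b)) ^ CARD('d) = 2 ^ CARD('d)"
    using assms by (simp add: power_mult_distrib mult.commute)
  finally show ?thesis .
qed

lemma nn_integral_translate:
  fixes H :: "'a::euclidean_space \<Rightarrow> ennreal"
  assumes [measurable]: "H \<in> borel_measurable borel"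
  shows "(\<integral>\<^sup>+x. H (x + a) \<partial>lborel) = (\<integral>\<^sup>+x. H x \<partial>lborel)"
proof -
  have "(\<integral>\<^sup>+x. H x \<partial>distr lborel borel ((+) a)) = (\<integral>\<^sup>+x. H (a + x) \<partial>lborel)"
    by (rule nn_integral_distr) simp_all
  then show ?thesis by (simp add: lborel_distr_plus add.commute)
qed

text \<open>For a fixed direction parameter \<open>u\<close> the shift is a translation, whatever its direction.\<close>

lemma tan_measure_shift_le:
  fixes h :: "('d::finite) pt \<Rightarrow> ennreal"
  assumes g: "C2_fun g" and b: "0 < b" and t: "0 < t" and [measurable]: "h \<in> borel_measurable borel"
  shows "(\<integral>\<^sup>+z. h (fst z + c *\<^sub>R tangent_vec g j (snd z)) \<partial>tan_measure b L g t) \<le> ennreal (2 ^ CARD('d)) * (\<integral>\<^sup>+\<xi>. h \<xi> \<partial>lborel)"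
proof -
  let ?w = "ennreal (1 / (b * t) ^ CARD('d))"
  \<comment> \<open>\<open>?S\<close> retains from the weight only the distance condition, which
    behaves well under translation; \<open>?S'\<close> is the same condition written in terms of the
    shifted point.\<close>
  let ?S = "{z :: 'd pt \<times> (real ^ 'd). norm (snd z - fst (fst z)) \<le> t * b}"
  let ?S' = "\<lambda>\<xi>. {u. norm (u - (fst \<xi> - c *\<^sub>R axis j 1)) \<le> t * b}"
  note [measurable] = borel_measurable_tan_weight[OF g]
  have [measurable]: "(\<lambda>z. fst z + c *\<^sub>R tangent_vec g j (snd z)) \<in> borel_measurable borel"
    by (intro borel_measurable_continuous_onI continuous_intros continuous_on_tangent_vec[OF g])
  have S[measurable]: "?S \<in> sets borel"
    by (intro borel_closed closed_Collect_le continuous_intros)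
  have S2: "{z :: 'd pt \<times> (real ^ 'd). norm (snd z - (fst (fst z) - c *\<^sub>R axis j 1)) \<le> t * b} \<in> sets borel"
    by (intro borel_closed closed_Collect_le continuous_intros)
  have m1: "(\<lambda>z. ?w * (indicator ?S z * h (fst z + c *\<^sub>R tangent_vec g j (snd z)))) \<in> borel_measurable (lborel \<Otimes>\<^sub>M lborel)"
    unfolding lborel_prod by measurable
  have m2: "(\<lambda>z. ?w * (indicator {z. norm (snd z - (fst (fst z) - c *\<^sub>R axis j 1)) \<le> t * b} z * h (fst z))) \<in> borel_measurable (lborel \<Otimes>\<^sub>M lborel)"
    unfolding lborel_prod using S2 by measurable
  have "(\<integral>\<^sup>+z. h (fst z + c *\<^sub>R tangent_vec g j (snd z)) \<partial>tan_measure b L g t)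
     = (\<integral>\<^sup>+z. tan_weight b L g t z * h (fst z + c *\<^sub>R tangent_vec g j (snd z)) \<partial>(lborel \<Otimes>\<^sub>M lborel))"
    unfolding tan_measure_def by (subst nn_integral_density) (auto simp: lborel_prod)
  also have "\<dots> \<le> (\<integral>\<^sup>+z. ?w * (indicator ?S z * h (fst z + c *\<^sub>R tangent_vec g j (snd z))) \<partial>(lborel \<Otimes>\<^sub>M lborel))"
    by (intro nn_integral_mono) (auto simp: tan_weight_def indicator_def tangent_nbhd_def)
  also have "\<dots> = (\<integral>\<^sup>+u. \<integral>\<^sup>+\<xi>. ?w * (indicator ?S (\<xi>, u) * h (\<xi> + c *\<^sub>R tangent_vec g j u)) \<partial>lborel \<partial>lborel)"
    by (subst lborel_pair.nn_integral_snd[symmetric, OF m1]) simp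
  also have "\<dots> = (\<integral>\<^sup>+u. \<integral>\<^sup>+\<xi>. ?w * (indicator (?S' \<xi>) u * h \<xi>) \<partial>lborel \<partial>lborel)"
  proof (rule nn_integral_cong)
    fix u :: "real ^ 'd"
    have "{\<xi> :: 'd pt. norm (u - (fst \<xi> - c *\<^sub>R axis j 1)) \<le> t * b} \<in> sets borel"
      by (intro borel_closed closed_Collect_le continuous_intros)
    then have [measurable]: "(\<lambda>\<xi> :: 'd pt. indicator (?S' \<xi>) u :: ennreal) \<in> borel_measurable borel"
      using borel_measurable_indicator[of "{\<xi> :: 'd pt. norm (u - (fst \<xi> - c *\<^sub>R axis j 1)) \<le> t * b}" borel]
      by (simp add: indicator_def)
    have "indicator ?S (\<xi>, u) = (indicator (?S' (\<xi> + c *\<^sub>R tangent_vec g j u)) u :: ennreal)" for \<xi>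
      by (simp add: indicator_def)
    then have "(\<integral>\<^sup>+\<xi>. ?w * (indicator ?S (\<xi>, u) * h (\<xi> + c *\<^sub>R tangent_vec g j u)) \<partial>lborel)
       = (\<integral>\<^sup>+\<xi>. (\<lambda>\<xi>. ?w * (indicator (?S' \<xi>) u * h \<xi>)) (\<xi> + c *\<^sub>R tangent_vec g j u) \<partial>lborel)" by simp
    also have "\<dots> = (\<integral>\<^sup>+\<xi>. ?w * (indicator (?S' \<xi>) u * h \<xi>) \<partial>lborel)"
      by (rule nn_integral_translate) measurable
    finally show "(\<integral>\<^sup>+\<xi>. ?w * (indicator ?S (\<xi>, u) * h (\<xi> + c *\<^sub>R tangent_vec g j u)) \<partial>lborel) = \<dots>" .
  qed
  also have "\<dots> = (\<integral>\<^sup>+\<xi>. \<integral>\<^sup>+u. ?w * (indicator (?S' \<xi>) u * h \<xi>) \<partial>lborel \<partial>lborel)"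
    using m2 by (intro lborel_pair.Fubini') (simp add: indicator_def split_beta')
  also have "\<dots> \<le> (\<integral>\<^sup>+\<xi>. ennreal (2 ^ CARD('d)) * h \<xi> \<partial>lborel)"
  proof (rule nn_integral_mono)
    fix \<xi> :: "'d pt"
    have S'[measurable]: "?S' \<xi> \<in> sets borel" by (intro borel_closed closed_Collect_le continuous_intros)
    have "(\<integral>\<^sup>+u. ?w * (indicator (?S' \<xi>) u * h \<xi>) \<partial>lborel) = (\<integral>\<^sup>+u. (?w * h \<xi>) * indicator (?S' \<xi>) u \<partial>lborel)"
      by (simp add: mult_ac)
    also have "\<dots> = (?w * h \<xi>) * emeasure lborel (?S' \<xi>)"
      by (rule nn_integral_cmult_indicator) simp
    also have "\<dots> = h \<xi> * (?w * emeasure lborel (?S' \<xi>))" by (simp add: mult_ac)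
    also have "\<dots> \<le> h \<xi> * ennreal (2 ^ CARD('d))"
      by (intro mult_left_mono nbhd_weight_le[OF b t, of _ "fst \<xi> - c *\<^sub>R axis j 1"]) auto
    finally show "(\<integral>\<^sup>+u. ?w * (indicator (?S' \<xi>) u * h \<xi>) \<partial>lborel) \<le> ennreal (2 ^ CARD('d)) * h \<xi>" by (simp add: mult.commute)
  qed
  also have "\<dots> = ennreal (2 ^ CARD('d)) * (\<integral>\<^sup>+\<xi>. h \<xi> \<partial>lborel)" by (rule nn_integral_cmult) simp
  finally show ?thesis .
qed

lemma continuous_on_paraboloid_point:
  assumes g: "C2_fun g" and f: "continuous_on A x" "continuous_on A v" "continuous_on A w"
  shows "continuous_on A (\<lambda>z. paraboloid_point M g j (x z) (v z) (w z))"
  unfolding paraboloid_point_def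
  by (intro continuous_intros f continuous_on_compose2[OF C2_fun_continuous(1)[OF g, of UNIV]] continuous_on_compose2[OF C2_fun_continuous(2)[OF g, of UNIV]]) auto

text \<open>For fixed \<open>v\<close> the paraboloid map is a shear followed by a translation, hence preserves volume.\<close>

lemma paraboloid_integral_le:
  fixes H :: "('d::finite) pt \<Rightarrow> ennreal"
  assumes g: "C2_fun g" and [measurable]: "H \<in> borel_measurable borel" and S[measurable]: "S \<in> sets borel"
    and sub: "\<And>x w. x \<in> cube b \<Longrightarrow> w \<in> {0..l} \<Longrightarrow> paraboloid_point M g j x v w \<in> S"
  shows "(\<integral>\<^sup>+x\<in>cube b. (\<integral>\<^sup>+w\<in>{0..l}. H (paraboloid_point M g j x v w) \<partial>lborel) \<partial>lborel) \<le> (\<integral>\<^sup>+\<xi>\<in>S. H \<xi> \<partial>lborel)"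
proof -
  let ?a = "\<lambda>x. g x + v * partial j g x - M * v\<^sup>2"
  let ?K = "\<lambda>\<xi>. H \<xi> * indicator S \<xi>"
  have Km: "?K \<in> borel_measurable (lborel \<Otimes>\<^sub>M lborel)" unfolding lborel_prod by measurable
  have Kx[measurable]: "(\<lambda>y. ?K (x, y)) \<in> borel_measurable borel" for x
  proof -
    have [measurable]: "(\<lambda>y::real. (x, y)) \<in> borel_measurable borel" by (intro borel_measurable_continuous_onI continuous_intros)
    show ?thesis by measurable
  qed
  have le: "(\<integral>\<^sup>+x\<in>cube b. (\<integral>\<^sup>+w\<in>{0..l}. H (paraboloid_point M g j x v w) \<partial>lborel) \<partial>lborel)
     \<le> (\<integral>\<^sup>+x. \<integral>\<^sup>+w. ?K (x + v *\<^sub>R axis j 1, ?a x + (-1) * w) \<partial>lborel \<partial>lborel)"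
  proof (intro nn_integral_mono)
    fix x :: "real ^ 'd"
    show "(\<integral>\<^sup>+w\<in>{0..l}. H (paraboloid_point M g j x v w) \<partial>lborel) * indicator (cube b) x
       \<le> (\<integral>\<^sup>+w. ?K (x + v *\<^sub>R axis j 1, ?a x + (-1) * w) \<partial>lborel)"
    proof (cases "x \<in> cube b")
      case True
      have "(\<integral>\<^sup>+w\<in>{0..l}. H (paraboloid_point M g j x v w) \<partial>lborel) \<le> (\<integral>\<^sup>+w. ?K (x + v *\<^sub>R axis j 1, ?a x + (-1) * w) \<partial>lborel)"
      proof (rule nn_integral_mono)
        fix w
        show "H (paraboloid_point M g j x v w) * indicator {0..l} w \<le> ?K (x + v *\<^sub>R axis j 1, ?a x + (-1) * w)"
          using sub[OF True, of w] by (cases "w \<in> {0..l}") (auto simp: paraboloid_point_def)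
      qed
      then show ?thesis using True by simp
    qed simp
  qed
  have "(\<integral>\<^sup>+x. \<integral>\<^sup>+w. ?K (x + v *\<^sub>R axis j 1, ?a x + (-1) * w) \<partial>lborel \<partial>lborel) = (\<integral>\<^sup>+x. \<integral>\<^sup>+y. ?K (x + v *\<^sub>R axis j 1, y) \<partial>lborel \<partial>lborel)"
  proof (rule nn_integral_cong)
    fix x :: "real ^ 'd"
    show "(\<integral>\<^sup>+w. ?K (x + v *\<^sub>R axis j 1, ?a x + (-1) * w) \<partial>lborel) = (\<integral>\<^sup>+y. ?K (x + v *\<^sub>R axis j 1, y) \<partial>lborel)"
      using nn_integral_real_affine[OF Kx, of "-1" "x + v *\<^sub>R axis j 1" "?a x"] by simp
  qed
  also have "\<dots> = (\<integral>\<^sup>+x. \<integral>\<^sup>+y. ?K (x, y) \<partial>lborel \<partial>lborel)"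
    using nn_integral_translate[of "\<lambda>x. \<integral>\<^sup>+y. ?K (x, y) \<partial>lborel" "v *\<^sub>R axis j 1"] lborel.borel_measurable_nn_integral_fst[OF Km] by simp
  also have "\<dots> = (\<integral>\<^sup>+\<xi>. ?K \<xi> \<partial>lborel)"
    by (subst lborel.nn_integral_fst[OF Km]) (simp add: lborel_prod)
  finally show ?thesis using le by simp
qed

text \<open>The vertical column over \<open>x\<close> is integrated innermost, with \<open>x\<close>
  and \<open>u\<close> fixed and the depth \<open>w = g x - y\<close> as variable. As the bound
  \<open>B x\<close> does not involve \<open>u\<close>, the average over \<open>u\<close> costs only
  \<open>2 ^ CARD('d)\<close>.\<close>

lemma tan_measure_column_le:
  fixes F :: "('d::finite) pt \<times> (real ^ 'd) \<Rightarrow> ennreal" and B :: "real ^ 'd \<Rightarrow> ennreal"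
  assumes g: "C2_fun g" and b: "0 < b" and t: "0 < t" and [measurable]: "F \<in> borel_measurable borel" "B \<in> borel_measurable borel"
    and le: "\<And>x u. x \<in> cube b \<Longrightarrow> u \<in> tangent_nbhd b t x \<Longrightarrow> (\<integral>\<^sup>+w\<in>{0..L * b}. F ((x, g x - w), u) \<partial>lborel) \<le> B x"
  shows "(\<integral>\<^sup>+z. F z \<partial>tan_measure b L g t) \<le> ennreal (2 ^ CARD('d)) * (\<integral>\<^sup>+x\<in>cube b. B x \<partial>lborel)"
proof -
  let ?w = "ennreal (1 / (b * t) ^ CARD('d))"
  note [measurable] = borel_measurable_tan_weight[OF g]
  let ?W = "\<lambda>z. tan_weight b L g t z * F z"
  have m: "?W \<in> borel_measurable (lborel \<Otimes>\<^sub>M lborel)" unfolding lborel_prod by measurable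
  have cp: "(\<lambda>z :: real \<times> (real ^ 'd). ((x, fst z), snd z)) \<in> borel_measurable borel" for x :: "real ^ 'd"
    by (intro borel_measurable_continuous_onI continuous_intros)
  have Wx: "(\<lambda>z. ?W ((x, fst z), snd z)) \<in> borel_measurable (lborel \<Otimes>\<^sub>M lborel)" for x
  proof -
    have "?W \<circ> (\<lambda>z. ((x, fst z), snd z)) \<in> borel_measurable borel" by (rule measurable_comp[OF cp]) measurable
    then show ?thesis unfolding lborel_prod by (simp add: o_def)
  qed
  have inner: "(\<lambda>\<xi>. \<integral>\<^sup>+u. ?W (\<xi>, u) \<partial>lborel) \<in> borel_measurable (lborel \<Otimes>\<^sub>M lborel)"
    unfolding lborel_prod using lborel.borel_measurable_nn_integral_fst[OF m] by simp
  have "(\<integral>\<^sup>+z. F z \<partial>tan_measure b L g t) = (\<integral>\<^sup>+z. ?W z \<partial>(lborel \<Otimes>\<^sub>M lborel))"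
    unfolding tan_measure_def by (subst nn_integral_density) (auto simp: lborel_prod)
  also have "\<dots> = (\<integral>\<^sup>+\<xi>. \<integral>\<^sup>+u. ?W (\<xi>, u) \<partial>lborel \<partial>lborel)"
    by (rule lborel.nn_integral_fst[OF m, symmetric])
  also have "\<dots> = (\<integral>\<^sup>+x. \<integral>\<^sup>+y. \<integral>\<^sup>+u. ?W ((x, y), u) \<partial>lborel \<partial>lborel \<partial>lborel)"
    by (subst lborel.nn_integral_fst[OF inner]) (simp add: lborel_prod)
  also have "\<dots> = (\<integral>\<^sup>+x. \<integral>\<^sup>+u. \<integral>\<^sup>+y. ?W ((x, y), u) \<partial>lborel \<partial>lborel \<partial>lborel)"
    using Wx by (intro nn_integral_cong lborel_pair.Fubini'[symmetric]) (simp add: split_beta')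
  also have "\<dots> \<le> (\<integral>\<^sup>+x. ennreal (2 ^ CARD('d)) * (B x * indicator (cube b) x) \<partial>lborel)"
  proof (rule nn_integral_mono)
    fix x :: "real ^ 'd"
    show "(\<integral>\<^sup>+u. \<integral>\<^sup>+y. ?W ((x, y), u) \<partial>lborel \<partial>lborel) \<le> ennreal (2 ^ CARD('d)) * (B x * indicator (cube b) x)"
    proof (cases "x \<in> cube b")
      case False
      then have W0: "?W ((x, y), u) = 0" for y u by (simp add: tan_weight_def model_set_def)
      show ?thesis unfolding W0 by simp
    next
      case True
      have nb: "tangent_nbhd b t x \<in> sets borel"
      proof -
        have "{u. norm (u - x) \<le> t * b} \<in> sets borel" by (intro borel_closed closed_Collect_le continuous_intros)
        moreover have "cube b \<in> sets (borel :: (real ^ 'd) measure)" by (intro borel_open open_box)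
        ultimately show ?thesis unfolding tangent_nbhd_def by (simp add: Collect_conj_eq sets.Int)
      qed
      have col: "(\<integral>\<^sup>+y. ?W ((x, y), u) \<partial>lborel) \<le> (?w * B x) * indicator (tangent_nbhd b t x) u" for u
      proof (cases "u \<in> tangent_nbhd b t x")
        case u: True
        have Fy: "(\<lambda>y. F ((x, y), u)) \<in> borel_measurable borel"
        proof -
          have "(\<lambda>y::real. ((x, y), u)) \<in> borel_measurable borel" by (intro borel_measurable_continuous_onI continuous_intros)
          then have "F \<circ> (\<lambda>y. ((x, y), u)) \<in> borel_measurable borel" by (rule measurable_comp) measurable
          then show ?thesis by (simp add: o_def)
        qed
        note [measurable] = Fy
        have "(\<integral>\<^sup>+y. ?W ((x, y), u) \<partial>lborel) \<le> (\<integral>\<^sup>+y. ?w * (F ((x, y), u) * indicator {g x - L * b..g x} y) \<partial>lborel)"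
          by (intro nn_integral_mono) (auto simp: tan_weight_def model_set_def indicator_def)
        also have "\<dots> = ?w * (\<integral>\<^sup>+y. F ((x, y), u) * indicator {g x - L * b..g x} y \<partial>lborel)"
          by (rule nn_integral_cmult) measurable
        also have "(\<integral>\<^sup>+y. F ((x, y), u) * indicator {g x - L * b..g x} y \<partial>lborel) = (\<integral>\<^sup>+w\<in>{0..L * b}. F ((x, g x - w), u) \<partial>lborel)"
          by (subst nn_integral_real_affine[where c = "-1" and t = "g x"], measurable)
             (auto intro!: nn_integral_cong simp: indicator_def)
        also have "?w * (\<integral>\<^sup>+w\<in>{0..L * b}. F ((x, g x - w), u) \<partial>lborel) \<le> ?w * B x"
          by (intro mult_left_mono le True u) auto
        finally show ?thesis using u by simp
      next
        case False
        then have W0: "?W ((x, y), u) = 0" for y by (simp add: tan_weight_def)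
        show ?thesis unfolding W0 by simp
      qed
      have "(\<integral>\<^sup>+u. \<integral>\<^sup>+y. ?W ((x, y), u) \<partial>lborel \<partial>lborel) \<le> (\<integral>\<^sup>+u. (?w * B x) * indicator (tangent_nbhd b t x) u \<partial>lborel)"
        by (intro nn_integral_mono col)
      also have "\<dots> = (?w * B x) * emeasure lborel (tangent_nbhd b t x)"
        using nb by (intro nn_integral_cmult_indicator) simp
      also have "\<dots> = B x * (?w * emeasure lborel (tangent_nbhd b t x))" by (simp add: mult_ac)
      also have "\<dots> \<le> B x * ennreal (2 ^ CARD('d))"
        by (intro mult_left_mono nbhd_weight_le[OF b t, of _ x]) (auto simp: tangent_nbhd_def)
      finally show ?thesis using True by (simp add: mult.commute)
    qed
  qed
  also have "\<dots> = ennreal (2 ^ CARD('d)) * (\<integral>\<^sup>+x\<in>cube b. B x \<partial>lborel)"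
    by (rule nn_integral_cmult) measurable
  finally show ?thesis .
qed

section \<open>From complex tangent lines to real points of the parabolas\<close>

lemma nn_integral_swap_borel:
  fixes f :: "'a::second_countable_topology \<times> 'b::second_countable_topology \<Rightarrow> ennreal"
  assumes "sigma_finite_measure M" "sigma_finite_measure N" and s: "sets M = sets borel" "sets N = sets borel"
    and f: "f \<in> borel_measurable borel"
  shows "(\<integral>\<^sup>+x. \<integral>\<^sup>+y. f (x, y) \<partial>N \<partial>M) = (\<integral>\<^sup>+y. \<integral>\<^sup>+x. f (x, y) \<partial>M \<partial>N)"
    "(\<lambda>x. \<integral>\<^sup>+y. f (x, y) \<partial>N) \<in> borel_measurable borel"
proof -
  interpret M: sigma_finite_measure M by fact
  interpret N: sigma_finite_measure N by fact
  interpret P: pair_sigma_finite M N ..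
  have "sets (M \<Otimes>\<^sub>M N) = sets (borel :: ('a \<times> 'b) measure)"
    unfolding borel_prod[symmetric] by (rule sets_pair_measure_cong[OF s])
  then have m: "f \<in> borel_measurable (M \<Otimes>\<^sub>M N)" using f measurable_cong_sets by blast
  show "(\<integral>\<^sup>+x. \<integral>\<^sup>+y. f (x, y) \<partial>N \<partial>M) = (\<integral>\<^sup>+y. \<integral>\<^sup>+x. f (x, y) \<partial>M \<partial>N)"
    by (rule P.Fubini'[symmetric]) (use m in simp)
  have "(\<lambda>x. \<integral>\<^sup>+y. f (x, y) \<partial>N) \<in> borel_measurable M"
    using N.borel_measurable_nn_integral_fst[OF m] by simp
  then show "(\<lambda>x. \<integral>\<^sup>+y. f (x, y) \<partial>N) \<in> borel_measurable borel" using s(1) measurable_cong_sets by blast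
qed

text \<open>\<open>|z^2 - 1| + |z|^2 \<le> 1 + 2 * |z|^2\<close>, so the ellipse criterion applies
  with \<open>\<delta> = |z|\<close>. A parameter of size \<open>1 / N\<close> thus has height at
  most \<open>1 / N\<close>, and for degrees of order \<open>N\<close> harmonic measure costs a
  bounded factor.\<close>

lemma Im_Arccos_le: "\<bar>Im (Arccos z)\<bar> \<le> cmod z"
proof (rule Im_arccos_le)
  have "cmod (z\<^sup>2 - 1) \<le> cmod (z\<^sup>2) + 1" using norm_triangle_ineq4[of "z\<^sup>2" 1] by simp
  then show "cmod ((cos (Arccos z))\<^sup>2 - 1) + (cmod (cos (Arccos z)))\<^sup>2 \<le> 1 + 2 * (cmod z)\<^sup>2"
    by (simp add: norm_power)
qed simp

text \<open>The right side is the additive perturbation that \<open>interval_perturb_ab_le\<close>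
  tolerates on a column of length \<open>l\<close>. Both \<open>a\<close> and \<open>z\<close> are
  of order \<open>1 / N\<close>, and a small \<open>\<kappa>\<close> compensates for
  \<open>M\<close>, \<open>b\<close> and \<open>l\<close>.\<close>

lemma paraboloid_shift_le:
  fixes z :: complex
  assumes M: "0 < M" and b: "0 < b" and \<kappa>: "0 < \<kappa>" "\<kappa> \<le> 1" "\<kappa> * (2 * M * (b + 1)) \<le> l"
    and N: "1 \<le> N" and z: "cmod z \<le> \<kappa> / real N" and a: "\<bar>a\<bar> \<le> M * (b / real N)"
  shows "cmod (z * of_real a - of_real M * z\<^sup>2) \<le> l / 2 / (real N)\<^sup>2"
proof -
  have "cmod (z * of_real a - of_real M * z\<^sup>2) \<le> cmod z * \<bar>a\<bar> + M * (cmod z)\<^sup>2"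
    using norm_triangle_ineq4[of "z * of_real a" "of_real M * z\<^sup>2"] M by (simp add: norm_mult norm_power)
  also have "\<dots> \<le> \<kappa> / real N * (M * (b / real N)) + M * (\<kappa> / real N)\<^sup>2"
    using z a M b \<kappa> by (intro add_mono mult_mono mult_left_mono power_mono) auto
  also have "\<dots> = (\<kappa> * (M * b) + M * (\<kappa> * \<kappa>)) / (real N)\<^sup>2"
    by (simp add: power2_eq_square add_divide_distrib)
  also have "\<dots> \<le> (\<kappa> * (M * b) + M * (\<kappa> * 1)) / (real N)\<^sup>2"
    using \<kappa> M by (intro divide_right_mono add_left_mono mult_left_mono) auto
  also have "\<dots> \<le> (l / 2) / (real N)\<^sup>2"
    using \<kappa>(3) by (intro divide_right_mono) (auto simp: algebra_simps)
  finally show ?thesis .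
qed

text \<open>For fixed \<open>x\<close> and \<open>u\<close> the integrand on the column is a
  polynomial of degree at most \<open>N\<close> in the depth, evaluated at
  \<open>w + \<beta>\<close> with \<open>\<beta>\<close> of order \<open>1 / N^2\<close>; the
  interval estimate removes \<open>\<beta>\<close> and with it the dependence on \<open>u\<close>.
  The complex parameter \<open>z\<close> left on the parabola is then averaged over real parameters
  \<open>c * v\<close>, with \<open>v\<close> in \<open>{-1..1}\<close>, by a measure that depends
  on \<open>z\<close> and \<open>c\<close> only. After an exchange of integrals, for each
  \<open>v\<close> the map from \<open>x\<close> and \<open>w\<close> to points of the parabolas
  preserves volume and has its values in \<open>S\<close>. In the pointwise version Bernstein-Walsh
  bounds replace the two integral estimates.\<close>

lemma tangent_perturb_le:
  fixes g :: "real ^ ('d::finite) \<Rightarrow> real" and p b L :: real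
  assumes p: "1 \<le> p" and g: "C2_fun g" and b: "0 < b" and L: "1 \<le> L"
  obtains C \<kappa> where "0 < C" "0 < \<kappa>" "\<kappa> \<le> 1"
    "\<And>N t z j P Pc S. 1 \<le> N \<Longrightarrow> 0 < t \<Longrightarrow> t \<le> 1 / real N \<Longrightarrow> cmod z \<le> \<kappa> / real N \<Longrightarrow> complex_extension N P Pc \<Longrightarrow> continuous_on UNIV P \<Longrightarrow>
      S \<in> sets borel \<Longrightarrow> model_star b L g \<subseteq> S \<Longrightarrow>
      (\<integral>\<^sup>+x. ennreal (cmod (Pc (\<lambda>k. of_real (coord k (fst x)) + z * of_real (coord k (tangent_vec g j (snd x))))) powr p) \<partial>tan_measure b L g t)
      \<le> ennreal C * (\<integral>\<^sup>+\<xi>\<in>S. ennreal (\<bar>P \<xi>\<bar> powr p) \<partial>lborel)"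
    "\<And>N t z j P Pc \<xi> u B. 1 \<le> N \<Longrightarrow> t \<le> 1 / real N \<Longrightarrow> cmod z \<le> \<kappa> / real N \<Longrightarrow> complex_extension N P Pc \<Longrightarrow>
      \<xi> \<in> model_set b L g \<Longrightarrow> u \<in> tangent_nbhd b t (fst \<xi>) \<Longrightarrow> (\<And>\<eta>. \<eta> \<in> model_star b L g \<Longrightarrow> \<bar>P \<eta>\<bar> \<le> B) \<Longrightarrow>
      cmod (Pc (\<lambda>k. of_real (coord k \<xi>) + z * of_real (coord k (tangent_vec g j u)))) \<le> C * B"
proof -
  obtain M c where M: "0 < M" and c: "0 < c"
    and lip: "\<And>x y j. x \<in> cube b \<Longrightarrow> y \<in> cube b \<Longrightarrow> \<bar>partial j g x - partial j g y\<bar> \<le> M * norm (x - y)"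
    and star: "\<And>x v w j. x \<in> cube b \<Longrightarrow> \<bar>v\<bar> \<le> c \<Longrightarrow> 0 \<le> w \<Longrightarrow> w \<le> L * b \<Longrightarrow> paraboloid_point M g j x v w \<in> model_star b L g"
    by (rule paraboloid_in_star[OF g b L]) blast
  obtain C1 where C1: "0 < C1" "\<And>N q z \<beta> a b. 1 \<le> N \<Longrightarrow> degree q \<le> N \<Longrightarrow> a < b \<Longrightarrow> cmod z \<le> 1 / real N \<Longrightarrow> cmod \<beta> \<le> (b - a) / 2 / (real N)\<^sup>2 \<Longrightarrow>
    (\<integral>\<^sup>+x\<in>{a..b}. ennreal (cmod (poly q (of_real x + z * of_real (phi_interval a b x) + \<beta>)) powr p) \<partial>lborel)
    \<le> ennreal C1 * (\<integral>\<^sup>+x\<in>{a..b}. ennreal (cmod (poly q (of_real x)) powr p) \<partial>lborel)"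
    by (rule interval_perturb_ab_le[OF p]) blast
  have l: "0 < L * b" using L b by simp
  \<comment> \<open>Chosen to satisfy the hypothesis of \<open>paraboloid_shift_le\<close> with
    \<open>l = L * b\<close>.\<close>
  define \<kappa> where "\<kappa> = min 1 (L * b / (2 * M * (b + 1)))"
  have den: "0 < 2 * M * (b + 1)" using M b by simp
  have \<kappa>: "0 < \<kappa>" "\<kappa> \<le> 1" "\<kappa> * (2 * M * (b + 1)) \<le> L * b"
  proof -
    have "\<kappa> \<le> L * b / (2 * M * (b + 1))" by (simp add: \<kappa>_def)
    then show "\<kappa> * (2 * M * (b + 1)) \<le> L * b" using den by (simp add: pos_le_divide_eq)
    show "0 < \<kappa>" unfolding \<kappa>_def using den l by simp
  qed (simp add: \<kappa>_def)
  \<comment> \<open>Harmonic measure costs the exponential of \<open>p\<close> times degree times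
    height; the degree in \<open>v\<close> is at most \<open>2 * N\<close> and the height of
    \<open>Arccos (z / c)\<close> at most \<open>\<kappa> / (N * c)\<close>.\<close>
  define K1 where "K1 = exp (p * (2 * \<kappa> / c))"
  define K2 where "K2 = exp 14 * exp (2 * \<kappa> / c)"
  \<comment> \<open>The sum serves both claims: its first term is the constant of the integral
    bound, \<open>K2\<close> that of the pointwise bound.\<close>
  have CC: "0 < 2 ^ CARD('d) * (C1 * K1) + K2" using C1 by (auto simp: K1_def K2_def intro!: add_pos_pos)
  have nb: "\<bar>partial j g x - partial j g u\<bar> \<le> M * (b / real N)"
    if "x \<in> cube b" "u \<in> tangent_nbhd b t x" "t \<le> 1 / real N" for x u t j N
  proof -
    have u: "u \<in> cube b" "norm (u - x) \<le> t * b" using that by (auto simp: tangent_nbhd_def)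
    have "norm (x - u) \<le> 1 / real N * b"
      using u(2) mult_right_mono[OF that(3), of b] b by (simp add: norm_minus_commute)
    then have "M * norm (x - u) \<le> M * (b / real N)" using M by (intro mult_left_mono) auto
    then show ?thesis using lip[OF that(1) u(1), of j] by simp
  qed
  have Im: "real (2 * N) * \<bar>Im (Arccos (z / of_real c))\<bar> \<le> 2 * \<kappa> / c" if "1 \<le> N" "cmod z \<le> \<kappa> / real N" for N z
  proof -
    have "\<bar>Im (Arccos (z / of_real c))\<bar> \<le> cmod z / c" using Im_Arccos_le[of "z / of_real c"] c by (simp add: norm_divide)
    also have "\<dots> \<le> \<kappa> / real N / c" using that c by (intro divide_right_mono) auto
    finally have "real (2 * N) * \<bar>Im (Arccos (z / of_real c))\<bar> \<le> real (2 * N) * (\<kappa> / real N / c)" by (intro mult_left_mono) auto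
    then show ?thesis using that by simp
  qed
  have cosz: "of_real c * cos (Arccos (z / of_real c)) = z" for z using c by simp
  show thesis
  proof (rule that[OF CC \<kappa>(1,2)])
    fix N :: nat and t :: real and z :: complex and j and P :: "'d pt \<Rightarrow> real" and Pc S
    assume N: "1 \<le> N" and t: "0 < t" "t \<le> 1 / real N" and z: "cmod z \<le> \<kappa> / real N" and Pc: "complex_extension N P Pc"
      and P: "continuous_on UNIV P" and S: "S \<in> sets borel" "model_star b L g \<subseteq> S"
    let ?\<theta> = "Arccos (z / of_real c)"
    let ?F = "\<lambda>x :: 'd pt \<times> (real ^ 'd). ennreal (cmod (Pc (\<lambda>k. of_real (coord k (fst x)) + z * of_real (coord k (tangent_vec g j (snd x))))) powr p)"
    let ?H = "\<lambda>\<xi>. ennreal (\<bar>P \<xi>\<bar> powr p)"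
    let ?pt = "\<lambda>x v w. paraboloid_point M g j x (c * v) w"
    obtain \<mu> :: "real measure" where \<mu>: "sets \<mu> = sets borel" "emeasure \<mu> UNIV = 1" "AE v in \<mu>. v \<in> {-1..1}"
      and pois: "\<And>N q. degree q \<le> N \<Longrightarrow> ennreal (cmod (poly q (cos ?\<theta>)) powr p) \<le>
       ennreal (exp (p * real N * \<bar>Im ?\<theta>\<bar>)) * (\<integral>\<^sup>+v. ennreal (cmod (poly q (of_real v)) powr p) \<partial>\<mu>)"
      by (rule poisson_measure_exists[OF p, of ?\<theta>]) blast
    have sp: "space \<mu> = UNIV" using sets_eq_imp_space_eq[OF \<mu>(1)] by simp
    have \<mu>s: "sigma_finite_measure \<mu>"
      by (rule finite_measure.axioms(1), rule finite_measureI) (simp add: sp \<mu>(2))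
    have ls: "sigma_finite_measure (lborel :: 'a::euclidean_space measure)" by (rule sigma_finite_lborel)
    have [measurable]: "P \<in> borel_measurable borel" by (rule borel_measurable_continuous_onI[OF P])
    have Hm: "?H \<in> borel_measurable borel" by measurable
    have comp: "(\<lambda>x. ?H (?pt (x1 x) (v1 x) (w1 x))) \<in> borel_measurable borel"
      if "continuous_on UNIV x1" "continuous_on UNIV v1" "continuous_on UNIV w1"
      for x1 :: "'z::topological_space \<Rightarrow> real ^ 'd" and v1 w1
    proof -
      have "(\<lambda>x. ?pt (x1 x) (v1 x) (w1 x)) \<in> borel_measurable borel"
        by (intro borel_measurable_continuous_onI continuous_on_paraboloid_point[OF g] that continuous_intros)
      from measurable_compose[OF this Hm] show ?thesis .
    qed
    have ind: "(\<lambda>x. indicator A (f x) :: ennreal) \<in> borel_measurable borel" if "f \<in> borel_measurable borel" "A \<in> sets borel"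
      for A :: "'y::topological_space set" and f :: "'z::topological_space \<Rightarrow> 'y"
      by (rule measurable_compose[OF that(1) borel_measurable_indicator[OF that(2)]])
    let ?J = "\<lambda>x v. \<integral>\<^sup>+w\<in>{0..L * b}. ?H (?pt x v w) \<partial>lborel"
    have Jm: "(\<lambda>y. ?J (fst y) (snd y)) \<in> borel_measurable borel"
    proof -
      have "(\<lambda>y. ?H (?pt (fst (fst y)) (snd (fst y)) (snd y)) * indicator {0..L * b} (snd y)) \<in> borel_measurable borel"
        by (intro borel_measurable_times_ennreal comp ind borel_measurable_fst_snd continuous_intros) auto
      from nn_integral_swap_borel(2)[OF ls ls _ _ this] show ?thesis by simp
    qed
    define B where "B = (\<lambda>x. ennreal (C1 * K1) * (\<integral>\<^sup>+v. ?J x v \<partial>\<mu>))"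
    have Bm0: "(\<lambda>x. \<integral>\<^sup>+v. ?J x v \<partial>\<mu>) \<in> borel_measurable borel"
      using nn_integral_swap_borel(2)[OF ls \<mu>s _ \<mu>(1) Jm] by simp
    have "(\<integral>\<^sup>+x. ?F x \<partial>tan_measure b L g t) \<le> ennreal (2 ^ CARD('d)) * (\<integral>\<^sup>+x\<in>cube b. B x \<partial>lborel)"
    proof (rule tan_measure_column_le[OF g b t(1)])
      have "continuous_on UNIV (\<lambda>x :: 'd pt \<times> (real ^ 'd). Pc (\<lambda>k. of_real (coord k (fst x)) + z * of_real (coord k (tangent_vec g j (snd x)))))"
        by (intro continuous_complex_extension[OF Pc] continuous_intros continuous_on_coord continuous_on_tangent_vec[OF g])
      then have [measurable]: "(\<lambda>x :: 'd pt \<times> (real ^ 'd). Pc (\<lambda>k. of_real (coord k (fst x)) + z * of_real (coord k (tangent_vec g j (snd x))))) \<in> borel_measurable borel"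
        by (rule borel_measurable_continuous_onI)
      show "?F \<in> borel_measurable borel" by measurable
      show "B \<in> borel_measurable borel" unfolding B_def using Bm0 by measurable
      fix x u :: "real ^ 'd" assume x: "x \<in> cube b" and u: "u \<in> tangent_nbhd b t x"
      define \<beta> where "\<beta> = z * of_real (partial j g x - partial j g u) - of_real M * z\<^sup>2"
      have \<beta>: "cmod \<beta> \<le> (L * b - 0) / 2 / (real N)\<^sup>2" unfolding \<beta>_def
        using paraboloid_shift_le[OF M b \<kappa> N z nb[OF x u t(2)]] by simp
      \<comment> \<open>In the depth the curve is a line, hence degree at most \<open>N\<close>. The
        interval estimate is used with multiplicative perturbation 0; only \<open>\<beta>\<close> is
        present.\<close>
      obtain q where q: "degree q \<le> N" "\<And>w. poly q w = Pc (paraboloid_coord M g j x z w)"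
        by (rule paraboloid_curve_w[OF Pc]) blast
      have "(\<integral>\<^sup>+w\<in>{0..L * b}. ?F ((x, g x - w), u) \<partial>lborel)
         = (\<integral>\<^sup>+w\<in>{0..L * b}. ennreal (cmod (poly q (of_real w + 0 * of_real (phi_interval 0 (L * b) w) + \<beta>)) powr p) \<partial>lborel)"
      proof (rule nn_integral_cong)
        fix w
        have "(\<lambda>k. of_real (coord k (x, g x - w)) + z * of_real (coord k (tangent_vec g j u))) = paraboloid_coord M g j x z (of_real w + \<beta>)"
          using tangent_curve_paraboloid[of _ x "g x - w" z g j u M] by (intro ext) (simp add: \<beta>_def)
        then show "?F ((x, g x - w), u) * indicator {0..L * b} w = ennreal (cmod (poly q (of_real w + 0 * of_real (phi_interval 0 (L * b) w) + \<beta>)) powr p) * indicator {0..L * b} w"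
          by (simp add: q(2))
      qed
      also have "\<dots> \<le> ennreal C1 * (\<integral>\<^sup>+w\<in>{0..L * b}. ennreal (cmod (poly q (of_real w)) powr p) \<partial>lborel)"
        using N by (intro C1(2)[OF N q(1) l _ \<beta>]) auto
      also have "(\<integral>\<^sup>+w\<in>{0..L * b}. ennreal (cmod (poly q (of_real w)) powr p) \<partial>lborel)
         \<le> (\<integral>\<^sup>+w. ennreal K1 * (\<integral>\<^sup>+v. ?H (?pt x v w) * indicator {0..L * b} w \<partial>\<mu>) \<partial>lborel)"
      proof (rule nn_integral_mono)
        fix w :: real
        have Hx: "(\<lambda>v. ?H (?pt x v w)) \<in> borel_measurable \<mu>"
          using comp[of "\<lambda>_. x" "\<lambda>v. v" "\<lambda>_. w"] \<mu>(1) by (simp cong: measurable_cong_sets)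
        obtain Q where Q: "degree Q \<le> 2 * N" "\<And>v. poly Q v = Pc (paraboloid_coord M g j x (of_real c * v) (of_real w))"
          by (rule paraboloid_curve_v[OF Pc]) blast
        have real: "poly Q (of_real v) = of_real (P (?pt x v w))" for v
        proof -
          have "paraboloid_coord M g j x (of_real c * of_real v) (of_real w) = (\<lambda>k. of_real (coord k (?pt x v w)))"
            using paraboloid_coord_of_real[of M g j x "c * v" w] by (intro ext) simp
          then show ?thesis unfolding Q(2) by (simp add: complex_extension_real[OF Pc])
        qed
        have "ennreal (cmod (poly q (of_real w)) powr p) = ennreal (cmod (poly Q (cos ?\<theta>)) powr p)"
          by (simp only: q(2) Q(2) cosz)
        also have "\<dots> \<le> ennreal (exp (p * real (2 * N) * \<bar>Im ?\<theta>\<bar>)) * (\<integral>\<^sup>+v. ennreal (cmod (poly Q (of_real v)) powr p) \<partial>\<mu>)"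
          by (rule pois[OF Q(1)])
        also have "\<dots> = ennreal (exp (p * real (2 * N) * \<bar>Im ?\<theta>\<bar>)) * (\<integral>\<^sup>+v. ?H (?pt x v w) \<partial>\<mu>)"
          unfolding real by simp
        also have "\<dots> \<le> ennreal K1 * (\<integral>\<^sup>+v. ?H (?pt x v w) \<partial>\<mu>)"
        proof (intro mult_right_mono ennreal_leI)
          have "p * (real (2 * N) * \<bar>Im ?\<theta>\<bar>) \<le> p * (2 * \<kappa> / c)" using Im[OF N z] p by (intro mult_left_mono) auto
          then show "exp (p * real (2 * N) * \<bar>Im ?\<theta>\<bar>) \<le> K1" unfolding K1_def by (simp add: mult.assoc)
        qed simp
        finally have "ennreal (cmod (poly q (of_real w)) powr p) * indicator {0..L * b} w \<le> ennreal K1 * (\<integral>\<^sup>+v. ?H (?pt x v w) \<partial>\<mu>) * indicator {0..L * b} w"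
          by (rule mult_right_mono) simp
        also have "\<dots> = ennreal K1 * (\<integral>\<^sup>+v. ?H (?pt x v w) * indicator {0..L * b} w \<partial>\<mu>)"
          by (simp add: nn_integral_multc[OF Hx] mult.assoc)
        finally show "ennreal (cmod (poly q (of_real w)) powr p) * indicator {0..L * b} w \<le> \<dots>" .
      qed
      also have "\<dots> = ennreal K1 * (\<integral>\<^sup>+v. ?J x v \<partial>\<mu>)"
      proof -
        have m: "(\<lambda>y. ?H (?pt x (snd y) (fst y)) * indicator {0..L * b} (fst y)) \<in> borel_measurable borel"
          by (intro borel_measurable_times_ennreal comp ind borel_measurable_fst_snd continuous_intros) auto
        from nn_integral_swap_borel[OF ls \<mu>s _ \<mu>(1) this] show ?thesis
          by (simp add: nn_integral_cmult)
      qed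
      finally show "(\<integral>\<^sup>+w\<in>{0..L * b}. ?F ((x, g x - w), u) \<partial>lborel) \<le> B x"
        using C1(1) by (simp add: B_def K1_def ennreal_mult mult.assoc mult_left_mono)
    qed
    also have "(\<integral>\<^sup>+x\<in>cube b. B x \<partial>lborel) = ennreal (C1 * K1) * (\<integral>\<^sup>+x. (\<integral>\<^sup>+v. ?J x v \<partial>\<mu>) * indicator (cube b) x \<partial>lborel)"
      unfolding B_def mult.assoc using Bm0 by (intro nn_integral_cmult borel_measurable_times_ennreal borel_measurable_indicator) auto
    also have "(\<integral>\<^sup>+x. (\<integral>\<^sup>+v. ?J x v \<partial>\<mu>) * indicator (cube b) x \<partial>lborel) = (\<integral>\<^sup>+x. \<integral>\<^sup>+v. ?J x v * indicator (cube b) x \<partial>\<mu> \<partial>lborel)"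
    proof (rule nn_integral_cong)
      fix x :: "real ^ 'd"
      have "(\<lambda>v. (x, v)) \<in> borel_measurable (borel :: real measure)" by (intro borel_measurable_continuous_onI continuous_intros)
      from measurable_compose[OF this Jm] have "?J x \<in> borel_measurable \<mu>" using \<mu>(1) by (simp cong: measurable_cong_sets)
      then show "(\<integral>\<^sup>+v. ?J x v \<partial>\<mu>) * indicator (cube b) x = (\<integral>\<^sup>+v. ?J x v * indicator (cube b) x \<partial>\<mu>)"
        by (rule nn_integral_multc[symmetric])
    qed
    also have "\<dots> = (\<integral>\<^sup>+v. \<integral>\<^sup>+x. ?J x v * indicator (cube b) x \<partial>lborel \<partial>\<mu>)"
    proof -
      have "(\<lambda>y. ?J (fst y) (snd y) * indicator (cube b) (fst y)) \<in> borel_measurable borel"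
        by (intro borel_measurable_times_ennreal Jm ind borel_measurable_fst_snd borel_open open_box)
      from nn_integral_swap_borel(1)[OF ls \<mu>s _ \<mu>(1) this] show ?thesis by simp
    qed
    also have "\<dots> \<le> (\<integral>\<^sup>+v. (\<integral>\<^sup>+\<xi>\<in>S. ?H \<xi> \<partial>lborel) \<partial>\<mu>)"
    proof (rule nn_integral_mono_AE)
      show "AE v in \<mu>. (\<integral>\<^sup>+x. ?J x v * indicator (cube b) x \<partial>lborel) \<le> (\<integral>\<^sup>+\<xi>\<in>S. ?H \<xi> \<partial>lborel)"
        using \<mu>(3)
      proof (rule eventually_mono)
        fix v :: real assume v: "v \<in> {-1..1}"
        have "\<bar>v\<bar> \<le> 1" using v by auto
        then have "\<bar>c * v\<bar> \<le> c" using c by (simp add: abs_mult mult_left_le)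
        then have "?pt x v w \<in> S" if "x \<in> cube b" "w \<in> {0..L * b}" for x w using star[OF that(1), of "c * v" w j] that S(2) by auto
        from paraboloid_integral_le[OF g Hm S(1) this]
        show "(\<integral>\<^sup>+x. ?J x v * indicator (cube b) x \<partial>lborel) \<le> (\<integral>\<^sup>+\<xi>\<in>S. ?H \<xi> \<partial>lborel)" .
      qed
    qed
    also have "\<dots> = (\<integral>\<^sup>+\<xi>\<in>S. ?H \<xi> \<partial>lborel)" by (simp add: sp \<mu>(2))
    finally have "(\<integral>\<^sup>+x. ?F x \<partial>tan_measure b L g t) \<le> ennreal (2 ^ CARD('d)) * (ennreal (C1 * K1) * (\<integral>\<^sup>+\<xi>\<in>S. ?H \<xi> \<partial>lborel))"
      by (simp add: mult_left_mono)
    also have "\<dots> = ennreal (2 ^ CARD('d) * (C1 * K1)) * (\<integral>\<^sup>+\<xi>\<in>S. ?H \<xi> \<partial>lborel)"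
      using C1(1) by (simp add: K1_def ennreal_mult mult.assoc)
    also have "\<dots> \<le> ennreal (2 ^ CARD('d) * (C1 * K1) + K2) * (\<integral>\<^sup>+\<xi>\<in>S. ?H \<xi> \<partial>lborel)"
      by (intro mult_right_mono ennreal_leI) (auto simp: K2_def)
    finally show "(\<integral>\<^sup>+x. ?F x \<partial>tan_measure b L g t) \<le> ennreal (2 ^ CARD('d) * (C1 * K1) + K2) * (\<integral>\<^sup>+\<xi>\<in>S. ?H \<xi> \<partial>lborel)" .
  next
    fix N :: nat and t :: real and z :: complex and j and P :: "'d pt \<Rightarrow> real" and Pc and \<xi> :: "'d pt" and u B
    assume N: "1 \<le> N" and t: "t \<le> 1 / real N" and z: "cmod z \<le> \<kappa> / real N" and Pc: "complex_extension N P Pc"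
      and \<xi>: "\<xi> \<in> model_set b L g" and u: "u \<in> tangent_nbhd b t (fst \<xi>)" and B: "\<And>\<eta>. \<eta> \<in> model_star b L g \<Longrightarrow> \<bar>P \<eta>\<bar> \<le> B"
    obtain x y where xy: "\<xi> = (x, y)" by fastforce
    have x: "x \<in> cube b" and y: "0 \<le> g x - y" "g x - y \<le> L * b" using \<xi> by (auto simp: model_set_def xy)
    have u: "u \<in> tangent_nbhd b t x" using u by (simp add: xy)
    define \<beta> where "\<beta> = z * of_real (partial j g x - partial j g u) - of_real M * z\<^sup>2"
    have \<beta>: "cmod \<beta> \<le> (L * b - 0) / 2 / (real N)\<^sup>2" unfolding \<beta>_def
      using paraboloid_shift_le[OF M b \<kappa> N z nb[OF x u t]] by simp
    obtain q where q: "degree q \<le> N" "\<And>w. poly q w = Pc (paraboloid_coord M g j x z w)"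
      by (rule paraboloid_curve_w[OF Pc]) blast
    have qB: "cmod (poly q (of_real w)) \<le> exp (2 * \<kappa> / c) * B" if w: "0 \<le> w" "w \<le> L * b" for w
    proof -
      obtain Q where Q: "degree Q \<le> 2 * N" "\<And>v. poly Q v = Pc (paraboloid_coord M g j x (of_real c * v) (of_real w))"
        by (rule paraboloid_curve_v[OF Pc]) blast
      have QB: "cmod (poly Q (of_real v)) \<le> B" if v: "-1 \<le> v" "v \<le> 1" for v
      proof -
        have "paraboloid_coord M g j x (of_real c * of_real v) (of_real w) = (\<lambda>k. of_real (coord k (paraboloid_point M g j x (c * v) w)))"
          using paraboloid_coord_of_real[of M g j x "c * v" w] by (intro ext) simp
        then have "poly Q (of_real v) = of_real (P (paraboloid_point M g j x (c * v) w))"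
          unfolding Q(2) by (simp add: complex_extension_real[OF Pc])
        moreover have "\<bar>c * v\<bar> \<le> c" using c v by (simp add: abs_mult mult_left_le abs_le_iff)
        ultimately show ?thesis using B[OF star[OF x _ w]] by simp
      qed
      have B0: "0 \<le> B" using order_trans[OF norm_ge_zero QB[of 0]] by simp
      have "poly q (of_real w) = poly Q (cos (Arccos (z / of_real c)))" by (simp only: q(2) Q(2) cosz)
      then have "cmod (poly q (of_real w)) \<le> exp (real (2 * N) * \<bar>Im (Arccos (z / of_real c))\<bar>) * B"
        using bernstein_walsh[OF Q(1) QB] by (simp only:)
      also have "\<dots> \<le> exp (2 * \<kappa> / c) * B" using Im[OF N z] B0 by (intro mult_right_mono) auto
      finally show ?thesis .
    qed
    have "0 \<le> exp (2 * \<kappa> / c) * B" using order_trans[OF norm_ge_zero qB[of 0]] l by simp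
    then have B0: "0 \<le> B" by (simp add: zero_le_mult_iff)
    have "(\<lambda>k. of_real (coord k \<xi>) + z * of_real (coord k (tangent_vec g j u))) = paraboloid_coord M g j x z (of_real (g x - y) + \<beta>)"
      using tangent_curve_paraboloid[of _ x y z g j u M] by (intro ext) (simp add: \<beta>_def xy)
    then have "cmod (Pc (\<lambda>k. of_real (coord k \<xi>) + z * of_real (coord k (tangent_vec g j u))))
       = cmod (poly q (of_real (g x - y) + 0 * of_real (phi_interval 0 (L * b) (g x - y)) + \<beta>))"
      by (simp add: q(2))
    also have "\<dots> \<le> exp 14 * (exp (2 * \<kappa> / c) * B)"
      by (rule bernstein_walsh_perturb_ab[OF N q(1) l _ \<beta> y qB]) simp_all
    also have "\<dots> \<le> (2 ^ CARD('d) * (C1 * K1) + K2) * B"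
      using B0 C1(1) by (simp add: K2_def K1_def distrib_right)
    finally show "cmod (Pc (\<lambda>k. of_real (coord k \<xi>) + z * of_real (coord k (tangent_vec g j u)))) \<le> (2 ^ CARD('d) * (C1 * K1) + K2) * B" .
  qed
qed

lemma tangent_difference_average:
  assumes Pc: "complex_extension N P Pc" and r: "1 \<le> r" and \<rho>: "0 < \<rho>" and s: "2 * real r * \<bar>s\<bar> \<le> \<rho>"
  shows "\<bar>fin_diff r (s *\<^sub>R \<eta>) P \<xi>\<bar> \<le> 2 * (2 * real r) ^ r * (\<bar>s\<bar> / \<rho>) ^ r *
    ((\<Sum>l<Suc N. cmod (Pc (\<lambda>k. of_real (coord k \<xi>) + of_real \<rho> * unity_root (Suc N) l * of_real (coord k \<eta>)))) / real (Suc N))"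
proof -
  obtain H where H: "degree H \<le> N" "\<And>z. poly H z = Pc (\<lambda>k. of_real (coord k \<xi>) + z * of_real (coord k \<eta>))"
    "\<And>s. poly H (of_real s) = of_real (P (\<xi> + s *\<^sub>R \<eta>))"
    by (rule tangent_curve_poly[OF Pc]) blast
  have "(\<Sum>j=0..r. of_real ((-1) ^ (r + j) * real (r choose j)) * poly H (of_real (real j * s))) = complex_of_real (fin_diff r (s *\<^sub>R \<eta>) P \<xi>)"
    unfolding fin_diff_def H(3) by simp
  then have "\<bar>fin_diff r (s *\<^sub>R \<eta>) P \<xi>\<bar> = cmod (\<Sum>j=0..r. of_real ((-1) ^ (r + j) * real (r choose j)) * poly H (of_real (real j * s)))"
    by simp
  also have "\<dots> \<le> 2 * (2 * real r) ^ r * (\<bar>s\<bar> / \<rho>) ^ r * ((\<Sum>l<Suc N. cmod (poly H (of_real \<rho> * unity_root (Suc N) l))) / real (Suc N))"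
    by (rule difference_le_average[OF H(1) r \<rho> s])
  finally show ?thesis unfolding H(2) .
qed

text \<open>The difference along the tangent line is bounded by an average over the circle of radius
  \<open>\<kappa>0 / N\<close> in the complexified line, whose points are treated one at a time by
  \<open>tangent_perturb_le\<close>.\<close>

lemma tangent_difference_le:
  fixes g :: "real ^ ('d::finite) \<Rightarrow> real" and p b L :: real and r :: nat
  assumes p: "1 \<le> p" and g: "C2_fun g" and b: "0 < b" and L: "1 \<le> L" and r: "1 \<le> r"
  obtains C \<kappa> where "0 < C" "0 < \<kappa>" "\<kappa> \<le> 1"
    "\<And>N n s j P Pc S. 1 \<le> N \<Longrightarrow> 1 \<le> n \<Longrightarrow> real N \<le> \<kappa> * real n \<Longrightarrow> 0 < s \<Longrightarrow> s \<le> 1 / real n \<Longrightarrow> complex_extension N P Pc \<Longrightarrow> continuous_on UNIV P \<Longrightarrow>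
      S \<in> sets borel \<Longrightarrow> model_star b L g \<subseteq> S \<Longrightarrow>
      lpn p (tan_measure b L g (1 / real n)) (\<lambda>x. ennreal \<bar>fin_diff r (s *\<^sub>R tangent_vec g j (snd x)) P (fst x)\<bar>)
      \<le> ennreal (C * (real N / real n) ^ r) * lpn p lborel (\<lambda>\<xi>. ennreal \<bar>P \<xi>\<bar> * indicator S \<xi>)"
    "\<And>N n s j P Pc \<xi> u B. 1 \<le> N \<Longrightarrow> 1 \<le> n \<Longrightarrow> real N \<le> \<kappa> * real n \<Longrightarrow> 0 < s \<Longrightarrow> s \<le> 1 / real n \<Longrightarrow> complex_extension N P Pc \<Longrightarrow>
      \<xi> \<in> model_set b L g \<Longrightarrow> u \<in> tangent_nbhd b (1 / real n) (fst \<xi>) \<Longrightarrow> (\<And>\<eta>. \<eta> \<in> model_star b L g \<Longrightarrow> \<bar>P \<eta>\<bar> \<le> B) \<Longrightarrow>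
      \<bar>fin_diff r (s *\<^sub>R tangent_vec g j u) P \<xi>\<bar> \<le> C * (real N / real n) ^ r * B"
proof -
  obtain C0 \<kappa>0 where C0: "0 < C0" and \<kappa>0: "0 < \<kappa>0" "\<kappa>0 \<le> 1"
    and int: "\<And>N t z j P Pc S. 1 \<le> N \<Longrightarrow> 0 < t \<Longrightarrow> t \<le> 1 / real N \<Longrightarrow> cmod z \<le> \<kappa>0 / real N \<Longrightarrow> complex_extension N P Pc \<Longrightarrow> continuous_on UNIV P \<Longrightarrow>
      S \<in> sets borel \<Longrightarrow> model_star b L g \<subseteq> S \<Longrightarrow>
      (\<integral>\<^sup>+x. ennreal (cmod (Pc (\<lambda>k. of_real (coord k (fst x)) + z * of_real (coord k (tangent_vec g j (snd x))))) powr p) \<partial>tan_measure b L g t)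
      \<le> ennreal C0 * (\<integral>\<^sup>+\<xi>\<in>S. ennreal (\<bar>P \<xi>\<bar> powr p) \<partial>lborel)"
    and pt: "\<And>N t z j P Pc \<xi> u B. 1 \<le> N \<Longrightarrow> t \<le> 1 / real N \<Longrightarrow> cmod z \<le> \<kappa>0 / real N \<Longrightarrow> complex_extension N P Pc \<Longrightarrow>
      \<xi> \<in> model_set b L g \<Longrightarrow> u \<in> tangent_nbhd b t (fst \<xi>) \<Longrightarrow> (\<And>\<eta>. \<eta> \<in> model_star b L g \<Longrightarrow> \<bar>P \<eta>\<bar> \<le> B) \<Longrightarrow>
      cmod (Pc (\<lambda>k. of_real (coord k \<xi>) + z * of_real (coord k (tangent_vec g j u)))) \<le> C0 * B"
    by (rule tangent_perturb_le[OF p g b L]) blast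
  \<comment> \<open>\<open>C0\<close> enters the pointwise bound and \<open>C0 powr (1 / p)\<close>
    the norm bound; their sum covers both.\<close>
  define C where "C = 2 * (2 * real r) ^ r * (1 / \<kappa>0) ^ r * (C0 + C0 powr (1 / p))"
  have C: "0 < C" using C0 \<kappa>0 r by (auto simp: C_def intro!: add_pos_pos mult_pos_pos)
  \<comment> \<open>Makes \<open>2 * r * s \<le> \<kappa>0 / N\<close> for all steps
    \<open>s \<le> 1 / n\<close> when \<open>N \<le> \<kappa> n\<close>.\<close>
  define \<kappa> where "\<kappa> = \<kappa>0 / (2 * real r)"
  have \<kappa>: "0 < \<kappa>" "\<kappa> \<le> 1" using \<kappa>0 r by (auto simp: \<kappa>_def)
  define K where "K = (\<lambda>N s. 2 * (2 * real r) ^ r * (\<bar>s\<bar> / (\<kappa>0 / real N)) ^ r)"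
  have K0: "0 \<le> K N s" for N s using \<kappa>0 by (auto simp: K_def)
  have facts: "K N s \<le> 2 * (2 * real r) ^ r * (1 / \<kappa>0) ^ r * (real N / real n) ^ r" "2 * real r * \<bar>s\<bar> \<le> \<kappa>0 / real N" "1 / real n \<le> 1 / real N"
    if "1 \<le> N" "1 \<le> n" "real N \<le> \<kappa> * real n" "0 < s" "s \<le> 1 / real n" for N n s
  proof -
    have "\<bar>s\<bar> / (\<kappa>0 / real N) = s * (1 / \<kappa>0 * real N)" using that by simp
    also have "\<dots> \<le> 1 / real n * (1 / \<kappa>0 * real N)" using that \<kappa>0 by (intro mult_right_mono) auto
    finally have "(\<bar>s\<bar> / (\<kappa>0 / real N)) ^ r \<le> (1 / \<kappa>0 * (real N / real n)) ^ r"
      using \<kappa>0 by (intro power_mono) (auto simp: mult.commute)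
    then show "K N s \<le> 2 * (2 * real r) ^ r * (1 / \<kappa>0) ^ r * (real N / real n) ^ r"
      unfolding K_def by (simp only: power_mult_distrib mult.assoc) (intro mult_left_mono; simp)
    have "2 * real r * \<bar>s\<bar> * real N \<le> 2 * real r * (1 / real n) * (\<kappa> * real n)"
      using that by (intro mult_mono mult_left_mono) auto
    also have "\<dots> = \<kappa>0" using r that by (simp add: \<kappa>_def)
    finally show "2 * real r * \<bar>s\<bar> \<le> \<kappa>0 / real N" using that by (simp add: pos_le_divide_eq)
    have "real N \<le> 1 * real n" using that(3) mult_right_mono[OF \<kappa>(2), of "real n"] by simp
    then show "1 / real n \<le> 1 / real N" using that by (intro divide_left_mono) auto
  qed
  have avg: "\<bar>fin_diff r (s *\<^sub>R \<eta>) P \<xi>\<bar> \<le> (\<Sum>l<Suc N. K N s / real (Suc N) * cmod (Pc (\<lambda>k. of_real (coord k \<xi>) + of_real (\<kappa>0 / real N) * unity_root (Suc N) l * of_real (coord k \<eta>))))"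
    if "1 \<le> N" "2 * real r * \<bar>s\<bar> \<le> \<kappa>0 / real N" "complex_extension N P Pc" for N s \<xi> \<eta> and P :: "'d pt \<Rightarrow> real" and Pc
  proof -
    have eq: "(\<Sum>l<Suc N. K N s / real (Suc N) * f l) = K N s * ((\<Sum>l<Suc N. f l) / real (Suc N))" for f
      by (simp only: times_divide_eq_left times_divide_eq_right sum_distrib_left sum_divide_distrib)
    have "0 < \<kappa>0 / real N" using that(1) \<kappa>0 by simp
    from tangent_difference_average[OF that(3) r this that(2)] show ?thesis unfolding eq unfolding K_def .
  qed
  have nz: "cmod (of_real (\<kappa>0 / real N) * unity_root (Suc N) l) \<le> \<kappa>0 / real N" for N l
    using \<kappa>0 by (simp add: norm_mult norm_divide)
  have avgc: "(\<Sum>l<Suc N. a / real (Suc N)) = a" for a N by (simp del: sum.lessThan_Suc of_nat_Suc)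
  have ee: "ennreal (\<Sum>l<m. a * f l) = (\<Sum>l<m. ennreal a * ennreal (f l))" if "0 \<le> a" "\<And>l. 0 \<le> f l" for a f and m :: nat
    using that by (simp add: sum_ennreal flip: ennreal_mult)
  show thesis
  proof (rule that[OF C \<kappa>])
    fix N n :: nat and s :: real and j and P :: "'d pt \<Rightarrow> real" and Pc S
    assume h: "1 \<le> N" "1 \<le> n" "real N \<le> \<kappa> * real n" "0 < s" "s \<le> 1 / real n" and Pc: "complex_extension N P Pc"
      and P: "continuous_on UNIV P" and S: "S \<in> sets borel" "model_star b L g \<subseteq> S"
    let ?\<mu> = "tan_measure b L g (1 / real n)"
    let ?G = "\<lambda>l x. ennreal (cmod (Pc (\<lambda>k. of_real (coord k (fst x)) + of_real (\<kappa>0 / real N) * unity_root (Suc N) l * of_real (coord k (tangent_vec g j (snd x))))))"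
    let ?R = "lpn p lborel (\<lambda>\<xi>. ennreal \<bar>P \<xi>\<bar> * indicator S \<xi>)"
    have Gm[measurable]: "?G l \<in> borel_measurable (borel :: ('d pt \<times> (real ^ 'd)) measure)" for l
    proof -
      have "continuous_on UNIV (\<lambda>x :: 'd pt \<times> (real ^ 'd). Pc (\<lambda>k. of_real (coord k (fst x)) + of_real (\<kappa>0 / real N) * unity_root (Suc N) l * of_real (coord k (tangent_vec g j (snd x)))))"
        by (intro continuous_complex_extension[OF Pc] continuous_intros continuous_on_coord continuous_on_tangent_vec[OF g])
      then have [measurable]: "(\<lambda>x :: 'd pt \<times> (real ^ 'd). Pc (\<lambda>k. of_real (coord k (fst x)) + of_real (\<kappa>0 / real N) * unity_root (Suc N) l * of_real (coord k (tangent_vec g j (snd x))))) \<in> borel_measurable borel"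
        by (rule borel_measurable_continuous_onI)
      show ?thesis by measurable
    qed
    have Gl: "lpn p ?\<mu> (?G l) \<le> ennreal (C0 powr (1 / p)) * ?R" for l
    proof -
      have "(\<integral>\<^sup>+x. ennreal_powr (?G l x) p \<partial>?\<mu>) \<le> ennreal C0 * (\<integral>\<^sup>+\<xi>\<in>S. ennreal (\<bar>P \<xi>\<bar> powr p) \<partial>lborel)"
        using int[OF h(1) _ facts(3)[OF h] nz Pc P S, of l j] h by simp
      also have "(\<integral>\<^sup>+\<xi>\<in>S. ennreal (\<bar>P \<xi>\<bar> powr p) \<partial>lborel) = (\<integral>\<^sup>+\<xi>. ennreal_powr (ennreal \<bar>P \<xi>\<bar> * indicator S \<xi>) p \<partial>lborel)"
        by (intro nn_integral_cong) (auto simp: indicator_def)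
      finally show ?thesis using p C0 by (subst lpn_le_iff) (auto simp: ennreal_powr_mult lpn_power powr_powr)
    qed
    have "lpn p ?\<mu> (\<lambda>x. ennreal \<bar>fin_diff r (s *\<^sub>R tangent_vec g j (snd x)) P (fst x)\<bar>)
       \<le> lpn p ?\<mu> (\<lambda>x. \<Sum>l<Suc N. ennreal (K N s / real (Suc N)) * ?G l x)"
    proof (rule lpn_mono[OF p])
      fix x :: "'d pt \<times> (real ^ 'd)"
      have "ennreal \<bar>fin_diff r (s *\<^sub>R tangent_vec g j (snd x)) P (fst x)\<bar> \<le> ennreal (\<Sum>l<Suc N. K N s / real (Suc N) *
          cmod (Pc (\<lambda>k. of_real (coord k (fst x)) + of_real (\<kappa>0 / real N) * unity_root (Suc N) l * of_real (coord k (tangent_vec g j (snd x))))))"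
        by (intro ennreal_leI avg[OF h(1) facts(2)[OF h] Pc])
      also have "\<dots> = (\<Sum>l<Suc N. ennreal (K N s / real (Suc N)) * ?G l x)"
        using K0[of N s] by (intro ee) auto
      finally show "ennreal \<bar>fin_diff r (s *\<^sub>R tangent_vec g j (snd x)) P (fst x)\<bar> \<le> \<dots>" .
    qed
    also have "\<dots> \<le> (\<Sum>l<Suc N. lpn p ?\<mu> (\<lambda>x. ennreal (K N s / real (Suc N)) * ?G l x))"
      by (rule lpn_sum[OF p]) measurable
    also have "\<dots> = (\<Sum>l<Suc N. ennreal (K N s / real (Suc N)) * lpn p ?\<mu> (?G l))"
      by (intro sum.cong refl lpn_cmult[OF p]) measurable
    also have "\<dots> \<le> (\<Sum>l<Suc N. ennreal (K N s / real (Suc N)) * (ennreal (C0 powr (1 / p)) * ?R))"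
      by (intro sum_mono mult_left_mono Gl) auto
    also have "\<dots> = (\<Sum>l<Suc N. ennreal (K N s / real (Suc N))) * (ennreal (C0 powr (1 / p)) * ?R)"
      by (rule sum_distrib_right[symmetric])
    also have "(\<Sum>l<Suc N. ennreal (K N s / real (Suc N))) = ennreal (K N s)"
      using K0[of N s] avgc[of "K N s" N] by (subst sum_ennreal) (auto simp del: sum.lessThan_Suc of_nat_Suc)
    also have "ennreal (K N s) * (ennreal (C0 powr (1 / p)) * ?R) = ennreal (K N s * C0 powr (1 / p)) * ?R"
      using K0[of N s] by (simp add: ennreal_mult' mult.assoc)
    also have "\<dots> \<le> ennreal (C * (real N / real n) ^ r) * ?R"
    proof (intro mult_right_mono ennreal_leI)
      have "K N s * C0 powr (1 / p) \<le> (2 * (2 * real r) ^ r * (1 / \<kappa>0) ^ r * (real N / real n) ^ r) * (C0 + C0 powr (1 / p))"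
        using facts(1)[OF h] C0 \<kappa>0 by (intro mult_mono) auto
      then show "K N s * C0 powr (1 / p) \<le> C * (real N / real n) ^ r" by (simp add: C_def mult_ac)
    qed simp
    finally show "lpn p ?\<mu> (\<lambda>x. ennreal \<bar>fin_diff r (s *\<^sub>R tangent_vec g j (snd x)) P (fst x)\<bar>) \<le> ennreal (C * (real N / real n) ^ r) * ?R" .
  next
    fix N n :: nat and s :: real and j and P :: "'d pt \<Rightarrow> real" and Pc and \<xi> :: "'d pt" and u B
    assume h: "1 \<le> N" "1 \<le> n" "real N \<le> \<kappa> * real n" "0 < s" "s \<le> 1 / real n" and Pc: "complex_extension N P Pc"
      and \<xi>: "\<xi> \<in> model_set b L g" and u: "u \<in> tangent_nbhd b (1 / real n) (fst \<xi>)" and B: "\<And>\<eta>. \<eta> \<in> model_star b L g \<Longrightarrow> \<bar>P \<eta>\<bar> \<le> B"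
    have "0 \<le> C0 * B" using order_trans[OF norm_ge_zero pt[OF h(1) facts(3)[OF h] nz Pc \<xi> u B, of 0 j]] .
    then have B0: "0 \<le> B" using C0 by (simp add: zero_le_mult_iff)
    have "\<bar>fin_diff r (s *\<^sub>R tangent_vec g j u) P \<xi>\<bar> \<le> (\<Sum>l<Suc N. K N s / real (Suc N) *
        cmod (Pc (\<lambda>k. of_real (coord k \<xi>) + of_real (\<kappa>0 / real N) * unity_root (Suc N) l * of_real (coord k (tangent_vec g j u)))))"
      by (rule avg[OF h(1) facts(2)[OF h] Pc])
    also have "\<dots> \<le> (\<Sum>l<Suc N. K N s / real (Suc N) * (C0 * B))"
      using K0[of N s] by (intro sum_mono mult_left_mono pt[OF h(1) facts(3)[OF h] nz Pc \<xi> u B]) auto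
    also have "\<dots> = K N s * (C0 * B)" by (simp only: sum_distrib_right[symmetric] avgc)
    also have "\<dots> \<le> (2 * (2 * real r) ^ r * (1 / \<kappa>0) ^ r * (real N / real n) ^ r) * ((C0 + C0 powr (1 / p)) * B)"
      using facts(1)[OF h] C0 \<kappa>0 B0 by (intro mult_mono mult_right_mono) auto
    also have "\<dots> = C * (real N / real n) ^ r * B" by (simp add: C_def mult_ac)
    finally show "\<bar>fin_diff r (s *\<^sub>R tangent_vec g j u) P \<xi>\<bar> \<le> C * (real N / real n) ^ r * B" .
  qed
qed

text \<open>All is pulled back by \<open>T\<close>, which preserves volume and turns polynomials
  into polynomials, so that the estimates on the model domain apply to \<open>P \<circ> T\<close> on
  the preimage \<open>S\<close> of \<open>\<Omega>\<close>. For \<open>f - P\<close> the shift is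
  undone for each \<open>u\<close> by translation, after which only \<open>T\<close>
  remains.\<close>

lemma omega_tan_le:
  fixes p :: ennreal and r :: nat and \<Omega> :: "('d::finite) pt set" and G :: "'d special_domain"
  assumes p: "1 \<le> p" and r: "1 \<le> r" and \<Omega>: "compact \<Omega>" and \<Omega>0: "\<Omega> \<noteq> {}"
    and valid: "special_domain_valid G" and att: "attached G \<Omega>"
  obtains C where "0 < C" "\<And>n f. 1 \<le> n \<Longrightarrow> f \<in> Lp_space p \<Omega> \<Longrightarrow>
    omega_tan A0 p \<Omega> G r f (1 / real n) \<le> ennreal (C / real n ^ r) * (\<Sum>j=0..n. ennreal (real (j + 1) ^ (r - 1)) * best_approx p \<Omega> j f)"
proof -
  define b where "b = sd_base G"
  define L where "L = sd_param G"
  define g where "g = sd_fun G"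
  define T where "T = sd_place G"
  define S where "S = T -` \<Omega>"
  have b: "0 < b" and L: "1 \<le> L" and g: "C2_fun g"
    using valid unfolding special_domain_valid_def b_def L_def g_def by auto
  \<comment> \<open>The box condition in \<open>attached\<close> places the starred domain, into
    which the parabolas extend, inside \<open>\<Omega>\<close>.\<close>
  have star: "model_star b L g \<subseteq> S"
  proof -
    obtain a c where "T ` model_star b L g = box a c \<inter> \<Omega>"
      using att unfolding attached_def sd_star_def T_def b_def L_def g_def by blast
    then show ?thesis unfolding S_def by blast
  qed
  have Tc: "continuous_on UNIV T" unfolding T_def sd_place_isometry by (rule continuous_coord_isometry)
  then have Tm[measurable]: "T \<in> borel_measurable borel" by (rule borel_measurable_continuous_onI)
  have \<Omega>b[measurable]: "\<Omega> \<in> sets borel" and \<Omega>l: "\<Omega> \<in> sets lebesgue" using \<Omega> by (auto intro: borel_compact lmeasurable_compact fmeasurableD)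
  have Sb[measurable]: "S \<in> sets borel"
    using measurable_sets[OF Tm \<Omega>b] by (simp add: S_def)
  have fin: "Lp_norm p \<Omega> f < \<infinity>" if "f \<in> Lp_space p \<Omega>" for f using that \<Omega> by (rule Lp_space_finite)
  have tri: "Lp_norm p \<Omega> (\<lambda>\<xi>. P \<xi> - Q \<xi>) \<le> Lp_norm p \<Omega> (\<lambda>\<xi>. f \<xi> - P \<xi>) + Lp_norm p \<Omega> (\<lambda>\<xi>. f \<xi> - Q \<xi>)"
    if "f \<in> Lp_space p \<Omega>" "P \<in> poly_space k" "Q \<in> poly_space k" for f P Q k
    using that \<Omega>l by (intro Lp_norm_triangle[OF p]) (auto intro: borel_measurable_poly_space)
  have ext: "\<exists>Pc. complex_extension N (P \<circ> T) Pc" if "P \<in> poly_space N" for N and P :: "'d pt \<Rightarrow> real"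
    using poly_space_complex_extension[OF that] complex_extension_place[of N P _ G] unfolding T_def by blast
  have cont: "continuous_on UNIV (P \<circ> T)" if "P \<in> poly_space N" for N and P :: "'d pt \<Rightarrow> real"
    using Tc continuous_on_poly_space[OF that] by (rule continuous_on_compose)
  have tri_diff: "ennreal \<bar>fin_diff r v (f \<circ> T) \<xi>\<bar> \<le> ennreal \<bar>fin_diff r v (P \<circ> T) \<xi>\<bar> +
      (\<Sum>k=0..r. ennreal (real (r choose k)) * ennreal \<bar>f (T (\<xi> + real k *\<^sub>R v)) - P (T (\<xi> + real k *\<^sub>R v))\<bar>)" for v \<xi> f P
  proof -
    have "ennreal \<bar>fin_diff r v (f \<circ> T) \<xi>\<bar> \<le> ennreal (\<bar>fin_diff r v (P \<circ> T) \<xi>\<bar> +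
        (\<Sum>k=0..r. real (r choose k) * \<bar>(f \<circ> T) (\<xi> + real k *\<^sub>R v) - (P \<circ> T) (\<xi> + real k *\<^sub>R v)\<bar>))"
      by (intro ennreal_leI fin_diff_triangle)
    also have "\<dots> = ennreal \<bar>fin_diff r v (P \<circ> T) \<xi>\<bar> +
        (\<Sum>k=0..r. ennreal (real (r choose k)) * ennreal \<bar>f (T (\<xi> + real k *\<^sub>R v)) - P (T (\<xi> + real k *\<^sub>R v))\<bar>)"
      by (subst ennreal_plus) (auto intro!: sum_nonneg simp: sum_ennreal simp flip: ennreal_mult)
    finally show ?thesis .
  qed
  \<comment> \<open>For \<open>p = \<infinity>\<close> the value 1 is a placeholder:
    \<open>tangent_difference_le\<close> asks for a finite exponent, and its pointwise part does not
    depend on which one in form.\<close>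
  define pr where "pr = (if p = \<infinity> then 1 else enn2real p)"
  have pr: "1 \<le> pr" unfolding pr_def using one_le_enn2real[OF p] by simp
  obtain c2 \<kappa> where c2: "0 < c2" and \<kappa>: "0 < \<kappa>" "\<kappa> \<le> 1"
    and intb: "\<And>N n s j P Pc S. 1 \<le> N \<Longrightarrow> 1 \<le> n \<Longrightarrow> real N \<le> \<kappa> * real n \<Longrightarrow> 0 < s \<Longrightarrow> s \<le> 1 / real n \<Longrightarrow> complex_extension N P Pc \<Longrightarrow> continuous_on UNIV P \<Longrightarrow>
      S \<in> sets borel \<Longrightarrow> model_star b L g \<subseteq> S \<Longrightarrow>
      lpn pr (tan_measure b L g (1 / real n)) (\<lambda>x. ennreal \<bar>fin_diff r (s *\<^sub>R tangent_vec g j (snd x)) P (fst x)\<bar>)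
      \<le> ennreal (c2 * (real N / real n) ^ r) * lpn pr lborel (\<lambda>\<xi>. ennreal \<bar>P \<xi>\<bar> * indicator S \<xi>)"
    and ptb: "\<And>N n s j P Pc \<xi> u B. 1 \<le> N \<Longrightarrow> 1 \<le> n \<Longrightarrow> real N \<le> \<kappa> * real n \<Longrightarrow> 0 < s \<Longrightarrow> s \<le> 1 / real n \<Longrightarrow> complex_extension N P Pc \<Longrightarrow>
      \<xi> \<in> model_set b L g \<Longrightarrow> u \<in> tangent_nbhd b (1 / real n) (fst \<xi>) \<Longrightarrow> (\<And>\<eta>. \<eta> \<in> model_star b L g \<Longrightarrow> \<bar>P \<eta>\<bar> \<le> B) \<Longrightarrow>
      \<bar>fin_diff r (s *\<^sub>R tangent_vec g j u) P \<xi>\<bar> \<le> c2 * (real N / real n) ^ r * B"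
    by (rule tangent_difference_le[OF pr g b L r]) blast
  \<comment> \<open>\<open>2 ^ r\<close> is the sum of the binomial coefficients, and
    \<open>2 ^ CARD('d)\<close> the mass of the average over the directions
    \<open>u\<close>.\<close>
  define c1 :: real where "c1 = 2 ^ CARD('d) * 2 ^ r"
  have c1: "0 < c1" "2 ^ r \<le> c1" by (auto simp: c1_def)
  obtain C where C: "0 < C" "\<And>p (\<Omega> :: 'd pt set) f n \<Psi> \<Psi>'. 1 \<le> n \<Longrightarrow> Lp_norm p \<Omega> f < \<infinity> \<Longrightarrow>
     (\<And>k P Q. P \<in> poly_space k \<Longrightarrow> Q \<in> poly_space k \<Longrightarrow> Lp_norm p \<Omega> (\<lambda>\<xi>. P \<xi> - Q \<xi>) \<le> Lp_norm p \<Omega> (\<lambda>\<xi>. f \<xi> - P \<xi>) + Lp_norm p \<Omega> (\<lambda>\<xi>. f \<xi> - Q \<xi>)) \<Longrightarrow>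
     (\<And>k P. P \<in> poly_space k \<Longrightarrow> \<Psi> \<le> \<Psi>' P + ennreal c1 * Lp_norm p \<Omega> (\<lambda>\<xi>. f \<xi> - P \<xi>)) \<Longrightarrow>
     (\<And>k P Q. P \<in> poly_space k \<Longrightarrow> Q \<in> poly_space k \<Longrightarrow> \<Psi>' P \<le> \<Psi>' Q + \<Psi>' (\<lambda>\<xi>. P \<xi> - Q \<xi>)) \<Longrightarrow>
     (\<And>N P. 1 \<le> N \<Longrightarrow> real N \<le> \<kappa> * real n \<Longrightarrow> P \<in> poly_space N \<Longrightarrow> \<Psi>' P \<le> ennreal (c2 * (real N / real n) ^ r) * Lp_norm p \<Omega> P) \<Longrightarrow>
     (\<And>P. P \<in> poly_space 0 \<Longrightarrow> \<Psi>' P = 0) \<Longrightarrow>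
     \<Psi> \<le> ennreal (C / real n ^ r) * (\<Sum>j=0..n. ennreal (real (j + 1) ^ (r - 1)) * best_approx p \<Omega> j f)"
    by (rule dyadic_inverse_estimate[OF \<kappa> c1(1) c2 r]) blast
  show thesis
  proof (rule that[OF C(1)])
    fix n :: nat and f :: "'d pt \<Rightarrow> real" assume n: "1 \<le> n" and f: "f \<in> Lp_space p \<Omega>"
    define t where "t = 1 / real n"
    have t: "0 < t" "min t 1 = t" using n by (auto simp: t_def)
    let ?in = "model_inner A0 b L g t"
    have inn: "\<xi> \<in> model_set b L g" if "\<xi> \<in> ?in" for \<xi> using that by (simp add: model_inner_def)
    show "omega_tan A0 p \<Omega> G r f (1 / real n) \<le> ennreal (C / real n ^ r) * (\<Sum>j=0..n. ennreal (real (j + 1) ^ (r - 1)) * best_approx p \<Omega> j f)"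
      unfolding omega_tan_def model_modulus_def t_def[symmetric] t(2)
        T_def[symmetric] S_def[symmetric] b_def[symmetric] L_def[symmetric] g_def[symmetric]
    proof (intro SUP_least)
      fix s j assume "s \<in> {0<..t}"
      then have s: "0 < s" "s \<le> 1 / real n" by (auto simp: t_def)
      let ?v = "\<lambda>u. s *\<^sub>R tangent_vec g j u"
      show "(if p = \<infinity> then (SUP \<xi>\<in>?in. SUP u\<in>tangent_nbhd b t (fst \<xi>). ennreal \<bar>fin_diff_on r (?v u) (f \<circ> T) S \<xi>\<bar>)
         else ennreal_powr (\<integral>\<^sup>+\<xi>\<in>?in. ennreal (1 / (b * t) ^ CARD('d)) *
              (\<integral>\<^sup>+u\<in>tangent_nbhd b t (fst \<xi>). ennreal (\<bar>fin_diff_on r (?v u) (f \<circ> T) S \<xi>\<bar> powr enn2real p) \<partial>lebesgue) \<partial>lebesgue) (1 / enn2real p))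
        \<le> ennreal (C / real n ^ r) * (\<Sum>j=0..n. ennreal (real (j + 1) ^ (r - 1)) * best_approx p \<Omega> j f)"
      proof (cases "p = \<infinity>")
        case True
        define D where "D = (\<lambda>P \<xi> u. ennreal \<bar>fin_diff r (?v u) (P \<circ> T) \<xi>\<bar>)"
        define \<Psi>' where "\<Psi>' = (\<lambda>P. SUP \<xi>\<in>?in. SUP u\<in>tangent_nbhd b t (fst \<xi>). D P \<xi> u)"
        have upper: "D P \<xi> u \<le> \<Psi>' P" if "\<xi> \<in> ?in" "u \<in> tangent_nbhd b t (fst \<xi>)" for P \<xi> u
          unfolding \<Psi>'_def by (rule SUP_upper2[OF that(1)], rule SUP_upper[OF that(2)])
        have "(SUP \<xi>\<in>?in. SUP u\<in>tangent_nbhd b t (fst \<xi>). ennreal \<bar>fin_diff_on r (?v u) (f \<circ> T) S \<xi>\<bar>)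
          \<le> ennreal (C / real n ^ r) * (\<Sum>j=0..n. ennreal (real (j + 1) ^ (r - 1)) * best_approx p \<Omega> j f)"
        proof (rule C(2)[OF n fin[OF f] tri[OF f], where \<Psi>' = \<Psi>'])
          fix k P assume P: "P \<in> (poly_space k :: ('d pt \<Rightarrow> real) set)"
          let ?E = "Lp_norm p \<Omega> (\<lambda>\<xi>. f \<xi> - P \<xi>)"
          have E: "?E = (SUP \<xi>\<in>\<Omega>. ennreal \<bar>f \<xi> - P \<xi>\<bar>)" by (simp only: True Lp_norm_uniform)
          show "(SUP \<xi>\<in>?in. SUP u\<in>tangent_nbhd b t (fst \<xi>). ennreal \<bar>fin_diff_on r (?v u) (f \<circ> T) S \<xi>\<bar>) \<le> \<Psi>' P + ennreal c1 * ?E"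
          proof (intro SUP_least)
            fix \<xi> u assume \<xi>: "\<xi> \<in> ?in" and u: "u \<in> tangent_nbhd b t (fst \<xi>)"
            show "ennreal \<bar>fin_diff_on r (?v u) (f \<circ> T) S \<xi>\<bar> \<le> \<Psi>' P + ennreal c1 * ?E"
            proof (cases "closed_segment \<xi> (\<xi> + real r *\<^sub>R ?v u) \<subseteq> S")
              case seg: True
              have "ennreal \<bar>fin_diff r (?v u) (f \<circ> T) \<xi>\<bar> \<le> D P \<xi> u +
                 (\<Sum>k=0..r. ennreal (real (r choose k)) * ennreal \<bar>f (T (\<xi> + real k *\<^sub>R ?v u)) - P (T (\<xi> + real k *\<^sub>R ?v u))\<bar>)"
                unfolding D_def by (rule tri_diff)
              also have "\<dots> \<le> \<Psi>' P + (\<Sum>k=0..r. ennreal (real (r choose k)) * ?E)"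
              proof (intro add_mono upper[OF \<xi> u] sum_mono mult_left_mono)
                fix k assume "k \<in> {0..r}"
                then have "\<xi> + real k *\<^sub>R ?v u \<in> S" using seg r by (intro segment_point) auto
                then have "T (\<xi> + real k *\<^sub>R ?v u) \<in> \<Omega>" by (simp add: S_def)
                then show "ennreal \<bar>f (T (\<xi> + real k *\<^sub>R ?v u)) - P (T (\<xi> + real k *\<^sub>R ?v u))\<bar> \<le> ?E"
                  unfolding E by (rule SUP_upper)
              qed simp
              also have "\<dots> \<le> \<Psi>' P + ennreal c1 * ?E"
                unfolding sum_binomial_ennreal using c1 by (intro add_left_mono mult_right_mono ennreal_leI) auto
              finally show ?thesis using seg by (simp add: fin_diff_on_def)
            qed (simp add: fin_diff_on_def)
          qed
        next
          fix k P Q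
          have "(SUP \<xi>\<in>?in. SUP u\<in>tangent_nbhd b t (fst \<xi>). D P \<xi> u) \<le> \<Psi>' Q + \<Psi>' (\<lambda>\<xi>. P \<xi> - Q \<xi>)"
          proof (intro SUP_least)
            fix \<xi> u assume \<xi>: "\<xi> \<in> ?in" "u \<in> tangent_nbhd b t (fst \<xi>)"
            have "D P \<xi> u \<le> D Q \<xi> u + D (\<lambda>\<xi>. P \<xi> - Q \<xi>) \<xi> u"
              unfolding D_def o_def fin_diff_diff by (rule ennreal_abs_le_add) linarith
            also have "\<dots> \<le> \<Psi>' Q + \<Psi>' (\<lambda>\<xi>. P \<xi> - Q \<xi>)" using \<xi> by (intro add_mono upper)
            finally show "D P \<xi> u \<le> \<dots>" .
          qed
          then show "\<Psi>' P \<le> \<Psi>' Q + \<Psi>' (\<lambda>\<xi>. P \<xi> - Q \<xi>)" unfolding \<Psi>'_def .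
        next
          fix N and P :: "'d pt \<Rightarrow> real" assume N: "1 \<le> N" "real N \<le> \<kappa> * real n" and P: "P \<in> poly_space N"
          obtain Pc where Pc: "complex_extension N (P \<circ> T) Pc" using ext[OF P] by blast
          obtain B where B: "\<And>\<eta>. \<eta> \<in> \<Omega> \<Longrightarrow> \<bar>P \<eta>\<bar> \<le> B" and BS: "ennreal B = (SUP \<xi>\<in>\<Omega>. ennreal \<bar>P \<xi>\<bar>)"
            using uniform_norm_attained[OF \<Omega> \<Omega>0 continuous_on_poly_space[OF P]] by blast
          have "\<Psi>' P \<le> ennreal (c2 * (real N / real n) ^ r * B)" unfolding \<Psi>'_def D_def t_def
          proof (intro SUP_least ennreal_leI ptb[OF N(1) n N(2) s Pc])
            fix \<eta> assume "\<eta> \<in> model_star b L g"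
            then show "\<bar>(P \<circ> T) \<eta>\<bar> \<le> B" using B star by (auto simp: S_def)
          qed (simp_all add: inn t_def)
          also have "\<dots> = ennreal (c2 * (real N / real n) ^ r) * Lp_norm p \<Omega> P"
            unfolding True Lp_norm_uniform BS[symmetric] using c2 by (intro ennreal_mult') auto
          finally show "\<Psi>' P \<le> ennreal (c2 * (real N / real n) ^ r) * Lp_norm p \<Omega> P" .
        next
          fix P :: "'d pt \<Rightarrow> real" assume "P \<in> poly_space 0"
          then obtain c where "P = (\<lambda>_. c)" by (rule poly_space_0_const)
          then have "D P \<xi> u = 0" for \<xi> u using r by (simp add: D_def o_def fin_diff_const)
          then have "\<Psi>' P \<le> 0" unfolding \<Psi>'_def by (intro SUP_least) simp
          then show "\<Psi>' P = 0" by simp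
        qed
        then show ?thesis using True by simp
      next
        case False
        have prp: "enn2real p = pr" using False by (simp add: pr_def)
        let ?\<mu> = "tan_measure b L g t"
        define D where "D = (\<lambda>P x. ennreal \<bar>fin_diff r (?v (snd x)) (P \<circ> T) (fst x)\<bar>)"
        define \<Psi>' where "\<Psi>' = (\<lambda>P. lpn pr ?\<mu> (D P))"
        have vm: "(\<lambda>x. fst x + c *\<^sub>R tangent_vec g j (snd x)) \<in> borel_measurable (borel :: ('d pt \<times> (real ^ 'd)) measure)" for c
          by (intro borel_measurable_continuous_onI continuous_intros continuous_on_tangent_vec[OF g])
        have Dm[measurable]: "D P \<in> borel_measurable borel" if [measurable]: "P \<in> borel_measurable borel" for P
        proof -
          have [measurable]: "(\<lambda>x. (P \<circ> T) (fst x + real k *\<^sub>R ?v (snd x))) \<in> borel_measurable (borel :: ('d pt \<times> (real ^ 'd)) measure)" for k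
            using measurable_compose[OF vm[of "real k * s"], of "P \<circ> T" borel] by (simp add: o_def)
          show ?thesis unfolding D_def fin_diff_def by measurable
        qed
        let ?\<Psi> = "ennreal_powr (\<integral>\<^sup>+\<xi>\<in>?in. ennreal (1 / (b * t) ^ CARD('d)) *
              (\<integral>\<^sup>+u\<in>tangent_nbhd b t (fst \<xi>). ennreal (\<bar>fin_diff_on r (?v u) (f \<circ> T) S \<xi>\<bar> powr pr) \<partial>lebesgue) \<partial>lebesgue) (1 / pr)"
        have "?\<Psi> \<le> ennreal (C / real n ^ r) * (\<Sum>j=0..n. ennreal (real (j + 1) ^ (r - 1)) * best_approx p \<Omega> j f)"
        proof (rule C(2)[OF n fin[OF f] tri[OF f], where \<Psi>' = \<Psi>'])
          fix k P assume P: "P \<in> (poly_space k :: ('d pt \<Rightarrow> real) set)"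
          have Pm[measurable]: "P \<in> borel_measurable borel" by (rule borel_measurable_poly_space[OF P])
          obtain h where h[measurable]: "h \<in> borel_measurable borel" and hF: "\<And>\<xi>. ennreal \<bar>f \<xi> - P \<xi>\<bar> * indicator \<Omega> \<xi> \<le> h \<xi>"
            and hn: "lpn pr lborel h = lpn pr lborel (\<lambda>\<xi>. ennreal \<bar>f \<xi> - P \<xi>\<bar> * indicator \<Omega> \<xi>)"
            using borel_majorant[OF pr Lp_space_diff_measurable[OF f False \<Omega>l Pm]] by blast
          define H where "H = (\<lambda>k x. h (T (fst x + (real k * s) *\<^sub>R tangent_vec g j (snd x))))"
          have Hm[measurable]: "H k \<in> borel_measurable borel" for k
            unfolding H_def by (rule measurable_compose[OF measurable_compose[OF vm Tm] h])
          have Hk: "lpn pr ?\<mu> (H k) \<le> ennreal (2 ^ CARD('d)) * lpn pr lborel h" for k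
          proof -
            have "(\<integral>\<^sup>+x. ennreal_powr (H k x) pr \<partial>?\<mu>) \<le> ennreal (2 ^ CARD('d)) * (\<integral>\<^sup>+\<xi>. ennreal_powr (h (T \<xi>)) pr \<partial>lborel)"
              unfolding H_def by (rule tan_measure_shift_le[OF g b t(1), where h = "\<lambda>\<xi>. ennreal_powr (h (T \<xi>)) pr"]) measurable
            also have "(\<integral>\<^sup>+\<xi>. ennreal_powr (h (T \<xi>)) pr \<partial>lborel) = (\<integral>\<^sup>+\<xi>. ennreal_powr (h \<xi>) pr \<partial>lborel)"
              unfolding T_def by (rule nn_integral_sd_place) measurable
            also have "\<dots> = ennreal_powr (lpn pr lborel h) pr" by (simp add: lpn_power pr)
            also have "ennreal (2 ^ CARD('d)) * \<dots> \<le> ennreal ((2 ^ CARD('d)) powr pr) * ennreal_powr (lpn pr lborel h) pr"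
            proof (intro mult_right_mono ennreal_leI)
              show "2 ^ CARD('d) \<le> (2 ^ CARD('d) :: real) powr pr" using powr_mono[OF pr, of "2 ^ CARD('d)"] by simp
            qed simp
            also have "\<dots> = ennreal_powr (ennreal (2 ^ CARD('d)) * lpn pr lborel h) pr"
              using pr by (simp add: ennreal_powr_mult)
            finally show ?thesis by (subst lpn_le_iff[OF pr])
          qed
          \<comment> \<open>A Borel function of the pair that dominates the difference of
            \<open>f\<close> everywhere. The passage to \<open>F\<close> is by monotonicity of the
            integral, which asks for no measurability of the original integrand.\<close>
          define F where "F = (\<lambda>x. D P x + (\<Sum>k=0..r. ennreal (real (r choose k)) * H k x))"
          have Fm[measurable]: "F \<in> borel_measurable borel" unfolding F_def by measurable
          have dom: "ennreal \<bar>fin_diff_on r (?v u) (f \<circ> T) S \<xi>\<bar> \<le> F (\<xi>, u)" for \<xi> u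
          proof (cases "closed_segment \<xi> (\<xi> + real r *\<^sub>R ?v u) \<subseteq> S")
            case seg: True
            have "ennreal \<bar>fin_diff r (?v u) (f \<circ> T) \<xi>\<bar> \<le> D P (\<xi>, u) +
                 (\<Sum>k=0..r. ennreal (real (r choose k)) * ennreal \<bar>f (T (\<xi> + real k *\<^sub>R ?v u)) - P (T (\<xi> + real k *\<^sub>R ?v u))\<bar>)"
              unfolding D_def fst_conv snd_conv by (rule tri_diff)
            also have "\<dots> \<le> F (\<xi>, u)" unfolding F_def
            proof (intro add_left_mono sum_mono mult_left_mono)
              fix k assume "k \<in> {0..r}"
              then have "\<xi> + real k *\<^sub>R ?v u \<in> S" using seg r by (intro segment_point) auto
              then have "T (\<xi> + real k *\<^sub>R ?v u) \<in> \<Omega>" by (simp add: S_def)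
              then show "ennreal \<bar>f (T (\<xi> + real k *\<^sub>R ?v u)) - P (T (\<xi> + real k *\<^sub>R ?v u))\<bar> \<le> H k (\<xi>, u)"
                using hF[of "T (\<xi> + real k *\<^sub>R ?v u)"] by (simp add: H_def)
            qed simp
            finally show ?thesis using seg by (simp add: fin_diff_on_def)
          qed (simp add: fin_diff_on_def)
          have "(\<integral>\<^sup>+\<xi>\<in>?in. ennreal (1 / (b * t) ^ CARD('d)) *
              (\<integral>\<^sup>+u\<in>tangent_nbhd b t (fst \<xi>). ennreal (\<bar>fin_diff_on r (?v u) (f \<circ> T) S \<xi>\<bar> powr pr) \<partial>lebesgue) \<partial>lebesgue)
            \<le> (\<integral>\<^sup>+\<xi>\<in>model_set b L g. ennreal (1 / (b * t) ^ CARD('d)) *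
              (\<integral>\<^sup>+u\<in>tangent_nbhd b t (fst \<xi>). ennreal_powr (F (\<xi>, u)) pr \<partial>lborel) \<partial>lborel)"
            unfolding nn_integral_completion
          proof (rule nn_integral_mono)
            fix \<xi> :: "'d pt"
            let ?I = "\<integral>\<^sup>+u\<in>tangent_nbhd b t (fst \<xi>). ennreal (\<bar>fin_diff_on r (?v u) (f \<circ> T) S \<xi>\<bar> powr pr) \<partial>lborel"
            let ?J = "\<integral>\<^sup>+u\<in>tangent_nbhd b t (fst \<xi>). ennreal_powr (F (\<xi>, u)) pr \<partial>lborel"
            have "?I \<le> ?J"
            proof (intro nn_integral_mono mult_right_mono)
              fix u
              have "ennreal (\<bar>fin_diff_on r (?v u) (f \<circ> T) S \<xi>\<bar> powr pr) = ennreal_powr (ennreal \<bar>fin_diff_on r (?v u) (f \<circ> T) S \<xi>\<bar>) pr" by simp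
              also have "\<dots> \<le> ennreal_powr (F (\<xi>, u)) pr" using pr by (intro ennreal_powr_mono dom) auto
              finally show "ennreal (\<bar>fin_diff_on r (?v u) (f \<circ> T) S \<xi>\<bar> powr pr) \<le> ennreal_powr (F (\<xi>, u)) pr" .
            qed simp
            then have "ennreal (1 / (b * t) ^ CARD('d)) * ?I * indicator ?in \<xi> \<le> ennreal (1 / (b * t) ^ CARD('d)) * ?J * indicator ?in \<xi>"
              by (intro mult_right_mono mult_left_mono) auto
            also have "\<dots> \<le> ennreal (1 / (b * t) ^ CARD('d)) * ?J * indicator (model_set b L g) \<xi>"
              using inn[of \<xi>] by (intro mult_left_mono) (auto simp: indicator_def)
            finally show "ennreal (1 / (b * t) ^ CARD('d)) * ?I * indicator ?in \<xi> \<le> \<dots>" .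
          qed
          also have "\<dots> = (\<integral>\<^sup>+x. ennreal_powr (F x) pr \<partial>?\<mu>)"
            by (rule nn_integral_tan_measure[OF g, symmetric]) measurable
          finally have "?\<Psi> \<le> lpn pr ?\<mu> F" unfolding lpn_def using pr by (intro ennreal_powr_mono) auto
          also have "\<dots> \<le> \<Psi>' P + lpn pr ?\<mu> (\<lambda>x. \<Sum>k=0..r. ennreal (real (r choose k)) * H k x)"
            unfolding F_def \<Psi>'_def by (rule lpn_add[OF pr]) measurable
          also have "\<dots> \<le> \<Psi>' P + (\<Sum>k=0..r. lpn pr ?\<mu> (\<lambda>x. ennreal (real (r choose k)) * H k x))"
            by (intro add_left_mono lpn_sum[OF pr]) measurable
          also have "(\<Sum>k=0..r. lpn pr ?\<mu> (\<lambda>x. ennreal (real (r choose k)) * H k x)) = (\<Sum>k=0..r. ennreal (real (r choose k)) * lpn pr ?\<mu> (H k))"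
            by (intro sum.cong refl lpn_cmult[OF pr]) measurable
          also have "\<Psi>' P + \<dots> \<le> \<Psi>' P + (\<Sum>k=0..r. ennreal (real (r choose k)) * (ennreal (2 ^ CARD('d)) * lpn pr lborel h))"
            by (intro add_left_mono sum_mono mult_left_mono Hk) auto
          also have "\<dots> = \<Psi>' P + ennreal c1 * lpn pr lborel h"
            unfolding sum_binomial_ennreal c1_def by (subst ennreal_mult) (auto simp: mult_ac)
          also have "\<dots> = \<Psi>' P + ennreal c1 * Lp_norm p \<Omega> (\<lambda>\<xi>. f \<xi> - P \<xi>)"
            by (simp only: hn Lp_norm_lpn[OF False] lpn_lebesgue prp)
          finally show "?\<Psi> \<le> \<Psi>' P + ennreal c1 * Lp_norm p \<Omega> (\<lambda>\<xi>. f \<xi> - P \<xi>)" .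
        next
          fix k and P Q :: "'d pt \<Rightarrow> real" assume PQ: "P \<in> poly_space k" "Q \<in> poly_space k"
          note [measurable] = PQ[THEN borel_measurable_poly_space]
          have "lpn pr ?\<mu> (D P) \<le> lpn pr ?\<mu> (\<lambda>x. D Q x + D (\<lambda>\<xi>. P \<xi> - Q \<xi>) x)"
          proof (rule lpn_mono[OF pr])
            fix x
            show "D P x \<le> D Q x + D (\<lambda>\<xi>. P \<xi> - Q \<xi>) x"
              unfolding D_def o_def fin_diff_diff by (rule ennreal_abs_le_add) linarith
          qed
          also have "\<dots> \<le> lpn pr ?\<mu> (D Q) + lpn pr ?\<mu> (D (\<lambda>\<xi>. P \<xi> - Q \<xi>))"
            by (rule lpn_add[OF pr]) measurable
          finally show "\<Psi>' P \<le> \<Psi>' Q + \<Psi>' (\<lambda>\<xi>. P \<xi> - Q \<xi>)" by (simp add: \<Psi>'_def)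
        next
          fix N and P :: "'d pt \<Rightarrow> real" assume N: "1 \<le> N" "real N \<le> \<kappa> * real n" and P: "P \<in> poly_space N"
          have Pm[measurable]: "P \<in> borel_measurable borel" by (rule borel_measurable_poly_space[OF P])
          obtain Pc where Pc: "complex_extension N (P \<circ> T) Pc" using ext[OF P] by blast
          have "\<Psi>' P \<le> ennreal (c2 * (real N / real n) ^ r) * lpn pr lborel (\<lambda>\<xi>. ennreal \<bar>(P \<circ> T) \<xi>\<bar> * indicator S \<xi>)"
            unfolding \<Psi>'_def D_def t_def by (rule intb[OF N(1) n N(2) s Pc cont[OF P] Sb star])
          also have "lpn pr lborel (\<lambda>\<xi>. ennreal \<bar>(P \<circ> T) \<xi>\<bar> * indicator S \<xi>) = Lp_norm p \<Omega> P"
          proof -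
            have "(\<integral>\<^sup>+\<xi>. ennreal_powr (ennreal \<bar>(P \<circ> T) \<xi>\<bar> * indicator S \<xi>) pr \<partial>lborel)
               = (\<integral>\<^sup>+\<xi>. (\<lambda>\<xi>. ennreal_powr (ennreal \<bar>P \<xi>\<bar> * indicator \<Omega> \<xi>) pr) (sd_place G \<xi>) \<partial>lborel)"
              by (simp add: S_def T_def indicator_def)
            also have "\<dots> = (\<integral>\<^sup>+\<xi>. ennreal_powr (ennreal \<bar>P \<xi>\<bar> * indicator \<Omega> \<xi>) pr \<partial>lborel)"
              by (rule nn_integral_sd_place) measurable
            finally show ?thesis by (simp only: Lp_norm_lpn[OF False] nn_integral_completion prp lpn_def)
          qed
          finally show "\<Psi>' P \<le> ennreal (c2 * (real N / real n) ^ r) * Lp_norm p \<Omega> P" .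
        next
          fix P :: "'d pt \<Rightarrow> real" assume "P \<in> poly_space 0"
          then obtain c where "P = (\<lambda>_. c)" by (rule poly_space_0_const)
          then have "D P = (\<lambda>x. 0)" using r by (simp add: D_def o_def fin_diff_const)
          then show "\<Psi>' P = 0" by (simp add: \<Psi>'_def lpn_0[OF pr])
        qed
        then show ?thesis using False by (simp add: prp)
      qed
    qed
  qed
qed

theorem theorem2p8:
  fixes D \<Omega> :: "('d::finite) pt set"
    and G :: "nat \<Rightarrow> 'd special_domain"
    and m0 r :: nat
    and A0 :: real
    and p :: ennreal
  assumes "C2_domain D" and "\<Omega> = closure D"
    and "A0 > 1"
    and "\<forall>j<m0. special_domain_valid (G j) \<and> attached (G j) \<Omega>"
    and "frontier \<Omega> \<subseteq> (\<Union>j<m0. sd_set (G j))"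
    and "r \<ge> 1" and "1 \<le> p"
  shows "\<exists>C>0. \<forall>n\<ge>1. \<forall>f\<in>Lp_space p \<Omega>.
           omega_full A0 p \<Omega> m0 G r f (1 / real n) \<le>
             ennreal (C / real n ^ r) *
               (\<Sum>j=0..n. ennreal (real (j + 1) ^ (r - 1)) * best_approx p \<Omega> j f)"
proof -
  have D: "bounded D" "D \<noteq> {}" using assms(1) unfolding C2_domain_def by blast+
  have \<Omega>: "compact \<Omega>" "\<Omega> \<noteq> {}" using D assms(2) by auto
  let ?S = "\<lambda>n f. \<Sum>j=0..n. ennreal (real (j + 1) ^ (r - 1)) * best_approx p \<Omega> j f"
  obtain C where C: "0 < C" "\<And>n f j. 1 \<le> n \<Longrightarrow> f \<in> Lp_space p \<Omega> \<Longrightarrow>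
    omega_dir p \<Omega> r f (1 / real n) (unit_vec j) \<le> ennreal (C / real n ^ r) * ?S n f"
    by (rule omega_dir_le[OF assms(7,6) \<Omega>]) blast
  let ?bd = "\<lambda>j C. 0 < C \<and> (\<forall>n\<ge>1. \<forall>f\<in>Lp_space p \<Omega>. omega_tan A0 p \<Omega> (G j) r f (1 / real n) \<le> ennreal (C / real n ^ r) * ?S n f)"
  have "\<exists>C. ?bd j C" if "j < m0" for j
  proof -
    have "special_domain_valid (G j)" "attached (G j) \<Omega>" using assms(4) that by auto
    then show ?thesis by (rule omega_tan_le[OF assms(7,6) \<Omega>, where ?A0.0 = A0]) blast
  qed
  then have "\<exists>K. \<forall>j\<in>{..<m0}. ?bd j (K j)" by (intro bchoice ballI) auto
  then obtain K where K': "\<forall>j\<in>{..<m0}. ?bd j (K j)" ..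
  have K: "0 < K j" "\<And>n f. 1 \<le> n \<Longrightarrow> f \<in> Lp_space p \<Omega> \<Longrightarrow> omega_tan A0 p \<Omega> (G j) r f (1 / real n) \<le> ennreal (K j / real n ^ r) * ?S n f"
    if "j < m0" for j
    using bspec[OF K', of j] that by auto
  have Kj: "0 \<le> K j" if "j \<in> {..<m0}" for j using K(1)[of j] that by simp
  have K0: "0 \<le> (\<Sum>j<m0. K j)" by (rule sum_nonneg[OF Kj])
  show ?thesis
  proof (intro exI[of _ "C + (\<Sum>j<m0. K j)"] conjI allI impI ballI)
    show "0 < C + (\<Sum>j<m0. K j)" using C(1) K0 by simp
    fix n :: nat and f assume n: "1 \<le> n" and f: "f \<in> Lp_space p \<Omega>"
    have "omega_phi p \<Omega> r f (1 / real n) \<le> ennreal (C / real n ^ r) * ?S n f"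
      unfolding omega_phi_def using C(2)[OF n f] by (intro Max.boundedI) auto
    moreover have "(\<Sum>j<m0. omega_tan A0 p \<Omega> (G j) r f (1 / real n)) \<le> ennreal ((\<Sum>j<m0. K j) / real n ^ r) * ?S n f"
    proof -
      have "(\<Sum>j<m0. omega_tan A0 p \<Omega> (G j) r f (1 / real n)) \<le> (\<Sum>j<m0. ennreal (K j / real n ^ r) * ?S n f)"
        using K(2) n f by (intro sum_mono) auto
      also have "\<dots> = (\<Sum>j<m0. ennreal (K j / real n ^ r)) * ?S n f" by (rule sum_distrib_right[symmetric])
      also have "(\<Sum>j<m0. ennreal (K j / real n ^ r)) = ennreal ((\<Sum>j<m0. K j) / real n ^ r)"
        using Kj by (subst sum_ennreal) (auto simp: sum_divide_distrib)
      finally show ?thesis .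
    qed
    ultimately have "omega_full A0 p \<Omega> m0 G r f (1 / real n) \<le> ennreal (C / real n ^ r) * ?S n f + ennreal ((\<Sum>j<m0. K j) / real n ^ r) * ?S n f"
      unfolding omega_full_def by (rule add_mono)
    also have "\<dots> = ennreal ((C + (\<Sum>j<m0. K j)) / real n ^ r) * ?S n f"
      using C(1) K0 by (simp add: add_divide_distrib ennreal_plus distrib_right)
    finally show "omega_full A0 p \<Omega> m0 G r f (1 / real n) \<le> ennreal ((C + (\<Sum>j<m0. K j)) / real n ^ r) * ?S n f" .
  qed
qed

end
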